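(* Let $A=\mathrm{k}\Delta/I^N$ be an $N$-truncated quiver algebra. Then the product $\vee$ on $\mathbf P^*$ induces the Yoneda product in $H^*(A,A)$, and in particular: (i) The product of two odd degree cohomology classes is zero. (ii) If $f_1,\dots,f_N$ are cohomology classes of positive degree, then $f_1\cdots f_N=0$. (iii) $H^*(A,A)/\mathcal N=\mathrm{k}$, where $\mathcal N$ is the ideal of $H^*(A,A)$ generated by the homogeneous nilpotent elements.
   Context: $\mathrm{k}$ is a field of characteristic $0$; $\Delta$ is a finite connected quiver (multiple arrows and loops allowed) with vertex set $\Delta_0$ and arrow set $\Delta_1$; $o$ and $t$ denote source and end of arrows and of paths. $\Delta_n$ is the set of paths of length $n$ (vertices are the paths of length $0$), and $\mathrm{k}\Delta=\bigoplus_{n\ge0}\mathrm{k}\Delta_n$ is the path algebra with product given by concatenation ($a_1\dots a_n$ is a path if $t(a_i)=o(a_{i+1})$; $\alpha\beta=0$ if $t(\alpha)\ne o(\beta)$). $I$ is the two-sided ideal generated by $\Delta_1$, $N\ge2$, and $A=\mathrm{k}\Delta/I^N$; paths of length $<N$ form a basis of $A$ and paths of length $\ge N$ are zero in $A$. $A^e=A\otimes_{\mathrm k}A^{op}$ and $H^n(A,A)=\mathrm{Ext}^n_{A^e}(A,A)$ is Hochschild cohomology; $H^*(A,A)=\bigoplus_{n\ge0}H^n(A,A)$ is a ring under the Yoneda product, which coincides with the cup product, given on cochains $f\in\mathrm{Hom}_{\mathrm k}(A^{\otimes m},A)$, $g\in\mathrm{Hom}_{\mathrm k}(A^{\otimes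 n},A)$ of the bar complex by $(f\cup g)(\alpha_1\otimes\dots\otimes\alpha_{m+n})=f(\alpha_1\otimes\dots\otimes\alpha_m)\,g(\alpha_{m+1}\otimes\dots\otimes\alpha_{m+n})$. The minimal $A^e$-projective resolution $(\mathbf P,d)$ of $A$ (tensors over $\mathrm{k}\Delta_0$) is $\mathbf P_{2k}=A\otimes\mathrm{k}\Delta_{kN}\otimes A$, $\mathbf P_{2k+1}=A\otimes\mathrm{k}\Delta_{kN+1}\otimes A$, with augmentation $\epsilon:\mathbf P_0=A\otimes A\to A$, $\epsilon(\alpha\otimes\beta)=\alpha\beta$, and $$d_{2k}(\alpha\otimes v_1\dots v_{kN}\otimes\beta)=\sum_{j=0}^{N-1}\alpha v_1\dots v_j\otimes v_{j+1}\dots v_{j+(k-1)N+1}\otimes v_{j+(k-1)N+2}\dots v_{kN}\beta,$$ $$d_{2k+1}(\alpha\otimes v_1\dots v_{kN+1}\otimes\beta)=\alpha v_1\otimes v_2\dots v_{kN+1}\otimes\beta-\alpha\otimes v_1\dots v_{kN}\otimes v_{kN+1}\beta.$$ Two paths are parallel if they have the same source and the same end; $\Delta_i/\!/\Delta_j$ is the set of pairs $(\alpha,\beta)$ of parallel paths with $\alpha\in\Delta_i$, $\beta\in\Delta_j$, and $\mathrm{k}\,\Delta_i/\!/\Delta_j$ the vector space with this basis. Put $\mathbf P^*_{2k}=\bigoplus_{i=0}^{N-1}\mathrm{k}\,\Delta_i/\!/\Delta_{kN}$ and $\mathbf P^*_{2k+1}=\bigoplus_{i=0}^{N-1}\mathrm{k}\,\Delta_i/\!/\Delta_{kN+1}$.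 Then $\mathbf P^*_n$ is identified with $\mathrm{Hom}_{A^e}(\mathbf P_n,A)$, where $(\alpha,\pi)$ corresponds to the bimodule map sending $1\otimes\pi\otimes1$ to $\alpha$ and $1\otimes\pi'\otimes1$ to $0$ for every path $\pi'\neq\pi$ of the same length as $\pi$; $\mathbf P^*=\bigoplus_n\mathbf P^*_n$ is a cochain complex with differential $f\mapsto f\circ d$, and its cohomology is $H^*(A,A)$. The bilinear product $\vee$ on $\mathbf P^*$ is defined for $(\alpha,\pi)\in\mathbf P^*_{n_1}$, $(\beta,\tau)\in\mathbf P^*_{n_2}$ by $(\alpha,\pi)\vee(\beta,\tau)=(\alpha\beta,\pi\tau)$ if $n_1$ or $n_2$ is even, and $0$ otherwise; here $(\alpha\beta,\pi\tau)$ is understood to be $0$ if the paths cannot be concatenated or if $\alpha\beta=0$ in $A$.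
   Formalization: Parts (ii) and (iii) are proved only for quivers Δ that are not an oriented cycle; for every oriented cycle both fail, e.g. A = k[x]/(x²), where the class of (1,x²) in degree 2 is not nilpotent. *)

theory Defs
  imports
    "HOL-Library.Poly_Mapping"
    "HOL-Algebra.QuotRing"
    "HOL-Algebra.Algebraic_Closure_Type"
    "Graph_Theory.Graph_Theory"
begin

text \<open>
  The free vector space on a set is modelled by finitely supported functions
  (\<open>Poly_Mapping\<close>), with basis vectors \<open>Poly_Mapping.single b 1\<close>; subspaces spanned by basis
  vectors are given by a condition on \<open>Poly_Mapping.keys\<close>.
\<close>

definition smul :: "'k::comm_ring_1 \<Rightarrow> ('b \<Rightarrow>\<^sub>0 'k) \<Rightarrow> ('b \<Rightarrow>\<^sub>0 'k)" where
  "smul c x = Poly_Mapping.map ((*) c) x"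

definition lin_ext :: "('b \<Rightarrow> 'c \<Rightarrow>\<^sub>0 'k::comm_ring_1) \<Rightarrow> ('b \<Rightarrow>\<^sub>0 'k) \<Rightarrow> ('c \<Rightarrow>\<^sub>0 'k)" where
  "lin_ext h x = (\<Sum>b\<in>Poly_Mapping.keys x. smul (Poly_Mapping.lookup x b) (h b))"

definition multilinear_on ::
  "('b \<Rightarrow>\<^sub>0 'k::comm_ring_1) set \<Rightarrow> (('b \<Rightarrow>\<^sub>0 'k) list \<Rightarrow> ('c \<Rightarrow>\<^sub>0 'k)) \<Rightarrow> bool" where
  "multilinear_on S F \<longleftrightarrow> (\<forall>xs ys. set xs \<subseteq> S \<longrightarrow> set ys \<subseteq> S \<longrightarrow>
     (\<forall>x\<in>S. \<forall>y\<in>S. F (xs @ (x + y) # ys) = F (xs @ x # ys) + F (xs @ y # ys)) \<and>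
     (\<forall>c. \<forall>x\<in>S. F (xs @ smul c x # ys) = smul c (F (xs @ x # ys))))"


section \<open>Paths\<close>

text \<open>
  A quiver is a \<open>pre_digraph\<close> (arcs have their own identity, so loops and multiple arrows are
  allowed). A path is the pair of its source and its list of arrows, so that every vertex
  \<open>v\<close> gives the path \<open>(v, [])\<close> of length \<open>0\<close>.
\<close>

type_synonym ('v,'e) path = "'v \<times> 'e list"
type_synonym ('v,'e,'k) alg = "('v,'e) path \<Rightarrow>\<^sub>0 'k"
type_synonym ('v,'e,'k) cochain = "('v,'e,'k) alg list \<Rightarrow> ('v,'e,'k) alg"
type_synonym ('v,'e,'k) res = "('v,'e) path \<times> ('v,'e) path \<times> ('v,'e) path \<Rightarrow>\<^sub>0 'k"
type_synonym ('v,'e,'k) pstar = "('v,'e) path \<times> ('v,'e) path \<Rightarrow>\<^sub>0 'k"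

definition plen :: "('v,'e) path \<Rightarrow> nat" where
  "plen p = length (snd p)"

definition psrc :: "('v,'e) path \<Rightarrow> 'v" where
  "psrc p = fst p"

text \<open>Only meaningful if \<open>ptgt p = psrc q\<close>, which is required explicitly wherever it is used.\<close>

definition pcat :: "('v,'e) path \<Rightarrow> ('v,'e) path \<Rightarrow> ('v,'e) path" where
  "pcat p q = (fst p, snd p @ snd q)"

context
  fixes G :: "('v,'e) pre_digraph" and N :: nat
begin

definition ptgt :: "('v,'e) path \<Rightarrow> 'v" where
  "ptgt p = pre_digraph.awlast G (fst p) (snd p)"

definition paths :: "nat \<Rightarrow> ('v,'e) path set" where
  "paths n = {p. pre_digraph.awalk G (psrc p) (snd p) (ptgt p) \<and> plen p = n}"

definition short_paths :: "('v,'e) path set" where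
  "short_paths = (\<Union>n<N. paths n)"

text \<open>
  For a path \<open>p = v\<^sub>1\<dots>v\<^sub>m\<close>: \<open>pseg i l p = v\<^sub>i\<^sub>+\<^sub>1\<dots>v\<^sub>i\<^sub>+\<^sub>l\<close> and \<open>pdrop i p = v\<^sub>i\<^sub>+\<^sub>1\<dots>v\<^sub>m\<close>; if these lists are
  empty, the result is the trivial path at the corresponding vertex of \<open>p\<close>.
\<close>

definition pdrop :: "nat \<Rightarrow> ('v,'e) path \<Rightarrow> ('v,'e) path" where
  "pdrop i p = (ptgt (fst p, take i (snd p)), drop i (snd p))"

definition pseg :: "nat \<Rightarrow> nat \<Rightarrow> ('v,'e) path \<Rightarrow> ('v,'e) path" where
  "pseg i l p = (ptgt (fst p, take i (snd p)), take l (drop i (snd p)))"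

text \<open>
  \<open>G\<close> consists of \<open>m \<ge> 1\<close> distinct vertices and \<open>m\<close> arrows arranged in one directed cycle
  (a single loop if \<open>m = 1\<close>). For these quivers the Hochschild cohomology ring has non-nilpotent
  classes of positive degree: e.g. for one loop \<open>x\<close> and \<open>N = 2\<close>, all powers of the class of
  \<open>(1, xx)\<close> in degree \<open>2\<close> are nonzero, because \<open>d(1, x\<^sup>2\<^sup>i\<^sup>-\<^sup>1) = (2x, x\<^sup>2\<^sup>i)\<close> and
  \<open>d(x, x\<^sup>2\<^sup>i\<^sup>-\<^sup>1) = 0\<close>, so \<open>(1, x\<^sup>2\<^sup>i)\<close> is not a coboundary.
\<close>

definition is_oriented_cycle :: bool where
  "is_oriented_cycle \<longleftrightarrow>
     (\<exists>p. pre_digraph.cycle G p \<and> arcs G = set p \<and> verts G = tail G ` set p)"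


section \<open>The truncated quiver algebra\<close>

text \<open>
  The power \<open>I\<^sup>N\<close> of the arrow ideal is the span of the paths of length \<open>\<ge> N\<close>. Every element of
  the quotient by \<open>I\<^sup>N\<close> is represented by its unique linear combination of paths of length
  \<open>< N\<close>, and a product of paths vanishes once its length reaches \<open>N\<close>.
\<close>

definition A_carrier :: "('v,'e,'k::comm_ring_1) alg set" where
  "A_carrier = {x. Poly_Mapping.keys x \<subseteq> short_paths}"

definition path_prod :: "('v,'e) path \<Rightarrow> ('v,'e) path \<Rightarrow> ('v,'e,'k::comm_ring_1) alg" where
  "path_prod p q =
     (if ptgt p = psrc q \<and> plen p + plen q < N then Poly_Mapping.single (pcat p q) 1 else 0)"

definition A_mult ::
  "('v,'e,'k::comm_ring_1) alg \<Rightarrow> ('v,'e,'k) alg \<Rightarrow> ('v,'e,'k) alg" where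
  "A_mult x y = lin_ext (\<lambda>p. lin_ext (\<lambda>q. path_prod p q) y) x"

definition A_one :: "('v,'e,'k::comm_ring_1) alg" where
  "A_one = (\<Sum>v\<in>verts G. Poly_Mapping.single (v, []) 1)"


section \<open>Hochschild cohomology with the cup product\<close>

text \<open>
  An \<open>A\<close>-bimodule map from \<open>A \<otimes> A\<^sup>\<otimes>\<^sup>n \<otimes> A\<close> (tensors over the field) to a bimodule with actions
  \<open>la\<close> and \<open>ra\<close> is the same as its restriction to \<open>1 \<otimes> A\<^sup>\<otimes>\<^sup>n \<otimes> 1\<close>, a multilinear function of
  lists of length \<open>n\<close>. In these terms, precomposition with the bar differential is:
\<close>

definition bar_precomp ::
  "(('v,'e,'k::comm_ring_1) alg \<Rightarrow> ('c \<Rightarrow>\<^sub>0 'k) \<Rightarrow> ('c \<Rightarrow>\<^sub>0 'k)) \<Rightarrow>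
   (('c \<Rightarrow>\<^sub>0 'k) \<Rightarrow> ('v,'e,'k) alg \<Rightarrow> ('c \<Rightarrow>\<^sub>0 'k)) \<Rightarrow>
   (('v,'e,'k) alg list \<Rightarrow> ('c \<Rightarrow>\<^sub>0 'k)) \<Rightarrow> ('v,'e,'k) alg list \<Rightarrow> ('c \<Rightarrow>\<^sub>0 'k)" where
  "bar_precomp la ra F xs =
     la (hd xs) (F (tl xs))
     + (\<Sum>i\<in>{1..<length xs}. smul ((-1) ^ i)
          (F (take (i - 1) xs @ A_mult (xs ! (i - 1)) (xs ! i) # drop (i + 1) xs)))
     + smul ((-1) ^ length xs) (ra (F (butlast xs)) (last xs))"

text \<open>
  An element of the total cochain space (the direct sum over all \<open>n\<close> of the \<open>n\<close>-linear
  functions) is one function \<open>F\<close> on lists; its component of degree \<open>n\<close> is the restriction of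
  \<open>F\<close> to lists of length \<open>n\<close>. Outside of lists over \<open>A\<close>, \<open>F\<close> is \<open>0\<close>.
\<close>

definition hoch_cochains :: "('v,'e,'k::comm_ring_1) cochain set" where
  "hoch_cochains = {F. multilinear_on A_carrier F
     \<and> (\<forall>xs. set xs \<subseteq> A_carrier \<longrightarrow> F xs \<in> A_carrier)
     \<and> (\<forall>xs. \<not> set xs \<subseteq> A_carrier \<longrightarrow> F xs = 0)
     \<and> (\<exists>d. \<forall>xs. d \<le> length xs \<longrightarrow> F xs = 0)}"

definition hoch_homogeneous :: "nat \<Rightarrow> ('v,'e,'k::comm_ring_1) cochain set" where
  "hoch_homogeneous n = {F \<in> hoch_cochains. \<forall>xs. length xs \<noteq> n \<longrightarrow> F xs = 0}"

definition hoch_diff :: "('v,'e,'k::comm_ring_1) cochain \<Rightarrow> ('v,'e,'k) cochain" where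
  "hoch_diff F xs =
     (if xs \<noteq> [] \<and> set xs \<subseteq> A_carrier then bar_precomp A_mult A_mult F xs else 0)"

definition cup ::
  "('v,'e,'k::comm_ring_1) cochain \<Rightarrow> ('v,'e,'k) cochain \<Rightarrow> ('v,'e,'k) cochain" where
  "cup F H xs = (\<Sum>i\<le>length xs. A_mult (F (take i xs)) (H (drop i xs)))"

definition hoch_scalar :: "'k::comm_ring_1 \<Rightarrow> ('v,'e,'k) cochain" where
  "hoch_scalar c xs = (if xs = [] then smul c A_one else 0)"

definition hoch_cocycle_ring :: "('v,'e,'k::comm_ring_1) cochain ring" where
  "hoch_cocycle_ring =
     \<lparr>carrier = {F \<in> hoch_cochains. hoch_diff F = (\<lambda>_. 0)},
      monoid.mult = cup, one = hoch_scalar 1,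
      zero = (\<lambda>_. 0), add = (\<lambda>F H xs. F xs + H xs)\<rparr>"

definition hoch_coboundaries :: "('v,'e,'k::comm_ring_1) cochain set" where
  "hoch_coboundaries = hoch_diff ` hoch_cochains"

definition HH :: "('v,'e,'k::comm_ring_1) cochain set ring" where
  "HH = hoch_cocycle_ring Quot hoch_coboundaries"

definition HH_class :: "('v,'e,'k::comm_ring_1) cochain \<Rightarrow> ('v,'e,'k) cochain set" where
  "HH_class F = hoch_coboundaries +>\<^bsub>hoch_cocycle_ring\<^esub> F"

definition HH_deg :: "nat \<Rightarrow> ('v,'e,'k::comm_ring_1) cochain set set" where
  "HH_deg n = HH_class ` (carrier hoch_cocycle_ring \<inter> hoch_homogeneous n)"

definition HH_nil_ideal :: "('v,'e,'k::comm_ring_1) cochain set set" where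
  "HH_nil_ideal = Idl\<^bsub>HH\<^esub> {x. (\<exists>n. x \<in> HH_deg n) \<and> (\<exists>m::nat. m > 0 \<and> x [^]\<^bsub>HH\<^esub> m = \<zero>\<^bsub>HH\<^esub>)}"


section \<open>The minimal bimodule resolution\<close>

definition res_len :: "nat \<Rightarrow> nat" where
  "res_len n = (if even n then (n div 2) * N else (n div 2) * N + 1)"

text \<open>
  Since the tensor products are over the span of the vertices, the \<open>n\<close>-th term has a basis
  consisting of the composable triples of paths.
\<close>

definition P_basis ::
  "nat \<Rightarrow> (('v,'e) path \<times> ('v,'e) path \<times> ('v,'e) path) set" where
  "P_basis n = {(a, p, b). a \<in> short_paths \<and> p \<in> paths (res_len n) \<and> b \<in> short_paths
     \<and> ptgt a = psrc p \<and> ptgt p = psrc b}"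

definition P_carrier :: "nat \<Rightarrow> ('v,'e,'k::comm_ring_1) res set" where
  "P_carrier n = {z. Poly_Mapping.keys z \<subseteq> P_basis n}"

definition tens ::
  "('v,'e) path \<Rightarrow> ('v,'e) path \<Rightarrow> ('v,'e) path \<Rightarrow> ('v,'e,'k::comm_ring_1) res" where
  "tens a p b = (if plen a < N \<and> plen b < N then Poly_Mapping.single (a, p, b) 1 else 0)"

definition P_lact ::
  "('v,'e,'k::comm_ring_1) alg \<Rightarrow> ('v,'e,'k) res \<Rightarrow> ('v,'e,'k) res" where
  "P_lact x z = lin_ext (\<lambda>q. lin_ext (\<lambda>(a, p, b).
     if ptgt q = psrc a then tens (pcat q a) p b else 0) z) x"

definition P_ract ::
  "('v,'e,'k::comm_ring_1) res \<Rightarrow> ('v,'e,'k) alg \<Rightarrow> ('v,'e,'k) res" where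
  "P_ract z x = lin_ext (\<lambda>q. lin_ext (\<lambda>(a, p, b).
     if ptgt b = psrc q then tens a p (pcat b q) else 0) z) x"

definition P_diff_basis :: "nat \<Rightarrow> ('v,'e) path \<Rightarrow> ('v,'e) path \<Rightarrow> ('v,'e) path \<Rightarrow>
    ('v,'e,'k::comm_ring_1) res" where
  "P_diff_basis n a p b =
     (let k = n div 2 in
      if even n
      then (\<Sum>j<N. tens (pcat a (pseg 0 j p)) (pseg j ((k - 1) * N + 1) p)
                        (pcat (pdrop (j + (k - 1) * N + 1) p) b))
      else tens (pcat a (pseg 0 1 p)) (pdrop 1 p) b
           - tens a (pseg 0 (k * N) p) (pcat (pdrop (k * N) p) b))"

text \<open>The differential from degree \<open>n\<close> to degree \<open>n - 1\<close>, for \<open>n \<ge> 1\<close>.\<close>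

definition P_diff :: "nat \<Rightarrow> ('v,'e,'k::comm_ring_1) res \<Rightarrow> ('v,'e,'k) res" where
  "P_diff n z = lin_ext (\<lambda>(a, p, b). P_diff_basis n a p b) z"

definition P_aug :: "('v,'e,'k::comm_ring_1) res \<Rightarrow> ('v,'e,'k) alg" where
  "P_aug z = lin_ext (\<lambda>(a, p, b). path_prod a b) z"


section \<open>The complex of parallel paths\<close>

definition Pstar_basis :: "nat \<Rightarrow> (('v,'e) path \<times> ('v,'e) path) set" where
  "Pstar_basis n = {(a, p). a \<in> short_paths \<and> p \<in> paths (res_len n)
     \<and> psrc a = psrc p \<and> ptgt a = ptgt p}"

definition Pstar :: "nat \<Rightarrow> ('v,'e,'k::comm_ring_1) pstar set" where
  "Pstar n = {f. Poly_Mapping.keys f \<subseteq> Pstar_basis n}"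

definition Pstar_eval :: "('v,'e,'k::comm_ring_1) pstar \<Rightarrow> ('v,'e) path \<Rightarrow> ('v,'e,'k) alg" where
  "Pstar_eval f p = lin_ext (\<lambda>(c, q). if q = p then Poly_Mapping.single c 1 else 0) f"

text \<open>The bimodule map on the resolution that corresponds to \<open>f\<close>.\<close>

definition Pstar_hom :: "('v,'e,'k::comm_ring_1) pstar \<Rightarrow> ('v,'e,'k) res \<Rightarrow> ('v,'e,'k) alg" where
  "Pstar_hom f z = lin_ext (\<lambda>(a, p, b).
     A_mult (A_mult (Poly_Mapping.single a 1) (Pstar_eval f p)) (Poly_Mapping.single b 1)) z"

text \<open>
  The element of degree \<open>n + 1\<close> corresponding to the bimodule map \<open>Pstar_hom f \<circ> P_diff (n + 1)\<close>,
  which is determined by its values on the generators \<open>1 \<otimes> p \<otimes> 1\<close>.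
\<close>

definition Pstar_diff :: "nat \<Rightarrow> ('v,'e,'k::comm_ring_1) pstar \<Rightarrow> ('v,'e,'k) pstar" where
  "Pstar_diff n f = (\<Sum>p\<in>paths (res_len (n + 1)).
     lin_ext (\<lambda>c. Poly_Mapping.single (c, p) 1)
       (Pstar_hom f (P_diff (n + 1) (tens (psrc p, []) p (ptgt p, [])))))"

definition Pstar_cocycles :: "nat \<Rightarrow> ('v,'e,'k::comm_ring_1) pstar set" where
  "Pstar_cocycles n = {f \<in> Pstar n. Pstar_diff n f = 0}"

definition Pstar_coboundaries :: "nat \<Rightarrow> ('v,'e,'k::comm_ring_1) pstar set" where
  "Pstar_coboundaries n = (if n = 0 then {0} else Pstar_diff (n - 1) ` Pstar (n - 1))"

text \<open>The product of an element of degree \<open>m\<close> and an element of degree \<open>n\<close>.\<close>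

definition vee :: "nat \<Rightarrow> nat \<Rightarrow> ('v,'e,'k::comm_ring_1) pstar \<Rightarrow> ('v,'e,'k) pstar \<Rightarrow>
    ('v,'e,'k) pstar" where
  "vee m n f g =
     (if even m \<or> even n
      then lin_ext (\<lambda>(a, p). lin_ext (\<lambda>(b, q).
             if ptgt a = psrc b \<and> ptgt p = psrc q \<and> plen a + plen b < N
             then Poly_Mapping.single (pcat a b, pcat p q) 1 else 0) g) f
      else 0)"

text \<open>
  A comparison morphism from the bar resolution to the minimal resolution, i.e. a chain map
  of bimodules lifting the identity of \<open>A\<close>, again given by its values on
  \<open>1 \<otimes> a\<^sub>1 \<otimes> \<dots> \<otimes> a\<^sub>n \<otimes> 1\<close>. Any such morphism induces the canonical identification of the
  cohomology of \<open>Pstar\<close> with Hochschild cohomology, \<open>[f] \<mapsto> comparison_class \<psi> n f\<close>.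
\<close>

definition is_comparison :: "(('v,'e,'k::comm_ring_1) alg list \<Rightarrow> ('v,'e,'k) res) \<Rightarrow> bool" where
  "is_comparison \<psi> \<longleftrightarrow>
     multilinear_on A_carrier \<psi>
     \<and> (\<forall>xs. set xs \<subseteq> A_carrier \<longrightarrow> \<psi> xs \<in> P_carrier (length xs))
     \<and> P_aug (\<psi> []) = A_one
     \<and> (\<forall>xs. xs \<noteq> [] \<longrightarrow> set xs \<subseteq> A_carrier \<longrightarrow>
           P_diff (length xs) (\<psi> xs) = bar_precomp P_lact P_ract \<psi> xs)"

definition comparison_class :: "(('v,'e,'k::comm_ring_1) alg list \<Rightarrow> ('v,'e,'k) res) \<Rightarrow> nat \<Rightarrow>
    ('v,'e,'k) pstar \<Rightarrow> ('v,'e,'k) cochain set" where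
  "comparison_class \<psi> n f = HH_class (\<lambda>xs.
     if set xs \<subseteq> A_carrier \<and> length xs = n then Pstar_hom f (\<psi> xs) else 0)"

end

end

theory Submission
  imports Defs
begin

text \<open>
  The minimal resolution is manageable because its terms have a basis of \<^emph>\<open>marked paths\<close>: an
  element \<open>a \<otimes> p \<otimes> b\<close> is the path \<open>\<rho> = apb\<close> together with the position \<open>i\<close> at which its middle
  segment, whose length depends on the degree only, begins. The differential preserves \<open>\<rho>\<close> and
  acts on positions: from odd to even degree it is the difference of the positions \<open>i + 1\<close> and \<open>i\<close>,
  from even to odd degree the sum of the positions \<open>i, \<dots>, i + N - 1\<close>. Partial sums over positions
  thus give a contraction of right modules (\<open>P_diff_contr\<close>). It determines, by recursion, a
  comparison morphism \<open>canon\<close> from the bar resolution, so comparison morphisms exist.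

  In the opposite direction the contraction of the bar resolution determines a map from the minimal
  resolution to the bar resolution. Only its transpose is used: \<open>pull\<close> maps a Hochschild cochain to
  an element of the complex of parallel paths and commutes with the differentials (\<open>pull_chain\<close>).
  For every comparison morphism, mapping a Hochschild cocycle to its pullback and back again changes
  it by a coboundary (\<open>cocycle_formula\<close>); and transporting an element along \<open>canon\<close> and pulling it
  back again is the identity (\<open>pull_comp_cochain\<close>). Hence all comparison morphisms induce the same
  bijection on cohomology, with inverse induced by \<open>pull\<close>.

  Both maps are explicit on paths. The value of \<open>pull n H\<close> at a path is in general a sum of values
  of \<open>H\<close> at decompositions of that path; for the cochains \<open>H\<close> that occur here all terms vanish but
  the one at the decomposition into pieces of lengths \<open>N - 1, 1, N - 1, 1, \<dots>\<close>, preceded by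
  a piece of length \<open>1\<close> in odd degree (\<open>pull_eval\<close>). Applied to a cup product this gives the product
  \<open>\<or>\<close> whenever one of the two degrees is even (\<open>pull_cup_eq_vee\<close>). For two odd degrees
  the pullback of the cup product vanishes by counting lengths (\<open>pull_cup_odd\<close>), provided
  that both factors take values in the radical. This holds for odd cocycles in characteristic \<open>0\<close>:
  the vertex coefficients at the rotations of a closed path have vanishing sums over \<open>N\<close>
  consecutive rotations, which makes all of them equal, hence zero (\<open>odd_cocycle_vcoeff\<close>).

  A cocycle of positive even degree with a nonzero vertex coefficient at a closed path \<open>\<pi>\<close> forces
  every arrow leaving the base vertex of \<open>\<pi>\<close> to be the first arrow of \<open>\<pi>\<close>, and every arrow
  entering it to be the last one; the rotated path has again a nonzero coefficient. By
  connectedness the quiver is then an oriented cycle (\<open>even_cocycle_vcoeff\<close>). For all other quivers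
  every class of positive degree is therefore represented by a cocycle with values in the radical, and a
  product of \<open>N\<close> of them takes values in the \<open>N\<close>-th power of the radical, which is zero. In degree
  \<open>0\<close> the vertex coefficients of a cocycle agree along arrows, so it is a scalar plus a radical, and
  hence nilpotent, part. Since the coefficient at a fixed vertex is a ring homomorphism to the field, which kills
  nilpotent elements, the quotient by the nilpotent ideal is exactly the field.
\<close>

section \<open>Linear maps between spaces with a basis\<close>

lemma lookup_smul [simp]: "Poly_Mapping.lookup (smul c x) b = c * Poly_Mapping.lookup x b"
  by (simp add: smul_def Poly_Mapping.map.rep_eq when_def)

lemma smul_add_right: "smul c (x + y) = smul c x + smul c y"
  and smul_add_left: "smul (c + d) x = smul c x + smul d x"
  and smul_smul: "smul c (smul d x) = smul (c * d) x"
  by (rule poly_mapping_eqI, simp add: lookup_add algebra_simps)+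

lemma smul_one [simp]: "smul 1 x = x"
  and smul_zero [simp]: "smul 0 x = 0" "smul c 0 = 0"
  and smul_minus_one: "smul (- 1) x = - x"
  and smul_minus: "smul (- c) x = - smul c x" "smul c (- x) = - smul c x"
  and smul_diff_right: "smul c (x - y) = smul c x - smul c y"
  by (rule poly_mapping_eqI, simp add: lookup_minus algebra_simps)+

lemma smul_sum: "smul c (sum f S) = (\<Sum>i\<in>S. smul c (f i))"
  by (induction S rule: infinite_finite_induct) (auto simp: smul_add_right)

definition linmap :: "(('b \<Rightarrow>\<^sub>0 'k::comm_ring_1) \<Rightarrow> ('c \<Rightarrow>\<^sub>0 'k)) \<Rightarrow> bool" where
  "linmap L \<longleftrightarrow> (\<forall>x y. L (x + y) = L x + L y) \<and> (\<forall>c x. L (smul c x) = smul c (L x))"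

named_theorems lin_intro

lemma linmapI:
  assumes "\<And>x y. L (x + y) = L x + L y" "\<And>c x. L (smul c x) = smul c (L x)"
  shows "linmap L"
  using assms by (simp add: linmap_def)

lemma linmap_add: "linmap L \<Longrightarrow> L (x + y) = L x + L y"
  and linmap_smul: "linmap L \<Longrightarrow> L (smul c x) = smul c (L x)"
  by (simp_all add: linmap_def)

lemma linmap_0: "linmap L \<Longrightarrow> L 0 = 0"
  using linmap_smul[of L 0 0] by simp

lemma linmap_minus: "linmap L \<Longrightarrow> L (- x) = - L x"
  using linmap_smul[of L "- 1" x] by (simp add: smul_minus_one)

lemma linmap_diff: "linmap L \<Longrightarrow> L (x - y) = L x - L y"
  using linmap_add[of L x "- y"] by (simp add: linmap_minus)

lemma linmap_sum: "linmap L \<Longrightarrow> L (sum f S) = (\<Sum>i\<in>S. L (f i))"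
  by (induction S rule: infinite_finite_induct) (auto simp: linmap_0 linmap_add)

lemma linmap_id [lin_intro]: "linmap (\<lambda>x. x)"
  and linmap_zero [lin_intro]: "linmap (\<lambda>x. 0)"
  by (simp_all add: linmap_def)

lemma linmap_plus [lin_intro]:
  "linmap L \<Longrightarrow> linmap M \<Longrightarrow> linmap (\<lambda>x. L x + M x)"
  by (simp add: linmap_def smul_add_right)

lemma linmap_uminus [lin_intro]: "linmap L \<Longrightarrow> linmap (\<lambda>x. - L x)"
  by (simp add: linmap_def smul_minus)

lemma linmap_minus' [lin_intro]:
  "linmap L \<Longrightarrow> linmap M \<Longrightarrow> linmap (\<lambda>x. L x - M x)"
  by (simp add: linmap_def smul_diff_right)

lemma linmap_smul' [lin_intro]: "linmap L \<Longrightarrow> linmap (\<lambda>x. smul c (L x))"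
  by (simp add: linmap_def smul_add_right smul_smul mult.commute)

lemma linmap_sum' [lin_intro]: "(\<And>i. i \<in> S \<Longrightarrow> linmap (L i)) \<Longrightarrow> linmap (\<lambda>x. \<Sum>i\<in>S. L i x)"
  by (induction S rule: infinite_finite_induct) (auto intro: lin_intro)

lemma linmap_comp: "linmap L \<Longrightarrow> linmap M \<Longrightarrow> linmap (\<lambda>x. L (M x))"
  by (simp add: linmap_def)

lemma lin_ext_superset:
  assumes "finite S" "Poly_Mapping.keys x \<subseteq> S"
  shows "lin_ext h x = (\<Sum>b\<in>S. smul (Poly_Mapping.lookup x b) (h b))"
  unfolding lin_ext_def
  by (rule sum.mono_neutral_left) (use assms in \<open>auto simp: in_keys_iff\<close>)

lemma linmap_lin_ext: "linmap (lin_ext h)"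
proof (rule linmapI)
  fix x y :: "'a \<Rightarrow>\<^sub>0 'b" and c :: 'b
  let ?S = "Poly_Mapping.keys x \<union> Poly_Mapping.keys y"
  have "lin_ext h (x + y) = (\<Sum>b\<in>?S. smul (Poly_Mapping.lookup (x + y) b) (h b))"
    by (rule lin_ext_superset) (auto dest: subsetD[OF Poly_Mapping.keys_add])
  also have "\<dots> = lin_ext h x + lin_ext h y"
    by (subst (1 2) lin_ext_superset[where S = ?S])
      (auto simp: lookup_add smul_add_left sum.distrib)
  finally show "lin_ext h (x + y) = lin_ext h x + lin_ext h y" .
  have "lin_ext h (smul c x) = (\<Sum>b\<in>Poly_Mapping.keys x. smul (c * Poly_Mapping.lookup x b) (h b))"
    by (subst lin_ext_superset[where S = "Poly_Mapping.keys x"]) (auto simp: in_keys_iff)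
  then show "lin_ext h (smul c x) = smul c (lin_ext h x)"
    by (simp add: lin_ext_def smul_sum smul_smul)
qed

lemma lin_ext_0 [simp]: "lin_ext h 0 = 0"
  by (simp add: lin_ext_def)

lemma lin_ext_single [simp]: "lin_ext h (Poly_Mapping.single b c) = smul c (h b)"
  by (cases "c = 0") (simp_all add: lin_ext_def)

lemma linmap_lin_ext_arg [lin_intro]: "linmap L \<Longrightarrow> linmap (\<lambda>x. lin_ext h (L x))"
  by (rule linmap_comp[OF linmap_lin_ext])

lemma linmap_lin_ext_fun [lin_intro]:
  "(\<And>b. linmap (\<lambda>x. L x b)) \<Longrightarrow> linmap (\<lambda>x. lin_ext (L x) y)"
  unfolding lin_ext_def by (intro lin_intro)

lemma lin_ext_cong:
  "x = y \<Longrightarrow> (\<And>b. b \<in> Poly_Mapping.keys y \<Longrightarrow> f b = g b) \<Longrightarrow> lin_ext f x = lin_ext g y"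
  by (simp add: lin_ext_def)

lemma lin_ext_basis: "lin_ext (\<lambda>b. Poly_Mapping.single b 1) x = x"
proof (rule poly_mapping_eqI)
  fix b
  have "Poly_Mapping.lookup (lin_ext (\<lambda>b. Poly_Mapping.single b 1) x) b
    = (\<Sum>a\<in>Poly_Mapping.keys x. if a = b then Poly_Mapping.lookup x a else 0)"
    by (simp add: lin_ext_def lookup_sum lookup_single when_def if_distrib cong: if_cong)
  then show "Poly_Mapping.lookup (lin_ext (\<lambda>b. Poly_Mapping.single b 1) x) b = Poly_Mapping.lookup x b"
    by (simp add: in_keys_iff)
qed

lemma linmap_lin_ext_eq: "linmap L \<Longrightarrow> L (lin_ext h x) = lin_ext (\<lambda>b. L (h b)) x"
  by (simp add: lin_ext_def linmap_sum linmap_smul)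

lemma linmap_expand: "linmap L \<Longrightarrow> L x = lin_ext (\<lambda>b. L (Poly_Mapping.single b 1)) x"
  using linmap_lin_ext_eq[of L "\<lambda>b. Poly_Mapping.single b 1" x] by (simp add: lin_ext_basis)

lemma linmap_eqI:
  assumes "linmap L" "linmap M"
    and "\<And>b. b \<in> Poly_Mapping.keys x \<Longrightarrow> L (Poly_Mapping.single b 1) = M (Poly_Mapping.single b 1)"
  shows "L x = M x"
proof -
  have "L x = lin_ext (\<lambda>b. L (Poly_Mapping.single b 1)) x" by (rule linmap_expand[OF assms(1)])
  also have "\<dots> = lin_ext (\<lambda>b. M (Poly_Mapping.single b 1)) x"
    by (rule lin_ext_cong) (simp_all add: assms(3))
  also have "\<dots> = M x" by (rule linmap_expand[OF assms(2), symmetric])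
  finally show ?thesis .
qed

lemma keys_smul: "Poly_Mapping.keys (smul c x) \<subseteq> Poly_Mapping.keys x"
  by (auto simp: in_keys_iff)

lemma keys_sum_subset:
  "(\<And>i. i \<in> S \<Longrightarrow> Poly_Mapping.keys (f i) \<subseteq> T) \<Longrightarrow> Poly_Mapping.keys (sum f S) \<subseteq> T"
proof (induction S rule: infinite_finite_induct)
  case (insert i S)
  then show ?case using Poly_Mapping.keys_add[of "f i" "sum f S"] by auto
qed auto

lemma keys_lin_ext_subset:
  "(\<And>b. b \<in> Poly_Mapping.keys x \<Longrightarrow> Poly_Mapping.keys (h b) \<subseteq> T)
    \<Longrightarrow> Poly_Mapping.keys (lin_ext h x) \<subseteq> T"
  unfolding lin_ext_def by (rule keys_sum_subset) (rule subset_trans[OF keys_smul])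

subsection \<open>Multilinear functions of lists\<close>

lemma multilinear_onI:
  fixes P :: "(('b \<Rightarrow>\<^sub>0 'k::comm_ring_1) list \<Rightarrow> ('c \<Rightarrow>\<^sub>0 'k)) \<Rightarrow> bool"
  assumes "P F"
    and shift: "\<And>F x. P F \<Longrightarrow> x \<in> S \<Longrightarrow> P (\<lambda>xs. F (x # xs))"
    and add: "\<And>F x y xs. P F \<Longrightarrow> x \<in> S \<Longrightarrow> y \<in> S \<Longrightarrow> set xs \<subseteq> S \<Longrightarrow>
      F ((x + y) # xs) = F (x # xs) + F (y # xs)"
    and scale: "\<And>F c x xs. P F \<Longrightarrow> x \<in> S \<Longrightarrow> set xs \<subseteq> S \<Longrightarrow> F (smul c x # xs) = smul c (F (x # xs))"
  shows "multilinear_on S F"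
proof -
  have "(\<forall>x\<in>S. \<forall>y\<in>S. F (xs @ (x + y) # ys) = F (xs @ x # ys) + F (xs @ y # ys)) \<and>
     (\<forall>c. \<forall>x\<in>S. F (xs @ smul c x # ys) = smul c (F (xs @ x # ys)))"
    if "P F" "set xs \<subseteq> S" "set ys \<subseteq> S" for F xs ys
    using that
  proof (induction xs arbitrary: F)
    case Nil
    then show ?case using add scale by auto
  next
    case (Cons a xs)
    from Cons.IH[of "\<lambda>xs. F (a # xs)"] shift[of F a] Cons.prems show ?case by simp
  qed
  from this[OF \<open>P F\<close>] show ?thesis unfolding multilinear_on_def by (intro allI impI)
qed

lemma multilinear_onD:
  assumes "multilinear_on S F" "set xs \<subseteq> S" "set ys \<subseteq> S" "x \<in> S"
  shows "y \<in> S \<Longrightarrow> F (xs @ (x + y) # ys) = F (xs @ x # ys) + F (xs @ y # ys)"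
    and "F (xs @ smul c x # ys) = smul c (F (xs @ x # ys))"
  using assms(1)[unfolded multilinear_on_def, rule_format, OF assms(2,3)] assms(4) by simp_all

lemma multilinear_on_hd:
  assumes "multilinear_on S F" "set ys \<subseteq> S" "x \<in> S"
  shows "y \<in> S \<Longrightarrow> F ((x + y) # ys) = F (x # ys) + F (y # ys)"
    and "F (smul c x # ys) = smul c (F (x # ys))"
  using multilinear_onD[OF assms(1) _ assms(2,3), of "[]"] by simp_all

lemma multilinear_on_shift:
  assumes "multilinear_on S F" "x \<in> S"
  shows "multilinear_on S (\<lambda>xs. F (x # xs))"
  unfolding multilinear_on_def
proof (intro allI impI conjI ballI)
  fix xs ys c y z assume *: "set xs \<subseteq> S" "set ys \<subseteq> S" "y \<in> S"
  show "F (x # xs @ smul c y # ys) = smul c (F (x # xs @ y # ys))"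
    using multilinear_onD(2)[OF assms(1), of "x # xs" ys] * assms(2) by simp
  show "z \<in> S \<Longrightarrow> F (x # xs @ (y + z) # ys) = F (x # xs @ y # ys) + F (x # xs @ z # ys)"
    using multilinear_onD(1)[OF assms(1), of "x # xs" ys] * assms(2) by simp
qed

section \<open>Paths\<close>

lemma psrc_simp [simp]: "psrc (v, es) = v"
  and plen_simp [simp]: "plen (v, es) = length es"
  and psrc_pcat [simp]: "psrc (pcat p q) = psrc p"
  and plen_pcat [simp]: "plen (pcat p q) = plen p + plen q"
  and pcat_assoc: "pcat (pcat p q) r = pcat p (pcat q r)"
  and pcat_nil [simp]: "pcat p (v, []) = p"
  by (simp_all add: psrc_def plen_def pcat_def)

lemma pcat_vertex [simp]: "psrc p = v \<Longrightarrow> pcat (v, []) p = p"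
  by (auto simp: psrc_def pcat_def)

lemma plen_0_iff: "plen p = 0 \<longleftrightarrow> p = (psrc p, [])"
  by (cases p) simp

lemma ptgt_nil [simp]: "ptgt G (v, []) = v"
  by (simp add: ptgt_def pre_digraph.awalk_verts.simps)

lemma awlast_Cons [simp]:
  "pre_digraph.awlast G u (e # es) = pre_digraph.awlast G (head G e) es"
  by (cases es) (simp_all add: pre_digraph.awalk_verts.simps)

lemma awlast_append:
  "pre_digraph.awlast G u (es @ fs) = pre_digraph.awlast G (pre_digraph.awlast G u es) fs"
proof (induction es arbitrary: u)
  case Nil
  then show ?case by (simp add: pre_digraph.awalk_verts.simps)
qed simp

lemma ptgt_append: "ptgt G (v, es @ fs) = ptgt G (ptgt G (v, es), fs)"
  by (simp add: ptgt_def awlast_append)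

lemma ptgt_pcat [simp]: "ptgt G p = psrc q \<Longrightarrow> ptgt G (pcat p q) = ptgt G q"
  by (cases p, cases q) (simp add: pcat_def ptgt_append)

lemma ptgt_take: "ptgt G (ptgt G (v, take i es), take l (drop i es)) = ptgt G (v, take (i + l) es)"
  by (simp add: take_add ptgt_append)

lemma psrc_pseg [simp]: "psrc (pseg G i l p) = ptgt G (fst p, take i (snd p))"
  and psrc_pdrop [simp]: "psrc (pdrop G i p) = ptgt G (fst p, take i (snd p))"
  and ptgt_pseg [simp]: "ptgt G (pseg G i l p) = ptgt G (fst p, take (i + l) (snd p))"
  and plen_pseg [simp]: "plen (pseg G i l p) = min (plen p - i) l"
  and plen_pdrop [simp]: "plen (pdrop G i p) = plen p - i"
  by (simp_all add: pseg_def pdrop_def plen_def min.commute ptgt_append take_add)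

lemma ptgt_pdrop [simp]: "ptgt G (pdrop G i p) = ptgt G p"
  using ptgt_append[of G "fst p" "take i (snd p)" "drop i (snd p)"] by (simp add: pdrop_def)

lemma pdrop_0 [simp]: "pdrop G 0 p = p"
  by (simp add: pdrop_def)

lemma pseg_0 [simp]: "pseg G i 0 p = (ptgt G (fst p, take i (snd p)), [])"
  by (simp add: pseg_def)

lemma pseg_all: "plen p \<le> l \<Longrightarrow> pseg G 0 l p = p"
  by (simp add: pseg_def plen_def)

lemma pseg_rest: "plen p \<le> i + l \<Longrightarrow> pseg G i l p = pdrop G i p"
  by (simp add: pseg_def pdrop_def plen_def)

lemma pdrop_all: "plen p \<le> i \<Longrightarrow> pdrop G i p = (ptgt G p, [])"
  by (simp add: pdrop_def plen_def)

lemma pcat_pseg_pseg: "pcat (pseg G i l p) (pseg G (i + l) m p) = pseg G i (l + m) p"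
  by (simp add: pcat_def pseg_def take_add add.commute)

lemma pcat_pseg_pdrop: "pcat (pseg G i l p) (pdrop G (i + l) p) = pdrop G i p"
  by (simp add: pcat_def pseg_def pdrop_def add.commute[of i l] flip: drop_drop)

lemma pcat_prefix_pdrop [simp]: "pcat (pseg G 0 i p) (pdrop G i p) = p"
  using pcat_pseg_pdrop[of G 0 i p] by simp

lemma pseg_pdrop: "pseg G i l (pdrop G j p) = pseg G (j + i) l p"
  and pdrop_pdrop: "pdrop G i (pdrop G j p) = pdrop G (j + i) p"
  by (simp_all add: pseg_def pdrop_def ptgt_take add.commute)

lemma pseg_pseg: "i + l \<le> m \<Longrightarrow> pseg G i l (pseg G j m p) = pseg G (j + i) l p"
  by (simp add: pseg_def ptgt_take drop_take add.commute min_def)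

lemma pseg_pcat1: "i + l \<le> plen p \<Longrightarrow> pseg G i l (pcat p q) = pseg G i l p"
  by (simp add: pseg_def pcat_def plen_def)

lemma pdrop_pcat1: "i \<le> plen p \<Longrightarrow> pdrop G i (pcat p q) = pcat (pdrop G i p) q"
  by (simp add: pdrop_def pcat_def plen_def)

lemma pseg_pcat2: "ptgt G p = psrc q \<Longrightarrow> pseg G (plen p + i) l (pcat p q) = pseg G i l q"
  and pdrop_pcat2: "ptgt G p = psrc q \<Longrightarrow> pdrop G (plen p + i) (pcat p q) = pdrop G i q"
  by (cases p, cases q, simp add: pseg_def pdrop_def pcat_def ptgt_append)+

locale truncated_quiver = fin_digraph G for G :: "('v,'e) pre_digraph" +
  fixes N :: nat
  assumes N2: "N \<ge> 2"
begin

lemma vertex_in_paths: "v \<in> verts G \<Longrightarrow> (v, []) \<in> paths G 0"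
  by (simp add: paths_def awalk_Nil_iff)

lemma psrc_in_verts: "p \<in> paths G n \<Longrightarrow> psrc p \<in> verts G"
  and ptgt_in_verts: "p \<in> paths G n \<Longrightarrow> ptgt G p \<in> verts G"
  and plen_paths: "p \<in> paths G n \<Longrightarrow> plen p = n"
  by (auto simp: paths_def)

lemma pcat_in_paths:
  "p \<in> paths G m \<Longrightarrow> q \<in> paths G n \<Longrightarrow> ptgt G p = psrc q \<Longrightarrow> pcat p q \<in> paths G (m + n)"
  by (cases p, cases q) (auto simp: paths_def pcat_def ptgt_append intro: awalk_appendI)

lemma pcat_in_pathsD:
  assumes "pcat p q \<in> paths G n" "ptgt G p = psrc q"
  shows "p \<in> paths G (plen p)" "q \<in> paths G (plen q)"
  using assms by (cases p, cases q, auto simp: paths_def pcat_def ptgt_append ptgt_def psrc_def)+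

lemma pdrop_in_paths: "p \<in> paths G n \<Longrightarrow> pdrop G i p \<in> paths G (n - i)"
  using pcat_in_pathsD(2)[of "pseg G 0 i p" "pdrop G i p" n] by (simp add: plen_paths)

lemma pseg_in_paths: "p \<in> paths G n \<Longrightarrow> pseg G i l p \<in> paths G (min (n - i) l)"
  using pcat_in_pathsD(1)[of "pseg G i l p" "pdrop G (i + l) p" "n - i"] pdrop_in_paths[of p n i]
  by (simp add: pcat_pseg_pdrop plen_paths)

lemma pseg_in_paths': "p \<in> paths G n \<Longrightarrow> i + l \<le> n \<Longrightarrow> pseg G i l p \<in> paths G l"
  using pseg_in_paths[of p n i l] by (simp add: min_absorb2)

lemma short_pathsI: "p \<in> paths G n \<Longrightarrow> n < N \<Longrightarrow> p \<in> short_paths G N"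
  by (auto simp: short_paths_def)

lemma short_pathsD: "p \<in> short_paths G N \<Longrightarrow> p \<in> paths G (plen p) \<and> plen p < N"
  by (auto simp: short_paths_def plen_paths)

lemma vertex_short: "v \<in> verts G \<Longrightarrow> (v, []) \<in> short_paths G N"
  using N2 by (intro short_pathsI[OF vertex_in_paths]) auto

lemma finite_paths: "finite (paths G n)"
proof (rule finite_subset)
  show "paths G n \<subseteq> verts G \<times> {es. set es \<subseteq> arcs G \<and> length es = n}"
    by (auto simp: paths_def psrc_def plen_def awalk_def)
  show "finite (verts G \<times> {es. set es \<subseteq> arcs G \<and> length es = n})"
    by (intro finite_cartesian_product finite_lists_length_eq) auto
qed

section \<open>The truncated quiver algebra\<close>

abbreviation mul :: "('v,'e,'k::comm_ring_1) alg \<Rightarrow> ('v,'e,'k) alg \<Rightarrow> ('v,'e,'k) alg"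
    (infixl "\<cdot>" 70) where
  "x \<cdot> y \<equiv> A_mult G N x y"

abbreviation carr :: "('v,'e,'k::comm_ring_1) alg set" where
  "carr \<equiv> A_carrier G N"

abbreviation path :: "('v,'e) path \<Rightarrow> ('v,'e,'k::comm_ring_1) alg" where
  "path p \<equiv> Poly_Mapping.single p 1"

abbreviation idem :: "'v \<Rightarrow> ('v,'e,'k::comm_ring_1) alg" where
  "idem v \<equiv> Poly_Mapping.single (v, []) 1"

lemma linmap_mult_left [lin_intro]: "linmap L \<Longrightarrow> linmap (\<lambda>x. L x \<cdot> y)"
  and linmap_mult_right [lin_intro]: "linmap L \<Longrightarrow> linmap (\<lambda>x. y \<cdot> L x)"
  unfolding A_mult_def by (intro lin_intro; assumption)+

lemmas mult_simps =
  linmap_add[OF linmap_mult_left[OF linmap_id]] linmap_add[OF linmap_mult_right[OF linmap_id]]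
  linmap_diff[OF linmap_mult_left[OF linmap_id]] linmap_diff[OF linmap_mult_right[OF linmap_id]]
  linmap_smul[OF linmap_mult_left[OF linmap_id]] linmap_smul[OF linmap_mult_right[OF linmap_id]]
  linmap_minus[OF linmap_mult_left[OF linmap_id]] linmap_minus[OF linmap_mult_right[OF linmap_id]]

lemma mult_zero [simp]: "0 \<cdot> x = 0" "x \<cdot> 0 = 0"
  using linmap_0[OF linmap_mult_left[OF linmap_id]] linmap_0[OF linmap_mult_right[OF linmap_id]] by auto

lemma mult_sum_left: "sum f S \<cdot> x = (\<Sum>i\<in>S. f i \<cdot> x)"
  and mult_sum_right: "x \<cdot> sum f S = (\<Sum>i\<in>S. x \<cdot> f i)"
  by (rule linmap_sum, intro lin_intro)+

lemma path_mult_path [simp]: "path p \<cdot> path q = path_prod G N p q"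
  by (simp add: A_mult_def)

lemma mult_assoc: "x \<cdot> y \<cdot> z = x \<cdot> (y \<cdot> z)"
proof -
  have 1: "path p \<cdot> path q \<cdot> path r = path p \<cdot> (path q \<cdot> path r)" for p q r
    by (auto simp: path_prod_def pcat_assoc)
  have 2: "path p \<cdot> path q \<cdot> z = path p \<cdot> (path q \<cdot> z)" for p q
    by (rule linmap_eqI[of "\<lambda>z. path p \<cdot> path q \<cdot> z" "\<lambda>z. path p \<cdot> (path q \<cdot> z)"])
      (intro lin_intro 1)+
  have 3: "path p \<cdot> y \<cdot> z = path p \<cdot> (y \<cdot> z)" for p
    by (rule linmap_eqI[of "\<lambda>y. path p \<cdot> y \<cdot> z" "\<lambda>y. path p \<cdot> (y \<cdot> z)"]) (intro lin_intro 2)+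
  show ?thesis
    by (rule linmap_eqI[of "\<lambda>x. x \<cdot> y \<cdot> z" "\<lambda>x. x \<cdot> (y \<cdot> z)"]) (intro lin_intro 3)+
qed

lemma carrI: "Poly_Mapping.keys x \<subseteq> short_paths G N \<Longrightarrow> x \<in> carr"
  and carrD: "x \<in> carr \<Longrightarrow> Poly_Mapping.keys x \<subseteq> short_paths G N"
  by (simp_all add: A_carrier_def)

lemma path_in_carr: "p \<in> short_paths G N \<Longrightarrow> path p \<in> carr"
  by (rule carrI) simp

lemma carr_closed [simp, intro]:
  "0 \<in> carr"
  "x \<in> carr \<Longrightarrow> y \<in> carr \<Longrightarrow> x + y \<in> carr"
  "x \<in> carr \<Longrightarrow> smul c x \<in> carr"
  "x \<in> carr \<Longrightarrow> - x \<in> carr"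
  unfolding A_carrier_def using Poly_Mapping.keys_add[of x y] keys_smul[of c x] by auto

lemma carr_diff [simp, intro]: "x \<in> carr \<Longrightarrow> y \<in> carr \<Longrightarrow> x - y \<in> carr"
  using carr_closed(2)[of x "- y"] by simp

lemma carr_sum: "(\<And>i. i \<in> S \<Longrightarrow> f i \<in> carr) \<Longrightarrow> sum f S \<in> carr"
  by (induction S rule: infinite_finite_induct) auto

lemma carr_lin_ext:
  "(\<And>b. b \<in> Poly_Mapping.keys x \<Longrightarrow> h b \<in> carr) \<Longrightarrow> lin_ext h x \<in> carr"
  unfolding lin_ext_def by (intro carr_sum carr_closed)

lemma path_prod_carr:
  "p \<in> short_paths G N \<Longrightarrow> q \<in> short_paths G N \<Longrightarrow> path_prod G N p q \<in> carr"
  unfolding path_prod_def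
  by (auto intro!: path_in_carr dest!: short_pathsD intro: short_pathsI[OF pcat_in_paths])

lemma mult_carr [simp, intro]: "x \<in> carr \<Longrightarrow> y \<in> carr \<Longrightarrow> x \<cdot> y \<in> carr"
  unfolding A_mult_def by (intro carr_lin_ext path_prod_carr) (auto dest: carrD)

lemma idem_mult_path: "idem v \<cdot> path p = (if psrc p = v \<and> plen p < N then path p else 0)"
  and path_mult_idem: "path p \<cdot> idem v = (if ptgt G p = v \<and> plen p < N then path p else 0)"
  by (auto simp: path_prod_def)

lemma one_carr: "A_one G \<in> carr"
  unfolding A_one_def by (intro carr_sum path_in_carr vertex_short)

lemma one_mult [simp]: "x \<in> carr \<Longrightarrow> A_one G \<cdot> x = x"
  and mult_one [simp]: "x \<in> carr \<Longrightarrow> x \<cdot> A_one G = x"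
proof -
  assume x: "x \<in> carr"
  have *: "psrc p \<in> verts G" "ptgt G p \<in> verts G" "plen p < N" if "p \<in> Poly_Mapping.keys x" for p
    using carrD[OF x] that by (auto dest!: short_pathsD simp: psrc_in_verts ptgt_in_verts)
  show "A_one G \<cdot> x = x"
    by (rule linmap_eqI[of "\<lambda>x. A_one G \<cdot> x" "\<lambda>x. x"])
      (intro lin_intro, intro lin_intro, simp add: A_one_def mult_sum_left idem_mult_path * del: path_mult_path)
  show "x \<cdot> A_one G = x"
    by (rule linmap_eqI[of "\<lambda>x. x \<cdot> A_one G" "\<lambda>x. x"])
      (intro lin_intro, intro lin_intro, simp add: A_one_def mult_sum_right path_mult_idem * del: path_mult_path)
qed

section \<open>The Hochschild complex\<close>

text \<open>
  The transpose of the bar differential without its first face, up to a global sign. The recursion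
  produces the alternating signs and the last face, which uses the right action \<open>ra\<close>. The first
  face needs a left action; leaving it out makes it possible to let the first entry of a list play the
  role of the left coefficient.
\<close>

fun bar_tail :: "(('c \<Rightarrow>\<^sub>0 'k::comm_ring_1) \<Rightarrow> ('v,'e,'k) alg \<Rightarrow> ('c \<Rightarrow>\<^sub>0 'k)) \<Rightarrow>
    (('v,'e,'k) alg list \<Rightarrow> ('c \<Rightarrow>\<^sub>0 'k)) \<Rightarrow> ('v,'e,'k) alg list \<Rightarrow> ('c \<Rightarrow>\<^sub>0 'k)" where
  "bar_tail ra F [] = 0"
| "bar_tail ra F [x] = ra (F []) x"
| "bar_tail ra F (x # y # ys) = F (x \<cdot> y # ys) - bar_tail ra (\<lambda>zs. F (x # zs)) (y # ys)"

lemma neg_add_eq: "s + t = - b \<Longrightarrow> (- f + - s) + - t = - (f - b)" for s t b f :: "'z::ab_group_add"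
proof -
  assume "s + t = - b"
  then have "b = - (s + t)" by simp
  then show ?thesis by simp
qed

lemma bar_precomp_eq:
  assumes "xs \<noteq> []"
  shows "bar_precomp G N la ra F xs = la (hd xs) (F (tl xs)) - bar_tail ra F xs"
proof -
  have "(\<Sum>i\<in>{1..<length xs}. smul ((-1) ^ i)
          (F (take (i - 1) xs @ (xs ! (i - 1)) \<cdot> (xs ! i) # drop (i + 1) xs)))
     + smul ((-1) ^ length xs) (ra (F (butlast xs)) (last xs)) = - bar_tail ra F xs"
    using assms
  proof (induction ra F xs rule: bar_tail.induct)
    case (2 ra F x)
    then show ?case by (simp add: smul_minus_one)
  next
    case (3 ra F x y ys)
    let ?f = "\<lambda>i. smul ((-1) ^ i)
      (F (take (i - 1) (x # y # ys) @ ((x # y # ys) ! (i - 1)) \<cdot> ((x # y # ys) ! i) # drop (i + 1) (x # y # ys)))"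
    let ?g = "\<lambda>i. smul ((-1) ^ i)
      (F (x # take (i - 1) (y # ys) @ ((y # ys) ! (i - 1)) \<cdot> ((y # ys) ! i) # drop (i + 1) (y # ys)))"
    have "sum ?f {1..<length (x # y # ys)} = ?f 1 + sum ?f {Suc 1..<Suc (length (y # ys))}"
      by (subst sum.atLeast_Suc_lessThan) auto
    also have "sum ?f {Suc 1..<Suc (length (y # ys))} = (\<Sum>i\<in>{1..<length (y # ys)}. ?f (Suc i))"
      by (rule sum.shift_bounds_Suc_ivl)
    also have "\<dots> = (\<Sum>i\<in>{1..<length (y # ys)}. - ?g i)"
    proof (rule sum.cong[OF refl])
      fix i assume "i \<in> {1..<length (y # ys)}"
      then obtain j where "i = Suc j" by (cases i) auto
      then show "?f (Suc i) = - ?g i" by (simp add: smul_minus)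
    qed
    also have "\<dots> = - sum ?g {1..<length (y # ys)}" by (simp add: sum_negf)
    also have "?f 1 = - F (x \<cdot> y # ys)" by (simp add: smul_minus_one)
    finally have sum: "sum ?f {1..<length (x # y # ys)} = - F (x \<cdot> y # ys) + - sum ?g {1..<length (y # ys)}" .
    have last: "smul ((-1) ^ length (x # y # ys)) (ra (F (butlast (x # y # ys))) (last (x # y # ys)))
      = - smul ((-1) ^ length (y # ys)) (ra (F (x # butlast (y # ys))) (last (y # ys)))"
      by (simp add: smul_minus)
    show ?case unfolding sum last bar_tail.simps(3) by (rule neg_add_eq, rule 3) simp
  qed simp
  then show ?thesis unfolding bar_precomp_def by (simp add: algebra_simps)
qed

lemma bar_tail_linmap:
  assumes "linmap L" "\<And>z x. x \<in> set xs \<Longrightarrow> L (ra z x) = ra' (L z) x"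
  shows "bar_tail ra' (\<lambda>ys. L (F ys)) xs = L (bar_tail ra F xs)"
  using assms(2)
  by (induction ra F xs rule: bar_tail.induct) (simp_all add: assms(1) linmap_0 linmap_diff)

lemma bar_tail_add:
  assumes "\<And>z w x. ra (z + w) x = ra z x + ra w x"
  shows "bar_tail ra (\<lambda>ys. F ys + H ys) xs = bar_tail ra F xs + bar_tail ra H xs"
proof (induction xs arbitrary: F H)
  case (Cons x xs)
  then show ?case by (cases xs) (simp_all add: assms)
qed simp

lemma bar_tail_cong:
  assumes "set xs \<subseteq> carr"
    and "\<And>ys. set ys \<subseteq> carr \<Longrightarrow> Suc (length ys) = length xs \<Longrightarrow> F ys = H ys"
  shows "bar_tail ra F xs = bar_tail ra H xs"
  using assms
proof (induction ra F xs arbitrary: H rule: bar_tail.induct)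
  case (3 ra F x y ys)
  have "bar_tail ra (\<lambda>zs. F (x # zs)) (y # ys) = bar_tail ra (\<lambda>zs. H (x # zs)) (y # ys)"
    using 3 by (intro 3(1)) auto
  moreover have "F (x \<cdot> y # ys) = H (x \<cdot> y # ys)" using 3 by auto
  ultimately show ?case by simp
qed auto

lemma bar_tail_diff:
  "bar_tail mul (\<lambda>ys. F ys - H ys) xs = bar_tail mul F xs - bar_tail mul H xs"
proof (induction xs arbitrary: F H)
  case (Cons x xs)
  then show ?case by (cases xs) (simp_all add: mult_simps)
qed simp

lemma bar_tail_lmult: "bar_tail mul (\<lambda>ys. x \<cdot> F ys) xs = x \<cdot> bar_tail mul F xs"
  by (rule bar_tail_linmap) (intro lin_intro, simp add: mult_assoc)

lemma bar_tail_smul: "bar_tail mul (\<lambda>ys. smul c (F ys)) xs = smul c (bar_tail mul F xs)"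
  by (rule bar_tail_linmap) (intro lin_intro, simp add: mult_simps)

text \<open>
  The first face of the bar differential when \<open>x\<close> is regarded as the left coefficient:
  it is multiplied into the next entry, or into the right coefficient if there is none.
\<close>

fun merge_hd :: "('v,'e,'k::comm_ring_1) alg \<Rightarrow> ('v,'e,'k) cochain \<Rightarrow> ('v,'e,'k) cochain" where
  "merge_hd x F [] = F [] \<cdot> x"
| "merge_hd x F (y # ys) = F (x \<cdot> y # ys)"

lemma bar_tail_Cons: "bar_tail mul F (x # xs) = merge_hd x F xs - bar_tail mul (\<lambda>ys. F (x # ys)) xs"
  by (cases xs) simp_all

lemma bar_tail_merge_hd: "bar_tail mul (merge_hd x F) (y # ys) = bar_tail mul F (x \<cdot> y # ys)"
  by (cases ys) (simp_all add: mult_assoc)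

text \<open>
  The recursion for \<open>bar_tail\<close> turns this into the identity that merging \<open>x\<close> into the
  list and then applying the remaining faces gives the same as the two operations in the other order.
\<close>

lemma bar_tail_bar_tail: "bar_tail mul (bar_tail mul F) xs = 0"
proof (induction xs arbitrary: F)
  case (Cons x xs)
  show ?case
  proof (cases xs)
    case (Cons y ys)
    have "bar_tail mul (\<lambda>zs. bar_tail mul F (x # zs)) xs
      = bar_tail mul (merge_hd x F) xs - bar_tail mul (bar_tail mul (\<lambda>ys. F (x # ys))) xs"
      unfolding bar_tail_Cons by (simp add: bar_tail_diff)
    with Cons.IH show ?thesis by (simp add: Cons bar_tail_merge_hd)
  qed simp
qed simp

text \<open>
  The Hochschild differential on arbitrary functions of lists. Without the restriction to lists over
  the algebra its square and the Leibniz rule can be treated by recursion on lists.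
\<close>

definition cobd :: "('v,'e,'k::comm_ring_1) cochain \<Rightarrow> ('v,'e,'k) cochain" where
  "cobd F xs = (if xs = [] then 0 else hd xs \<cdot> F (tl xs) - bar_tail mul F xs)"

lemma cobd_Nil [simp]: "cobd F [] = 0"
  and cobd_Cons: "cobd F (x # xs) = x \<cdot> F xs - bar_tail mul F (x # xs)"
  by (simp_all add: cobd_def)

lemma hoch_diff_eq: "hoch_diff G N F xs = (if set xs \<subseteq> carr then cobd F xs else 0)"
  by (auto simp: hoch_diff_def cobd_def bar_precomp_eq)

lemma cobd_cobd: "cobd (cobd F) xs = 0"
proof (cases xs)
  case (Cons x xs')
  show ?thesis
  proof (cases xs')
    case (Cons y ys)
    have "(\<lambda>zs. cobd F (x # zs)) = (\<lambda>zs. x \<cdot> F zs - bar_tail mul F (x # zs))"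
      by (simp add: cobd_Cons fun_eq_iff)
    moreover have "bar_tail mul (bar_tail mul F) xs = 0" by (rule bar_tail_bar_tail)
    ultimately show ?thesis
      using \<open>xs = x # xs'\<close> Cons
      by (simp add: cobd_Cons bar_tail_diff bar_tail_lmult mult_simps mult_assoc)
  qed (use Cons in \<open>simp add: cobd_Cons\<close>)
qed simp

lemma cup_Nil: "cup G N F H [] = F [] \<cdot> H []"
  by (simp add: cup_def)

lemma cup_Cons: "cup G N F H (x # xs) = F [] \<cdot> H (x # xs) + cup G N (\<lambda>ys. F (x # ys)) H xs"
  unfolding cup_def by (simp add: sum.atMost_Suc_shift del: sum.atMost_Suc)

lemma cup_lin:
  "cup G N (\<lambda>ys. F ys + F' ys) H xs = cup G N F H xs + cup G N F' H xs"
  "cup G N F (\<lambda>ys. H ys + H' ys) xs = cup G N F H xs + cup G N F H' xs"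
  "cup G N (\<lambda>ys. F ys - F' ys) H xs = cup G N F H xs - cup G N F' H xs"
  "cup G N (\<lambda>ys. - F ys) H xs = - cup G N F H xs"
  "cup G N (\<lambda>ys. smul c (F ys)) H xs = smul c (cup G N F H xs)"
  "cup G N (\<lambda>ys. x \<cdot> F ys) H xs = x \<cdot> cup G N F H xs"
  "cup G N (\<lambda>ys. 0) H xs = 0" "cup G N F (\<lambda>ys. 0) xs = 0"
  by (simp_all add: cup_def mult_simps sum.distrib sum_subtractf sum_negf smul_sum mult_sum_right mult_assoc)

lemma cup_cong:
  assumes "set xs \<subseteq> carr" "\<And>ys. set ys \<subseteq> carr \<Longrightarrow> F ys = F' ys" "\<And>ys. set ys \<subseteq> carr \<Longrightarrow> H ys = H' ys"
  shows "cup G N F H xs = cup G N F' H' xs"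
  unfolding cup_def
proof (rule sum.cong[OF refl])
  fix i
  have "set (take i xs) \<subseteq> carr" "set (drop i xs) \<subseteq> carr"
    using assms(1) set_take_subset[of i xs] set_drop_subset[of i xs] by auto
  with assms(2,3) show "F (take i xs) \<cdot> H (drop i xs) = F' (take i xs) \<cdot> H' (drop i xs)" by simp
qed

lemma cup_assoc: "cup G N (cup G N F H) L xs = cup G N F (cup G N H L) xs"
proof (induction xs arbitrary: F)
  case (Cons x xs)
  have "cup G N (cup G N F H) L (x # xs)
    = F [] \<cdot> H [] \<cdot> L (x # xs) + cup G N (\<lambda>ys. F [] \<cdot> H (x # ys) + cup G N (\<lambda>ys. F (x # ys)) H ys) L xs"
    by (simp add: cup_Cons cup_Nil)
  also have "\<dots> = F [] \<cdot> cup G N H L (x # xs) + cup G N (\<lambda>ys. F (x # ys)) (cup G N H L) xs"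
    by (simp add: cup_lin Cons.IH cup_Cons mult_simps mult_assoc)
  finally show ?case by (simp add: cup_Cons)
qed (simp add: cup_Nil mult_assoc)

text \<open>
  The sign twist that makes the Leibniz rule for the cup product free of case distinctions on degrees,
  also for inhomogeneous cochains.
\<close>

definition signed :: "('v,'e,'k::comm_ring_1) cochain \<Rightarrow> ('v,'e,'k) cochain" where
  "signed F xs = smul ((- 1) ^ length xs) (F xs)"

lemma signed_Nil [simp]: "signed F [] = F []"
  and signed_Cons: "(\<lambda>ys. signed F (x # ys)) = (\<lambda>ys. - signed (\<lambda>ys. F (x # ys)) ys)"
  by (simp_all add: signed_def smul_minus)

lemma signed_signed [simp]: "signed (signed F) = F"
  by (simp add: signed_def fun_eq_iff smul_smul flip: power_mult_distrib)

lemma bar_tail_cup: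
  "xs \<noteq> [] \<Longrightarrow> bar_tail mul (cup G N F H) xs
    = cup G N (bar_tail mul F) H xs - cup G N (signed F) (cobd H) xs"
proof (induction xs arbitrary: F)
  case (Cons x xs)
  show ?case
  proof (cases xs)
    case Nil
    then show ?thesis by (simp add: cup_Cons cup_Nil cobd_Cons mult_simps mult_assoc)
  next
    case (Cons y ys)
    let ?F = "\<lambda>ys. F (x # ys)"
    have "bar_tail mul (cup G N F H) (x # xs)
      = cup G N F H (x \<cdot> y # ys) - bar_tail mul (\<lambda>zs. F [] \<cdot> H (x # zs) + cup G N ?F H zs) (y # ys)"
      by (simp add: Cons cup_Cons)
    also have "\<dots> = F [] \<cdot> H (x \<cdot> y # ys) + cup G N (\<lambda>ys. F (x \<cdot> y # ys)) H ys
      - F [] \<cdot> bar_tail mul (\<lambda>zs. H (x # zs)) (y # ys)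
      - cup G N (bar_tail mul ?F) H (y # ys) + cup G N (signed ?F) (cobd H) (y # ys)"
      using Cons.IH[of ?F] by (simp add: Cons cup_Cons bar_tail_add bar_tail_lmult mult_simps)
    finally have lhs: "bar_tail mul (cup G N F H) (x # xs) = \<dots>" .
    have "cup G N (bar_tail mul F) H (x # xs)
      = cup G N (\<lambda>zs. merge_hd x F zs - bar_tail mul ?F zs) H xs"
      by (simp add: cup_Cons bar_tail_Cons)
    also have "\<dots> = F [] \<cdot> x \<cdot> H (y # ys) + cup G N (\<lambda>ys. F (x \<cdot> y # ys)) H ys - cup G N (bar_tail mul ?F) H (y # ys)"
      by (simp add: cup_lin Cons) (simp add: cup_Cons)
    finally have r1: "cup G N (bar_tail mul F) H (x # xs) = \<dots>" .
    have r2: "cup G N (signed F) (cobd H) (x # xs)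
      = F [] \<cdot> (x \<cdot> H (y # ys) - H (x \<cdot> y # ys) + bar_tail mul (\<lambda>zs. H (x # zs)) (y # ys))
        - cup G N (signed ?F) (cobd H) (y # ys)"
      by (simp add: cup_Cons[of _ _ x] signed_Cons cup_lin cobd_Cons[of _ x] Cons algebra_simps)
    show ?thesis unfolding lhs r1 r2 by (simp add: mult_simps mult_assoc)
  qed
qed simp

text \<open>
  The graded Leibniz rule. Both the cup product and \<open>bar_tail\<close> are recursive in the list, so it
  follows by splitting off the first entry.
\<close>

lemma cobd_cup:
  "cobd (cup G N F H) xs = cup G N (cobd F) H xs + cup G N (signed F) (cobd H) xs"
proof (cases xs)
  case (Cons x xs')
  have "cup G N (bar_tail mul F) H xs = cup G N (\<lambda>ys. bar_tail mul F (x # ys)) H xs'"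
    by (simp add: Cons cup_Cons)
  moreover have "cup G N (cobd F) H xs
      = x \<cdot> cup G N F H xs' - cup G N (\<lambda>ys. bar_tail mul F (x # ys)) H xs'"
    by (simp add: Cons cup_Cons cobd_Cons cup_lin)
  ultimately show ?thesis
    using bar_tail_cup[of xs F H] by (simp add: Cons cobd_Cons)
qed (simp add: cup_Nil)

lemma cobd_cong:
  assumes "set xs \<subseteq> carr"
    and "\<And>ys. set ys \<subseteq> carr \<Longrightarrow> Suc (length ys) = length xs \<Longrightarrow> F ys = H ys"
  shows "cobd F xs = cobd H xs"
proof (cases xs)
  case (Cons x ys)
  have "bar_tail mul F xs = bar_tail mul H xs" using assms by (rule bar_tail_cong)
  with Cons assms show ?thesis by (auto simp: cobd_Cons)
qed simp

lemma cobd_smul: "cobd (\<lambda>ys. smul c (F ys)) xs = smul c (cobd F xs)"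
  and cobd_add: "cobd (\<lambda>ys. F ys + H ys) xs = cobd F xs + cobd H xs"
  by (cases xs; simp add: cobd_Cons bar_tail_smul bar_tail_add mult_simps smul_diff_right)+

lemma cobd_signed:
  assumes "set xs \<subseteq> carr"
  shows "cobd (signed F) xs = - signed (cobd F) xs"
proof (cases xs)
  case (Cons x ys)
  have "cobd (signed F) xs = cobd (\<lambda>zs. smul ((- 1) ^ length ys) (F zs)) xs"
    by (rule cobd_cong) (use Cons assms in \<open>auto simp: signed_def\<close>)
  then show ?thesis by (simp add: cobd_smul signed_def Cons smul_minus)
qed simp

subsection \<open>The Hochschild cohomology ring\<close>

lemma multilinear_on_ConsI:
  assumes "\<And>x y xs. x \<in> S \<Longrightarrow> y \<in> S \<Longrightarrow> set xs \<subseteq> S \<Longrightarrow> F ((x + y) # xs) = F (x # xs) + F (y # xs)"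
    and "\<And>c x xs. x \<in> S \<Longrightarrow> set xs \<subseteq> S \<Longrightarrow> F (smul c x # xs) = smul c (F (x # xs))"
    and "\<And>x. x \<in> S \<Longrightarrow> multilinear_on S (\<lambda>xs. F (x # xs))"
  shows "multilinear_on S F"
  unfolding multilinear_on_def
proof (intro allI impI conjI ballI)
  fix xs ys c x y assume *: "set xs \<subseteq> S" "set ys \<subseteq> S" "x \<in> S"
  show "F (xs @ smul c x # ys) = smul c (F (xs @ x # ys))"
    using * multilinear_onD(2)[OF assms(3)] by (cases xs) (simp_all add: assms(2))
  show "y \<in> S \<Longrightarrow> F (xs @ (x + y) # ys) = F (xs @ x # ys) + F (xs @ y # ys)"
    using * multilinear_onD(1)[OF assms(3)] by (cases xs) (simp_all add: assms(1))
qed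

lemma multilinear_on_linmap:
  "linmap L \<Longrightarrow> multilinear_on S F \<Longrightarrow> multilinear_on S (\<lambda>xs. L (F xs))"
  unfolding multilinear_on_def by (simp add: linmap_add linmap_smul)

lemma multilinear_on_add:
  assumes "multilinear_on S F" "multilinear_on S H"
  shows "multilinear_on S (\<lambda>xs. F xs + H xs)"
  using assms unfolding multilinear_on_def by (simp add: algebra_simps smul_add_right)

lemma multilinear_on_diff:
  assumes "multilinear_on S F" "multilinear_on S H"
  shows "multilinear_on S (\<lambda>xs. F xs - H xs)"
  using assms unfolding multilinear_on_def by (simp add: algebra_simps smul_diff_right)

lemma multilinear_on_zero: "multilinear_on S (\<lambda>xs. 0)"
  unfolding multilinear_on_def by simp

lemma multilinear_on_cong:
  assumes "multilinear_on carr F" "\<And>xs. set xs \<subseteq> carr \<Longrightarrow> F xs = H xs"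
  shows "multilinear_on carr H"
  unfolding multilinear_on_def
proof (intro allI impI conjI ballI)
  fix xs ys :: "('v,'e,'a) alg list" and x y :: "('v,'e,'a) alg" and c :: 'a
  assume *: "set xs \<subseteq> carr" "set ys \<subseteq> carr" "x \<in> carr"
  show "H (xs @ smul c x # ys) = smul c (H (xs @ x # ys))"
    using * multilinear_onD(2)[OF assms(1) *] by (simp flip: assms(2))
  show "y \<in> carr \<Longrightarrow> H (xs @ (x + y) # ys) = H (xs @ x # ys) + H (xs @ y # ys)"
    using * multilinear_onD(1)[OF assms(1) *] by (simp flip: assms(2))
qed

lemma multilinear_merge_hd:
  assumes "multilinear_on carr F" "x \<in> carr"
  shows "multilinear_on carr (merge_hd x F)"
proof (rule multilinear_on_ConsI)
  fix y :: "('v,'e,'a) alg" assume "y \<in> carr"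
  then show "multilinear_on carr (\<lambda>ys. merge_hd x F (y # ys))"
    using multilinear_on_shift[OF assms(1), of "x \<cdot> y"] assms(2) by simp
qed (use assms in \<open>simp_all add: mult_simps multilinear_on_hd\<close>)

lemma merge_hd_lin:
  assumes "multilinear_on carr F" "x \<in> carr" "y \<in> carr" "set xs \<subseteq> carr"
  shows "merge_hd (x + y) F xs = merge_hd x F xs + merge_hd y F xs"
    and "merge_hd (smul c x) F xs = smul c (merge_hd x F xs)"
  using assms by (cases xs; simp add: mult_simps multilinear_on_hd)+

lemma multilinear_bar_tail:
  assumes "multilinear_on carr F"
  shows "multilinear_on carr (bar_tail mul F)"
proof -
  define P where "P K \<longleftrightarrow> (\<exists>M F. multilinear_on carr M \<and> multilinear_on carr F \<and>
    K = (\<lambda>xs. M xs + bar_tail mul F xs))" for K :: "('v,'e,'a) cochain"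
  show ?thesis
  proof (rule multilinear_onI[where P = P])
    show "P (bar_tail mul F)"
      unfolding P_def using assms by (intro exI[of _ "\<lambda>_. 0"] exI[of _ F]) (simp add: multilinear_on_zero)
  next
    fix K and x :: "('v,'e,'a) alg" assume "P K" and x: "x \<in> carr"
    then obtain M F where *: "multilinear_on carr M" "multilinear_on carr F"
      and K: "K = (\<lambda>xs. M xs + bar_tail mul F xs)" unfolding P_def by blast
    have "multilinear_on carr (\<lambda>xs. M (x # xs) + merge_hd x F xs)"
      "multilinear_on carr (\<lambda>xs. - F (x # xs))"
      using * x multilinear_on_linmap[OF linmap_uminus[OF linmap_id]]
      by (auto intro!: multilinear_on_add multilinear_merge_hd multilinear_on_shift)
    moreover have "bar_tail mul (\<lambda>ys. - F (x # ys)) xs = - bar_tail mul (\<lambda>ys. F (x # ys)) xs" for xs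
      by (rule bar_tail_linmap) (intro lin_intro, simp add: mult_simps)
    then have "(\<lambda>xs. K (x # xs)) = (\<lambda>xs. (M (x # xs) + merge_hd x F xs) + bar_tail mul (\<lambda>xs. - F (x # xs)) xs)"
      by (simp add: K bar_tail_Cons algebra_simps)
    ultimately show "P (\<lambda>xs. K (x # xs))" unfolding P_def by blast
  next
    fix K and x y :: "('v,'e,'a) alg" and xs :: "('v,'e,'a) alg list" and c :: 'a
    assume "P K" and x: "x \<in> carr" and xs: "set xs \<subseteq> carr"
    then obtain M F where *: "multilinear_on carr M" "multilinear_on carr F"
      and K: "K = (\<lambda>xs. M xs + bar_tail mul F xs)" unfolding P_def by blast
    have "bar_tail mul (\<lambda>ys. F (smul c x # ys)) xs = bar_tail mul (\<lambda>ys. smul c (F (x # ys))) xs"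
      using multilinear_on_hd(2)[OF *(2)] x xs by (intro bar_tail_cong) auto
    then show "K (smul c x # xs) = smul c (K (x # xs))"
      using * x xs multilinear_on_hd[OF *(1)]
      by (simp add: K bar_tail_Cons merge_hd_lin bar_tail_smul smul_add_right smul_diff_right)
    show "K ((x + y) # xs) = K (x # xs) + K (y # xs)" if y: "y \<in> carr"
    proof -
      have "bar_tail mul (\<lambda>ys. F ((x + y) # ys)) xs = bar_tail mul (\<lambda>ys. F (x # ys) + F (y # ys)) xs"
        using multilinear_on_hd(1)[OF *(2)] x y xs by (intro bar_tail_cong) auto
      then show ?thesis
        using * x y xs multilinear_on_hd[OF *(1)]
        by (simp add: K bar_tail_Cons merge_hd_lin bar_tail_add mult_simps)
    qed
  qed
qed

lemma multilinear_cup: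
  assumes "multilinear_on carr F" "multilinear_on carr H"
  shows "multilinear_on carr (cup G N F H)"
proof -
  define P where "P K \<longleftrightarrow> (\<exists>M F. multilinear_on carr M \<and> multilinear_on carr F \<and>
    K = (\<lambda>xs. M xs + cup G N F H xs))" for K :: "('v,'e,'a) cochain"
  show ?thesis
  proof (rule multilinear_onI[where P = P])
    show "P (cup G N F H)"
      unfolding P_def using assms by (intro exI[of _ "\<lambda>_. 0"] exI[of _ F]) (simp add: multilinear_on_zero)
  next
    fix K and x :: "('v,'e,'a) alg" assume "P K" and x: "x \<in> carr"
    then obtain M F where *: "multilinear_on carr M" "multilinear_on carr F"
      and K: "K = (\<lambda>xs. M xs + cup G N F H xs)" unfolding P_def by blast
    have "multilinear_on carr (\<lambda>xs. M (x # xs) + F [] \<cdot> H (x # xs))"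
      "multilinear_on carr (\<lambda>xs. F (x # xs))"
      using * x assms multilinear_on_linmap[OF linmap_mult_right[OF linmap_id]]
      by (auto intro!: multilinear_on_add multilinear_on_shift)
    moreover have "(\<lambda>xs. K (x # xs)) = (\<lambda>xs. (M (x # xs) + F [] \<cdot> H (x # xs)) + cup G N (\<lambda>xs. F (x # xs)) H xs)"
      by (simp add: K cup_Cons algebra_simps)
    ultimately show "P (\<lambda>xs. K (x # xs))" unfolding P_def by blast
  next
    fix K and x y :: "('v,'e,'a) alg" and xs :: "('v,'e,'a) alg list" and c :: 'a
    assume "P K" and x: "x \<in> carr" and xs: "set xs \<subseteq> carr"
    then obtain M F where *: "multilinear_on carr M" "multilinear_on carr F"
      and K: "K = (\<lambda>xs. M xs + cup G N F H xs)" unfolding P_def by blast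
    have "cup G N (\<lambda>ys. F (smul c x # ys)) H xs = cup G N (\<lambda>ys. smul c (F (x # ys))) H xs"
      using multilinear_on_hd(2)[OF *(2)] x xs by (intro cup_cong) auto
    then show "K (smul c x # xs) = smul c (K (x # xs))"
      using * x xs multilinear_on_hd[OF *(1)] multilinear_on_hd[OF assms(2)]
      by (simp add: K cup_Cons cup_lin smul_add_right mult_simps)
    show "K ((x + y) # xs) = K (x # xs) + K (y # xs)" if y: "y \<in> carr"
    proof -
      have "cup G N (\<lambda>ys. F ((x + y) # ys)) H xs = cup G N (\<lambda>ys. F (x # ys) + F (y # ys)) H xs"
        using multilinear_on_hd(1)[OF *(2)] x y xs by (intro cup_cong) auto
      then show ?thesis
        using * x y xs multilinear_on_hd[OF *(1)] multilinear_on_hd[OF assms(2)]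
        by (simp add: K cup_Cons cup_lin mult_simps)
    qed
  qed
qed

lemma bar_tail_carr:
  "set xs \<subseteq> carr \<Longrightarrow> (\<And>ys. set ys \<subseteq> carr \<Longrightarrow> F ys \<in> carr) \<Longrightarrow> bar_tail mul F xs \<in> carr"
proof (induction xs arbitrary: F)
  case (Cons x xs)
  then show ?case by (cases xs) auto
qed simp

lemma bar_tail_zero [simp]: "bar_tail mul (\<lambda>_. 0) xs = 0"
proof (induction xs)
  case (Cons x xs)
  then show ?case by (cases xs) simp_all
qed simp

lemma bar_tail_long:
  "(\<And>ys. d \<le> length ys \<Longrightarrow> F ys = 0) \<Longrightarrow> Suc d \<le> length xs \<Longrightarrow> bar_tail mul F xs = 0"
proof (induction xs arbitrary: F d)
  case (Cons x xs)
  show ?case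
  proof (cases xs)
    case (Cons y ys)
    have "bar_tail mul (\<lambda>zs. F (x # zs)) xs = 0"
    proof (cases d)
      case 0
      then show ?thesis using Cons.prems by simp
    next
      case (Suc n)
      show ?thesis by (rule Cons.IH[of n]) (use Cons.prems Suc in auto)
    qed
    then show ?thesis using Cons.prems Cons by simp
  qed (use Cons.prems in simp)
qed simp

lemma hoch_cochainsD:
  assumes "F \<in> hoch_cochains G N"
  shows "multilinear_on carr F" "set xs \<subseteq> carr \<Longrightarrow> F xs \<in> carr" "\<not> set xs \<subseteq> carr \<Longrightarrow> F xs = 0"
    "\<exists>d. \<forall>xs. d \<le> length xs \<longrightarrow> F xs = 0"
  using assms by (auto simp: hoch_cochains_def)

lemma hoch_cochains_eqI:
  assumes "F \<in> hoch_cochains G N" "H \<in> hoch_cochains G N" "\<And>xs. set xs \<subseteq> carr \<Longrightarrow> F xs = H xs"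
  shows "F = H"
  using assms(3) hoch_cochainsD(3)[OF assms(1)] hoch_cochainsD(3)[OF assms(2)] by (metis ext)

lemma hoch_diff_cochain:
  assumes "F \<in> hoch_cochains G N"
  shows "hoch_diff G N F \<in> hoch_cochains G N"
proof -
  note F = hoch_cochainsD[OF assms]
  have "multilinear_on carr (\<lambda>xs. cobd F xs)"
  proof (rule multilinear_on_cong)
    show "multilinear_on carr (\<lambda>xs. (if xs = [] then 0 else hd xs \<cdot> F (tl xs)) - bar_tail mul F xs)"
    proof (rule multilinear_on_diff[OF _ multilinear_bar_tail[OF F(1)]], rule multilinear_on_ConsI)
      fix x :: "('v,'e,'a) alg" assume "x \<in> carr"
      show "multilinear_on carr (\<lambda>xs. if x # xs = [] then 0 else hd (x # xs) \<cdot> F (tl (x # xs)))"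
        using multilinear_on_linmap[OF linmap_mult_right[OF linmap_id] F(1)] by simp
    qed (simp_all add: mult_simps)
  qed (simp add: cobd_def)
  then have "multilinear_on carr (hoch_diff G N F)"
    by (rule multilinear_on_cong) (simp add: hoch_diff_eq)
  moreover have "hoch_diff G N F xs \<in> carr" if "set xs \<subseteq> carr" for xs
  proof (cases xs)
    case (Cons x ys)
    have "x \<cdot> F ys - bar_tail mul F xs \<in> carr"
      using that F(2) Cons by (intro carr_diff mult_carr bar_tail_carr) auto
    then show ?thesis using that Cons by (simp add: hoch_diff_eq cobd_Cons)
  qed (simp add: hoch_diff_eq)
  moreover obtain d where d: "\<And>xs. d \<le> length xs \<Longrightarrow> F xs = 0" using F(4) by blast
  have "hoch_diff G N F xs = 0" if "Suc d \<le> length xs" for xs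
    using that d bar_tail_long[OF d that] by (cases xs) (auto simp: hoch_diff_eq cobd_Cons)
  then have "\<exists>d. \<forall>xs. d \<le> length xs \<longrightarrow> hoch_diff G N F xs = 0" by blast
  ultimately show ?thesis unfolding hoch_cochains_def by (simp add: hoch_diff_eq)
qed

lemma cup_outside:
  assumes "F \<in> hoch_cochains G N" "H \<in> hoch_cochains G N" "\<not> set xs \<subseteq> carr"
  shows "cup G N F H xs = 0"
  unfolding cup_def
proof (rule sum.neutral, rule ballI)
  fix i
  have "set (take i xs) \<union> set (drop i xs) = set xs" by (metis append_take_drop_id set_append)
  then have "\<not> set (take i xs) \<subseteq> carr \<or> \<not> set (drop i xs) \<subseteq> carr" using assms(3) by blast
  then show "F (take i xs) \<cdot> H (drop i xs) = 0"
    using hoch_cochainsD(3)[OF assms(1), of "take i xs"] hoch_cochainsD(3)[OF assms(2), of "drop i xs"]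
    by (elim disjE) simp_all
qed

lemma cup_cochain:
  assumes "F \<in> hoch_cochains G N" "H \<in> hoch_cochains G N"
  shows "cup G N F H \<in> hoch_cochains G N"
proof -
  note F = hoch_cochainsD[OF assms(1)] and H = hoch_cochainsD[OF assms(2)]
  have "cup G N F H xs \<in> carr" if "set xs \<subseteq> carr" for xs
    unfolding cup_def using that
    by (intro carr_sum mult_carr F(2) H(2)) (meson order_trans set_take_subset set_drop_subset)+
  moreover obtain d e where d: "\<And>xs. d \<le> length xs \<Longrightarrow> F xs = 0" and e: "\<And>xs. e \<le> length xs \<Longrightarrow> H xs = 0"
    using F(4) H(4) by blast
  have "cup G N F H xs = 0" if "d + e \<le> length xs" for xs
    unfolding cup_def
  proof (rule sum.neutral, rule ballI)
    fix i assume "i \<in> {..length xs}"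
    then show "F (take i xs) \<cdot> H (drop i xs) = 0"
      using d[of "take i xs"] e[of "drop i xs"] that by (cases "d \<le> i") auto
  qed
  ultimately show ?thesis unfolding hoch_cochains_def
    using multilinear_cup[OF F(1) H(1)] cup_outside[OF assms] by blast
qed

lemma cochain_add:
  assumes "F \<in> hoch_cochains G N" "H \<in> hoch_cochains G N"
  shows "(\<lambda>xs. F xs + H xs) \<in> hoch_cochains G N"
proof -
  note F = hoch_cochainsD[OF assms(1)] and H = hoch_cochainsD[OF assms(2)]
  obtain d e where d: "\<And>xs. d \<le> length xs \<Longrightarrow> F xs = 0" and e: "\<And>xs. e \<le> length xs \<Longrightarrow> H xs = 0"
    using F(4) H(4) by blast
  have "F xs + H xs = 0" if "d + e \<le> length xs" for xs using d[of xs] e[of xs] that by simp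
  then have "\<exists>d. \<forall>xs. d \<le> length xs \<longrightarrow> F xs + H xs = 0" by blast
  then show ?thesis
    using F(2,3) H(2,3) multilinear_on_add[OF F(1) H(1)] unfolding hoch_cochains_def by simp
qed

lemma cochain_linmap:
  assumes "F \<in> hoch_cochains G N" "linmap L" "\<And>x. x \<in> carr \<Longrightarrow> L x \<in> carr"
  shows "(\<lambda>xs. L (F xs)) \<in> hoch_cochains G N"
proof -
  note F = hoch_cochainsD[OF assms(1)]
  have "\<exists>d. \<forall>xs. d \<le> length xs \<longrightarrow> L (F xs) = 0"
    using F(4) linmap_0[OF assms(2)] by metis
  then show ?thesis
    using F(2,3) assms(2,3) multilinear_on_linmap[OF assms(2) F(1)]
    unfolding hoch_cochains_def by (simp add: linmap_0)
qed

lemma cochain_smul: "F \<in> hoch_cochains G N \<Longrightarrow> (\<lambda>xs. smul c (F xs)) \<in> hoch_cochains G N"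
  by (rule cochain_linmap) (auto intro: lin_intro)

lemma zero_cochain: "(\<lambda>_. 0) \<in> hoch_cochains G N"
  unfolding hoch_cochains_def by (auto simp: multilinear_on_zero)

lemma restrict_degree_cochain:
  assumes "multilinear_on carr F" "\<And>xs. set xs \<subseteq> carr \<Longrightarrow> length xs = n \<Longrightarrow> F xs \<in> carr"
  shows "(\<lambda>xs. if set xs \<subseteq> carr \<and> length xs = n then F xs else 0) \<in> hoch_homogeneous G N n"
proof -
  let ?F = "\<lambda>xs. if set xs \<subseteq> carr \<and> length xs = n then F xs else 0"
  have "multilinear_on carr (\<lambda>xs. if length xs = n then F xs else 0)"
    using assms(1) unfolding multilinear_on_def by auto
  then have "multilinear_on carr ?F"
    by (rule multilinear_on_cong) auto
  moreover have "\<exists>d. \<forall>xs. d \<le> length xs \<longrightarrow> ?F xs = 0" by (rule exI[of _ "Suc n"]) auto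
  ultimately show ?thesis using assms(2) unfolding hoch_cochains_def hoch_homogeneous_def by simp
qed

lemma scalar_cochain: "hoch_scalar G c \<in> hoch_homogeneous G N 0"
proof -
  have "multilinear_on carr (hoch_scalar G c)"
    unfolding multilinear_on_def hoch_scalar_def by simp
  from restrict_degree_cochain[OF this, of 0] one_carr show ?thesis
    by (auto simp: hoch_scalar_def hoch_homogeneous_def hoch_cochains_def multilinear_on_def)
qed

lemma signed_cochain:
  assumes "F \<in> hoch_cochains G N"
  shows "signed F \<in> hoch_cochains G N"
proof -
  note F = hoch_cochainsD[OF assms]
  have "multilinear_on carr (signed F)"
    using F(1) unfolding multilinear_on_def signed_def by (simp add: smul_add_right smul_smul mult.commute)
  then show ?thesis using F unfolding hoch_cochains_def signed_def by fastforce
qed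

abbreviation "cocycle F \<equiv> F \<in> carrier (hoch_cocycle_ring G N)"

lemma cocycle_iff:
  "cocycle F \<longleftrightarrow> F \<in> hoch_cochains G N \<and> (\<forall>xs. set xs \<subseteq> carr \<longrightarrow> cobd F xs = 0)"
  by (auto simp: hoch_cocycle_ring_def hoch_diff_eq fun_eq_iff)

lemma cocycle_ring_simps [simp]:
  "F \<otimes>\<^bsub>hoch_cocycle_ring G N\<^esub> H = cup G N F H"
  "\<one>\<^bsub>hoch_cocycle_ring G N\<^esub> = hoch_scalar G 1"
  "\<zero>\<^bsub>hoch_cocycle_ring G N\<^esub> = (\<lambda>_. 0)"
  "F \<oplus>\<^bsub>hoch_cocycle_ring G N\<^esub> H = (\<lambda>xs. F xs + H xs)"
  by (simp_all add: hoch_cocycle_ring_def)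

lemma cup_cocycle:
  assumes "cocycle F" "cocycle H"
  shows "cocycle (cup G N F H)"
proof -
  have "cup G N (cobd F) H xs = cup G N (\<lambda>_. 0) H xs"
    "cup G N (signed F) (cobd H) xs = cup G N (signed F) (\<lambda>_. 0) xs" if "set xs \<subseteq> carr" for xs
    using assms that by (auto intro!: cup_cong simp: cocycle_iff)
  then show ?thesis using assms by (simp add: cocycle_iff cup_cochain cobd_cup cup_lin)
qed

lemma cup_scalar_left:
  assumes "\<And>ys. set ys \<subseteq> carr \<Longrightarrow> F ys \<in> carr" "set xs \<subseteq> carr"
  shows "cup G N (hoch_scalar G c) F xs = smul c (F xs)"
proof (cases xs)
  case (Cons x ys)
  have "(\<lambda>zs. hoch_scalar G c (x # zs)) = (\<lambda>_. 0)" by (simp add: hoch_scalar_def)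
  with assms show ?thesis by (simp add: cup_Cons Cons cup_lin hoch_scalar_def mult_simps)
qed (use assms in \<open>simp add: cup_Nil hoch_scalar_def mult_simps\<close>)

lemma cup_scalar_right:
  assumes "\<And>ys. set ys \<subseteq> carr \<Longrightarrow> F ys \<in> carr" "set xs \<subseteq> carr"
  shows "cup G N F (hoch_scalar G c) xs = smul c (F xs)"
  using assms
proof (induction xs arbitrary: F)
  case (Cons x xs)
  from Cons.prems Cons.IH[of "\<lambda>ys. F (x # ys)"] show ?case
    by (simp add: cup_Cons hoch_scalar_def)
qed (simp add: cup_Nil hoch_scalar_def mult_simps)

lemma scalar_cocycle: "cocycle (hoch_scalar G c)"
proof -
  have "cobd (hoch_scalar G c) xs = 0" if "set xs \<subseteq> carr" for xs
    using that
  proof (cases xs)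
    case (Cons x ys)
    have *: "bar_tail mul (\<lambda>zs. hoch_scalar G c (x # zs)) ys = 0"
      by (simp add: hoch_scalar_def)
    with Cons that show ?thesis
      by (cases ys) (simp_all add: cobd_Cons bar_tail_Cons hoch_scalar_def mult_simps)
  qed simp
  then show ?thesis using scalar_cochain[of c] by (simp add: cocycle_iff hoch_homogeneous_def)
qed

lemma cocycle_linear:
  assumes "cocycle F"
  shows "cocycle H \<Longrightarrow> cocycle (\<lambda>xs. F xs + H xs)" "cocycle (\<lambda>xs. - F xs)" "cocycle (\<lambda>xs. smul c (F xs))"
proof -
  show "cocycle (\<lambda>xs. smul c (F xs))" for c
    using assms by (simp add: cocycle_iff cochain_add cochain_smul cobd_smul)
  from this[of "- 1"] show "cocycle (\<lambda>xs. - F xs)" by (simp add: smul_minus_one)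
  show "cocycle H \<Longrightarrow> cocycle (\<lambda>xs. F xs + H xs)"
    using assms by (simp add: cocycle_iff cochain_add cochain_smul cobd_add)
qed

lemma zero_cocycle: "cocycle (\<lambda>_. 0)"
  using cocycle_linear(3)[OF scalar_cocycle, of 0 0] by simp

lemma cocycle_ring: "ring (hoch_cocycle_ring G N :: ('v,'e,'k::comm_ring_1) cochain ring)"
proof (rule ringI)
  let ?R = "hoch_cocycle_ring G N :: ('v,'e,'k) cochain ring"
  show "abelian_group ?R"
  proof (rule abelian_groupI)
    fix F assume "F \<in> carrier ?R"
    then show "\<exists>H\<in>carrier ?R. H \<oplus>\<^bsub>?R\<^esub> F = \<zero>\<^bsub>?R\<^esub>"
      by (intro bexI[of _ "\<lambda>xs. - F xs"]) (simp_all add: cocycle_linear)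
  qed (simp_all add: cocycle_linear zero_cocycle algebra_simps)
  show "Group.monoid ?R"
  proof (rule monoidI)
    fix F assume F: "F \<in> carrier ?R"
    have Fc: "F \<in> hoch_cochains G N" using F by (simp add: cocycle_iff)
    show "\<one>\<^bsub>?R\<^esub> \<otimes>\<^bsub>?R\<^esub> F = F" "F \<otimes>\<^bsub>?R\<^esub> \<one>\<^bsub>?R\<^esub> = F"
      using F scalar_cocycle
      by (auto intro!: hoch_cochains_eqI[OF cup_cochain Fc]
          simp: cocycle_iff hoch_cochainsD(2) cup_scalar_left cup_scalar_right)
  qed (simp_all add: cup_cocycle scalar_cocycle fun_eq_iff cup_assoc)
qed (simp_all add: fun_eq_iff cup_lin)

lemma coboundary_cocycle: "F \<in> hoch_cochains G N \<Longrightarrow> cocycle (hoch_diff G N F)"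
proof -
  assume F: "F \<in> hoch_cochains G N"
  have "cobd (hoch_diff G N F) xs = cobd (cobd F) xs" if "set xs \<subseteq> carr" for xs
    using that by (rule cobd_cong) (simp add: hoch_diff_eq)
  then show ?thesis using F by (simp add: cocycle_iff hoch_diff_cochain cobd_cobd)
qed

text \<open>
  By the Leibniz rule: the product with a cocycle as second factor is the coboundary of a cup product. If the
  cocycle is the first factor, it is twisted beforehand to compensate the sign; the twisted cochain
  is again a cocycle because the twist anticommutes with the differential.
\<close>

lemma cup_coboundary:
  assumes "cocycle F" "H \<in> hoch_cochains G N"
  shows "cup G N (hoch_diff G N H) F \<in> hoch_coboundaries G N"
    and "cup G N F (hoch_diff G N H) \<in> hoch_coboundaries G N"
proof -
  have F: "F \<in> hoch_cochains G N" and F0: "\<And>ys. set ys \<subseteq> carr \<Longrightarrow> cobd F ys = 0"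
    using assms(1) by (auto simp: cocycle_iff)
  have "cup G N (hoch_diff G N H) F = hoch_diff G N (cup G N H F)"
  proof (rule hoch_cochains_eqI)
    fix xs :: "('v,'e,'a) alg list" assume xs: "set xs \<subseteq> carr"
    have "cup G N (hoch_diff G N H) F xs = cup G N (cobd H) F xs"
      using xs by (rule cup_cong) (simp_all add: hoch_diff_eq)
    moreover have "cup G N (signed H) (cobd F) xs = cup G N (signed H) (\<lambda>_. 0) xs"
      using xs by (rule cup_cong) (simp_all add: F0)
    ultimately show "cup G N (hoch_diff G N H) F xs = hoch_diff G N (cup G N H F) xs"
      using xs by (simp add: hoch_diff_eq cobd_cup cup_lin)
  qed (use F assms in \<open>auto intro: cup_cochain hoch_diff_cochain\<close>)
  then show "cup G N (hoch_diff G N H) F \<in> hoch_coboundaries G N"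
    using F assms by (auto simp: hoch_coboundaries_def intro: cup_cochain)
  have "cup G N F (hoch_diff G N H) = hoch_diff G N (cup G N (signed F) H)"
  proof (rule hoch_cochains_eqI)
    fix xs :: "('v,'e,'a) alg list" assume xs: "set xs \<subseteq> carr"
    have "cup G N F (hoch_diff G N H) xs = cup G N F (cobd H) xs"
      using xs by (rule cup_cong) (simp_all add: hoch_diff_eq)
    moreover have "cup G N (cobd (signed F)) H xs = cup G N (\<lambda>_. 0) H xs"
      using xs by (rule cup_cong) (simp_all add: cobd_signed signed_def F0)
    ultimately show "cup G N F (hoch_diff G N H) xs = hoch_diff G N (cup G N (signed F) H) xs"
      using xs by (simp add: hoch_diff_eq cobd_cup cup_lin)
  qed (use F assms in \<open>auto intro: cup_cochain hoch_diff_cochain signed_cochain\<close>)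
  then show "cup G N F (hoch_diff G N H) \<in> hoch_coboundaries G N"
    using F assms by (auto simp: hoch_coboundaries_def intro: cup_cochain signed_cochain)
qed

lemma hoch_diff_linear:
  "hoch_diff G N (\<lambda>ys. F ys + H ys) = (\<lambda>xs. hoch_diff G N F xs + hoch_diff G N H xs)"
  "hoch_diff G N (\<lambda>ys. smul c (F ys)) = (\<lambda>xs. smul c (hoch_diff G N F xs))"
  by (auto simp: fun_eq_iff hoch_diff_eq cobd_add cobd_smul)

lemma coboundaries_ideal:
  "ideal (hoch_coboundaries G N) (hoch_cocycle_ring G N :: ('v,'e,'k::comm_ring_1) cochain ring)"
proof (rule idealI)
  let ?R = "hoch_cocycle_ring G N :: ('v,'e,'k) cochain ring"
  interpret R: ring ?R by (rule cocycle_ring)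
  show "ring ?R" by (rule cocycle_ring)
  show "subgroup (hoch_coboundaries G N) (add_monoid ?R)"
  proof (rule R.add.subgroupI)
    show "hoch_coboundaries G N \<subseteq> carrier ?R"
      by (auto simp: hoch_coboundaries_def coboundary_cocycle)
    show "hoch_coboundaries G N \<noteq> {}"
      using zero_cochain by (auto simp: hoch_coboundaries_def)
    fix F H :: "('v,'e,'k) cochain" assume "F \<in> hoch_coboundaries G N"
    then obtain F' where F': "F' \<in> hoch_cochains G N" "F = hoch_diff G N F'"
      by (auto simp: hoch_coboundaries_def)
    have neg: "(\<lambda>xs. - F xs) \<in> hoch_coboundaries G N"
      unfolding hoch_coboundaries_def
      by (rule image_eqI[of _ _ "\<lambda>ys. smul (- 1) (F' ys)"])
        (use F' cochain_smul[OF F'(1), of "- 1"] hoch_diff_linear(2)[of "- 1" F'] in \<open>simp_all add: smul_minus_one\<close>)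
    have "\<ominus>\<^bsub>?R\<^esub> F = (\<lambda>xs. - F xs)"
      by (rule R.minus_equality) (use F' in \<open>simp_all add: coboundary_cocycle cocycle_linear\<close>)
    then show "\<ominus>\<^bsub>?R\<^esub> F \<in> hoch_coboundaries G N"
      using neg by simp
    assume "H \<in> hoch_coboundaries G N"
    then obtain H' where H': "H' \<in> hoch_cochains G N" "H = hoch_diff G N H'"
      by (auto simp: hoch_coboundaries_def)
    have "(\<lambda>xs. F xs + H xs) \<in> hoch_coboundaries G N"
      unfolding hoch_coboundaries_def
      by (rule image_eqI[of _ _ "\<lambda>ys. F' ys + H' ys"])
        (use F' H' in \<open>simp_all add: hoch_diff_linear cochain_add cochain_smul\<close>)
    then show "F \<oplus>\<^bsub>?R\<^esub> H \<in> hoch_coboundaries G N" by simp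
  qed
qed (auto simp: cup_coboundary hoch_coboundaries_def[where G = G and N = N]
    dest: cup_coboundary[unfolded hoch_coboundaries_def])

section \<open>The minimal resolution and its contraction\<close>

text \<open>
  A marked path: \<open>\<rho>\<close> cut at the positions \<open>i\<close> and \<open>i + res_len n\<close>. It is zero as soon
  as one of the two outer parts reaches length \<open>N\<close>.
\<close>

definition pt :: "nat \<Rightarrow> ('v,'e) path \<Rightarrow> nat \<Rightarrow> ('v,'e,'k::comm_ring_1) res" where
  "pt n \<rho> i = tens N (pseg G 0 i \<rho>) (pseg G i (res_len N n) \<rho>) (pdrop G (i + res_len N n) \<rho>)"

lemma res_len_simps [simp]:
  "res_len N 0 = 0" "res_len N (2 * k) = k * N" "res_len N (Suc (2 * k)) = k * N + 1"
  "res_len N (Suc (Suc n)) = res_len N n + N"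
  by (simp_all add: res_len_def)

lemma pt_eq:
  assumes "i + res_len N n \<le> plen \<rho>"
  shows "pt n \<rho> i = (if i < N \<and> plen \<rho> < i + res_len N n + N
    then Poly_Mapping.single (pseg G 0 i \<rho>, pseg G i (res_len N n) \<rho>, pdrop G (i + res_len N n) \<rho>) 1 else 0)"
  using assms by (auto simp: pt_def tens_def min_def)

lemma pt_0:
  assumes "i + res_len N n \<le> plen \<rho>" "N \<le> i \<or> i + res_len N n + N \<le> plen \<rho>"
  shows "pt n \<rho> i = 0"
  using assms by (auto simp: pt_eq)

lemma tens_eq_pt:
  assumes "plen p = res_len N n" "ptgt G a = psrc p" "ptgt G p = psrc b"
  shows "tens N a p b = pt n (pcat a (pcat p b)) (plen a)"
proof -
  have "pseg G (plen a) (res_len N n) (pcat a (pcat p b)) = p"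
    using pseg_pcat2[of G a "pcat p b" 0] assms by (simp add: pseg_pcat1 pseg_all)
  moreover have "pdrop G (plen a + res_len N n) (pcat a (pcat p b)) = b"
    using pdrop_pcat2[of G a "pcat p b" "res_len N n"] pdrop_pcat2[of G p b 0] assms by simp
  ultimately show ?thesis by (simp add: pt_def pseg_pcat1 pseg_all)
qed

lemma P_carrier_closed [simp, intro]:
  "0 \<in> P_carrier G N n"
  "z \<in> P_carrier G N n \<Longrightarrow> w \<in> P_carrier G N n \<Longrightarrow> z + w \<in> P_carrier G N n"
  "z \<in> P_carrier G N n \<Longrightarrow> smul c z \<in> P_carrier G N n"
  "z \<in> P_carrier G N n \<Longrightarrow> - z \<in> P_carrier G N n"
  unfolding P_carrier_def using Poly_Mapping.keys_add[of z w] keys_smul[of c z] by auto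

lemma P_carrier_diff [simp, intro]:
  "z \<in> P_carrier G N n \<Longrightarrow> w \<in> P_carrier G N n \<Longrightarrow> z - w \<in> P_carrier G N n"
  using P_carrier_closed(2)[of z n "- w"] by simp

lemma P_carrier_sum: "(\<And>i. i \<in> S \<Longrightarrow> f i \<in> P_carrier G N n) \<Longrightarrow> sum f S \<in> P_carrier G N n"
  by (induction S rule: infinite_finite_induct) auto

lemma pt_carrier:
  assumes "\<rho> \<in> paths G m" "i + res_len N n \<le> plen \<rho>"
  shows "pt n \<rho> i \<in> P_carrier G N n"
proof -
  have m: "plen \<rho> = m" using assms(1) by (rule plen_paths)
  have "(pseg G 0 i \<rho>, pseg G i (res_len N n) \<rho>, pdrop G (i + res_len N n) \<rho>) \<in> P_basis G N n"
    if "i < N" "m < i + res_len N n + N"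
    unfolding P_basis_def using assms m that
    by (auto intro!: short_pathsI[OF pseg_in_paths'] short_pathsI[OF pdrop_in_paths] pseg_in_paths')
  then show ?thesis using assms m by (auto simp: pt_eq P_carrier_def)
qed

text \<open>
  Marked paths are another description of the basis, indexed by the whole path and the position of the mark.
\<close>

lemma basis_eq_pt:
  assumes "(a, p, b) \<in> P_basis G N n"
  shows "Poly_Mapping.single (a, p, b) 1 = pt n (pcat a (pcat p b)) (plen a)"
    and "pcat a (pcat p b) \<in> paths G (plen (pcat a (pcat p b)))"
    and "plen p = res_len N n" "plen a < N" "plen b < N" "ptgt G a = psrc p" "ptgt G p = psrc b"
proof -
  have *: "plen a < N" "plen b < N" "ptgt G a = psrc p" "ptgt G p = psrc b" "plen p = res_len N n"
    "a \<in> paths G (plen a)" "b \<in> paths G (plen b)" "p \<in> paths G (plen p)"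
    using assms by (auto simp: P_basis_def plen_paths dest: short_pathsD)
  then show "Poly_Mapping.single (a, p, b) 1 = pt n (pcat a (pcat p b)) (plen a)"
    by (simp add: tens_eq_pt[symmetric]) (simp add: tens_def)
  from * have "pcat p b \<in> paths G (plen p + plen b)" by (intro pcat_in_paths)
  with * show "pcat a (pcat p b) \<in> paths G (plen (pcat a (pcat p b)))"
    using pcat_in_paths[of a "plen a" "pcat p b" "plen p + plen b"] by simp
  show "plen p = res_len N n" "plen a < N" "plen b < N" "ptgt G a = psrc p" "ptgt G p = psrc b"
    using * by simp_all
qed

text \<open>
  The range of positions in the last two premises is exactly the one in which marked paths do not vanish.
\<close>

lemma P_eqI:
  assumes "linmap L" "linmap M" "z \<in> P_carrier G N n"
    and "\<And>\<rho> i. \<rho> \<in> paths G (plen \<rho>) \<Longrightarrow> i + res_len N n \<le> plen \<rho> \<Longrightarrow> i < N \<Longrightarrow>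
      plen \<rho> < i + res_len N n + N \<Longrightarrow> L (pt n \<rho> i) = M (pt n \<rho> i)"
  shows "L z = M z"
proof (rule linmap_eqI[OF assms(1,2)])
  fix t assume "t \<in> Poly_Mapping.keys z"
  moreover obtain a p b where t: "t = (a, p, b)" by (cases t)
  ultimately have "(a, p, b) \<in> P_basis G N n" using assms(3) by (auto simp: P_carrier_def)
  note b = basis_eq_pt[OF this]
  show "L (Poly_Mapping.single t 1) = M (Poly_Mapping.single t 1)"
    unfolding t b(1) by (rule assms(4)) (use b in simp_all)
qed

lemma linmap_carrier:
  assumes "linmap L" "z \<in> P_carrier G N n"
    and "\<And>\<rho> i. \<rho> \<in> paths G (plen \<rho>) \<Longrightarrow> i + res_len N n \<le> plen \<rho> \<Longrightarrow> i < N \<Longrightarrow>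
      plen \<rho> < i + res_len N n + N \<Longrightarrow> L (pt n \<rho> i) \<in> P_carrier G N m"
  shows "L z \<in> P_carrier G N m"
proof -
  have "L (Poly_Mapping.single t 1) \<in> P_carrier G N m" if "t \<in> Poly_Mapping.keys z" for t
  proof -
    obtain a p b where t: "t = (a, p, b)" by (cases t)
    with that have "(a, p, b) \<in> P_basis G N n" using assms(2) by (auto simp: P_carrier_def)
    note b = basis_eq_pt[OF this]
    show ?thesis unfolding t b(1) by (rule assms(3)) (use b in simp_all)
  qed
  then show ?thesis unfolding linmap_expand[OF assms(1), of z] lin_ext_def
    by (intro P_carrier_sum P_carrier_closed)
qed

lemma linmap_P_lact1 [lin_intro]: "linmap L \<Longrightarrow> linmap (\<lambda>x. P_lact G N (L x) z)"
  unfolding P_lact_def by (intro lin_intro)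

lemma linmap_P_lact2 [lin_intro]: "linmap L \<Longrightarrow> linmap (\<lambda>z. P_lact G N x (L z))"
  unfolding P_lact_def by (intro lin_intro)

lemma linmap_P_ract1 [lin_intro]: "linmap L \<Longrightarrow> linmap (\<lambda>z. P_ract G N (L z) x)"
  unfolding P_ract_def by (intro lin_intro)

lemma linmap_P_ract2 [lin_intro]: "linmap L \<Longrightarrow> linmap (\<lambda>x. P_ract G N z (L x))"
  unfolding P_ract_def by (intro lin_intro)

lemma linmap_P_diff [lin_intro]: "linmap L \<Longrightarrow> linmap (\<lambda>z. P_diff G N n (L z))"
  unfolding P_diff_def by (intro lin_intro)

lemma linmap_P_aug [lin_intro]: "linmap L \<Longrightarrow> linmap (\<lambda>z. P_aug G N (L z))"
  unfolding P_aug_def by (intro lin_intro)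

lemma P_lact_path_pt:
  assumes "i + res_len N n \<le> plen \<rho>"
  shows "P_lact G N (path q) (pt n \<rho> i :: ('v,'e,'k::comm_ring_1) res) = (if ptgt G q = psrc \<rho> then pt n (pcat q \<rho>) (plen q + i) else 0)"
proof (cases "i < N \<and> plen \<rho> < i + res_len N n + N")
  case True
  let ?a = "pseg G 0 i \<rho>" and ?p = "pseg G i (res_len N n) \<rho>" and ?b = "pdrop G (i + res_len N n) \<rho>"
  have "pcat ?a (pcat ?p ?b) = \<rho>" by (simp add: pcat_pseg_pdrop)
  moreover have "tens N (pcat q ?a) ?p ?b = (pt n (pcat (pcat q ?a) (pcat ?p ?b)) (plen (pcat q ?a)) :: ('v,'e,'k) res)"
    if "ptgt G q = psrc \<rho>" using assms that by (intro tens_eq_pt) (auto simp: psrc_def[of \<rho>])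
  ultimately have "tens N (pcat q ?a) ?p ?b = (pt n (pcat q \<rho>) (plen q + i) :: ('v,'e,'k) res)"
    if "ptgt G q = psrc \<rho>" using assms that by (simp add: pcat_assoc min_absorb2)
  then show ?thesis using True assms by (simp add: pt_eq[of i n \<rho>] P_lact_def psrc_def[of \<rho>])
next
  case False
  then show ?thesis using assms N2
    by (auto simp: pt_0 not_less linmap_0[OF linmap_P_lact2[OF linmap_id]] sum.neutral)
qed

lemma P_ract_path_pt:
  assumes "i + res_len N n \<le> plen \<rho>"
  shows "P_ract G N (pt n \<rho> i :: ('v,'e,'k::comm_ring_1) res) (path q) = (if ptgt G \<rho> = psrc q then pt n (pcat \<rho> q) i else 0)"
proof (cases "i < N \<and> plen \<rho> < i + res_len N n + N")
  case True
  let ?a = "pseg G 0 i \<rho>" and ?p = "pseg G i (res_len N n) \<rho>" and ?b = "pdrop G (i + res_len N n) \<rho>"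
  have "pcat ?a (pcat ?p ?b) = \<rho>" by (simp add: pcat_pseg_pdrop)
  moreover have "tens N ?a ?p (pcat ?b q) = (pt n (pcat ?a (pcat ?p (pcat ?b q))) (plen ?a) :: ('v,'e,'k) res)"
    using assms by (intro tens_eq_pt) (auto simp: psrc_def[of \<rho>])
  ultimately have "tens N ?a ?p (pcat ?b q) = (pt n (pcat \<rho> q) i :: ('v,'e,'k) res)"
    using assms by (simp add: min_absorb2 flip: pcat_assoc)
  then show ?thesis using True assms by (simp add: pt_eq[of i n \<rho>] P_ract_def)
next
  case False
  then show ?thesis using assms N2
    by (auto simp: pt_0 not_less linmap_0[OF linmap_P_ract1[OF linmap_id]] sum.neutral)
qed

lemma pdrop_pseg: "m \<le> r \<Longrightarrow> pdrop G m (pseg G i r \<rho>) = pseg G (i + m) (r - m) \<rho>"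
  by (simp add: pseg_def pdrop_def ptgt_take min_def drop_take add.commute)

text \<open>
  Moving the mark by one step: the first term of the differential moves the first arrow of the middle
  segment to the left coefficient, the second one moves its last arrow to the right coefficient.
\<close>

lemma P_diff_odd_pt:
  assumes "i + (k * N + 1) \<le> plen \<rho>"
  shows "P_diff G N (Suc (2 * k)) (pt (Suc (2 * k)) \<rho> i) = pt (2 * k) \<rho> (Suc i) - pt (2 * k) \<rho> i"
proof (cases "i < N \<and> plen \<rho> < i + (k * N + 1) + N")
  case True
  let ?r = "k * N + 1"
  let ?a = "pseg G 0 i \<rho>" and ?p = "pseg G i ?r \<rho>" and ?b = "pdrop G (i + ?r) \<rho>"
  have "pcat ?a (pseg G 0 1 ?p) = pseg G 0 (Suc i) \<rho>"
    using pcat_pseg_pseg[of G 0 i \<rho> 1] by (simp add: pseg_pseg)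
  moreover have "pcat (pdrop G (k * N) ?p) ?b = pdrop G (i + k * N) \<rho>"
    using pcat_pseg_pdrop[of G "i + k * N" 1 \<rho>] by (simp add: pdrop_pseg)
  ultimately have "P_diff_basis G N (Suc (2 * k)) ?a ?p ?b = pt (2 * k) \<rho> (Suc i) - pt (2 * k) \<rho> i"
    by (simp add: P_diff_basis_def pt_def pdrop_pseg pseg_pseg)
  then show ?thesis using True assms by (simp add: pt_eq[of i "Suc (2 * k)" \<rho>] P_diff_def)
next
  case False
  then show ?thesis using assms N2
    by (auto simp: pt_0 not_less linmap_0[OF linmap_P_diff[OF linmap_id]] sum.neutral)
qed

text \<open>
  Position \<open>i + j\<close> with \<open>j < N\<close> is the term in which the left coefficient is extended by \<open>j\<close>
  arrows; terms with a coefficient of length \<open>\<ge> N\<close> vanish on both sides.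
\<close>

lemma P_diff_even_pt:
  assumes "i + (k * N + N) \<le> plen \<rho>"
  shows "P_diff G N (Suc (Suc (2 * k))) (pt (Suc (Suc (2 * k))) \<rho> i) = (\<Sum>j<N. pt (Suc (2 * k)) \<rho> (i + j))"
proof (cases "i < N \<and> plen \<rho> < i + (k * N + N) + N")
  case True
  let ?r = "k * N + N"
  let ?a = "pseg G 0 i \<rho>" and ?p = "pseg G i ?r \<rho>" and ?b = "pdrop G (i + ?r) \<rho>"
  have "tens N (pcat ?a (pseg G 0 j ?p)) (pseg G j (k * N + 1) ?p) (pcat (pdrop G (j + k * N + 1) ?p) ?b)
    = pt (Suc (2 * k)) \<rho> (i + j)" if "j < N" for j
  proof -
    have "pcat ?a (pseg G 0 j ?p) = pseg G 0 (i + j) \<rho>"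
      using pcat_pseg_pseg[of G 0 i \<rho> j] that by (simp add: pseg_pseg)
    moreover have "pcat (pdrop G (j + k * N + 1) ?p) ?b = pdrop G (i + j + (k * N + 1)) \<rho>"
      using pcat_pseg_pdrop[of G "i + (j + k * N + 1)" "?r - (j + k * N + 1)" \<rho>] that
      by (simp add: pdrop_pseg add.assoc)
    ultimately show ?thesis using that by (simp add: pt_def pseg_pseg)
  qed
  then have "P_diff_basis G N (Suc (Suc (2 * k))) ?a ?p ?b = (\<Sum>j<N. pt (Suc (2 * k)) \<rho> (i + j))"
    by (auto simp: P_diff_basis_def intro!: sum.cong)
  then show ?thesis using True assms by (simp add: pt_eq[of i "Suc (Suc (2 * k))" \<rho>] P_diff_def)
next
  case False
  then show ?thesis using assms N2
    by (auto simp: pt_0 not_less linmap_0[OF linmap_P_diff[OF linmap_id]] sum.neutral)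
qed

lemma P_diff_1_pt:
  "Suc i \<le> plen \<rho> \<Longrightarrow> P_diff G N (Suc 0) (pt (Suc 0) \<rho> i) = pt 0 \<rho> (Suc i) - pt 0 \<rho> i"
  by (rule P_diff_odd_pt[of i 0, simplified])

lemma P_diff_odd_pt':
  "Suc (i + k * N + N) \<le> plen \<rho> \<Longrightarrow> P_diff G N (Suc (Suc (Suc (2 * k)))) (pt (Suc (Suc (Suc (2 * k)))) \<rho> i)
    = pt (Suc (Suc (2 * k))) \<rho> (Suc i) - pt (Suc (Suc (2 * k))) \<rho> i"
  using P_diff_odd_pt[of i "Suc k" \<rho>] by (simp add: add.commute add.left_commute)

lemma parity_cases: 
  obtains (even) k where "n = 2 * k" | (odd) k where "n = Suc (2 * k)"
  by (metis evenE oddE Suc_eq_plus1)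

lemma P_diff_carrier:
  assumes "z \<in> P_carrier G N (Suc n)"
  shows "P_diff G N (Suc n) z \<in> P_carrier G N n"
proof (rule linmap_carrier[OF _ assms])
  fix \<rho> i assume *: "\<rho> \<in> paths G (plen \<rho>)" "i + res_len N (Suc n) \<le> plen \<rho>"
  show "P_diff G N (Suc n) (pt (Suc n) \<rho> i) \<in> P_carrier G N n"
  proof (cases n rule: parity_cases)
    case (even k)
    then show ?thesis using * by (auto simp: P_diff_odd_pt intro!: pt_carrier)
  next
    case (odd k)
    then show ?thesis using * by (auto simp: P_diff_even_pt intro!: P_carrier_sum pt_carrier)
  qed
qed (intro lin_intro)

lemma P_diff_lact:
  assumes "z \<in> P_carrier G N (Suc n)"
  shows "P_diff G N (Suc n) (P_lact G N x z) = P_lact G N x (P_diff G N (Suc n) z)"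
proof -
  have 1: "P_diff G N (Suc n) (P_lact G N (path q) z) = P_lact G N (path q) (P_diff G N (Suc n) z)" for q
  proof (rule P_eqI[OF _ _ assms])
    fix \<rho> i assume *: "\<rho> \<in> paths G (plen \<rho>)" "i + res_len N (Suc n) \<le> plen \<rho>"
    show "P_diff G N (Suc n) (P_lact G N (path q) (pt (Suc n) \<rho> i))
      = P_lact G N (path q) (P_diff G N (Suc n) (pt (Suc n) \<rho> i))"
    proof (cases n rule: parity_cases)
      case (even k)
      then show ?thesis using *
        by (simp add: P_lact_path_pt P_diff_odd_pt linmap_diff[OF linmap_P_lact2[OF linmap_id]]
            linmap_0[OF linmap_P_diff[OF linmap_id]])
    next
      case (odd k)
      then show ?thesis using *
        by (simp add: P_lact_path_pt P_diff_even_pt linmap_sum[OF linmap_P_lact2[OF linmap_id]]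
            linmap_0[OF linmap_P_diff[OF linmap_id]] add.assoc)
    qed
  qed (intro lin_intro)+
  show ?thesis
    by (rule linmap_eqI[of "\<lambda>x. P_diff G N (Suc n) (P_lact G N x z)" "\<lambda>x. P_lact G N x (P_diff G N (Suc n) z)"])
      (intro lin_intro 1)+
qed

lemma P_diff_ract:
  assumes "z \<in> P_carrier G N (Suc n)"
  shows "P_diff G N (Suc n) (P_ract G N z x) = P_ract G N (P_diff G N (Suc n) z) x"
proof -
  have 1: "P_diff G N (Suc n) (P_ract G N z (path q)) = P_ract G N (P_diff G N (Suc n) z) (path q)" for q
  proof (rule P_eqI[OF _ _ assms])
    fix \<rho> i assume *: "\<rho> \<in> paths G (plen \<rho>)" "i + res_len N (Suc n) \<le> plen \<rho>"
    show "P_diff G N (Suc n) (P_ract G N (pt (Suc n) \<rho> i) (path q))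
      = P_ract G N (P_diff G N (Suc n) (pt (Suc n) \<rho> i)) (path q)"
    proof (cases n rule: parity_cases)
      case (even k)
      then show ?thesis using *
        by (simp add: P_ract_path_pt P_diff_odd_pt linmap_diff[OF linmap_P_ract1[OF linmap_id]]
            linmap_0[OF linmap_P_diff[OF linmap_id]])
    next
      case (odd k)
      then show ?thesis using *
        by (simp add: P_ract_path_pt P_diff_even_pt linmap_sum[OF linmap_P_ract1[OF linmap_id]]
            linmap_0[OF linmap_P_diff[OF linmap_id]] add.assoc)
    qed
  qed (intro lin_intro)+
  show ?thesis
    by (rule linmap_eqI[of "\<lambda>x. P_diff G N (Suc n) (P_ract G N z x)" "\<lambda>x. P_ract G N (P_diff G N (Suc n) z) x"])
      (intro lin_intro 1)+
qed

lemma P_aug_pt: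
  assumes "i \<le> plen \<rho>"
  shows "P_aug G N (pt 0 \<rho> i) = (if plen \<rho> < N then path \<rho> else 0)"
proof (cases "i < N \<and> plen \<rho> < i + N")
  case True
  then show ?thesis using assms
    by (auto simp: pt_eq P_aug_def path_prod_def min_def)
next
  case False
  then show ?thesis using assms by (auto simp: pt_0 linmap_0[OF linmap_P_aug[OF linmap_id]])
qed

lemma sum_telescope: "(\<Sum>j<m. f (Suc j) - f j) = f m - f 0" for f :: "nat \<Rightarrow> 'z::ab_group_add"
  by (induction m) auto

lemma P_aug_diff: 
  assumes "z \<in> P_carrier G N (Suc 0)"
  shows "P_aug G N (P_diff G N (Suc 0) z) = 0"
proof (rule P_eqI[OF _ _ assms, where M = "\<lambda>_. 0"])
  fix \<rho> :: "('v,'e) path" and i assume "i + res_len N (Suc 0) \<le> plen \<rho>"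
  then show "P_aug G N (P_diff G N (Suc 0) (pt (Suc 0) \<rho> i)) = 0"
    using res_len_simps(3)[of 0]
    by (simp add: P_diff_1_pt linmap_diff[OF linmap_P_aug[OF linmap_id]] P_aug_pt del: res_len_simps)
qed (intro lin_intro)+

text \<open>
  A sum over \<open>N\<close> consecutive positions composed with a difference telescopes to the positions
  \<open>i + N\<close> and \<open>i\<close>. In the former the left part, in the latter the right part has length at least \<open>N\<close>.
\<close>

lemma P_diff_diff:
  assumes "z \<in> P_carrier G N (Suc (Suc n))"
  shows "P_diff G N (Suc n) (P_diff G N (Suc (Suc n)) z) = 0"
proof (rule P_eqI[OF _ _ assms, where M = "\<lambda>_. 0"])
  fix \<rho> :: "('v,'e) path" and i assume i: "i + res_len N (Suc (Suc n)) \<le> plen \<rho>"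
  show "P_diff G N (Suc n) (P_diff G N (Suc (Suc n)) (pt (Suc (Suc n)) \<rho> i)) = 0"
  proof (cases n rule: parity_cases)
    case (even k)
    have "P_diff G N (Suc n) (P_diff G N (Suc (Suc n)) (pt (Suc (Suc n)) \<rho> i))
      = (\<Sum>j<N. pt n \<rho> (Suc (i + j)) - pt n \<rho> (i + j))"
      using i even by (simp add: P_diff_even_pt P_diff_odd_pt linmap_sum[OF linmap_P_diff[OF linmap_id]])
    also have "\<dots> = pt n \<rho> (i + N) - pt n \<rho> i"
      using sum_telescope[of "\<lambda>j. pt n \<rho> (i + j)" N] by simp
    also have "\<dots> = 0" using i by (simp add: pt_0)
    finally show ?thesis .
  next
    case (odd k)
    note * = P_diff_even_pt[of _ k \<rho>]
    have "P_diff G N (Suc n) (P_diff G N (Suc (Suc n)) (pt (Suc (Suc n)) \<rho> i))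
      = (\<Sum>j<N. pt n \<rho> (Suc i + j)) - (\<Sum>j<N. pt n \<rho> (i + j))"
      using i odd
      by (simp add: P_diff_odd_pt' * linmap_diff[OF linmap_P_diff[OF linmap_id]] add.commute add.left_commute)
    also have "\<dots> = pt n \<rho> (i + N) - pt n \<rho> i"
      using sum_telescope[of "\<lambda>j. pt n \<rho> (i + j)" N] by (simp add: sum_subtractf)
    also have "\<dots> = 0" using i odd by (simp add: pt_0)
    finally show ?thesis .
  qed
qed (intro lin_intro)+

text \<open>
  The contraction inverts the differential on marked paths: a difference of consecutive positions is
  inverted by the sum over all smaller positions, and a sum over \<open>N\<close> consecutive positions by keeping
  only position \<open>N - 1\<close>, the last one at which the left coefficient can be nonzero, and sending it
  to position \<open>0\<close>. Only the left coefficient matters, so this commutes with the right action.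
\<close>

definition contr :: "nat \<Rightarrow> ('v,'e,'k::comm_ring_1) res \<Rightarrow> ('v,'e,'k) res" where
  "contr n z = lin_ext (\<lambda>(a, p, b).
     if even n then \<Sum>j<plen a. pt (Suc n) (pcat a (pcat p b)) j
     else if plen a = N - 1 then pt (Suc n) (pcat a (pcat p b)) 0 else 0) z"

lemma linmap_contr [lin_intro]: "linmap L \<Longrightarrow> linmap (\<lambda>z. contr n (L z))"
  unfolding contr_def by (intro lin_intro)

lemma contr_even_pt:
  assumes "i + k * N \<le> plen \<rho>" "i < N"
  shows "contr (2 * k) (pt (2 * k) \<rho> i) = (\<Sum>j<i. pt (Suc (2 * k)) \<rho> j)"
proof (cases "plen \<rho> < i + k * N + N")
  case True
  with assms show ?thesis by (simp add: pt_eq[of i "2 * k"] contr_def pcat_pseg_pdrop min_absorb2)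
next
  case False
  then show ?thesis using assms N2
    by (auto simp: pt_0 not_less linmap_0[OF linmap_contr[OF linmap_id]] sum.neutral)
qed

lemma contr_0_pt: "i \<le> plen \<rho> \<Longrightarrow> i < N \<Longrightarrow> contr 0 (pt 0 \<rho> i) = (\<Sum>j<i. pt (Suc 0) \<rho> j)"
  by (rule contr_even_pt[of i 0, simplified])

lemma contr_even_pt':
  "i + k * N + N \<le> plen \<rho> \<Longrightarrow> i < N \<Longrightarrow>
    contr (Suc (Suc (2 * k))) (pt (Suc (Suc (2 * k))) \<rho> i) = (\<Sum>j<i. pt (Suc (Suc (Suc (2 * k)))) \<rho> j)"
  using contr_even_pt[of i "Suc k" \<rho>] by (simp add: add.commute add.left_commute)

lemma contr_odd_pt:
  assumes "i + (k * N + 1) \<le> plen \<rho>"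
  shows "contr (Suc (2 * k)) (pt (Suc (2 * k)) \<rho> i) = (if i = N - 1 then pt (Suc (Suc (2 * k))) \<rho> 0 else 0)"
proof (cases "i < N \<and> plen \<rho> < i + (k * N + 1) + N")
  case True
  have "pcat (pseg G 0 i \<rho>) (pcat (pseg G i (k * N + 1) \<rho>) (pdrop G (i + (k * N + 1)) \<rho>)) = \<rho>"
    by (simp only: pcat_pseg_pdrop pcat_prefix_pdrop)
  with True assms show ?thesis
    by (cases "i = N - 1") (simp_all add: pt_eq[of i "Suc (2 * k)"] pt_eq[of "N - Suc 0" "Suc (2 * k)"] contr_def min_absorb2)
next
  case False
  then show ?thesis using assms N2
    by (auto simp: pt_0 not_less linmap_0[OF linmap_contr[OF linmap_id]] sum.neutral)
qed

lemma contr_carrier: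
  assumes "z \<in> P_carrier G N n"
  shows "contr n z \<in> P_carrier G N (Suc n)"
proof (rule linmap_carrier[OF _ assms])
  fix \<rho> i assume *: "\<rho> \<in> paths G (plen \<rho>)" "i + res_len N n \<le> plen \<rho>" "i < N"
  show "contr n (pt n \<rho> i) \<in> P_carrier G N (Suc n)"
  proof (cases n rule: parity_cases)
    case (even k)
    then show ?thesis using * by (auto simp: contr_even_pt intro!: P_carrier_sum pt_carrier)
  next
    case (odd k)
    then show ?thesis using * by (auto simp: contr_odd_pt intro!: pt_carrier)
  qed
qed (intro lin_intro)

lemma contr_ract:
  assumes "z \<in> P_carrier G N n"
  shows "contr n (P_ract G N z x) = P_ract G N (contr n z) x"
proof -
  have 1: "contr n (P_ract G N z (path q)) = P_ract G N (contr n z) (path q)" for q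
  proof (rule P_eqI[OF _ _ assms])
    fix \<rho> i assume *: "\<rho> \<in> paths G (plen \<rho>)" "i + res_len N n \<le> plen \<rho>" "i < N"
    show "contr n (P_ract G N (pt n \<rho> i) (path q)) = P_ract G N (contr n (pt n \<rho> i)) (path q)"
    proof (cases n rule: parity_cases)
      case (even k)
      then show ?thesis using *
        by (simp add: P_ract_path_pt contr_even_pt linmap_sum[OF linmap_P_ract1[OF linmap_id]]
            linmap_0[OF linmap_contr[OF linmap_id]])
    next
      case (odd k)
      then show ?thesis using *
        by (simp add: P_ract_path_pt contr_odd_pt linmap_0[OF linmap_P_ract1[OF linmap_id]]
            linmap_0[OF linmap_contr[OF linmap_id]])
    qed
  qed (intro lin_intro)+
  show ?thesis
    by (rule linmap_eqI[of "\<lambda>x. contr n (P_ract G N z x)" "\<lambda>x. P_ract G N (contr n z) x"])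
      (intro lin_intro 1)+
qed

lemma contr_idem:
  assumes "z \<in> P_carrier G N n"
  shows "contr n (P_lact G N (idem v) z) = P_lact G N (idem v) (contr n z)"
proof (rule P_eqI[OF _ _ assms])
  fix \<rho> i assume *: "\<rho> \<in> paths G (plen \<rho>)" "i + res_len N n \<le> plen \<rho>" "i < N"
  show "contr n (P_lact G N (idem v) (pt n \<rho> i)) = P_lact G N (idem v) (contr n (pt n \<rho> i))"
  proof (cases n rule: parity_cases)
    case (even k)
    then show ?thesis using *
      by (simp add: P_lact_path_pt contr_even_pt linmap_sum[OF linmap_P_lact2[OF linmap_id]]
          linmap_0[OF linmap_contr[OF linmap_id]])
  next
    case (odd k)
    then show ?thesis using *
      by (simp add: P_lact_path_pt contr_odd_pt linmap_0[OF linmap_P_lact2[OF linmap_id]]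
          linmap_0[OF linmap_contr[OF linmap_id]])
  qed
qed (intro lin_intro)+

text \<open>
  The even contraction produces odd marks at positions \<open>j < i \<le> N - 1\<close> only, which the next one
  kills; the odd one produces position \<open>0\<close>, over which the next sum is empty.
\<close>

lemma contr_contr:
  assumes "z \<in> P_carrier G N n"
  shows "contr (Suc n) (contr n z) = 0"
proof (rule P_eqI[OF _ _ assms, where M = "\<lambda>_. 0"])
  fix \<rho> i assume *: "\<rho> \<in> paths G (plen \<rho>)" "i + res_len N n \<le> plen \<rho>" "i < N"
  show "contr (Suc n) (contr n (pt n \<rho> i)) = 0"
  proof (cases n rule: parity_cases)
    case (even k)
    then show ?thesis using *
      by (auto simp: contr_even_pt contr_odd_pt linmap_sum[OF linmap_contr[OF linmap_id]] intro!: sum.neutral)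
  next
    case (odd k)
    then show ?thesis using *
      by (auto simp: contr_odd_pt contr_even_pt' linmap_0[OF linmap_contr[OF linmap_id]] add.commute)
  qed
qed (intro lin_intro)+

text \<open>
  The bimodule resolution is contractible as a complex of right modules; \<open>x \<mapsto> 1 \<otimes> x\<close> is the part of
  the contraction in degree \<open>-1\<close>.
\<close>

definition unit_right :: "('v,'e,'k::comm_ring_1) alg \<Rightarrow> ('v,'e,'k) res" where
  "unit_right x = lin_ext (\<lambda>p. pt 0 p 0) x"

lemma linmap_unit_right [lin_intro]: "linmap L \<Longrightarrow> linmap (\<lambda>z. unit_right (L z))"
  unfolding unit_right_def by (intro lin_intro)

text \<open>
  Moving the mark down step by step from \<open>i\<close> to \<open>0\<close>; at \<open>0\<close> the whole path has become the right coefficient.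
\<close>

lemma P_diff_contr_0:
  fixes z :: "('v,'e,'k::comm_ring_1) res"
  assumes "z \<in> P_carrier G N 0"
  shows "P_diff G N (Suc 0) (contr 0 z) = z - unit_right (P_aug G N z)"
proof (rule P_eqI[OF _ _ assms])
  fix \<rho> i assume *: "\<rho> \<in> paths G (plen \<rho>)" "i + res_len N 0 \<le> plen \<rho>" "i < N"
  have "P_diff G N (Suc 0) (pt (Suc 0) \<rho> j) = (pt 0 \<rho> (Suc j) - pt 0 \<rho> j :: ('v,'e,'k) res)" if "j < i" for j
    using * that by (simp add: P_diff_1_pt)
  then have "P_diff G N (Suc 0) (contr 0 (pt 0 \<rho> i)) = (pt 0 \<rho> i - pt 0 \<rho> 0 :: ('v,'e,'k) res)"
    using *
    by (simp add: contr_0_pt linmap_sum[OF linmap_P_diff[OF linmap_id]] sum_telescope)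
  moreover have "unit_right (P_aug G N (pt 0 \<rho> i)) = (pt 0 \<rho> 0 :: ('v,'e,'k) res)"
    using * by (simp add: P_aug_pt unit_right_def pt_0)
  ultimately show "P_diff G N (Suc 0) (contr 0 (pt 0 \<rho> i :: ('v,'e,'k) res)) = pt 0 \<rho> i - unit_right (P_aug G N (pt 0 \<rho> i))"
    by simp
qed (intro lin_intro)+

text \<open>
  The contracting homotopy identity, checked on marked paths. In odd degree the two cases are
  position \<open>N - 1\<close>, where the next position vanishes but the contraction contributes, and the smaller
  positions, where it is the other way round.
\<close>

lemma P_diff_contr:
  fixes z :: "('v,'e,'k::comm_ring_1) res"
  assumes "z \<in> P_carrier G N (Suc n)"
  shows "P_diff G N (Suc (Suc n)) (contr (Suc n) z) = z - contr n (P_diff G N (Suc n) z)"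
proof (rule P_eqI[OF _ _ assms])
  fix \<rho> i assume *: "\<rho> \<in> paths G (plen \<rho>)" "i + res_len N (Suc n) \<le> plen \<rho>" "i < N"
    "plen \<rho> < i + res_len N (Suc n) + N"
  show "P_diff G N (Suc (Suc n)) (contr (Suc n) (pt (Suc n) \<rho> i :: ('v,'e,'k) res))
    = pt (Suc n) \<rho> i - contr n (P_diff G N (Suc n) (pt (Suc n) \<rho> i))"
  proof (cases n rule: parity_cases)
    case (even k)
    have sd: "contr n (P_diff G N (Suc n) (pt (Suc n) \<rho> i)) =
      contr n (pt n \<rho> (Suc i)) - (\<Sum>j<i. pt (Suc n) \<rho> j :: ('v,'e,'k) res)"
      using * even by (simp add: P_diff_odd_pt linmap_diff[OF linmap_contr[OF linmap_id]] contr_even_pt)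
    show ?thesis
    proof (cases "Suc i = N")
      case True
      have "contr n (pt n \<rho> (Suc i)) = (0 :: ('v,'e,'k) res)"
        using * even True by (simp add: pt_0 linmap_0[OF linmap_contr[OF linmap_id]])
      moreover have "P_diff G N (Suc (Suc n)) (contr (Suc n) (pt (Suc n) \<rho> i)) = (\<Sum>j<Suc i. pt (Suc n) \<rho> j :: ('v,'e,'k) res)"
        using * even True by (auto simp: contr_odd_pt P_diff_even_pt simp del: sum.lessThan_Suc)
      ultimately show ?thesis unfolding sd by simp
    next
      case False
      have "contr n (pt n \<rho> (Suc i)) = (\<Sum>j<Suc i. pt (Suc n) \<rho> j :: ('v,'e,'k) res)"
        using * even False by (simp add: contr_even_pt)
      moreover have "contr (Suc n) (pt (Suc n) \<rho> i) = (0 :: ('v,'e,'k) res)"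
        using * even False by (auto simp: contr_odd_pt)
      ultimately show ?thesis unfolding sd by (simp add: linmap_0[OF linmap_P_diff[OF linmap_id]])
    qed
  next
    case (odd k)
    have d: "P_diff G N (Suc n) (pt (Suc n) \<rho> i) = (\<Sum>j<N. pt n \<rho> (i + j) :: ('v,'e,'k) res)"
      using * odd by (simp add: P_diff_even_pt)
    have "contr n (pt n \<rho> (i + j)) = ((if j = N - 1 - i then pt (Suc n) \<rho> 0 else 0) :: ('v,'e,'k) res)" if "j < N" for j
      using * odd that by (auto simp: contr_odd_pt)
    then have sd: "contr n (P_diff G N (Suc n) (pt (Suc n) \<rho> i)) = (pt (Suc n) \<rho> 0 :: ('v,'e,'k) res)"
      using \<open>i < N\<close> by (simp add: d linmap_sum[OF linmap_contr[OF linmap_id]])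
    have "contr (Suc n) (pt (Suc n) \<rho> i) = (\<Sum>j<i. pt (Suc (Suc n)) \<rho> j :: ('v,'e,'k) res)"
      using * odd by (simp add: contr_even_pt')
    moreover have "P_diff G N (Suc (Suc n)) (pt (Suc (Suc n)) \<rho> j) = (pt (Suc n) \<rho> (Suc j) - pt (Suc n) \<rho> j :: ('v,'e,'k) res)"
      if "j < i" for j
      using * odd that by (simp add: P_diff_odd_pt')
    ultimately show ?thesis
      unfolding sd by (simp add: linmap_sum[OF linmap_P_diff[OF linmap_id]] sum_telescope)
  qed
qed (intro lin_intro)+

subsection \<open>The canonical comparison morphism\<close>

lemma P_lact_carrier:
  assumes "x \<in> carr" "z \<in> P_carrier G N n"
  shows "P_lact G N x z \<in> P_carrier G N n"
proof (rule linmap_carrier[OF _ assms(2)])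
  fix \<rho> :: "('v,'e) path" and i assume *: "\<rho> \<in> paths G (plen \<rho>)" "i + res_len N n \<le> plen \<rho>"
  have "P_lact G N (path q) (pt n \<rho> i) \<in> P_carrier G N n" if "q \<in> short_paths G N" for q
    using * short_pathsD[OF that]
    by (auto simp: P_lact_path_pt intro!: pt_carrier[OF pcat_in_paths])
  then show "P_lact G N x (pt n \<rho> i) \<in> P_carrier G N n"
    unfolding linmap_expand[OF linmap_P_lact1[OF linmap_id], of x] lin_ext_def
    using carrD[OF assms(1)] by (intro P_carrier_sum P_carrier_closed) auto
qed (intro lin_intro)

lemma P_ract_carrier:
  assumes "x \<in> carr" "z \<in> P_carrier G N n"
  shows "P_ract G N z x \<in> P_carrier G N n"
proof (rule linmap_carrier[OF _ assms(2)])
  fix \<rho> :: "('v,'e) path" and i assume *: "\<rho> \<in> paths G (plen \<rho>)" "i + res_len N n \<le> plen \<rho>"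
  have "P_ract G N (pt n \<rho> i) (path q) \<in> P_carrier G N n" if "q \<in> short_paths G N" for q
    using * short_pathsD[OF that]
    by (auto simp: P_ract_path_pt intro!: pt_carrier[OF pcat_in_paths])
  then show "P_ract G N (pt n \<rho> i) x \<in> P_carrier G N n"
    unfolding linmap_expand[OF linmap_P_ract2[OF linmap_id], of _ x] lin_ext_def
    using carrD[OF assms(1)] by (intro P_carrier_sum P_carrier_closed) auto
qed (intro lin_intro)

lemma P_lact_mult:
  assumes "z \<in> P_carrier G N n"
  shows "P_lact G N (x \<cdot> y) z = P_lact G N x (P_lact G N y z)"
proof -
  have 1: "P_lact G N (path p \<cdot> path q) z = P_lact G N (path p) (P_lact G N (path q) z)" for p q
  proof (rule P_eqI[OF _ _ assms])
    fix \<rho> :: "('v,'e) path" and i assume *: "i + res_len N n \<le> plen \<rho>"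
    show "P_lact G N (path p \<cdot> path q) (pt n \<rho> i) = P_lact G N (path p) (P_lact G N (path q) (pt n \<rho> i))"
    proof (cases "plen p + plen q < N")
      case True
      then show ?thesis using *
        by (auto simp: path_prod_def P_lact_path_pt pcat_assoc linmap_0[OF linmap_P_lact2[OF linmap_id]]
            linmap_0[OF linmap_P_lact1[OF linmap_id]] add.assoc)
    next
      case False
      then show ?thesis using *
        by (auto simp: path_prod_def P_lact_path_pt linmap_0[OF linmap_P_lact2[OF linmap_id]]
            linmap_0[OF linmap_P_lact1[OF linmap_id]] pt_0)
    qed
  qed (intro lin_intro)+
  have 2: "P_lact G N (path p \<cdot> y) z = P_lact G N (path p) (P_lact G N y z)" for p
    by (rule linmap_eqI[of "\<lambda>y. P_lact G N (path p \<cdot> y) z" "\<lambda>y. P_lact G N (path p) (P_lact G N y z)"])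
      (intro lin_intro 1)+
  show ?thesis
    by (rule linmap_eqI[of "\<lambda>x. P_lact G N (x \<cdot> y) z" "\<lambda>x. P_lact G N x (P_lact G N y z)"])
      (intro lin_intro 2)+
qed

lemma P_lact_ract:
  assumes "z \<in> P_carrier G N n"
  shows "P_lact G N x (P_ract G N z y) = P_ract G N (P_lact G N x z) y"
proof -
  have 1: "P_lact G N (path p) (P_ract G N z (path q)) = P_ract G N (P_lact G N (path p) z) (path q)" for p q
  proof (rule P_eqI[OF _ _ assms])
    fix \<rho> :: "('v,'e) path" and i assume *: "i + res_len N n \<le> plen \<rho>"
    then show "P_lact G N (path p) (P_ract G N (pt n \<rho> i) (path q)) = P_ract G N (P_lact G N (path p) (pt n \<rho> i)) (path q)"
      by (auto simp: P_lact_path_pt P_ract_path_pt pcat_assoc linmap_0[OF linmap_P_lact2[OF linmap_id]]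
          linmap_0[OF linmap_P_ract1[OF linmap_id]])
  qed (intro lin_intro)+
  have 2: "P_lact G N (path p) (P_ract G N z y) = P_ract G N (P_lact G N (path p) z) y" for p
    by (rule linmap_eqI[of "\<lambda>y. P_lact G N (path p) (P_ract G N z y)" "\<lambda>y. P_ract G N (P_lact G N (path p) z) y"])
      (intro lin_intro 1)+
  show ?thesis
    by (rule linmap_eqI[of "\<lambda>x. P_lact G N x (P_ract G N z y)" "\<lambda>x. P_ract G N (P_lact G N x z) y"])
      (intro lin_intro 2)+
qed

lemma P_aug_lact:
  assumes "z \<in> P_carrier G N 0"
  shows "P_aug G N (P_lact G N x z) = x \<cdot> P_aug G N z"
proof -
  have 1: "P_aug G N (P_lact G N (path q) z) = path q \<cdot> P_aug G N z" for q
  proof (rule P_eqI[OF _ _ assms])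
    fix \<rho> :: "('v,'e) path" and i assume "i + res_len N 0 \<le> plen \<rho>"
    then show "P_aug G N (P_lact G N (path q) (pt 0 \<rho> i)) = path q \<cdot> P_aug G N (pt 0 \<rho> i)"
      by (auto simp: P_lact_path_pt P_aug_pt path_prod_def linmap_0[OF linmap_P_aug[OF linmap_id]])
  qed (intro lin_intro)+
  show ?thesis
    by (rule linmap_eqI[of "\<lambda>x. P_aug G N (P_lact G N x z)" "\<lambda>x. x \<cdot> P_aug G N z"])
      (intro lin_intro 1)+
qed

text \<open>
  The standard recursion for a chain map out of a free resolution into one with a contraction. It is
  applied on the left because the contraction commutes with the right action only.
\<close>

primrec canon :: "('v,'e,'k::comm_ring_1) alg list \<Rightarrow> ('v,'e,'k) res" where
  "canon [] = (\<Sum>v\<in>verts G. pt 0 (v, []) 0)"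
| "canon (x # xs) = contr (length xs) (P_lact G N x (canon xs))"

lemma canon_carrier: "set xs \<subseteq> carr \<Longrightarrow> canon xs \<in> P_carrier G N (length xs)"
proof (induction xs)
  case Nil
  then show ?case by (auto intro!: P_carrier_sum pt_carrier vertex_in_paths)
qed (auto intro!: contr_carrier P_lact_carrier)

lemma canon_Nil_carrier: "canon [] \<in> P_carrier G N 0"
  using canon_carrier[of "[]"] by (simp del: canon.simps)

lemma canon_multilinear: "multilinear_on carr canon"
proof -
  have "(\<forall>x\<in>carr. \<forall>y\<in>carr. canon (xs @ (x + y) # ys) = canon (xs @ x # ys) + canon (xs @ y # ys)) \<and>
     (\<forall>c. \<forall>x\<in>carr. canon (xs @ smul c x # ys) = smul c (canon (xs @ x # ys)))" for xs ys :: "('v,'e,'a) alg list"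
  proof (induction xs)
    case Nil
    have L: "linmap (\<lambda>x. contr (length ys) (P_lact G N x (canon ys)))" by (intro lin_intro)
    show ?case by (simp add: linmap_add[OF L] linmap_smul[OF L])
  next
    case (Cons a xs)
    have L: "linmap (\<lambda>z. contr n (P_lact G N a z))" for n by (intro lin_intro)
    show ?case using Cons by (simp add: linmap_add[OF L] linmap_smul[OF L])
  qed
  then show ?thesis unfolding multilinear_on_def by blast
qed

lemma canon_Nil_ract:
  assumes "x \<in> carr"
  shows "P_ract G N (canon []) x = unit_right x"
proof (rule linmap_eqI[of "\<lambda>x. P_ract G N (canon []) x" unit_right])
  fix p assume "p \<in> Poly_Mapping.keys x"
  then have p: "p \<in> short_paths G N" using carrD[OF assms] by auto
  then have "psrc p \<in> verts G" by (auto dest!: short_pathsD simp: psrc_in_verts)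
  show "P_ract G N (canon []) (path p) = unit_right (path p)"
    using \<open>psrc p \<in> verts G\<close>
    by (simp add: P_ract_path_pt linmap_sum[OF linmap_P_ract1[OF linmap_id]] unit_right_def)
qed (intro lin_intro, simp add: linmap_unit_right[OF linmap_id])

lemma P_aug_canon: "P_aug G N (canon []) = A_one G"
  using N2 by (simp add: linmap_sum[OF linmap_P_aug[OF linmap_id]] P_aug_pt A_one_def)

lemma bar_tail_linmap_on:
  assumes L: "linmap L" and "set xs \<subseteq> carr"
    and "\<And>x ys. x \<in> carr \<Longrightarrow> set ys \<subseteq> carr \<Longrightarrow> Suc (length ys) = length xs \<Longrightarrow>
      L (ra (F ys) x) = ra' (L (F ys)) x"
  shows "bar_tail ra' (\<lambda>ys. L (F ys)) xs = L (bar_tail ra F xs)"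
  using assms(2,3)
proof (induction ra F xs rule: bar_tail.induct)
  case (3 ra F x y ys)
  have "bar_tail ra' (\<lambda>zs. L (F (x # zs))) (y # ys) = L (bar_tail ra (\<lambda>zs. F (x # zs)) (y # ys))"
    using 3(2,3) by (intro 3(1)) auto
  then show ?case by (simp add: linmap_diff[OF L])
qed (simp_all add: linmap_0[OF L])

text \<open>
  The usual induction: apply the homotopy identity to \<open>x \<cdot> canon xs\<close> and use the induction hypothesis
  for the differential of \<open>canon xs\<close>. The extra terms are contractions of \<open>canon\<close> on shorter lists, which are again
  values of \<open>canon\<close>.
\<close>

lemma canon_diff:
  fixes x :: "('v,'e,'k::comm_ring_1) alg"
  assumes "set (x # xs) \<subseteq> carr"
  shows "P_diff G N (length (x # xs)) (canon (x # xs)) = P_lact G N x (canon xs) - bar_tail (P_ract G N) canon (x # xs)"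
  using assms
proof (induction xs arbitrary: x)
  case Nil
  have "P_lact G N x (canon []) \<in> P_carrier G N 0"
    using Nil canon_Nil_carrier by (intro P_lact_carrier) auto
  then have "P_diff G N (Suc 0) (contr 0 (P_lact G N x (canon [])))
    = P_lact G N x (canon []) - unit_right (P_aug G N (P_lact G N x (canon [])))"
    by (rule P_diff_contr_0)
  also have "P_aug G N (P_lact G N x (canon [])) = x"
    using Nil by (simp add: P_aug_lact[OF canon_Nil_carrier] P_aug_canon del: canon.simps)
  finally show ?case using Nil by (simp add: canon_Nil_ract del: canon.simps(1))
next
  case (Cons y ys)
  let ?n = "length ys"
  have c: "canon ys \<in> P_carrier G N ?n" "canon (y # ys) \<in> P_carrier G N (Suc ?n)"
    using Cons.prems canon_carrier[of ys] canon_carrier[of "y # ys"] by auto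
  have L: "linmap (\<lambda>z. contr ?n (P_lact G N x z))" by (intro lin_intro)
  have 1: "contr ?n (P_lact G N x (bar_tail (P_ract G N) canon (y # ys)))
    = bar_tail (P_ract G N) (\<lambda>zs. canon (x # zs)) (y # ys)"
  proof -
    have "bar_tail (P_ract G N) (\<lambda>zs. canon (x # zs)) (y # ys)
      = bar_tail (P_ract G N) (\<lambda>zs. contr ?n (P_lact G N x (canon zs))) (y # ys)"
      by (rule bar_tail_cong) (use Cons.prems in auto)
    also have "\<dots> = contr ?n (P_lact G N x (bar_tail (P_ract G N) canon (y # ys)))"
    proof (rule bar_tail_linmap_on[OF L])
      fix w :: "('v,'e,'k) alg" and zs :: "('v,'e,'k) alg list" assume *: "w \<in> carr" "set zs \<subseteq> carr" "Suc (length zs) = length (y # ys)"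
      then have "canon zs \<in> P_carrier G N ?n" using canon_carrier[of zs] by simp
      then show "contr ?n (P_lact G N x (P_ract G N (canon zs) w)) = P_ract G N (contr ?n (P_lact G N x (canon zs))) w"
        using Cons.prems by (simp add: P_lact_ract contr_ract P_lact_carrier)
    qed (use Cons.prems in auto)
    finally show ?thesis by simp
  qed
  have "P_diff G N (Suc (Suc ?n)) (contr (Suc ?n) (P_lact G N x (canon (y # ys))))
    = P_lact G N x (canon (y # ys)) - contr ?n (P_diff G N (Suc ?n) (P_lact G N x (canon (y # ys))))"
    using Cons.prems c by (intro P_diff_contr P_lact_carrier) auto
  also have "P_diff G N (Suc ?n) (P_lact G N x (canon (y # ys)))
    = P_lact G N x (P_lact G N y (canon ys) - bar_tail (P_ract G N) canon (y # ys))"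
    using Cons.IH[of y] Cons.prems c by (simp add: P_diff_lact del: canon.simps)
  also have "contr ?n \<dots> = canon (x \<cdot> y # ys) - bar_tail (P_ract G N) (\<lambda>zs. canon (x # zs)) (y # ys)"
    unfolding linmap_diff[OF L] 1 using c by (simp add: P_lact_mult)
  finally show ?case by simp
qed

lemma canon_comparison: "is_comparison G N canon"
  unfolding is_comparison_def
proof (intro conjI allI impI)
  fix xs :: "('v,'e,'a) alg list" assume "xs \<noteq> []" "set xs \<subseteq> carr"
  then show "P_diff G N (length xs) (canon xs) = bar_precomp G N (P_lact G N) (P_ract G N) canon xs"
    using canon_diff[of "hd xs" "tl xs"] by (simp add: bar_precomp_eq del: canon.simps)
qed (use canon_multilinear canon_carrier P_aug_canon in auto)

lemma canon_idem_Cons: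
  assumes "set xs \<subseteq> carr"
  shows "canon (idem v # xs) = 0"
proof (cases xs)
  case Nil
  show ?thesis using N2
    by (auto simp: Nil P_lact_path_pt contr_0_pt linmap_0[OF linmap_contr[OF linmap_id]]
        linmap_sum[OF linmap_contr[OF linmap_P_lact2[OF linmap_id]]] intro!: sum.neutral)
next
  case (Cons y ys)
  then have c: "P_lact G N y (canon ys) \<in> P_carrier G N (length ys)"
    using assms canon_carrier[of ys] by (intro P_lact_carrier) auto
  then show ?thesis
    by (simp add: Cons contr_idem[OF contr_carrier] contr_contr linmap_0[OF linmap_P_lact2[OF linmap_id]])
qed

lemma canon_zero_append: "canon ys = 0 \<Longrightarrow> canon (xs @ ys) = 0"
  by (induction xs) (simp_all add: linmap_0[OF linmap_contr[OF linmap_P_lact2[OF linmap_id]]])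

text \<open>
  The morphism is normalized: a vertex can be moved out of the inner contraction, and two consecutive
  contractions give zero.
\<close>

lemma canon_idem:
  assumes "set ys \<subseteq> carr"
  shows "canon (xs @ idem v # ys) = 0"
  by (rule canon_zero_append[OF canon_idem_Cons[OF assms]])

section \<open>Bimodule maps on the minimal resolution\<close>

lemma long_path_mult [simp]: "N \<le> plen a \<Longrightarrow> path a \<cdot> x = 0"
  and mult_long_path [simp]: "N \<le> plen a \<Longrightarrow> x \<cdot> path a = 0"
proof -
  assume a: "N \<le> plen a"
  show "path a \<cdot> x = 0"
    by (rule linmap_eqI[of "\<lambda>x. path a \<cdot> x" "\<lambda>x. 0"])
      (intro lin_intro, intro lin_intro, use a in \<open>simp add: path_prod_def\<close>)
  show "x \<cdot> path a = 0"
    by (rule linmap_eqI[of "\<lambda>x. x \<cdot> path a" "\<lambda>x. 0"])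
      (intro lin_intro, intro lin_intro, use a in \<open>simp add: path_prod_def\<close>)
qed

lemma path_mult_path_mult:
  "path p \<cdot> (path q \<cdot> x) = (if ptgt G p = psrc q then path (pcat p q) \<cdot> x else 0)"
  by (simp add: path_prod_def flip: mult_assoc)

lemma mult_path_mult_path:
  "x \<cdot> path p \<cdot> path q = (if ptgt G p = psrc q then x \<cdot> path (pcat p q) else 0)"
  by (simp add: path_prod_def mult_assoc)

lemma keys_idem_mult: "Poly_Mapping.keys (idem v \<cdot> x) \<subseteq> {c. psrc c = v}"
  and keys_mult_idem: "Poly_Mapping.keys (x \<cdot> idem v) \<subseteq> {c. ptgt G c = v}"
proof -
  have "idem v \<cdot> x = lin_ext (\<lambda>q. path_prod G N (v, []) q) x" by (simp add: A_mult_def)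
  also have "Poly_Mapping.keys \<dots> \<subseteq> {c. psrc c = v}"
    by (rule keys_lin_ext_subset) (auto simp: path_prod_def split: if_splits)
  finally show "Poly_Mapping.keys (idem v \<cdot> x) \<subseteq> {c. psrc c = v}" .
  have "x \<cdot> idem v = lin_ext (\<lambda>p. path_prod G N p (v, [])) x" by (simp add: A_mult_def)
  also have "Poly_Mapping.keys \<dots> \<subseteq> {c. ptgt G c = v}"
    by (rule keys_lin_ext_subset) (auto simp: path_prod_def split: if_splits)
  finally show "Poly_Mapping.keys (x \<cdot> idem v) \<subseteq> {c. ptgt G c = v}" .
qed

lemma lookup_lin_ext:
  "Poly_Mapping.lookup (lin_ext h x) c = (\<Sum>b\<in>Poly_Mapping.keys x. Poly_Mapping.lookup x b * Poly_Mapping.lookup (h b) c)"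
  by (simp add: lin_ext_def lookup_sum)

lemma lookup_Pstar_eval: "Poly_Mapping.lookup (Pstar_eval f p) c = Poly_Mapping.lookup f (c, p)"
proof -
  have "Poly_Mapping.lookup (Pstar_eval f p) c
    = (\<Sum>b\<in>Poly_Mapping.keys f. if b = (c, p) then Poly_Mapping.lookup f b else 0)"
    unfolding Pstar_eval_def lookup_lin_ext
    by (rule sum.cong) (auto simp: lookup_single when_def split: if_splits)
  also have "\<dots> = Poly_Mapping.lookup f (c, p)" by (simp add: in_keys_iff)
  finally show ?thesis .
qed

lemma Pstar_eqI: "(\<And>p. Pstar_eval f p = Pstar_eval g p) \<Longrightarrow> f = g"
  by (rule poly_mapping_eqI) (metis lookup_Pstar_eval surj_pair)

lemma linmap_Pstar_eval [lin_intro]: "linmap L \<Longrightarrow> linmap (\<lambda>x. Pstar_eval (L x) p)"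
  unfolding Pstar_eval_def by (intro lin_intro)

lemma linmap_Pstar_hom [lin_intro]: "linmap L \<Longrightarrow> linmap (\<lambda>x. Pstar_hom G N f (L x))"
  unfolding Pstar_hom_def by (intro lin_intro)

lemma Pstar_eval_single: "Pstar_eval (Poly_Mapping.single (c, q) 1) p = (if q = p then path c else 0)"
  by (simp add: Pstar_eval_def)

lemma Pstar_eval_parallel:
  assumes "f \<in> Pstar G N n"
  shows "Pstar_eval f p \<in> carr" "idem (psrc p) \<cdot> Pstar_eval f p = Pstar_eval f p"
    "Pstar_eval f p \<cdot> idem (ptgt G p) = Pstar_eval f p"
    "p \<notin> paths G (res_len N n) \<Longrightarrow> Pstar_eval f p = 0"
proof -
  have k: "(c, p) \<in> Pstar_basis G N n" if "c \<in> Poly_Mapping.keys (Pstar_eval f p)" for c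
    using that assms by (auto simp: in_keys_iff lookup_Pstar_eval Pstar_def)
  then show "Pstar_eval f p \<in> carr" by (auto simp: Pstar_basis_def intro!: carrI)
  show "idem (psrc p) \<cdot> Pstar_eval f p = Pstar_eval f p"
    by (rule linmap_eqI[of "\<lambda>x. idem (psrc p) \<cdot> x" "\<lambda>x. x"])
      (intro lin_intro, intro lin_intro, use k in \<open>auto simp: Pstar_basis_def idem_mult_path simp del: path_mult_path dest: short_pathsD\<close>)
  show "Pstar_eval f p \<cdot> idem (ptgt G p) = Pstar_eval f p"
    by (rule linmap_eqI[of "\<lambda>x. x \<cdot> idem (ptgt G p)" "\<lambda>x. x"])
      (intro lin_intro, intro lin_intro, use k in \<open>auto simp: Pstar_basis_def path_mult_idem simp del: path_mult_path dest: short_pathsD\<close>)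
  show "Pstar_eval f p = 0" if "p \<notin> paths G (res_len N n)"
  proof -
    have "c \<notin> Poly_Mapping.keys (Pstar_eval f p)" for c
      using that k[of c] by (auto simp: Pstar_basis_def)
    then show ?thesis by (metis keys_eq_empty equals0I)
  qed
qed

definition of_eval :: "nat \<Rightarrow> (('v,'e) path \<Rightarrow> ('v,'e,'k::comm_ring_1) alg) \<Rightarrow> ('v,'e,'k) pstar" where
  "of_eval n g = (\<Sum>p\<in>paths G (res_len N n). lin_ext (\<lambda>c. Poly_Mapping.single (c, p) 1) (g p))"

lemma Pstar_eval_of_eval:
  fixes g :: "('v,'e) path \<Rightarrow> ('v,'e,'k::comm_ring_1) alg"
  shows "Pstar_eval (of_eval n g) q = (if q \<in> paths G (res_len N n) then g q else 0)"
proof -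
  have "Pstar_eval (lin_ext (\<lambda>c. Poly_Mapping.single (c, p) 1) x) q = (if p = q then x else 0)" for p and x :: "('v,'e,'k) alg"
  proof -
    have "Pstar_eval (lin_ext (\<lambda>c. Poly_Mapping.single (c, p) 1) x) q
      = lin_ext (\<lambda>c. if p = q then path c else 0) x"
      by (simp add: linmap_lin_ext_eq[OF linmap_Pstar_eval[OF linmap_id]] Pstar_eval_single)
    then show ?thesis by (simp add: lin_ext_basis) (simp add: lin_ext_def)
  qed
  then show ?thesis
    by (simp add: of_eval_def linmap_sum[OF linmap_Pstar_eval[OF linmap_id]] finite_paths)
qed

lemma of_eval_Pstar:
  assumes "\<And>p. p \<in> paths G (res_len N n) \<Longrightarrow>
    g p \<in> carr \<and> idem (psrc p) \<cdot> g p = g p \<and> g p \<cdot> idem (ptgt G p) = g p"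
  shows "of_eval n g \<in> Pstar G N n"
  unfolding Pstar_def
proof (rule CollectI, rule subsetI)
  fix t assume t: "t \<in> Poly_Mapping.keys (of_eval n g)"
  obtain c p where cp: "t = (c, p)" by (cases t)
  have "c \<in> Poly_Mapping.keys (Pstar_eval (of_eval n g) p)"
    using t by (simp add: in_keys_iff lookup_Pstar_eval cp)
  then have p: "p \<in> paths G (res_len N n)" and c: "c \<in> Poly_Mapping.keys (g p)"
    by (auto simp: Pstar_eval_of_eval split: if_splits)
  then have "psrc c = psrc p" "ptgt G c = ptgt G p" "c \<in> short_paths G N"
    using assms[OF p] keys_idem_mult[of "psrc p" "g p"] keys_mult_idem[of "g p" "ptgt G p"] carrD[of "g p"]
    by auto
  with p show "t \<in> Pstar_basis G N n" by (simp add: Pstar_basis_def cp)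
qed

lemma Pstar_hom_pt:
  assumes "i + res_len N n \<le> plen \<rho>"
  shows "Pstar_hom G N f (pt n \<rho> i)
    = path (pseg G 0 i \<rho>) \<cdot> Pstar_eval f (pseg G i (res_len N n) \<rho>) \<cdot> path (pdrop G (i + res_len N n) \<rho>)"
proof (cases "i < N \<and> plen \<rho> < i + res_len N n + N")
  case True
  with assms show ?thesis by (simp add: pt_eq Pstar_hom_def)
next
  case False
  then show ?thesis using assms
    by (auto simp: pt_0 not_less linmap_0[OF linmap_Pstar_hom[OF linmap_id]])
qed

lemma pt_split:
  assumes "i + res_len N n \<le> plen \<rho>"
  shows "pt n \<rho> i = P_lact G N (path (pseg G 0 i \<rho>))
    (P_ract G N (pt n (pseg G i (res_len N n) \<rho>) 0) (path (pdrop G (i + res_len N n) \<rho>)))"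
  using assms
  by (simp add: P_ract_path_pt P_lact_path_pt pcat_pseg_pdrop min_absorb2)

lemma Pstar_hom_lact:
  assumes "z \<in> P_carrier G N n"
  shows "Pstar_hom G N f (P_lact G N x z) = x \<cdot> Pstar_hom G N f z"
proof -
  have 1: "Pstar_hom G N f (P_lact G N (path q) z) = path q \<cdot> Pstar_hom G N f z" for q
  proof (rule P_eqI[OF _ _ assms])
    fix \<rho> :: "('v,'e) path" and i assume i: "i + res_len N n \<le> plen \<rho>"
    have "pseg G 0 (plen q + i) (pcat q \<rho>) = pcat q (pseg G 0 i \<rho>)" 
      by (simp add: pseg_def pcat_def plen_def)
    then show "Pstar_hom G N f (P_lact G N (path q) (pt n \<rho> i)) = path q \<cdot> Pstar_hom G N f (pt n \<rho> i)"
      using i by (auto simp: P_lact_path_pt Pstar_hom_pt path_mult_path_mult mult_assoc pseg_pcat2 pdrop_pcat2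
          add.assoc linmap_0[OF linmap_Pstar_hom[OF linmap_id]] psrc_def[of \<rho>])
  qed (intro lin_intro)+
  show ?thesis
    by (rule linmap_eqI[of "\<lambda>x. Pstar_hom G N f (P_lact G N x z)" "\<lambda>x. x \<cdot> Pstar_hom G N f z"])
      (intro lin_intro 1)+
qed

lemma Pstar_hom_ract:
  assumes "z \<in> P_carrier G N n"
  shows "Pstar_hom G N f (P_ract G N z x) = Pstar_hom G N f z \<cdot> x"
proof -
  have 1: "Pstar_hom G N f (P_ract G N z (path q)) = Pstar_hom G N f z \<cdot> path q" for q
  proof (rule P_eqI[OF _ _ assms])
    fix \<rho> :: "('v,'e) path" and i assume i: "i + res_len N n \<le> plen \<rho>"
    then show "Pstar_hom G N f (P_ract G N (pt n \<rho> i) (path q)) = Pstar_hom G N f (pt n \<rho> i) \<cdot> path q"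
      by (auto simp: P_ract_path_pt Pstar_hom_pt mult_path_mult_path pseg_pcat1 pdrop_pcat1
          linmap_0[OF linmap_Pstar_hom[OF linmap_id]])
  qed (intro lin_intro)+
  show ?thesis
    by (rule linmap_eqI[of "\<lambda>x. Pstar_hom G N f (P_ract G N z x)" "\<lambda>x. Pstar_hom G N f z \<cdot> x"])
      (intro lin_intro 1)+
qed

lemma pt_0_carrier: "p \<in> paths G (res_len N n) \<Longrightarrow> pt n p 0 \<in> P_carrier G N n"
  by (rule pt_carrier) (auto simp: plen_paths)

lemma bimodule_eqI:
  assumes lin: "linmap L" "linmap M" and z: "z \<in> P_carrier G N n"
    and left: "\<And>q z. q \<in> short_paths G N \<Longrightarrow> z \<in> P_carrier G N n \<Longrightarrow> L (P_lact G N (path q) z) = path q \<cdot> L z"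
       "\<And>q z. q \<in> short_paths G N \<Longrightarrow> z \<in> P_carrier G N n \<Longrightarrow> M (P_lact G N (path q) z) = path q \<cdot> M z"
    and right: "\<And>q z. q \<in> short_paths G N \<Longrightarrow> z \<in> P_carrier G N n \<Longrightarrow> L (P_ract G N z (path q)) = L z \<cdot> path q"
       "\<And>q z. q \<in> short_paths G N \<Longrightarrow> z \<in> P_carrier G N n \<Longrightarrow> M (P_ract G N z (path q)) = M z \<cdot> path q"
    and gen: "\<And>p. p \<in> paths G (res_len N n) \<Longrightarrow> L (pt n p 0) = M (pt n p 0)"
  shows "L z = M z"
proof (rule P_eqI[OF lin z])
  fix \<rho> i assume *: "\<rho> \<in> paths G (plen \<rho>)" "i + res_len N n \<le> plen \<rho>" "i < N" "plen \<rho> < i + res_len N n + N"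
  let ?a = "pseg G 0 i \<rho>" and ?p = "pseg G i (res_len N n) \<rho>" and ?b = "pdrop G (i + res_len N n) \<rho>"
  have p: "?p \<in> paths G (res_len N n)" using * by (intro pseg_in_paths') auto
  have ab: "?a \<in> short_paths G N" "?b \<in> short_paths G N"
    using * by (auto intro!: short_pathsI[OF pseg_in_paths'] short_pathsI[OF pdrop_in_paths])
  have c: "P_ract G N (pt n ?p 0) (path ?b) \<in> P_carrier G N n"
    by (intro P_ract_carrier path_in_carr ab pt_0_carrier p)
  show "L (pt n \<rho> i) = M (pt n \<rho> i)"
    unfolding pt_split[OF *(2)] left(1)[OF ab(1) c] left(2)[OF ab(1) c]
      right(1)[OF ab(2) pt_0_carrier[OF p]] right(2)[OF ab(2) pt_0_carrier[OF p]] gen[OF p] ..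
qed

lemma Pstar_hom_carr:
  assumes "f \<in> Pstar G N n" "z \<in> P_carrier G N n"
  shows "Pstar_hom G N f z \<in> carr"
proof -
  have "Pstar_hom G N f (Poly_Mapping.single t 1) \<in> carr" if t: "t \<in> Poly_Mapping.keys z" for t
  proof -
    have "t \<in> P_basis G N n" using t assms(2) by (auto simp: P_carrier_def)
    then show ?thesis using Pstar_eval_parallel(1)[OF assms(1)]
      by (cases t) (auto simp: Pstar_hom_def P_basis_def intro!: mult_carr path_in_carr)
  qed
  then show ?thesis
    unfolding linmap_expand[OF linmap_Pstar_hom[OF linmap_id], of _ z] by (rule carr_lin_ext)
qed

lemma Pstar_hom_generator:
  assumes "f \<in> Pstar G N n" "p \<in> paths G (res_len N n)"
  shows "Pstar_hom G N f (pt n p 0) = Pstar_eval f p"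
  using assms by (simp add: Pstar_hom_pt plen_paths pseg_all pdrop_all Pstar_eval_parallel flip: psrc_def)

lemma idem_pt: "p \<in> paths G (res_len N n) \<Longrightarrow> P_lact G N (idem (psrc p)) (pt n p 0) = pt n p 0"
  and pt_idem: "p \<in> paths G (res_len N n) \<Longrightarrow> P_ract G N (pt n p 0) (idem (ptgt G p)) = pt n p 0"
  by (simp_all add: P_lact_path_pt P_ract_path_pt plen_paths)

lemma tens_generator:
  "p \<in> paths G (res_len N n) \<Longrightarrow> tens N (psrc p, []) p (ptgt G p, []) = pt n p 0"
  by (subst tens_eq_pt) (simp_all add: plen_paths)

lemma Pstar_eval_diff:
  "Pstar_eval (Pstar_diff G N n f) p
    = (if p \<in> paths G (res_len N (Suc n)) then Pstar_hom G N f (P_diff G N (Suc n) (pt (Suc n) p 0)) else 0)"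
proof -
  have "Pstar_diff G N n f = of_eval (Suc n) (\<lambda>p. Pstar_hom G N f (P_diff G N (Suc n) (pt (Suc n) p 0)))"
    unfolding Pstar_diff_def of_eval_def Suc_eq_plus1[symmetric]
    by (rule sum.cong) (simp_all add: tens_generator)
  then show ?thesis by (simp add: Pstar_eval_of_eval)
qed

lemma Pstar_diff_eq_of_eval:
  "Pstar_diff G N n f = of_eval (Suc n) (\<lambda>p. Pstar_hom G N f (P_diff G N (Suc n) (pt (Suc n) p 0)))"
  by (rule Pstar_eqI) (simp add: Pstar_eval_diff Pstar_eval_of_eval)

lemma Pstar_diff_Pstar:
  fixes f :: "('v,'e,'k::comm_ring_1) pstar"
  assumes "f \<in> Pstar G N n"
  shows "Pstar_diff G N n f \<in> Pstar G N (Suc n)"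
  unfolding Pstar_diff_eq_of_eval
proof (rule of_eval_Pstar, intro conjI)
  fix p assume p: "p \<in> paths G (res_len N (Suc n))"
  let ?g = "pt (Suc n) p 0 :: ('v,'e,'k) res"
  let ?d = "P_diff G N (Suc n) ?g"
  have g: "?g \<in> P_carrier G N (Suc n)" by (rule pt_0_carrier[OF p])
  have d: "?d \<in> P_carrier G N n" by (rule P_diff_carrier[OF g])
  show "Pstar_hom G N f ?d \<in> carr" using assms d by (rule Pstar_hom_carr)
  show "idem (psrc p) \<cdot> Pstar_hom G N f ?d = Pstar_hom G N f ?d"
    unfolding Pstar_hom_lact[OF d, symmetric] P_diff_lact[OF g, symmetric] idem_pt[OF p] ..
  show "Pstar_hom G N f ?d \<cdot> idem (ptgt G p) = Pstar_hom G N f ?d"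
    unfolding Pstar_hom_ract[OF d, symmetric] P_diff_ract[OF g, symmetric] pt_idem[OF p] ..
qed

text \<open>
  Both sides are bimodule maps, and they agree on generators by definition of \<open>Pstar_diff\<close>.
\<close>

lemma Pstar_hom_diff:
  assumes "f \<in> Pstar G N n" "z \<in> P_carrier G N (Suc n)"
  shows "Pstar_hom G N (Pstar_diff G N n f) z = Pstar_hom G N f (P_diff G N (Suc n) z)"
proof (rule bimodule_eqI[OF _ _ assms(2)])
  fix p assume p: "p \<in> paths G (res_len N (Suc n))"
  then show "Pstar_hom G N (Pstar_diff G N n f) (pt (Suc n) p 0) = Pstar_hom G N f (P_diff G N (Suc n) (pt (Suc n) p 0))"
    using assms(1) by (simp add: Pstar_hom_generator[OF Pstar_diff_Pstar] Pstar_eval_diff)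
qed (auto intro!: lin_intro simp: Pstar_hom_lact Pstar_hom_ract Pstar_hom_lact[OF P_diff_carrier] Pstar_hom_ract[OF P_diff_carrier] P_diff_lact P_diff_ract)

section \<open>Pulling Hochschild cochains back to the minimal resolution\<close>

text \<open>
  The comparison map \<open>\<mu>\<close> from the minimal resolution to the bar resolution is
  \<open>\<mu>(a \<otimes> p \<otimes> b) = a \<otimes> \<mu>(d(1 \<otimes> p \<otimes> 1)) b\<close>, by the contraction \<open>y \<mapsto> 1 \<otimes> y\<close> of the bar resolution. To avoid
  tensor powers, \<open>Phi n H z\<close> is the value at \<open>\<mu>(z)\<close> of the right linear map
  \<open>a\<^sub>0 \<otimes> \<dots> \<otimes> a\<^sub>n \<otimes> b \<mapsto> H [a\<^sub>0, \<dots>, a\<^sub>n] b\<close>; the list has \<open>n + 1\<close> entries because the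
  first one is the left coefficient.
\<close>

primrec Phi :: "nat \<Rightarrow> ('v,'e,'k::comm_ring_1) cochain \<Rightarrow> ('v,'e,'k) res \<Rightarrow> ('v,'e,'k) alg" where
  "Phi 0 H = lin_ext (\<lambda>(a, p, b). H [path a] \<cdot> path b)"
| "Phi (Suc n) H = lin_ext (\<lambda>(a, p, b).
     Phi n (\<lambda>xs. H (path a # xs)) (P_diff G N (Suc n) (tens N (psrc p, []) p (ptgt G p, []))) \<cdot> path b)"

lemma linmap_Phi [lin_intro]: "linmap L \<Longrightarrow> linmap (\<lambda>z. Phi n H (L z))"
  by (cases n) (auto intro: lin_intro)

lemma Phi_0_pt:
  assumes "i \<le> plen \<rho>" "i < N"
  shows "Phi 0 H (pt 0 \<rho> i) = H [path (pseg G 0 i \<rho>)] \<cdot> path (pdrop G i \<rho>)"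
proof (cases "plen \<rho> < i + N")
  case True
  with assms show ?thesis by (simp add: pt_eq)
next
  case False
  with assms show ?thesis by (simp del: Phi.simps add: pt_0 linmap_0[OF linmap_Phi[OF linmap_id]])
qed

lemma Phi_Suc_pt:
  assumes "\<rho> \<in> paths G (plen \<rho>)" "i + res_len N (Suc n) \<le> plen \<rho>" "i < N"
  shows "Phi (Suc n) H (pt (Suc n) \<rho> i)
    = Phi n (\<lambda>xs. H (path (pseg G 0 i \<rho>) # xs))
        (P_diff G N (Suc n) (pt (Suc n) (pseg G i (res_len N (Suc n)) \<rho>) 0))
      \<cdot> path (pdrop G (i + res_len N (Suc n)) \<rho>)"
proof (cases "plen \<rho> < i + res_len N (Suc n) + N")
  case True
  have "pseg G i (res_len N (Suc n)) \<rho> \<in> paths G (res_len N (Suc n))"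
    using assms by (intro pseg_in_paths')
  with True assms show ?thesis by (simp add: pt_eq[of i] tens_generator del: psrc_pseg ptgt_pseg)
next
  case False
  with assms show ?thesis by (simp del: Phi.simps add: pt_0 linmap_0[OF linmap_Phi[OF linmap_id]])
qed

lemma Phi_linmap:
  assumes L: "linmap L" "\<And>x y. L (x \<cdot> y) = L x \<cdot> y"
  shows "Phi n (\<lambda>xs. L (F xs)) z = L (Phi n F z)"
proof (induction n arbitrary: F z)
  case 0
  then show ?case by (simp add: linmap_lin_ext_eq[OF L(1)] L(2) case_prod_unfold)
next
  case (Suc n)
  show ?case by (simp add: linmap_lin_ext_eq[OF L(1)] L(2) case_prod_unfold Suc[of "\<lambda>xs. F (_ # xs)"])
qed

lemma lin_ext_fun_add: "lin_ext (\<lambda>b. f b + g b) x = lin_ext f x + lin_ext g x"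
  by (simp add: lin_ext_def smul_add_right sum.distrib)

lemma Phi_add: "Phi n (\<lambda>xs. F xs + H xs) z = Phi n F z + Phi n H z"
proof (induction n arbitrary: F H z)
  case 0
  then show ?case by (simp add: mult_simps case_prod_unfold lin_ext_fun_add)
next
  case (Suc n)
  show ?case
    by (simp add: mult_simps case_prod_unfold lin_ext_fun_add Suc[of "\<lambda>xs. F (_ # xs)" "\<lambda>xs. H (_ # xs)"])
qed

lemma Phi_lmult: "Phi n (\<lambda>xs. x \<cdot> F xs) z = x \<cdot> Phi n F z"
  by (rule Phi_linmap) (auto intro!: lin_intro simp: mult_assoc)

lemma Phi_smul: "Phi n (\<lambda>xs. smul c (F xs)) z = smul c (Phi n F z)"
  by (rule Phi_linmap) (auto intro!: lin_intro simp: mult_simps)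

lemma Phi_uminus: "Phi n (\<lambda>xs. - F xs) z = - Phi n F z"
  by (rule Phi_linmap) (auto intro!: lin_intro simp: mult_simps)

lemma Phi_diff: "Phi n (\<lambda>xs. F xs - H xs) z = Phi n F z - Phi n H z"
  using Phi_add[of n F "\<lambda>xs. - H xs" z] by (simp add: Phi_uminus)

lemma Phi_zero: "Phi n (\<lambda>_. 0) z = 0"
  using Phi_smul[of n 0 "\<lambda>_. 0" z] by simp

lemma Phi_cong:
  assumes "z \<in> P_carrier G N n"
    and "\<And>xs. set xs \<subseteq> carr \<Longrightarrow> length xs = Suc n \<Longrightarrow> F xs = H xs"
  shows "Phi n F z = Phi n H z"
  using assms
proof (induction n arbitrary: F H z)
  case 0
  show ?case
  proof (rule P_eqI[OF _ _ 0(1)])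
    fix \<rho> i assume "\<rho> \<in> paths G (plen \<rho>)" "i + res_len N 0 \<le> plen \<rho>" "i < N"
    then show "Phi 0 F (pt 0 \<rho> i) = Phi 0 H (pt 0 \<rho> i)"
      by (simp add: Phi_0_pt 0(2) path_in_carr short_pathsI[OF pseg_in_paths'] del: Phi.simps)
  qed (intro lin_intro)+
next
  case (Suc n)
  show ?case
  proof (rule P_eqI[OF _ _ Suc(2)])
    fix \<rho> i assume *: "\<rho> \<in> paths G (plen \<rho>)" "i + res_len N (Suc n) \<le> plen \<rho>" "i < N"
    let ?p = "pseg G i (res_len N (Suc n)) \<rho>"
    have "Phi n (\<lambda>xs. F (path (pseg G 0 i \<rho>) # xs)) (P_diff G N (Suc n) (pt (Suc n) ?p 0))
      = Phi n (\<lambda>xs. H (path (pseg G 0 i \<rho>) # xs)) (P_diff G N (Suc n) (pt (Suc n) ?p 0))"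
    proof (rule Suc.IH)
      show "P_diff G N (Suc n) (pt (Suc n) ?p 0) \<in> P_carrier G N n"
        using * by (intro P_diff_carrier pt_0_carrier pseg_in_paths')
      show "F (path (pseg G 0 i \<rho>) # xs) = H (path (pseg G 0 i \<rho>) # xs)"
        if "set xs \<subseteq> carr" "length xs = Suc n" for xs
        using * that by (intro Suc.prems) (auto intro!: path_in_carr short_pathsI[OF pseg_in_paths'])
    qed
    then show "Phi (Suc n) F (pt (Suc n) \<rho> i) = Phi (Suc n) H (pt (Suc n) \<rho> i)"
      using * by (simp add: Phi_Suc_pt del: Phi.simps)
  qed (intro lin_intro)+
qed

lemma Phi_ract:
  assumes z: "z \<in> P_carrier G N n" and x: "x \<in> carr"
  shows "Phi n H (P_ract G N z x) = Phi n H z \<cdot> x"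
proof -
  have 1: "Phi n H (P_ract G N z (path q)) = Phi n H z \<cdot> path q" if q: "q \<in> short_paths G N" for q
  proof (rule P_eqI[OF _ _ z])
    fix \<rho> i assume *: "\<rho> \<in> paths G (plen \<rho>)" "i + res_len N n \<le> plen \<rho>" "i < N"
    have pq: "pcat \<rho> q \<in> paths G (plen (pcat \<rho> q))" if "ptgt G \<rho> = psrc q"
      using pcat_in_paths[OF *(1) _ that] short_pathsD[OF q] by simp
    show "Phi n H (P_ract G N (pt n \<rho> i) (path q)) = Phi n H (pt n \<rho> i) \<cdot> path q"
    proof (cases n)
      case 0
      then show ?thesis using *
        by (auto simp: P_ract_path_pt Phi_0_pt mult_path_mult_path pseg_pcat1 pdrop_pcat1
          linmap_0[OF linmap_Phi[OF linmap_id]] simp del: Phi.simps)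
    next
      case (Suc m)
      then show ?thesis using * pq
        by (auto simp: P_ract_path_pt Phi_Suc_pt mult_path_mult_path pseg_pcat1 pdrop_pcat1
          linmap_0[OF linmap_Phi[OF linmap_id]] simp del: Phi.simps)
    qed
  qed (intro lin_intro)+
  show ?thesis
    by (rule linmap_eqI[of "\<lambda>x. Phi n H (P_ract G N z x)" "\<lambda>x. Phi n H z \<cdot> x"])
      (intro lin_intro, intro lin_intro, use carrD[OF x] in \<open>auto simp: 1\<close>)
qed

lemma carr_induct [consumes 1, case_names zero path add smul]:
  assumes "x \<in> carr" "P 0" "\<And>q. q \<in> short_paths G N \<Longrightarrow> P (path q)"
    and "\<And>x y. x \<in> carr \<Longrightarrow> y \<in> carr \<Longrightarrow> P x \<Longrightarrow> P y \<Longrightarrow> P (x + y)"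
    and "\<And>c x. x \<in> carr \<Longrightarrow> P x \<Longrightarrow> P (smul c x)"
  shows "P x"
proof -
  have "P (sum (\<lambda>q. smul (Poly_Mapping.lookup x q) (path q)) S) \<and> sum (\<lambda>q. smul (Poly_Mapping.lookup x q) (path q)) S \<in> carr"
    if "finite S" "S \<subseteq> short_paths G N" for S
    using that
  proof (induction S)
    case (insert q S)
    then have q: "path q \<in> carr" "P (path q)" by (auto simp: assms(3) intro: path_in_carr)
    with insert show ?case by (auto intro!: assms(4,5))
  qed (simp add: assms(2))
  from this[of "Poly_Mapping.keys x"] carrD[OF assms(1)]
  have "P (lin_ext path x)" by (simp add: lin_ext_def)
  then show ?thesis by (simp add: lin_ext_basis)
qed

text \<open>
  \<open>\<mu>\<close> is a map of left modules, and the left action on the bar resolution changes the first entry only.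
\<close>

lemma Phi_lact:
  fixes H :: "('v,'e,'k::comm_ring_1) cochain"
  assumes H: "multilinear_on carr H" and "x \<in> carr" and z: "z \<in> P_carrier G N n"
  shows "Phi n H (P_lact G N x z) = Phi n (\<lambda>ys. H (x \<cdot> hd ys # tl ys)) z"
  using assms(2)
proof (induction x rule: carr_induct)
  case zero
  have "Phi n (\<lambda>ys. H (0 \<cdot> hd ys # tl ys)) z = Phi n (\<lambda>_. 0) z"
  proof (rule Phi_cong[OF z])
    fix xs :: "('v,'e,'k) alg list" assume "set xs \<subseteq> carr" "length xs = Suc n"
    then have "set (tl xs) \<subseteq> carr" by (cases xs) auto
    from multilinear_on_hd(2)[OF H this, of 0 0] show "H (0 \<cdot> hd xs # tl xs) = 0" by simp
  qed
  then show ?case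
    by (simp add: Phi_zero linmap_0[OF linmap_P_lact1[OF linmap_id]] linmap_0[OF linmap_Phi[OF linmap_id]])
next
  case (path q)
  have H0: "H (0 # ys) = 0" if "set ys \<subseteq> carr" for ys
    using multilinear_on_hd(2)[OF H that, of 0 0] by simp
  show ?case
  proof (rule P_eqI[OF _ _ z])
    fix \<rho> i assume *: "\<rho> \<in> paths G (plen \<rho>)" "i + res_len N n \<le> plen \<rho>" "i < N"
    let ?a = "pseg G 0 i \<rho>" and ?p = "pseg G i (res_len N n) \<rho>"
    have a: "ptgt G q = psrc \<rho> \<Longrightarrow> pseg G 0 (plen q + i) (pcat q \<rho>) = pcat q ?a"
      "psrc ?a = psrc \<rho>"
      by (simp_all add: pseg_def pcat_def plen_def psrc_def)
    have m: "path q \<cdot> path ?a = (if ptgt G q = psrc \<rho> \<and> plen q + i < N then path (pcat q ?a) else 0)"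
      using * a by (simp add: path_prod_def min_absorb2)
    have pq: "pcat q \<rho> \<in> paths G (plen (pcat q \<rho>))" if "ptgt G q = psrc \<rho>"
      using pcat_in_paths[OF _ *(1) that] short_pathsD[OF path] by simp
    have Hz: "Phi m (\<lambda>ys. H (0 # ys)) w = 0" if "w \<in> P_carrier G N m" for m w
      using Phi_cong[OF that, of "\<lambda>ys. H (0 # ys)" "\<lambda>_. 0"] by (simp add: H0 Phi_zero)
    show "Phi n H (P_lact G N (path q) (pt n \<rho> i)) = Phi n (\<lambda>ys. H (path q \<cdot> hd ys # tl ys)) (pt n \<rho> i)"
    proof (cases "ptgt G q = psrc \<rho> \<and> plen q + i < N")
      case True
      then show ?thesis
      proof (cases n)
        case 0
        then show ?thesis using * True
          by (simp add: P_lact_path_pt Phi_0_pt m a pdrop_pcat2 del: Phi.simps path_mult_path)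
      next
        case (Suc k)
        then show ?thesis using * True pq
          by (simp add: P_lact_path_pt Phi_Suc_pt m a pdrop_pcat2 pseg_pcat2 add.assoc del: Phi.simps path_mult_path)
      qed
    next
      case False
      then have "P_lact G N (path q) (pt n \<rho> i) = (0 :: ('v,'e,'k) res)"
        using * by (auto simp: P_lact_path_pt pt_0)
      moreover have "Phi n (\<lambda>ys. H (path q \<cdot> hd ys # tl ys)) (pt n \<rho> i) = 0"
      proof (cases n)
        case 0
        then show ?thesis using * False H0[of "[]"]
          by (auto simp: Phi_0_pt m simp del: Phi.simps path_mult_path)
      next
        case (Suc k)
        have "P_diff G N (Suc k) (pt (Suc k) ?p 0 :: ('v,'e,'k) res) \<in> P_carrier G N k"
          using *(2) Suc by (intro P_diff_carrier pt_0_carrier) (simp add: pseg_in_paths'[OF *(1)])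
        then show ?thesis using * Suc False
          by (auto simp: Phi_Suc_pt Hz m simp del: Phi.simps path_mult_path)
      qed
      ultimately show ?thesis by (simp add: linmap_0[OF linmap_Phi[OF linmap_id]])
    qed
  qed (intro lin_intro)+
next
  case (add x y)
  have "Phi n (\<lambda>ys. H ((x + y) \<cdot> hd ys # tl ys)) z
    = Phi n (\<lambda>ys. H (x \<cdot> hd ys # tl ys) + H (y \<cdot> hd ys # tl ys)) z"
  proof (rule Phi_cong[OF z])
    fix xs :: "('v,'e,'k) alg list" assume "set xs \<subseteq> carr" "length xs = Suc n"
    then have "hd xs \<in> carr" "set (tl xs) \<subseteq> carr" by (cases xs; auto)+
    with multilinear_on_hd(1)[OF H this(2)] add
    show "H ((x + y) \<cdot> hd xs # tl xs) = H (x \<cdot> hd xs # tl xs) + H (y \<cdot> hd xs # tl xs)"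
      by (simp add: mult_simps)
  qed
  then show ?case using add
    by (simp add: linmap_add[OF linmap_P_lact1[OF linmap_id]] linmap_add[OF linmap_Phi[OF linmap_id]] Phi_add)
next
  case (smul c x)
  have "Phi n (\<lambda>ys. H (smul c x \<cdot> hd ys # tl ys)) z
    = Phi n (\<lambda>ys. smul c (H (x \<cdot> hd ys # tl ys))) z"
  proof (rule Phi_cong[OF z])
    fix xs :: "('v,'e,'k) alg list" assume "set xs \<subseteq> carr" "length xs = Suc n"
    then have "hd xs \<in> carr" "set (tl xs) \<subseteq> carr" by (cases xs; auto)+
    with multilinear_on_hd(2)[OF H this(2)] smul
    show "H (smul c x \<cdot> hd xs # tl xs) = smul c (H (x \<cdot> hd xs # tl xs))"
      by (simp add: mult_simps)
  qed
  then show ?case using smul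
    by (simp add: linmap_smul[OF linmap_P_lact1[OF linmap_id]] linmap_smul[OF linmap_Phi[OF linmap_id]] Phi_smul)
qed

lemma Phi_carr:
  assumes "z \<in> P_carrier G N n" "\<And>xs. set xs \<subseteq> carr \<Longrightarrow> length xs = Suc n \<Longrightarrow> H xs \<in> carr"
  shows "Phi n H z \<in> carr"
  using assms
proof (induction n arbitrary: H z)
  case 0
  show ?case unfolding Phi.simps
  proof (rule carr_lin_ext, clarify)
    fix va a vp p vb b assume "((va, a), (vp, p), vb, b) \<in> Poly_Mapping.keys z"
    then have "(va, a) \<in> short_paths G N" "(vb, b) \<in> short_paths G N"
      using 0(1) by (auto simp: P_carrier_def P_basis_def)
    then show "H [path (va, a)] \<cdot> path (vb, b) \<in> carr"
      by (intro mult_carr 0(2)) (auto intro: path_in_carr)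
  qed
next
  case (Suc n)
  show ?case unfolding Phi.simps
  proof (rule carr_lin_ext, clarify)
    fix va a vp p vb b assume "((va, a), (vp, p), vb, b) \<in> Poly_Mapping.keys z"
    then have *: "(va, a) \<in> short_paths G N" "(vb, b) \<in> short_paths G N" "(vp, p) \<in> paths G (res_len N (Suc n))"
      using Suc.prems(1) by (auto simp: P_carrier_def P_basis_def)
    then have "P_diff G N (Suc n) (tens N (psrc (vp, p), []) (vp, p) (ptgt G (vp, p), [])) \<in> P_carrier G N n"
      unfolding tens_generator[OF *(3)] by (intro P_diff_carrier pt_0_carrier)
    then have "Phi n (\<lambda>xs. H (path (va, a) # xs)) (P_diff G N (Suc n) (tens N (psrc (vp, p), []) (vp, p) (ptgt G (vp, p), []))) \<in> carr"
      by (rule Suc.IH) (auto intro!: Suc.prems(2) path_in_carr *)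
    then show "Phi n (\<lambda>xs. H (path (va, a) # xs)) (P_diff G N (Suc n) (tens N (psrc (vp, p), []) (vp, p) (ptgt G (vp, p), []))) \<cdot> path (vb, b) \<in> carr"
      using * by (intro mult_carr path_in_carr)
  qed
qed

lemma Phi_0_bar_tail:
  assumes "z \<in> P_carrier G N 0"
  shows "Phi 0 (bar_tail mul F) z = F [] \<cdot> P_aug G N z"
proof (rule P_eqI[OF _ _ assms])
  fix \<rho> :: "('v,'e) path" and i assume "i + res_len N 0 \<le> plen \<rho>" "i < N"
  then show "Phi 0 (bar_tail mul F) (pt 0 \<rho> i) = F [] \<cdot> P_aug G N (pt 0 \<rho> i)"
    by (simp add: Phi_0_pt P_aug_pt mult_path_mult_path del: Phi.simps)
qed (intro lin_intro)+

text \<open>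
  The chain map property for \<open>\<mu>\<close> follows from \<open>d \<mu> d = 0\<close> in the degree below, which in turn follows
  from the chain map property there. Hence the hypothesis \<open>exact\<close>; the next lemma discharges it by induction.
\<close>

lemma Phi_Suc_bar_tail:
  fixes H :: "('v,'e,'k::comm_ring_1) cochain"
  assumes H: "multilinear_on carr H" and z: "z \<in> P_carrier G N (Suc n)"
    and exact: "\<And>(F :: ('v,'e,'k) cochain) u. multilinear_on carr F \<Longrightarrow> u \<in> P_carrier G N (Suc n) \<Longrightarrow>
      Phi n (bar_tail mul F) (P_diff G N (Suc n) u) = 0"
  shows "Phi (Suc n) (bar_tail mul H) z = Phi n H (P_diff G N (Suc n) z)"
proof (rule P_eqI[OF _ _ z])
  fix \<rho> i assume *: "\<rho> \<in> paths G (plen \<rho>)" "i + res_len N (Suc n) \<le> plen \<rho>" "i < N"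
    "plen \<rho> < i + res_len N (Suc n) + N"
  let ?a = "pseg G 0 i \<rho>" and ?p = "pseg G i (res_len N (Suc n)) \<rho>" and ?b = "pdrop G (i + res_len N (Suc n)) \<rho>"
  let ?u = "pt (Suc n) ?p 0 :: ('v,'e,'k) res"
  let ?w = "P_diff G N (Suc n) ?u"
  have u: "?u \<in> P_carrier G N (Suc n)"
    using * by (intro pt_0_carrier pseg_in_paths')
  have w: "?w \<in> P_carrier G N n"
    using u by (rule P_diff_carrier)
  have a: "path ?a \<in> carr" and b: "path ?b \<in> carr"
    using * by (auto intro!: path_in_carr short_pathsI[OF pseg_in_paths'] short_pathsI[OF pdrop_in_paths])
  have "Phi (Suc n) (bar_tail mul H) (pt (Suc n) \<rho> i)
    = Phi n (\<lambda>xs. merge_hd (path ?a) H xs - bar_tail mul (\<lambda>ys. H (path ?a # ys)) xs) ?w \<cdot> path ?b"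
    using * by (simp add: Phi_Suc_pt bar_tail_Cons del: Phi.simps)
  also have "\<dots> = Phi n (merge_hd (path ?a) H) ?w \<cdot> path ?b"
    unfolding Phi_diff using exact[OF multilinear_on_shift[OF H a] u] by simp
  also have "Phi n (merge_hd (path ?a) H) ?w = Phi n (\<lambda>ys. H (path ?a \<cdot> hd ys # tl ys)) ?w"
  proof (rule Phi_cong[OF w])
    fix xs :: "('v,'e,'k) alg list" assume "length xs = Suc n"
    then show "merge_hd (path ?a) H xs = H (path ?a \<cdot> hd xs # tl xs)" by (cases xs) auto
  qed
  also have "\<dots> = Phi n H (P_lact G N (path ?a) ?w)" by (rule Phi_lact[OF H a w, symmetric])
  also have "\<dots> \<cdot> path ?b = Phi n H (P_ract G N (P_lact G N (path ?a) ?w) (path ?b))"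
    by (rule Phi_ract[OF P_lact_carrier[OF a w] b, symmetric])
  also have "P_ract G N (P_lact G N (path ?a) ?w) (path ?b) = P_diff G N (Suc n) (pt (Suc n) \<rho> i)"
    unfolding pt_split[OF *(2)]
    by (simp only: P_lact_ract[OF w, symmetric] P_diff_ract[OF u, symmetric]
        P_diff_lact[OF P_ract_carrier[OF b u], symmetric])
  finally show "Phi (Suc n) (bar_tail mul H) (pt (Suc n) \<rho> i) = Phi n H (P_diff G N (Suc n) (pt (Suc n) \<rho> i :: ('v,'e,'k) res))" .
qed (intro lin_intro)+

lemma Phi_bar_tail_diff:
  assumes "multilinear_on carr F" "u \<in> P_carrier G N (Suc n)"
  shows "Phi n (bar_tail mul F) (P_diff G N (Suc n) u) = 0"
  using assms
proof (induction n arbitrary: F u)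
  case 0
  then show ?case by (simp add: Phi_0_bar_tail P_diff_carrier P_aug_diff del: Phi.simps)
next
  case (Suc n)
  have "Phi (Suc n) (bar_tail mul F) (P_diff G N (Suc (Suc n)) u)
    = Phi n F (P_diff G N (Suc n) (P_diff G N (Suc (Suc n)) u))"
    using Suc by (intro Phi_Suc_bar_tail P_diff_carrier)
  then show ?case using Suc.prems by (simp add: P_diff_diff linmap_0[OF linmap_Phi[OF linmap_id]])
qed

lemma Phi_chain:
  assumes "multilinear_on carr H" "z \<in> P_carrier G N (Suc n)"
  shows "Phi (Suc n) (bar_tail mul H) z = Phi n H (P_diff G N (Suc n) z)"
  using assms Phi_bar_tail_diff by (rule Phi_Suc_bar_tail)

declare Phi.simps [simp del]

subsection \<open>The pullback as a chain map\<close>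

text \<open>
  The bimodule map determined by a Hochschild cochain, with the left coefficient as first entry.
\<close>

definition ext_left :: "('v,'e,'k::comm_ring_1) cochain \<Rightarrow> ('v,'e,'k) cochain" where
  "ext_left H xs = hd xs \<cdot> H (tl xs)"

lemma ext_left_Cons [simp]: "ext_left H (x # xs) = x \<cdot> H xs"
  by (simp add: ext_left_def)

lemma ext_left_multilinear:
  assumes "multilinear_on carr H"
  shows "multilinear_on carr (ext_left H)"
proof (rule multilinear_on_ConsI)
  fix x :: "('v,'e,'a) alg"
  show "multilinear_on carr (\<lambda>xs. ext_left H (x # xs))"
    using multilinear_on_linmap[OF linmap_mult_right[OF linmap_id] assms] by simp
qed (simp_all add: mult_simps)

definition pull :: "nat \<Rightarrow> ('v,'e,'k::comm_ring_1) cochain \<Rightarrow> ('v,'e,'k) pstar" where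
  "pull n H = of_eval n (\<lambda>p. Phi n (ext_left H) (pt n p 0))"

lemma Pstar_eval_pull:
  "Pstar_eval (pull n H) p = (if p \<in> paths G (res_len N n) then Phi n (ext_left H) (pt n p 0) else 0)"
  by (simp add: pull_def Pstar_eval_of_eval)

lemma Phi_ext_left_lact:
  assumes "multilinear_on carr H" "x \<in> carr" "z \<in> P_carrier G N n"
  shows "Phi n (ext_left H) (P_lact G N x z) = x \<cdot> Phi n (ext_left H) z"
proof -
  have "Phi n (ext_left H) (P_lact G N x z) = Phi n (\<lambda>ys. ext_left H (x \<cdot> hd ys # tl ys)) z"
    by (rule Phi_lact[OF ext_left_multilinear[OF assms(1)] assms(2,3)])
  also have "\<dots> = Phi n (\<lambda>ys. x \<cdot> ext_left H ys) z"
    by (simp add: ext_left_def mult_assoc)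
  finally show ?thesis by (simp add: Phi_lmult)
qed

lemma pull_Pstar:
  fixes H :: "('v,'e,'k::comm_ring_1) cochain"
  assumes H: "multilinear_on carr H" "\<And>xs. set xs \<subseteq> carr \<Longrightarrow> H xs \<in> carr"
  shows "pull n H \<in> Pstar G N n"
  unfolding pull_def
proof (rule of_eval_Pstar, intro conjI)
  fix p assume p: "p \<in> paths G (res_len N n)"
  let ?g = "pt n p 0 :: ('v,'e,'k) res"
  have g: "?g \<in> P_carrier G N n" by (rule pt_0_carrier[OF p])
  have i: "idem (psrc p) \<in> carr" "idem (ptgt G p) \<in> carr"
    using p by (auto intro!: path_in_carr vertex_short simp: psrc_in_verts ptgt_in_verts)
  show "Phi n (ext_left H) ?g \<in> carr"
  proof (rule Phi_carr[OF g])
    fix xs :: "('v,'e,'k) alg list" assume "set xs \<subseteq> carr" "length xs = Suc n"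
    then show "ext_left H xs \<in> carr" using H(2) by (cases xs) auto
  qed
  show "idem (psrc p) \<cdot> Phi n (ext_left H) ?g = Phi n (ext_left H) ?g"
    unfolding Phi_ext_left_lact[OF H(1) i(1) g, symmetric] idem_pt[OF p] ..
  show "Phi n (ext_left H) ?g \<cdot> idem (ptgt G p) = Phi n (ext_left H) ?g"
    unfolding Phi_ract[OF g i(2), symmetric] pt_idem[OF p] ..
qed

lemma Pstar_hom_pull:
  assumes H: "multilinear_on carr H" "\<And>xs. set xs \<subseteq> carr \<Longrightarrow> H xs \<in> carr" and "z \<in> P_carrier G N n"
  shows "Pstar_hom G N (pull n H) z = Phi n (ext_left H) z"
proof (rule bimodule_eqI[OF _ _ assms(3)])
  fix p assume p: "p \<in> paths G (res_len N n)"
  then show "Pstar_hom G N (pull n H) (pt n p 0) = Phi n (ext_left H) (pt n p 0)"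
    by (simp add: Pstar_hom_generator[OF pull_Pstar[OF H]] Pstar_eval_pull)
qed (auto intro!: lin_intro simp: Pstar_hom_lact Pstar_hom_ract Phi_ext_left_lact[OF H(1) path_in_carr]
      Phi_ract[OF _ path_in_carr])

lemma bar_tail_ext_left: "bar_tail mul (ext_left H) (x # y # ys) = x \<cdot> cobd H (y # ys)"
  by (simp add: cobd_Cons bar_tail_lmult mult_simps mult_assoc)

text \<open>
  On generators this is the chain map property of \<open>Phi\<close>, since \<open>bar_tail\<close> of the extended cochain is
  the extension of its Hochschild coboundary.
\<close>

lemma pull_chain:
  assumes "H \<in> hoch_cochains G N"
  shows "Pstar_diff G N n (pull n H) = pull (Suc n) (hoch_diff G N H)"
proof (rule Pstar_eqI)
  fix p
  note H = hoch_cochainsD(1,2)[OF assms]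
  show "Pstar_eval (Pstar_diff G N n (pull n H)) p = Pstar_eval (pull (Suc n) (hoch_diff G N H)) p"
  proof (cases "p \<in> paths G (res_len N (Suc n))")
    case True
    let ?g = "pt (Suc n) p 0 :: ('v,'e,'a) res"
    have g: "?g \<in> P_carrier G N (Suc n)" by (rule pt_0_carrier[OF True])
    have "Pstar_eval (Pstar_diff G N n (pull n H)) p = Pstar_hom G N (pull n H) (P_diff G N (Suc n) ?g)"
      using True by (simp add: Pstar_eval_diff)
    also have "\<dots> = Phi n (ext_left H) (P_diff G N (Suc n) ?g)"
      by (rule Pstar_hom_pull[OF H P_diff_carrier[OF g]])
    also have "\<dots> = Phi (Suc n) (bar_tail mul (ext_left H)) ?g"
      by (rule Phi_chain[OF ext_left_multilinear[OF H(1)] g, symmetric])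
    also have "\<dots> = Phi (Suc n) (ext_left (hoch_diff G N H)) ?g"
    proof (rule Phi_cong[OF g])
      fix xs :: "('v,'e,'a) alg list" assume "set xs \<subseteq> carr" "length xs = Suc (Suc n)"
      moreover then obtain x y ys where "xs = x # y # ys" by (metis Suc_length_conv)
      ultimately show "bar_tail mul (ext_left H) xs = ext_left (hoch_diff G N H) xs"
        by (simp add: bar_tail_ext_left hoch_diff_eq del: bar_tail.simps)
    qed
    finally show ?thesis using True by (simp add: Pstar_eval_pull del: Phi.simps)
  qed (simp add: Pstar_eval_diff Pstar_eval_pull)
qed

section \<open>Comparison morphisms\<close>

lemma is_comparisonD:
  assumes "is_comparison G N \<psi>"
  shows "multilinear_on carr \<psi>" "set xs \<subseteq> carr \<Longrightarrow> \<psi> xs \<in> P_carrier G N (length xs)"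
    "P_aug G N (\<psi> []) = A_one G"
    "set (x # xs) \<subseteq> carr \<Longrightarrow> P_diff G N (Suc (length xs)) (\<psi> (x # xs))
      = P_lact G N x (\<psi> xs) - bar_tail (P_ract G N) \<psi> (x # xs)"
proof -
  show "P_diff G N (Suc (length xs)) (\<psi> (x # xs)) = P_lact G N x (\<psi> xs) - bar_tail (P_ract G N) \<psi> (x # xs)"
    if "set (x # xs) \<subseteq> carr"
  proof -
    have "P_diff G N (length (x # xs)) (\<psi> (x # xs)) = bar_precomp G N (P_lact G N) (P_ract G N) \<psi> (x # xs)"
      using assms that unfolding is_comparison_def by blast
    then show ?thesis by (simp add: bar_precomp_eq)
  qed
qed (use assms in \<open>simp_all add: is_comparison_def\<close>)

text \<open>
  The transpose of a homotopy between \<open>\<mu> \<circ> \<psi>\<close> and the identity of the bar resolution, again obtained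
  by the recursion for the contraction \<open>y \<mapsto> 1 \<otimes> y\<close>; as for \<open>Phi\<close>, the
  function \<open>H\<close> takes one entry more than the list \<open>xs\<close> has, the first one being the left coefficient.
\<close>

primrec homot :: "(('v,'e,'k::comm_ring_1) alg list \<Rightarrow> ('v,'e,'k) res) \<Rightarrow>
    ('v,'e,'k) alg list \<Rightarrow> ('v,'e,'k) cochain \<Rightarrow> ('v,'e,'k) alg" where
  "homot \<psi> [] H = Phi 0 H (\<psi> [])"
| "homot \<psi> (x # xs) H = Phi (Suc (length xs)) H (\<psi> (x # xs)) - homot \<psi> xs (\<lambda>ys. H (x # ys))"

lemma homot_lin:
  "homot \<psi> xs (\<lambda>ys. F ys + H ys) = homot \<psi> xs F + homot \<psi> xs H"
  "homot \<psi> xs (\<lambda>ys. F ys - H ys) = homot \<psi> xs F - homot \<psi> xs H"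
  "homot \<psi> xs (\<lambda>ys. - F ys) = - homot \<psi> xs F"
  "homot \<psi> xs (\<lambda>ys. smul c (F ys)) = smul c (homot \<psi> xs F)"
  "homot \<psi> xs (\<lambda>ys. y \<cdot> F ys) = y \<cdot> homot \<psi> xs F"
proof (induction xs arbitrary: F H)
  case (Cons x xs)
  { case 1 show ?case by (simp add: Phi_add Cons(1)[of "\<lambda>ys. F (x # ys)"] del: Phi.simps) }
  { case 2 show ?case by (simp add: Phi_diff Cons(2)[of "\<lambda>ys. F (x # ys)"] del: Phi.simps) }
  { case 3 show ?case by (simp add: Phi_uminus Cons(3)[of "\<lambda>ys. F (x # ys)"] del: Phi.simps) }
  { case 4 show ?case by (simp add: Phi_smul Cons(4)[of "\<lambda>ys. F (x # ys)"] smul_diff_right del: Phi.simps) }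
  { case 5 show ?case by (simp add: Phi_lmult Cons(5)[of "\<lambda>ys. F (x # ys)"] mult_simps del: Phi.simps) }
qed (simp_all add: Phi_add Phi_diff Phi_uminus Phi_smul Phi_lmult del: Phi.simps)

lemma homot_cong:
  assumes \<psi>: "is_comparison G N \<psi>" and "set xs \<subseteq> carr"
    and "\<And>ys. set ys \<subseteq> carr \<Longrightarrow> length ys = Suc (length xs) \<Longrightarrow> F ys = H ys"
  shows "homot \<psi> xs F = homot \<psi> xs H"
  using assms(2,3)
proof (induction xs arbitrary: F H)
  case Nil
  then show ?case using is_comparisonD(2)[OF \<psi>, of "[]"] by (auto intro!: Phi_cong simp del: Phi.simps)
next
  case (Cons x xs)
  have "Phi (Suc (length xs)) F (\<psi> (x # xs)) = Phi (Suc (length xs)) H (\<psi> (x # xs))"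
    using Cons.prems is_comparisonD(2)[OF \<psi>, of "x # xs"] by (intro Phi_cong) auto
  moreover have "homot \<psi> xs (\<lambda>ys. F (x # ys)) = homot \<psi> xs (\<lambda>ys. H (x # ys))"
    using Cons.prems by (intro Cons.IH) auto
  ultimately show ?case by (simp del: Phi.simps)
qed

lemma multilinear_Phi:
  assumes "multilinear_on carr \<psi>"
  shows "multilinear_on carr (\<lambda>xs. Phi (length xs) H (\<psi> xs))"
  unfolding multilinear_on_def
proof (intro allI impI conjI ballI)
  fix xs ys :: "('v,'e,'a) alg list" and x y :: "('v,'e,'a) alg" and c :: 'a
  assume *: "set xs \<subseteq> carr" "set ys \<subseteq> carr" "x \<in> carr"
  show "Phi (length (xs @ smul c x # ys)) H (\<psi> (xs @ smul c x # ys)) = smul c (Phi (length (xs @ x # ys)) H (\<psi> (xs @ x # ys)))"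
    using multilinear_onD(2)[OF assms *] by (simp add: linmap_smul[OF linmap_Phi[OF linmap_id]])
  show "y \<in> carr \<Longrightarrow> Phi (length (xs @ (x + y) # ys)) H (\<psi> (xs @ (x + y) # ys))
    = Phi (length (xs @ x # ys)) H (\<psi> (xs @ x # ys)) + Phi (length (xs @ y # ys)) H (\<psi> (xs @ y # ys))"
    using multilinear_onD(1)[OF assms *] by (simp add: linmap_add[OF linmap_Phi[OF linmap_id]])
qed

lemma multilinear_homot:
  fixes H :: "('v,'e,'k::comm_ring_1) cochain"
  assumes \<psi>: "is_comparison G N \<psi>" and "multilinear_on carr H"
  shows "multilinear_on carr (\<lambda>xs. homot \<psi> xs H)"
proof -
  define P where "P K \<longleftrightarrow> (\<exists>M H. multilinear_on carr M \<and> multilinear_on carr H \<and>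
    K = (\<lambda>xs. M xs + homot \<psi> xs H))" for K :: "('v,'e,'k) cochain"
  have Psi: "multilinear_on carr (\<lambda>xs. Phi (length xs) H (\<psi> xs))" for H
    by (rule multilinear_Phi[OF is_comparisonD(1)[OF \<psi>]])
  have hom: "homot \<psi> (x # xs) H = Phi (length (x # xs)) H (\<psi> (x # xs)) + homot \<psi> xs (\<lambda>ys. - H (x # ys))" for x xs H
    by (simp add: homot_lin del: Phi.simps)
  show ?thesis
  proof (rule multilinear_onI[where P = P])
    show "P (\<lambda>xs. homot \<psi> xs H)"
      unfolding P_def using assms by (intro exI[of _ "\<lambda>_. 0"] exI[of _ H]) (simp add: multilinear_on_zero)
  next
    fix K and x :: "('v,'e,'k) alg" assume "P K" and x: "x \<in> carr"
    then obtain M H where *: "multilinear_on carr M" "multilinear_on carr H"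
      and K: "K = (\<lambda>xs. M xs + homot \<psi> xs H)" unfolding P_def by blast
    have "multilinear_on carr (\<lambda>xs. M (x # xs) + Phi (length (x # xs)) H (\<psi> (x # xs)))"
      by (rule multilinear_on_add[OF multilinear_on_shift[OF *(1) x] multilinear_on_shift[OF Psi x]])
    moreover have "multilinear_on carr (\<lambda>xs. - H (x # xs))"
      by (rule multilinear_on_linmap[OF linmap_uminus[OF linmap_id] multilinear_on_shift[OF *(2) x]])
    moreover have "(\<lambda>xs. K (x # xs)) = (\<lambda>xs. (M (x # xs) + Phi (length (x # xs)) H (\<psi> (x # xs)))
        + homot \<psi> xs (\<lambda>xs. - H (x # xs)))"
      unfolding K hom by (simp add: add.assoc)
    ultimately show "P (\<lambda>xs. K (x # xs))" unfolding P_def by blast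
  next
    fix K and x y :: "('v,'e,'k) alg" and xs :: "('v,'e,'k) alg list" and c :: 'k
    assume "P K" and x: "x \<in> carr" and xs: "set xs \<subseteq> carr"
    then obtain M H where *: "multilinear_on carr M" "multilinear_on carr H"
      and K: "K = (\<lambda>xs. M xs + homot \<psi> xs H)" unfolding P_def by blast
    have "homot \<psi> xs (\<lambda>ys. H (smul c x # ys)) = homot \<psi> xs (\<lambda>ys. smul c (H (x # ys)))"
      using multilinear_on_hd(2)[OF *(2)] x xs by (intro homot_cong[OF \<psi>]) auto
    then show "K (smul c x # xs) = smul c (K (x # xs))"
      using multilinear_on_hd(2)[OF *(1) xs x] multilinear_on_hd(2)[OF Psi xs x]
      by (simp add: K homot_lin smul_add_right smul_diff_right del: Phi.simps)
    show "K ((x + y) # xs) = K (x # xs) + K (y # xs)" if y: "y \<in> carr"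
    proof -
      have "homot \<psi> xs (\<lambda>ys. H ((x + y) # ys)) = homot \<psi> xs (\<lambda>ys. H (x # ys) + H (y # ys))"
        using multilinear_on_hd(1)[OF *(2)] x y xs by (intro homot_cong[OF \<psi>]) auto
      then show ?thesis
        using multilinear_on_hd(1)[OF *(1) xs x y] multilinear_on_hd(1)[OF Psi xs x y]
        by (simp add: K homot_lin del: Phi.simps)
    qed
  qed
qed

lemma homot_carr:
  assumes \<psi>: "is_comparison G N \<psi>" and "set xs \<subseteq> carr" "\<And>ys. set ys \<subseteq> carr \<Longrightarrow> H ys \<in> carr"
  shows "homot \<psi> xs H \<in> carr"
  using assms(2,3)
proof (induction xs arbitrary: H)
  case Nil
  then show ?case using is_comparisonD(2)[OF \<psi>, of "[]"] by (auto intro!: Phi_carr simp del: Phi.simps)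
next
  case (Cons x xs)
  have "Phi (Suc (length xs)) H (\<psi> (x # xs)) \<in> carr"
    using Cons.prems is_comparisonD(2)[OF \<psi>, of "x # xs"] by (intro Phi_carr) auto
  moreover have "homot \<psi> xs (\<lambda>ys. H (x # ys)) \<in> carr"
    using Cons.prems by (intro Cons.IH) auto
  ultimately show ?case by (simp del: Phi.simps)
qed

text \<open>
  Combines the chain map property of \<open>Phi\<close> with that of \<open>\<psi>\<close>, where the
  first face of the bar differential becomes a change of the left coefficient.
\<close>

lemma Phi_comparison:
  assumes \<psi>: "is_comparison G N \<psi>" and H: "multilinear_on carr H" and xs: "set (x # xs) \<subseteq> carr"
  shows "Phi (Suc (length xs)) (bar_tail mul H) (\<psi> (x # xs))
    = Phi (length xs) (merge_hd x H) (\<psi> xs) - bar_tail mul (\<lambda>ys. Phi (length ys) H (\<psi> ys)) (x # xs)"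
proof -
  let ?n = "length xs"
  have c: "\<psi> (x # xs) \<in> P_carrier G N (Suc ?n)" "\<psi> xs \<in> P_carrier G N ?n"
    using is_comparisonD(2)[OF \<psi>, of "x # xs"] is_comparisonD(2)[OF \<psi>, of xs] xs by auto
  have "Phi (Suc ?n) (bar_tail mul H) (\<psi> (x # xs)) = Phi ?n H (P_diff G N (Suc ?n) (\<psi> (x # xs)))"
    by (rule Phi_chain[OF H c(1)])
  also have "\<dots> = Phi ?n H (P_lact G N x (\<psi> xs)) - Phi ?n H (bar_tail (P_ract G N) \<psi> (x # xs))"
    using is_comparisonD(4)[OF \<psi> xs] by (simp add: linmap_diff[OF linmap_Phi[OF linmap_id]])
  also have "Phi ?n H (P_lact G N x (\<psi> xs)) = Phi ?n (\<lambda>ys. H (x \<cdot> hd ys # tl ys)) (\<psi> xs)"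
    using xs by (intro Phi_lact[OF H _ c(2)]) auto
  also have "\<dots> = Phi ?n (merge_hd x H) (\<psi> xs)"
  proof (rule Phi_cong[OF c(2)])
    fix ys :: "('v,'e,'a) alg list" assume "length ys = Suc ?n"
    then show "H (x \<cdot> hd ys # tl ys) = merge_hd x H ys" by (cases ys) auto
  qed
  also have "Phi ?n H (bar_tail (P_ract G N) \<psi> (x # xs)) = bar_tail mul (\<lambda>ys. Phi ?n H (\<psi> ys)) (x # xs)"
  proof (rule bar_tail_linmap_on[symmetric])
    fix w :: "('v,'e,'a) alg" and ys :: "('v,'e,'a) alg list"
    assume "w \<in> carr" "set ys \<subseteq> carr" "Suc (length ys) = length (x # xs)"
    then show "Phi ?n H (P_ract G N (\<psi> ys) w) = Phi ?n H (\<psi> ys) \<cdot> w"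
      using is_comparisonD(2)[OF \<psi>, of ys] by (intro Phi_ract) auto
  qed (use xs in \<open>auto intro: lin_intro\<close>)
  also have "\<dots> = bar_tail mul (\<lambda>ys. Phi (length ys) H (\<psi> ys)) (x # xs)"
    using xs by (rule bar_tail_cong) simp
  finally show ?thesis .
qed

text \<open>
  The induction hypothesis is used for \<open>H\<close> with its first argument fixed; the terms with \<open>Phi\<close> that
  arise in the recursion cancel by the chain map property.
\<close>

lemma homot_homotopy:
  assumes \<psi>: "is_comparison G N \<psi>"
  shows "multilinear_on carr H \<Longrightarrow> (\<And>ys. set ys \<subseteq> carr \<Longrightarrow> H ys \<in> carr) \<Longrightarrow> set xs \<subseteq> carr \<Longrightarrow>
    homot \<psi> xs (bar_tail mul H) + bar_tail mul (\<lambda>ys. homot \<psi> ys H) xs = H xs"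
proof (induction xs arbitrary: H)
  case Nil
  have "\<psi> [] \<in> P_carrier G N 0" using is_comparisonD(2)[OF \<psi>, of "[]"] by simp
  then have "Phi 0 (bar_tail mul H) (\<psi> []) = H [] \<cdot> A_one G"
    by (simp add: Phi_0_bar_tail is_comparisonD(3)[OF \<psi>] del: Phi.simps)
  then show ?case using Nil(2)[of "[]"] by (simp del: Phi.simps)
next
  case (Cons x xs)
  let ?Psi = "\<lambda>H ys. Phi (length ys) H (\<psi> ys)"
  let ?Hx = "\<lambda>ys. H (x # ys)"
  have x: "x \<in> carr" using Cons.prems by auto
  \<comment> \<open>the terms in which \<open>x\<close> is merged with the following entry; they occur twice and cancel\<close>
  define R where "R = (case xs of [] \<Rightarrow> 0 | y # ys \<Rightarrow> homot \<psi> ys (\<lambda>zs. H (x \<cdot> y # zs)))"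
  have 1: "homot \<psi> (x # xs) (bar_tail mul H)
    = ?Psi (merge_hd x H) xs - bar_tail mul (?Psi H) (x # xs) - homot \<psi> xs (merge_hd x H) + homot \<psi> xs (bar_tail mul ?Hx)"
  proof -
    have "homot \<psi> xs (\<lambda>ys. bar_tail mul H (x # ys)) = homot \<psi> xs (merge_hd x H) - homot \<psi> xs (bar_tail mul ?Hx)"
      unfolding bar_tail_Cons by (rule homot_lin)
    then show ?thesis
      using Phi_comparison[OF \<psi> Cons.prems(1,3)] by (simp del: Phi.simps)
  qed
  have 2: "homot \<psi> xs (merge_hd x H) = ?Psi (merge_hd x H) xs - R"
    unfolding R_def by (cases xs) (simp_all del: Phi.simps)
  have 3: "bar_tail mul (\<lambda>ys. homot \<psi> ys H) (x # xs)
    = bar_tail mul (?Psi H) (x # xs) - R + bar_tail mul (\<lambda>ys. homot \<psi> ys ?Hx) xs"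
  proof -
    have "merge_hd x (\<lambda>ys. homot \<psi> ys H) xs = merge_hd x (?Psi H) xs - R"
      unfolding R_def by (cases xs) (simp_all del: Phi.simps)
    moreover have "bar_tail mul (\<lambda>ys. homot \<psi> (x # ys) H) xs
      = bar_tail mul (\<lambda>ys. ?Psi H (x # ys)) xs - bar_tail mul (\<lambda>ys. homot \<psi> ys ?Hx) xs"
      by (simp add: bar_tail_diff del: Phi.simps)
    ultimately show ?thesis unfolding bar_tail_Cons by simp
  qed
  have "homot \<psi> xs (bar_tail mul ?Hx) + bar_tail mul (\<lambda>ys. homot \<psi> ys ?Hx) xs = ?Hx xs"
    using Cons.prems x by (intro Cons.IH multilinear_on_shift) auto
  then show ?case unfolding 1 2 3 by (simp add: algebra_simps)
qed

text \<open>
  For a cocycle \<open>F\<close> the functions \<open>bar_tail mul F\<close> and \<open>ext_left F\<close> agree, so that the homotopy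
  identity expresses \<open>F\<close> by its pullback up to a coboundary.
\<close>

lemma cocycle_formula:
  assumes \<psi>: "is_comparison G N \<psi>" and F: "F \<in> hoch_cochains G N"
    and cocycle: "\<And>ys. set ys \<subseteq> carr \<Longrightarrow> cobd F ys = 0" and xs: "set xs \<subseteq> carr"
  shows "F xs = Pstar_hom G N (pull (length xs) F) (\<psi> xs) - cobd (\<lambda>ys. homot \<psi> ys F) xs"
proof -
  note F' = hoch_cochainsD(1,2)[OF F]
  have "homot \<psi> xs (bar_tail mul F) = homot \<psi> xs (ext_left F)"
  proof (rule homot_cong[OF \<psi> xs])
    fix ys :: "('v,'e,'a) alg list" assume "set ys \<subseteq> carr" "length ys = Suc (length xs)"
    then show "bar_tail mul F ys = ext_left F ys" using cocycle[of ys] by (cases ys) (auto simp: cobd_Cons)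
  qed
  then have "F xs = homot \<psi> xs (ext_left F) + bar_tail mul (\<lambda>ys. homot \<psi> ys F) xs"
    using homot_homotopy[OF \<psi> F' xs] by simp
  moreover have "Pstar_hom G N (pull (length xs) F) (\<psi> xs) = Phi (length xs) (ext_left F) (\<psi> xs)"
    using xs by (intro Pstar_hom_pull F' is_comparisonD(2)[OF \<psi>])
  moreover have "homot \<psi> xs (ext_left F) = Phi (length xs) (ext_left F) (\<psi> xs)
      - (case xs of [] \<Rightarrow> 0 | y # ys \<Rightarrow> y \<cdot> homot \<psi> ys F)"
    by (cases xs) (simp_all add: homot_lin del: Phi.simps)
  ultimately show ?thesis by (cases xs) (simp_all add: cobd_Cons del: Phi.simps homot.simps)
qed

subsection \<open>Cohomology classes\<close>

lemma HH_class_eqI: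
  assumes "cocycle F" "cocycle F'" "K \<in> hoch_cochains G N"
    and eq: "\<And>xs. set xs \<subseteq> carr \<Longrightarrow> F xs = F' xs + cobd K xs"
  shows "HH_class G N F = HH_class G N F'"
proof -
  interpret ideal "hoch_coboundaries G N" "hoch_cocycle_ring G N :: ('v,'e,'a) cochain ring"
    by (rule coboundaries_ideal)
  have c: "F \<in> hoch_cochains G N" "F' \<in> hoch_cochains G N"
    using assms(1,2) by (auto simp: cocycle_iff)
  have "F = hoch_diff G N K \<oplus>\<^bsub>hoch_cocycle_ring G N\<^esub> F'"
    using cochain_add[OF hoch_diff_cochain[OF assms(3)] c(2)]
    by (auto intro!: hoch_cochains_eqI[OF c(1)] simp: hoch_diff_eq[abs_def] eq)
  then have "F \<in> hoch_coboundaries G N +>\<^bsub>hoch_cocycle_ring G N\<^esub> F'"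
    using assms(3) unfolding a_r_coset_def' hoch_coboundaries_def by auto
  then show ?thesis
    unfolding HH_class_def using a_repr_independence[OF _ assms(2) a_subgroup] by simp
qed

lemma HH_zero: "\<zero>\<^bsub>HH G N\<^esub> = hoch_coboundaries G N"
  by (simp add: HH_def FactRing_def)

lemma HH_class_zero_iff:
  assumes "cocycle F"
  shows "HH_class G N F = \<zero>\<^bsub>HH G N\<^esub> \<longleftrightarrow> F \<in> hoch_coboundaries G N"
proof -
  interpret ideal "hoch_coboundaries G N" "hoch_cocycle_ring G N :: ('v,'e,'a) cochain ring"
    by (rule coboundaries_ideal)
  show ?thesis unfolding HH_zero HH_class_def
    using a_rcos_self[OF assms] a_rcos_const by metis
qed

lemma HH_class_cup:
  assumes "cocycle F" "cocycle F'"
  shows "HH_class G N F \<otimes>\<^bsub>HH G N\<^esub> HH_class G N F' = HH_class G N (cup G N F F')"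
proof -
  interpret ideal "hoch_coboundaries G N" "hoch_cocycle_ring G N :: ('v,'e,'a) cochain ring"
    by (rule coboundaries_ideal)
  show ?thesis using rcoset_mult_add[OF assms] by (simp add: HH_def FactRing_def HH_class_def)
qed

lemma homogeneous_cochain: "F \<in> hoch_homogeneous G N n \<Longrightarrow> F \<in> hoch_cochains G N"
  by (simp add: hoch_homogeneous_def)

definition comp_cochain :: "(('v,'e,'k::comm_ring_1) alg list \<Rightarrow> ('v,'e,'k) res) \<Rightarrow> nat \<Rightarrow>
    ('v,'e,'k) pstar \<Rightarrow> ('v,'e,'k) cochain" where
  "comp_cochain \<psi> n f xs = (if set xs \<subseteq> carr \<and> length xs = n then Pstar_hom G N f (\<psi> xs) else 0)"

lemma comparison_class_eq: "comparison_class G N \<psi> n f = HH_class G N (comp_cochain \<psi> n f)"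
  by (simp add: comparison_class_def comp_cochain_def[abs_def])

lemma comp_cochain_homogeneous:
  assumes \<psi>: "is_comparison G N \<psi>" and f: "f \<in> Pstar G N n"
  shows "comp_cochain \<psi> n f \<in> hoch_homogeneous G N n"
  unfolding comp_cochain_def[abs_def]
proof (rule restrict_degree_cochain)
  show "multilinear_on carr (\<lambda>xs. Pstar_hom G N f (\<psi> xs))"
    by (rule multilinear_on_linmap[OF linmap_Pstar_hom[OF linmap_id] is_comparisonD(1)[OF \<psi>]])
  show "Pstar_hom G N f (\<psi> xs) \<in> carr" if "set xs \<subseteq> carr" "length xs = n" for xs
    using is_comparisonD(2)[OF \<psi> that(1)] that f by (auto intro: Pstar_hom_carr)
qed

lemma cobd_degree:
  assumes "set xs \<subseteq> carr" "length xs \<noteq> Suc n" "\<And>ys. length ys \<noteq> n \<Longrightarrow> F ys = 0"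
  shows "cobd F xs = 0"
proof -
  have "cobd F xs = cobd (\<lambda>_. 0) xs" using assms by (intro cobd_cong) auto
  also have "\<dots> = 0" using cobd_smul[of 0 "\<lambda>_. 0" xs] by simp
  finally show ?thesis .
qed

lemma comp_cochain_diff:
  assumes \<psi>: "is_comparison G N \<psi>" and f: "f \<in> Pstar G N n"
  shows "hoch_diff G N (comp_cochain \<psi> n f) = comp_cochain \<psi> (Suc n) (Pstar_diff G N n f)"
proof (rule hoch_cochains_eqI)
  show "hoch_diff G N (comp_cochain \<psi> n f) \<in> hoch_cochains G N"
    by (intro hoch_diff_cochain homogeneous_cochain[OF comp_cochain_homogeneous[OF assms]])
  show "comp_cochain \<psi> (Suc n) (Pstar_diff G N n f) \<in> hoch_cochains G N"
    by (rule homogeneous_cochain[OF comp_cochain_homogeneous[OF \<psi> Pstar_diff_Pstar[OF f]]])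
  fix xs :: "('v,'e,'a) alg list" assume xs: "set xs \<subseteq> carr"
  show "hoch_diff G N (comp_cochain \<psi> n f) xs = comp_cochain \<psi> (Suc n) (Pstar_diff G N n f) xs"
  proof (cases "length xs = Suc n")
    case True
    then obtain x ys where xs': "xs = x # ys" by (cases xs) auto
    then have n: "length ys = n" using True by simp
    have "cobd (comp_cochain \<psi> n f) xs = cobd (\<lambda>ys. Pstar_hom G N f (\<psi> ys)) xs"
      using xs by (rule cobd_cong) (use True in \<open>simp add: comp_cochain_def\<close>)
    also have "\<dots> = x \<cdot> Pstar_hom G N f (\<psi> ys) - Pstar_hom G N f (bar_tail (P_ract G N) \<psi> xs)"
    proof -
      have "bar_tail mul (\<lambda>ys. Pstar_hom G N f (\<psi> ys)) xs = Pstar_hom G N f (bar_tail (P_ract G N) \<psi> xs)"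
      proof (rule bar_tail_linmap_on)
        fix w :: "('v,'e,'a) alg" and zs :: "('v,'e,'a) alg list"
        assume "w \<in> carr" "set zs \<subseteq> carr"
        then show "Pstar_hom G N f (P_ract G N (\<psi> zs) w) = Pstar_hom G N f (\<psi> zs) \<cdot> w"
          using is_comparisonD(2)[OF \<psi>, of zs] by (intro Pstar_hom_ract)
      qed (use xs in \<open>auto intro: lin_intro\<close>)
      then show ?thesis by (simp add: xs' cobd_Cons)
    qed
    also have "x \<cdot> Pstar_hom G N f (\<psi> ys) = Pstar_hom G N f (P_lact G N x (\<psi> ys))"
      using is_comparisonD(2)[OF \<psi>, of ys] xs xs' by (intro Pstar_hom_lact[symmetric]) auto
    also have "\<dots> - Pstar_hom G N f (bar_tail (P_ract G N) \<psi> xs)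
      = Pstar_hom G N f (P_diff G N (Suc n) (\<psi> xs))"
      using is_comparisonD(4)[OF \<psi>, of x ys] xs xs' n
      by (simp add: linmap_diff[OF linmap_Pstar_hom[OF linmap_id]])
    also have "\<dots> = Pstar_hom G N (Pstar_diff G N n f) (\<psi> xs)"
      using is_comparisonD(2)[OF \<psi>, of xs] xs True by (intro Pstar_hom_diff[symmetric] f) auto
    finally show ?thesis using xs True by (simp add: hoch_diff_eq comp_cochain_def[of _ _ _ xs])
  next
    case False
    then have "cobd (comp_cochain \<psi> n f) xs = 0"
      using xs by (intro cobd_degree[of _ n]) (auto simp: comp_cochain_def)
    then show ?thesis using False by (simp add: hoch_diff_eq comp_cochain_def)
  qed
qed

lemma Pstar_cocyclesD: "f \<in> Pstar_cocycles G N n \<Longrightarrow> f \<in> Pstar G N n"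
  by (simp add: Pstar_cocycles_def)

lemma comp_cochain_zero: "comp_cochain \<psi> n 0 = (\<lambda>_. 0)"
  by (auto simp: comp_cochain_def Pstar_hom_def lin_ext_def Pstar_eval_def intro!: ext sum.neutral)

lemma comp_cochain_cocycle:
  assumes \<psi>: "is_comparison G N \<psi>" and f: "f \<in> Pstar_cocycles G N n"
  shows "cocycle (comp_cochain \<psi> n f)"
proof -
  have "hoch_diff G N (comp_cochain \<psi> n f) = (\<lambda>_. 0)"
    using f comp_cochain_diff[OF \<psi> Pstar_cocyclesD[OF f]] by (simp add: Pstar_cocycles_def comp_cochain_zero)
  then show ?thesis
    using comp_cochain_homogeneous[OF \<psi> Pstar_cocyclesD[OF f]]
    by (simp add: hoch_cocycle_ring_def homogeneous_cochain)
qed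

lemma pull_zero: "pull n (\<lambda>_. 0) = 0"
proof (rule Pstar_eqI)
  have "ext_left (\<lambda>_. 0) = (\<lambda>_. 0 :: ('v,'e,'a) alg)" by (simp add: ext_left_def fun_eq_iff)
  then show "Pstar_eval (pull n (\<lambda>_. 0)) p = Pstar_eval (0 :: ('v,'e,'a) pstar) p" for p
    by (simp add: Pstar_eval_pull Phi_zero) (simp add: Pstar_eval_def)
qed

lemma cobd_uminus: "cobd (\<lambda>ys. - F ys) xs = - cobd F xs"
  using cobd_smul[of "- 1" F xs] by (simp add: smul_minus_one)

lemma pull_cocycle:
  assumes "cocycle F"
  shows "pull n F \<in> Pstar_cocycles G N n"
proof -
  have F: "F \<in> hoch_cochains G N" and d: "hoch_diff G N F = (\<lambda>_. 0)"
    using assms by (auto simp: hoch_cocycle_ring_def)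
  show ?thesis
    using pull_Pstar[OF hoch_cochainsD(1,2)[OF F]] pull_chain[OF F] d by (simp add: Pstar_cocycles_def pull_zero)
qed

text \<open>
  By \<open>cocycle_formula\<close> the two cochains differ by the coboundary of a homotopy, which has to be cut
  down to lists over the algebra of one fixed length in order to be a cochain.
\<close>

lemma HH_class_pull:
  assumes \<psi>: "is_comparison G N \<psi>" and F: "cocycle F" "F \<in> hoch_homogeneous G N n"
  shows "HH_class G N F = comparison_class G N \<psi> n (pull n F)"
proof -
  have Fc: "F \<in> hoch_cochains G N" and F0: "\<And>xs. set xs \<subseteq> carr \<Longrightarrow> cobd F xs = 0"
    using F(1) by (auto simp: cocycle_iff)
  note Fm = hoch_cochainsD(1,2)[OF Fc]
  define K where "K xs = (if set xs \<subseteq> carr \<and> Suc (length xs) = n then - homot \<psi> xs F else 0)" for xs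
  have K: "K \<in> hoch_cochains G N"
  proof (cases n)
    case 0
    then show ?thesis using zero_cochain by (simp add: K_def[abs_def])
  next
    case (Suc m)
    have "multilinear_on carr (\<lambda>xs. - homot \<psi> xs F)"
      by (rule multilinear_on_linmap[OF linmap_uminus[OF linmap_id] multilinear_homot[OF \<psi> Fm(1)]])
    from restrict_degree_cochain[OF this, of m] homot_carr[OF \<psi> _ Fm(2)]
    show ?thesis by (simp add: K_def[abs_def] Suc homogeneous_cochain)
  qed
  show ?thesis
    unfolding comparison_class_eq
  proof (rule HH_class_eqI[OF F(1) comp_cochain_cocycle[OF \<psi> pull_cocycle[OF F(1)]] K])
    fix xs :: "('v,'e,'a) alg list" assume xs: "set xs \<subseteq> carr"
    show "F xs = comp_cochain \<psi> n (pull n F) xs + cobd K xs"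
    proof (cases "length xs = n")
      case True
      have "cobd K xs = cobd (\<lambda>ys. - homot \<psi> ys F) xs"
        using xs by (rule cobd_cong) (use True in \<open>simp add: K_def\<close>)
      then have "cobd K xs = - cobd (\<lambda>ys. homot \<psi> ys F) xs"
        by (simp only: cobd_uminus)
      then show ?thesis
        using cocycle_formula[OF \<psi> Fc F0 xs] xs True by (simp add: comp_cochain_def)
    next
      case False
      have "cobd K xs = 0"
      proof (cases n)
        case 0
        then have "K = (\<lambda>_. smul 0 0)" by (simp add: K_def[abs_def])
        then show ?thesis using cobd_smul[of 0 "\<lambda>_. 0" xs] by simp
      next
        case (Suc m)
        then show ?thesis using xs False by (intro cobd_degree[of _ m]) (auto simp: K_def)
      qed
      then show ?thesis using False F(2) by (simp add: comp_cochain_def hoch_homogeneous_def)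
    qed
  qed
qed

section \<open>The product on parallel paths\<close>

primrec pieces :: "nat list \<Rightarrow> ('v,'e) path \<Rightarrow> ('v,'e) path list" where
  "pieces [] p = []"
| "pieces (l # ls) p = pseg G 0 l p # pieces ls (pdrop G l p)"

lemma pieces_append: "pieces (ls @ ks) p = pieces ls p @ pieces ks (pdrop G (sum_list ls) p)"
  by (induction ls arbitrary: p) (simp_all add: pdrop_pdrop)

lemma length_pieces [simp]: "length (pieces ls p) = length ls"
  by (induction ls arbitrary: p) simp_all

lemma plen_pieces: "sum_list ls \<le> plen p \<Longrightarrow> map plen (pieces ls p) = ls"
  by (induction ls arbitrary: p) (auto simp: min_absorb2)

lemma pieces_short:
  "p \<in> paths G n \<Longrightarrow> sum_list ls \<le> n \<Longrightarrow> \<forall>l\<in>set ls. l < N \<Longrightarrow> set (pieces ls p) \<subseteq> short_paths G N"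
proof (induction ls arbitrary: p n)
  case (Cons l ls)
  from Cons.IH[OF pdrop_in_paths[OF Cons.prems(1)], of l] Cons.prems show ?case
    by (auto intro: short_pathsI[OF pseg_in_paths'])
qed simp

lemma pieces_pseg: "sum_list ls \<le> s \<Longrightarrow> pieces ls (pseg G 0 s p) = pieces ls p"
proof (induction ls arbitrary: p s)
  case (Cons l ls)
  have "pdrop G l (pseg G 0 s p) = pseg G 0 (s - l) (pdrop G l p)"
    using Cons.prems by (simp add: pdrop_pseg pseg_pdrop)
  with Cons show ?case by (simp add: pseg_pseg)
qed simp

text \<open>
  Three conditions on the lengths of consecutive pairs of arguments. The terms of the pullback have
  lengths of the form \<open>alt\<close>; \<open>paired\<close> is the weaker condition under which \<open>canon\<close> can be computed
  pair by pair; and \<open>full\<close> says that all pairs have the maximal total length \<open>N\<close>, without which \<open>canon\<close> vanishes.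
\<close>

fun alt :: "nat list \<Rightarrow> bool" where
  "alt [] \<longleftrightarrow> True"
| "alt [x] \<longleftrightarrow> False"
| "alt (j # l # ls) \<longleftrightarrow> 1 \<le> j \<and> j < N \<and> l = 1 \<and> alt ls"

fun paired :: "nat list \<Rightarrow> bool" where
  "paired [] \<longleftrightarrow> True"
| "paired [x] \<longleftrightarrow> False"
| "paired (j # l # ls) \<longleftrightarrow> 1 \<le> j \<and> 1 \<le> l \<and> j + l \<le> N \<and> paired ls"

fun full :: "nat list \<Rightarrow> bool" where
  "full [] \<longleftrightarrow> True"
| "full [x] \<longleftrightarrow> False"
| "full (j # l # ls) \<longleftrightarrow> j + l = N \<and> full ls"

lemma alt_paired: "alt ls \<Longrightarrow> paired ls"
  by (induction ls rule: alt.induct) auto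

lemma paired_bound: "paired ls \<Longrightarrow> \<forall>l\<in>set ls. l < N"
  by (induction ls rule: paired.induct) auto

lemma sum_full: "full ls \<Longrightarrow> length ls = 2 * k \<Longrightarrow> sum_list ls = k * N"
proof (induction k arbitrary: ls)
  case (Suc k)
  then obtain x y zs where "ls = x # y # zs" by (metis length_Suc_conv mult_Suc_right add_2_eq_Suc)
  with Suc show ?case by (auto simp: add.assoc[symmetric])
qed simp

lemma carr_map_path: "set qs \<subseteq> short_paths G N \<Longrightarrow> set (map path qs) \<subseteq> carr"
  by (auto intro: path_in_carr)

text \<open>
  Two contractions prolong the middle segment by \<open>N\<close>: the even one sums over the marks left of
  position \<open>|w|\<close>, of which, after multiplication by \<open>x\<close>, the odd one keeps only the mark at \<open>N - 1\<close>. It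
  occurs among them only if \<open>|x| + |w| = N\<close>, by the bound on the lengths.
\<close>

lemma pair_step:
  fixes W :: "('v,'e,'k::comm_ring_1) res"
  assumes "P_lact G N (path w) W = pt (2 * k) \<rho> (plen w)" "plen \<rho> = k * N + plen w"
    "1 \<le> plen w" "1 \<le> plen x" "plen x + plen w \<le> N"
  shows "contr (Suc (2 * k)) (P_lact G N (path x) (contr (2 * k) (P_lact G N (path w) W)))
    = (if ptgt G x = psrc \<rho> \<and> plen x + plen w = N then pt (Suc (Suc (2 * k))) (pcat x \<rho>) 0 else 0)"
proof -
  have "contr (2 * k) (P_lact G N (path w) W) = (\<Sum>j<plen w. pt (Suc (2 * k)) \<rho> j)"
    unfolding assms(1) using assms by (intro contr_even_pt) auto
  then have "contr (Suc (2 * k)) (P_lact G N (path x) (contr (2 * k) (P_lact G N (path w) W)))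
    = (\<Sum>j<plen w. contr (Suc (2 * k)) (P_lact G N (path x) (pt (Suc (2 * k)) \<rho> j)))"
    by (simp add: linmap_sum[OF linmap_contr[OF linmap_P_lact2[OF linmap_id]]])
  also have "\<dots> = (\<Sum>j<plen w. if j = N - 1 - plen x then
      if ptgt G x = psrc \<rho> then pt (Suc (Suc (2 * k))) (pcat x \<rho>) 0 else 0 else 0)"
  proof (rule sum.cong[OF refl])
    fix j assume "j \<in> {..<plen w}"
    then show "contr (Suc (2 * k)) (P_lact G N (path x) (pt (Suc (2 * k)) \<rho> j))
      = (if j = N - 1 - plen x then if ptgt G x = psrc \<rho> then pt (Suc (Suc (2 * k))) (pcat x \<rho>) 0 else 0 else 0)"
      using assms(2-5) by (auto simp: P_lact_path_pt contr_odd_pt linmap_0[OF linmap_contr[OF linmap_id]])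
  qed
  also have "\<dots> = (if ptgt G x = psrc \<rho> \<and> plen x + plen w = N then pt (Suc (Suc (2 * k))) (pcat x \<rho>) 0 else 0)"
    using assms(3-5) by auto
  finally show ?thesis .
qed

lemma canon_Nil_lact:
  assumes "w \<in> short_paths G N"
  shows "P_lact G N (path w) (canon []) = pt 0 w (plen w)"
  using assms
  by (auto simp: P_lact_path_pt linmap_sum[OF linmap_P_lact2[OF linmap_id]] ptgt_in_verts
      cong: if_cong dest!: short_pathsD)

text \<open>
  The lengths in the lists may be full although consecutive paths do not compose, hence the disjunction.
\<close>

lemma canon_pairs:
  assumes "length qs = 2 * k" "paired (map plen qs)" "set qs \<subseteq> short_paths G N" "w \<in> short_paths G N"
  shows "P_lact G N (path w) (canon (map path qs)) = (0 :: ('v,'e,'k::comm_ring_1) res) \<or>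
    full (map plen qs) \<and> (\<exists>\<rho>. plen \<rho> = k * N + plen w \<and>
      P_lact G N (path w) (canon (map path qs)) = (pt (2 * k) \<rho> (plen w) :: ('v,'e,'k) res))"
  using assms
proof (induction k arbitrary: qs w)
  case 0
  then have "P_lact G N (path w) (canon (map path qs)) = (pt (2 * 0) w (plen w) :: ('v,'e,'k) res)"
    by (simp add: canon_Nil_lact del: canon.simps(1))
  moreover have "full (map plen qs)" using 0 by simp
  moreover have "plen w = 0 * N + plen w" by simp
  ultimately show ?case by blast
next
  case (Suc k)
  then obtain x y zs where qs: "qs = x # y # zs" by (metis length_Suc_conv mult_Suc_right add_2_eq_Suc)
  let ?Z = "canon (map path zs) :: ('v,'e,'k) res"
  have l: "length zs = 2 * k" using Suc.prems qs by simp
  have c: "canon (map path qs) = contr (Suc (2 * k)) (P_lact G N (path x) (contr (2 * k) (P_lact G N (path y) ?Z)))"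
    by (simp add: qs l)
  have "P_lact G N (path y) ?Z = 0 \<or> full (map plen zs) \<and>
    (\<exists>\<rho>. plen \<rho> = k * N + plen y \<and> P_lact G N (path y) ?Z = pt (2 * k) \<rho> (plen y))"
    using Suc.prems qs l by (intro Suc.IH) auto
  then show ?case
  proof (elim disjE conjE exE)
    assume "P_lact G N (path y) ?Z = 0"
    then show ?thesis unfolding c
      by (simp add: linmap_0[OF linmap_contr[OF linmap_id]] linmap_0[OF linmap_P_lact2[OF linmap_id]])
  next
    fix \<rho> assume f: "full (map plen zs)" and \<rho>: "plen \<rho> = k * N + plen y"
      and Z: "P_lact G N (path y) ?Z = pt (2 * k) \<rho> (plen y)"
    have b: "1 \<le> plen y" "1 \<le> plen x" "plen x + plen y \<le> N" using Suc.prems qs by auto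
    note c' = pair_step[OF Z \<rho> b, folded c]
    show ?thesis
    proof (cases "ptgt G x = psrc \<rho> \<and> plen x + plen y = N \<and> ptgt G w = psrc x")
      case True
      then have "P_lact G N (path w) (canon (map path qs)) = (pt (2 * Suc k) (pcat w (pcat x \<rho>)) (plen w) :: ('v,'e,'k) res)"
        unfolding c' using \<rho> b by (simp add: P_lact_path_pt)
      moreover have "plen (pcat w (pcat x \<rho>)) = Suc k * N + plen w" using True \<rho> by simp
      moreover have "full (map plen qs)" using True f by (simp add: qs)
      ultimately show ?thesis by blast
    next
      case False
      then have "P_lact G N (path w) (canon (map path qs)) = (0 :: ('v,'e,'k) res)"
        unfolding c' using \<rho> b by (auto simp: P_lact_path_pt linmap_0[OF linmap_P_lact2[OF linmap_id]])
      then show ?thesis by blast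
    qed
  qed
qed

lemma canon_pairs_zero:
  assumes "length qs = 2 * k" "paired (map plen qs)" "set qs \<subseteq> short_paths G N" "\<not> full (map plen qs)"
  shows "canon (map path qs) = (0 :: ('v,'e,'k::comm_ring_1) res)"
proof (cases k)
  case 0
  with assms show ?thesis by simp
next
  case (Suc k')
  with assms(1) obtain x y zs where qs: "qs = x # y # zs"
    by (metis length_Suc_conv mult_Suc_right add_2_eq_Suc)
  let ?Z = "canon (map path zs) :: ('v,'e,'k) res"
  have l: "length zs = 2 * k'" using assms qs Suc by simp
  have c: "canon (map path qs) = contr (Suc (2 * k')) (P_lact G N (path x) (contr (2 * k') (P_lact G N (path y) ?Z)))"
    by (simp add: qs l)
  have "P_lact G N (path y) ?Z = 0 \<or> full (map plen zs) \<and>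
    (\<exists>\<rho>. plen \<rho> = k' * N + plen y \<and> P_lact G N (path y) ?Z = pt (2 * k') \<rho> (plen y))"
    using assms qs l by (intro canon_pairs) auto
  then show ?thesis
  proof (elim disjE conjE exE)
    assume "P_lact G N (path y) ?Z = 0"
    then show ?thesis unfolding c
      by (simp add: linmap_0[OF linmap_contr[OF linmap_id]] linmap_0[OF linmap_P_lact2[OF linmap_id]])
  next
    fix \<rho> assume f: "full (map plen zs)" and \<rho>: "plen \<rho> = k' * N + plen y"
      and Z: "P_lact G N (path y) ?Z = pt (2 * k') \<rho> (plen y)"
    have b: "1 \<le> plen y" "1 \<le> plen x" "plen x + plen y \<le> N" using assms qs by auto
    show ?thesis using pair_step[OF Z \<rho> b, folded c] f assms(4) qs by auto
  qed
qed

lemma canon_pieces: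
  assumes "length ls = 2 * k" "paired ls" "full ls" "\<rho> \<in> paths G (k * N)" "y \<in> short_paths G N" "ptgt G y = psrc \<rho>"
  shows "P_lact G N (path y) (canon (map path (pieces ls \<rho>))) = (pt (2 * k) (pcat y \<rho>) (plen y) :: ('v,'e,'k::comm_ring_1) res)"
  using assms
proof (induction k arbitrary: ls \<rho> y)
  case 0
  then have "\<rho> = (psrc \<rho>, [])" by (simp add: plen_paths flip: plen_0_iff)
  then have "pcat y \<rho> = y" by (metis pcat_nil)
  with 0 show ?case by (simp add: canon_Nil_lact del: canon.simps(1))
next
  case (Suc k)
  then obtain a b ls' where ls: "ls = a # b # ls'" by (metis length_Suc_conv mult_Suc_right add_2_eq_Suc)
  have ab: "a + b = N" "1 \<le> a" "1 \<le> b" using Suc.prems ls by auto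
  have p: "plen \<rho> = N + k * N" using Suc.prems(4) by (simp add: plen_paths)
  let ?x = "pseg G 0 a \<rho>" and ?w = "pseg G a b \<rho>" and ?r = "pdrop G N \<rho>"
  let ?Z = "canon (map path (pieces ls' ?r)) :: ('v,'e,'k) res"
  have l: "length ls' = 2 * k" using Suc.prems ls by simp
  have c: "canon (map path (pieces ls \<rho>)) = contr (Suc (2 * k)) (P_lact G N (path ?x) (contr (2 * k) (P_lact G N (path ?w) ?Z)))"
    using ab by (simp add: ls l pseg_pdrop pdrop_pdrop)
  have pw: "plen ?w = b" "plen ?x = a" using ab p by (simp_all add: min_absorb2)
  have w: "?w \<in> short_paths G N"
    using Suc.prems(4) ab by (intro short_pathsI[OF pseg_in_paths']) auto
  have "P_lact G N (path ?w) ?Z = pt (2 * k) (pcat ?w ?r) (plen ?w)"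
    using Suc.prems ls l w ab pdrop_in_paths[OF Suc.prems(4), of N] by (intro Suc.IH) auto
  also have "pcat ?w ?r = pdrop G a \<rho>" using pcat_pseg_pdrop[of G a b \<rho>] ab by simp
  finally have Z: "P_lact G N (path ?w) ?Z = pt (2 * k) (pdrop G a \<rho>) (plen ?w)" .
  have "canon (map path (pieces ls \<rho>)) = (pt (Suc (Suc (2 * k))) \<rho> 0 :: ('v,'e,'k) res)"
    unfolding c using ab p pw by (subst pair_step[OF Z]) auto
  then show ?case using Suc.prems p by (simp add: P_lact_path_pt)
qed

text \<open>
  The middle segments of odd degree are one arrow longer than \<open>k N\<close>; decompositions put this
  arrow at the front.
\<close>

definition good :: "nat \<Rightarrow> nat list \<Rightarrow> bool" where
  "good n L \<longleftrightarrow> length L = n \<and> (if even n then paired L else L \<noteq> [] \<and> hd L = 1 \<and> paired (tl L))"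

definition altn :: "nat \<Rightarrow> nat list \<Rightarrow> bool" where
  "altn n L \<longleftrightarrow> length L = n \<and> (if even n then alt L else L \<noteq> [] \<and> hd L = 1 \<and> alt (tl L))"

definition fulln :: "nat \<Rightarrow> nat list \<Rightarrow> bool" where
  "fulln n L \<longleftrightarrow> (if even n then full L else full (tl L))"

lemma altn_good: "altn n L \<Longrightarrow> good n L"
  by (auto simp: altn_def good_def alt_paired)

lemma good_bound: "good n L \<Longrightarrow> \<forall>l\<in>set L. l < N"
  using N2 paired_bound[of L] paired_bound[of "tl L"] by (cases L) (auto simp: good_def split: if_splits)

lemma sum_fulln:
  assumes "good n L" "fulln n L"
  shows "sum_list L = res_len N n"
proof (cases n rule: parity_cases)
  case (even k)
  with assms show ?thesis by (simp add: good_def fulln_def sum_full)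
next
  case (odd k)
  with assms show ?thesis by (cases L) (simp_all add: good_def fulln_def sum_full)
qed

lemma canon_good_zero:
  assumes "good n (map plen qs)" "\<not> fulln n (map plen qs)" "set qs \<subseteq> short_paths G N"
  shows "canon (map path qs) = 0"
proof (cases n rule: parity_cases)
  case (even k)
  with assms show ?thesis by (intro canon_pairs_zero[of _ k]) (auto simp: good_def fulln_def)
next
  case (odd k)
  then obtain x zs where "qs = x # zs" using assms by (cases qs) (auto simp: good_def)
  with odd assms show ?thesis
    by (simp add: canon_pairs_zero[of zs k] good_def fulln_def linmap_0[OF linmap_contr[OF linmap_P_lact2[OF linmap_id]]])
qed

text \<open>
  \<open>canon\<close> maps the pieces of a path to that path with the mark on all of it, up to terms that start at
  other vertices; multiplication by the source vertex removes those.
\<close>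

lemma Pstar_hom_canon_pieces:
  fixes f :: "('v,'e,'k::comm_ring_1) pstar"
  assumes L: "good n L" "fulln n L" and \<rho>: "\<rho> \<in> paths G (res_len N n)" and f: "f \<in> Pstar G N n"
  shows "idem (psrc \<rho>) \<cdot> Pstar_hom G N f (canon (map path (pieces L \<rho>))) = Pstar_eval f \<rho>"
proof (cases n rule: parity_cases)
  case (even k)
  let ?c = "canon (map path (pieces L \<rho>)) :: ('v,'e,'k) res"
  have "set (pieces L \<rho>) \<subseteq> short_paths G N"
    using \<rho> sum_fulln[OF L] good_bound[OF L(1)] by (intro pieces_short) auto
  from canon_carrier[OF carr_map_path[OF this]] have "?c \<in> P_carrier G N n"
    using L by (simp add: good_def)
  then have "idem (psrc \<rho>) \<cdot> Pstar_hom G N f ?c = Pstar_hom G N f (P_lact G N (idem (psrc \<rho>)) ?c)"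
    by (simp add: Pstar_hom_lact)
  also have "P_lact G N (idem (psrc \<rho>)) ?c = (pt n \<rho> 0 :: ('v,'e,'k) res)"
    using canon_pieces[of L k \<rho> "(psrc \<rho>, [])"] L \<rho> even
    by (simp add: good_def fulln_def vertex_short psrc_in_verts)
  finally show ?thesis using f \<rho> by (simp add: Pstar_hom_generator)
next
  case (odd k)
  then obtain ls where L': "L = 1 # ls" "paired ls" "full ls" "length ls = 2 * k"
    using L by (cases L) (auto simp: good_def fulln_def)
  have p: "plen \<rho> = Suc (k * N)" using \<rho> odd by (simp add: plen_paths)
  have x: "pseg G 0 1 \<rho> \<in> short_paths G N"
    using \<rho> odd N2 by (intro short_pathsI[OF pseg_in_paths']) auto
  have "pdrop G 1 \<rho> \<in> paths G (k * N)" using pdrop_in_paths[OF \<rho>, of 1] odd by simp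
  then have "P_lact G N (path (pseg G 0 1 \<rho>)) (canon (map path (pieces ls (pdrop G 1 \<rho>)))) = (pt (2 * k) \<rho> 1 :: ('v,'e,'k) res)"
    using L' x p by (subst canon_pieces[of _ k]) auto
  then have "canon (map path (pieces L \<rho>)) = (pt n \<rho> 0 :: ('v,'e,'k) res)"
    using L' N2 p odd by (simp add: contr_even_pt)
  then show ?thesis using f \<rho> by (simp add: Pstar_hom_generator Pstar_eval_parallel)
qed

lemma Phi_vertex:
  assumes "\<rho> \<in> paths G (plen \<rho>)" "res_len N n \<le> plen \<rho>"
    and "\<And>ys. set ys \<subseteq> carr \<Longrightarrow> H (idem (psrc \<rho>) # ys) = 0"
  shows "Phi n H (pt n \<rho> 0) = 0"
proof -
  have a: "pseg G 0 0 \<rho> = (psrc \<rho>, [])" by (simp add: psrc_def)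
  show ?thesis
  proof (cases n)
    case 0
    with assms a N2 show ?thesis by (simp add: Phi_0_pt del: pseg_0)
  next
    case (Suc m)
    have "P_diff G N n (pt n (pseg G 0 (res_len N n) \<rho>) 0) \<in> P_carrier G N m"
      unfolding Suc using assms(2) Suc
      by (intro P_diff_carrier pt_0_carrier) (simp add: pseg_in_paths'[OF assms(1)])
    then have "Phi m (\<lambda>xs. H (idem (psrc \<rho>) # xs)) (P_diff G N n (pt n (pseg G 0 (res_len N n) \<rho>) 0)) = Phi m (\<lambda>_. 0) (P_diff G N n (pt n (pseg G 0 (res_len N n) \<rho>) 0))"
      by (rule Phi_cong) (simp add: assms(3))
    with Suc assms a N2 show ?thesis by (simp add: Phi_Suc_pt Phi_zero del: pseg_0)
  qed
qed

text \<open>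
  The lengths of the only decomposition that contributes to the pullback.
\<close>

definition std :: "nat \<Rightarrow> nat list" where
  "std k = concat (replicate k [N - 1, 1])"

lemma std_simps [simp]: "std 0 = []" "std (Suc k) = (N - 1) # 1 # std k"
  by (simp_all add: std_def)

lemma std_props: "alt (std k)" "full (std k)" "length (std k) = 2 * k" "sum_list (std k) = k * N"
  using N2 by (induction k) auto

text \<open>
  Two steps of the recursion for \<open>Phi\<close> produce the lengths \<open>j, 1\<close> at the front, with \<open>j < N\<close>. The term
  with \<open>j = 0\<close> vanishes because it has a vertex as argument, the terms with \<open>0 < j < N - 1\<close> because their
  lengths are not full.
\<close>

lemma Phi_even:
  fixes H :: "('v,'e,'k::comm_ring_1) cochain"
  assumes "multilinear_on carr H"
    and "\<And>x ys v zs. x \<in> carr \<Longrightarrow> set ys \<subseteq> carr \<Longrightarrow> set zs \<subseteq> carr \<Longrightarrow> H (x # ys @ idem v # zs) = 0"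
    and "\<And>qs. set qs \<subseteq> short_paths G N \<Longrightarrow> length qs = 2 * k \<Longrightarrow> alt (map plen qs) \<Longrightarrow>
      \<not> full (map plen qs) \<Longrightarrow> H (path (pseg G 0 i \<rho>) # map path qs) = 0"
    and "\<rho> \<in> paths G (plen \<rho>)" "i + k * N \<le> plen \<rho>" "i < N"
  shows "Phi (2 * k) H (pt (2 * k) \<rho> i)
    = H (path (pseg G 0 i \<rho>) # map path (pieces (std k) (pdrop G i \<rho>))) \<cdot> path (pdrop G (i + k * N) \<rho>)"
  using assms
proof (induction k arbitrary: H \<rho> i)
  case 0
  then show ?case using Phi_0_pt[of i \<rho> H] by simp
next
  case (Suc k)
  note norm = Suc.prems(2) and red = Suc.prems(3)
  let ?a = "pseg G 0 i \<rho>" and ?p = "pseg G i (Suc k * N) \<rho>" and ?b = "pdrop G (i + Suc k * N) \<rho>"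
  let ?H1 = "\<lambda>xs. H (path ?a # xs)"
  have p: "?p \<in> paths G (Suc k * N)" using Suc.prems by (intro pseg_in_paths') auto
  then have lp: "plen ?p = Suc k * N" by (rule plen_paths)
  have p': "?p \<in> paths G (plen ?p)" using p lp by simp
  have a: "?a \<in> short_paths G N" using Suc.prems by (intro short_pathsI[OF pseg_in_paths']) auto
  have H1: "multilinear_on carr ?H1" by (rule multilinear_on_shift[OF Suc.prems(1) path_in_carr[OF a]])
  define T where "T j = Phi (Suc (2 * k)) ?H1 (pt (Suc (2 * k)) ?p j)" for j
  define V where "V j = H (path ?a # path (pseg G 0 j ?p) # path (pseg G 0 1 (pseg G j (Suc (k * N)) ?p))
    # map path (pieces (std k) (pdrop G 1 (pseg G j (Suc (k * N)) ?p))))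
    \<cdot> path (pdrop G (1 + k * N) (pseg G j (Suc (k * N)) ?p)) \<cdot> path (pdrop G (j + (k * N + 1)) ?p)" for j
  have T: "T j = (if j = 0 then 0 else V j)" if j: "j < N" for j
  proof (cases "j = 0")
    case True
    have "Phi (Suc (2 * k)) ?H1 (pt (Suc (2 * k)) ?p 0) = 0"
    proof (rule Phi_vertex[OF p'])
      show "H (path ?a # idem (psrc ?p) # ys) = 0" if "set ys \<subseteq> carr" for ys
        using norm[of "path ?a" "[]" ys "psrc ?p"] that path_in_carr[OF a] by simp
    qed (use lp N2 in simp)
    then show ?thesis using True by (simp add: T_def)
  next
    case False
    let ?q = "pseg G j (Suc (k * N)) ?p" and ?v = "pseg G 0 j ?p"
    let ?H2 = "\<lambda>xs. H (path ?a # path ?v # xs)"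
    have q: "?q \<in> paths G (Suc (k * N))" using j by (intro pseg_in_paths'[OF p]) auto
    then have lq: "plen ?q = Suc (k * N)" by (rule plen_paths)
    have q': "?q \<in> paths G (plen ?q)" using q lq by simp
    have v: "?v \<in> short_paths G N" using j by (intro short_pathsI[OF pseg_in_paths'[OF p]]) auto
    have lv: "plen ?v = j" using j lp by simp
    have av: "path ?a \<in> carr" "path ?v \<in> carr" using a v by (auto intro: path_in_carr)
    have H2: "multilinear_on carr ?H2" by (rule multilinear_on_shift[OF H1 av(2)])
    have "T j = Phi (2 * k) ?H2 (P_diff G N (Suc (2 * k)) (pt (Suc (2 * k)) ?q 0)) \<cdot> path (pdrop G (j + (k * N + 1)) ?p)"
      unfolding T_def using j lp p' by (subst Phi_Suc_pt) (auto simp: min_absorb2)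
    also have "Phi (2 * k) ?H2 (P_diff G N (Suc (2 * k)) (pt (Suc (2 * k)) ?q 0))
      = Phi (2 * k) ?H2 (pt (2 * k) ?q 1) - Phi (2 * k) ?H2 (pt (2 * k) ?q 0)"
      by (subst P_diff_odd_pt) (use lq in \<open>simp_all add: linmap_diff[OF linmap_Phi[OF linmap_id]]\<close>)
    also have "Phi (2 * k) ?H2 (pt (2 * k) ?q 0) = 0"
    proof (rule Phi_vertex[OF q'])
      show "H (path ?a # path ?v # idem (psrc ?q) # ys) = 0" if "set ys \<subseteq> carr" for ys
        using norm[of "path ?a" "[path ?v]" ys "psrc ?q"] that av by simp
    qed (use lq in simp)
    also have "Phi (2 * k) ?H2 (pt (2 * k) ?q 1)
      = ?H2 (path (pseg G 0 1 ?q) # map path (pieces (std k) (pdrop G 1 ?q))) \<cdot> path (pdrop G (1 + k * N) ?q)"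
    proof (rule Suc.IH[OF H2 _ _ q'])
      fix x :: "('v,'e,'k) alg" and ys zs :: "('v,'e,'k) alg list" and u assume "x \<in> carr" "set ys \<subseteq> carr" "set zs \<subseteq> carr"
      then show "H (path ?a # path ?v # x # ys @ idem u # zs) = 0"
        using norm[of "path ?a" "path ?v # x # ys" zs u] av by simp
    next
      fix qs assume qs: "set qs \<subseteq> short_paths G N" "length qs = 2 * k" "alt (map plen qs)" "\<not> full (map plen qs)"
      have "pseg G 0 1 ?q \<in> short_paths G N"
        by (rule short_pathsI[OF pseg_in_paths'[OF q]]) (use N2 in auto)
      moreover have "plen (pseg G 0 1 ?q) = 1" using lq by simp
      ultimately show "H (path ?a # path ?v # path (pseg G 0 1 ?q) # map path qs) = 0"
        using red[of "?v # pseg G 0 1 ?q # qs"] qs v lv j False by (simp del: plen_pseg)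
    qed (use lq N2 in auto)
    finally show ?thesis using False by (simp add: V_def)
  qed
  have V: "V j = 0" if j: "j < N - 1" "j \<noteq> 0" for j
  proof -
    let ?q = "pseg G j (Suc (k * N)) ?p" and ?v = "pseg G 0 j ?p"
    have q: "?q \<in> paths G (Suc (k * N))" using j by (intro pseg_in_paths'[OF p]) auto
    have lq: "plen ?q = Suc (k * N)" using q by (rule plen_paths)
    have d: "pdrop G 1 ?q \<in> paths G (k * N)" using pdrop_in_paths[OF q, of 1] by simp
    have s: "set (pieces (std k) (pdrop G 1 ?q)) \<subseteq> short_paths G N"
      by (rule pieces_short[OF d]) (use std_props[of k] paired_bound[OF alt_paired] in auto)
    have l: "map plen (pieces (std k) (pdrop G 1 ?q)) = std k"
      using std_props(4)[of k] lq by (intro plen_pieces) simp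
    have "?v \<in> short_paths G N" by (rule short_pathsI[OF pseg_in_paths'[OF p]]) (use j in auto)
    moreover have "pseg G 0 1 ?q \<in> short_paths G N"
      by (rule short_pathsI[OF pseg_in_paths'[OF q]]) (use N2 in auto)
    moreover have "plen ?v = j" "plen (pseg G 0 1 ?q) = 1" using j lp lq by simp_all
    ultimately have "H (path ?a # map path (?v # pseg G 0 1 ?q # pieces (std k) (pdrop G 1 ?q))) = 0"
      using s l j std_props[of k] by (intro red) (auto simp del: plen_pseg)
    then show ?thesis by (simp add: V_def)
  qed
  have sumT: "(\<Sum>j<N. T j) = V (N - 1)"
  proof -
    have "T j = (if j = N - 1 then V (N - 1) else 0)" if "j < N" for j
      using that T[OF that] V[of j] N2 by auto
    then have "(\<Sum>j<N. T j) = (\<Sum>j<N. if j = N - 1 then V (N - 1) else 0)" by (intro sum.cong) auto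
    then show ?thesis using N2 by simp
  qed
  have "Phi (2 * Suc k) H (pt (2 * Suc k) \<rho> i)
    = Phi (Suc (2 * k)) ?H1 (P_diff G N (Suc (Suc (2 * k))) (pt (Suc (Suc (2 * k))) ?p 0)) \<cdot> path ?b"
    using Suc.prems Phi_Suc_pt[of \<rho> i "Suc (2 * k)" H] by (simp add: add.commute)
  also have "Phi (Suc (2 * k)) ?H1 (P_diff G N (Suc (Suc (2 * k))) (pt (Suc (Suc (2 * k))) ?p 0)) = (\<Sum>j<N. T j)"
    by (subst P_diff_even_pt)
      (use lp in \<open>simp_all add: linmap_sum[OF linmap_Phi[OF linmap_id]] add.commute T_def\<close>)
  also note sumT
  finally have 1: "Phi (2 * Suc k) H (pt (2 * Suc k) \<rho> i) = V (N - 1) \<cdot> path ?b" .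
  have q: "pseg G (N - 1) (Suc (k * N)) ?p = pdrop G (N - 1) ?p"
    using lp N2 by (intro pseg_rest) auto
  have e: "pdrop G (1 + k * N) (pdrop G (N - 1) ?p) = (ptgt G ?p, [])" "pdrop G (N - 1 + (k * N + 1)) ?p = (ptgt G ?p, [])"
    using lp N2 by (simp_all only: pdrop_pdrop, simp_all add: pdrop_all del: plen_pseg ptgt_pseg)
  have "V (N - 1) \<cdot> path ?b = H (path ?a # map path (pieces (std (Suc k)) ?p)) \<cdot> path ?b"
    unfolding V_def q e by (simp add: mult_path_mult_path psrc_def[of ?b] pdrop_def[of G _ \<rho>] add.commute)
  also have "pieces (std (Suc k)) ?p = pieces (std (Suc k)) (pdrop G i \<rho>)"
    using pieces_pseg[of "std (Suc k)" "Suc k * N" "pdrop G i \<rho>"] std_props(4)[of "Suc k"]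
    by (simp add: pseg_pdrop)
  finally show ?case unfolding 1 by simp
qed

definition stdn :: "nat \<Rightarrow> nat list" where
  "stdn n = (if even n then std (n div 2) else 1 # std (n div 2))"

lemma stdn_props: "altn n (stdn n)" "fulln n (stdn n)"
  by (auto simp: altn_def fulln_def stdn_def std_props elim: oddE evenE)

lemma pull_eval:
  fixes H :: "('v,'e,'k::comm_ring_1) cochain"
  assumes H: "multilinear_on carr H"
    and norm: "\<And>ys v zs. set ys \<subseteq> carr \<Longrightarrow> set zs \<subseteq> carr \<Longrightarrow> H (ys @ idem v # zs) = 0"
    and red: "\<And>qs. set qs \<subseteq> short_paths G N \<Longrightarrow> altn n (map plen qs) \<Longrightarrow> \<not> fulln n (map plen qs) \<Longrightarrow>
      H (map path qs) = 0"
    and p: "p \<in> paths G (res_len N n)"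
  shows "Pstar_eval (pull n H) p = idem (psrc p) \<cdot> H (map path (pieces (stdn n) p)) \<cdot> idem (ptgt G p)"
proof -
  have p': "p \<in> paths G (plen p)" and lp: "plen p = res_len N n" using p by (auto simp: plen_paths)
  have e: "pseg G 0 0 p = (psrc p, [])" by (simp add: psrc_def)
  show ?thesis
  proof (cases n rule: parity_cases)
    case (even k)
    have "Phi (2 * k) (ext_left H) (pt (2 * k) p 0)
      = ext_left H (path (pseg G 0 0 p) # map path (pieces (std k) (pdrop G 0 p))) \<cdot> path (pdrop G (0 + k * N) p)"
    proof (rule Phi_even[OF ext_left_multilinear[OF H]])
      fix x :: "('v,'e,'k) alg" and ys zs :: "('v,'e,'k) alg list" and v assume "x \<in> carr" "set ys \<subseteq> carr" "set zs \<subseteq> carr"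
      then show "ext_left H (x # ys @ idem v # zs) = 0" using norm[of ys zs v] by simp
    next
      fix qs assume "set qs \<subseteq> short_paths G N" "length qs = 2 * k" "alt (map plen qs)" "\<not> full (map plen qs)"
      then show "ext_left H (path (pseg G 0 0 p) # map path qs) = 0"
        using red[of qs] even by (simp add: altn_def fulln_def)
    qed (use p' lp even N2 in auto)
    then show ?thesis
      using p even lp by (simp add: Pstar_eval_pull stdn_def pdrop_all e del: pseg_0)
  next
    case (odd k)
    let ?e = "psrc p"
    let ?H = "\<lambda>xs. idem ?e \<cdot> H xs"
    have ml: "multilinear_on carr ?H" by (rule multilinear_on_linmap[OF linmap_mult_right[OF linmap_id] H])
    have "Phi (Suc (2 * k)) (ext_left H) (pt (Suc (2 * k)) p 0)
      = Phi (2 * k) ?H (P_diff G N (Suc (2 * k)) (pt (Suc (2 * k)) p 0)) \<cdot> idem (ptgt G p)"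
      using lp odd p' N2 by (subst Phi_Suc_pt) (auto simp: e pseg_all pdrop_all simp del: pseg_0)
    also have "Phi (2 * k) ?H (P_diff G N (Suc (2 * k)) (pt (Suc (2 * k)) p 0))
      = Phi (2 * k) ?H (pt (2 * k) p 1) - Phi (2 * k) ?H (pt (2 * k) p 0)"
      by (subst P_diff_odd_pt) (use lp odd in \<open>simp_all add: linmap_diff[OF linmap_Phi[OF linmap_id]]\<close>)
    also have "Phi (2 * k) ?H (pt (2 * k) p 0) = 0"
    proof (rule Phi_vertex[OF p'])
      show "idem ?e \<cdot> H (idem ?e # ys) = 0" if "set ys \<subseteq> carr" for ys
        using norm[of "[]" ys ?e] that by simp
    qed (use lp odd in simp)
    also have "Phi (2 * k) ?H (pt (2 * k) p 1)
      = ?H (path (pseg G 0 1 p) # map path (pieces (std k) (pdrop G 1 p))) \<cdot> path (pdrop G (1 + k * N) p)"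
    proof (rule Phi_even[OF ml])
      fix x :: "('v,'e,'k) alg" and ys zs :: "('v,'e,'k) alg list" and v assume "x \<in> carr" "set ys \<subseteq> carr" "set zs \<subseteq> carr"
      then show "idem ?e \<cdot> H (x # ys @ idem v # zs) = 0" using norm[of "x # ys" zs v] by simp
    next
      fix qs assume qs: "set qs \<subseteq> short_paths G N" "length qs = 2 * k" "alt (map plen qs)" "\<not> full (map plen qs)"
      have "pseg G 0 1 p \<in> short_paths G N" "plen (pseg G 0 1 p) = 1"
        using N2 lp odd by (auto intro!: short_pathsI[OF pseg_in_paths'[OF p]])
      then show "idem ?e \<cdot> H (path (pseg G 0 1 p) # map path qs) = 0"
        using red[of "pseg G 0 1 p # qs"] qs odd by (simp add: altn_def fulln_def)
    qed (use p' lp odd N2 in auto)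
    finally show ?thesis
      using p odd lp by (simp add: Pstar_eval_pull stdn_def pdrop_all mult_path_mult_path)
  qed
qed

lemma split_even_left:
  assumes "length L = 2 * a + n" "altn (2 * a + n) L"
  shows "good (2 * a) (take (2 * a) L) \<and> good n (drop (2 * a) L) \<and>
    (fulln (2 * a + n) L \<longleftrightarrow> fulln (2 * a) (take (2 * a) L) \<and> fulln n (drop (2 * a) L))"
  using assms
proof (induction a arbitrary: L)
  case 0
  then show ?case using altn_good[of n L] by (simp add: good_def fulln_def)
next
  case (Suc a)
  then obtain x y L' where L: "L = x # y # L'"
    by (metis length_Suc_conv mult_Suc_right add_2_eq_Suc add_Suc)
  show ?case
  proof (cases "even n")
    case True
    then have xy: "1 \<le> x" "x < N" "y = 1" "altn (2 * a + n) L'" using Suc.prems L by (auto simp: altn_def)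
    with Suc.IH[of L'] Suc.prems L True show ?thesis by (simp add: good_def fulln_def)
  next
    case False
    then have x: "x = 1" "alt (y # L')" using Suc.prems L by (auto simp: altn_def)
    with Suc.prems L False obtain z L'' where L': "L' = z # L''" by (cases L') auto
    then have "1 \<le> y" "y < N" "z = 1" "altn (2 * a + n) L'" using x Suc.prems L False by (auto simp: altn_def)
    with Suc.IH[of L'] Suc.prems L L' x False show ?thesis
      by (simp add: good_def fulln_def add.commute[of _ "Suc 0"])
  qed
qed

lemma split_altn:
  assumes "altn (m + n) L" "even m \<or> even n"
  shows "good m (take m L)" "good n (drop m L)"
    "fulln (m + n) L \<longleftrightarrow> fulln m (take m L) \<and> fulln n (drop m L)"
proof -
  have l: "length L = m + n" using assms(1) by (simp add: altn_def)
  have "good m (take m L) \<and> good n (drop m L) \<and> (fulln (m + n) L \<longleftrightarrow> fulln m (take m L) \<and> fulln n (drop m L))"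
  proof (cases m rule: parity_cases)
    case (even a)
    then show ?thesis using split_even_left[of L a n] l assms by simp
  next
    case (odd a)
    then obtain L' where L: "L = 1 # L'" "alt L'" "length L' = 2 * a + n"
      using assms by (cases L) (auto simp: altn_def)
    then have "altn (2 * a + n) L'" using assms(2) odd by (simp add: altn_def)
    from split_even_left[OF L(3) this] L odd assms(2) show ?thesis
      by (auto simp: good_def fulln_def)
  qed
  then show "good m (take m L)" "good n (drop m L)"
    "fulln (m + n) L \<longleftrightarrow> fulln m (take m L) \<and> fulln n (drop m L)" by auto
qed

lemma cup_comp_cochain:
  assumes "set xs \<subseteq> carr" "length xs = m + n"
  shows "cup G N (comp_cochain \<psi> m f) (comp_cochain \<psi> n g) xs
    = Pstar_hom G N f (\<psi> (take m xs)) \<cdot> Pstar_hom G N g (\<psi> (drop m xs))"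
proof -
  have s: "set (take i xs) \<subseteq> carr" "set (drop i xs) \<subseteq> carr" for i
    using assms(1) set_take_subset[of i xs] set_drop_subset[of i xs] by auto
  have "cup G N (comp_cochain \<psi> m f) (comp_cochain \<psi> n g) xs
    = (\<Sum>i\<le>length xs. if i = m then Pstar_hom G N f (\<psi> (take m xs)) \<cdot> Pstar_hom G N g (\<psi> (drop m xs)) else 0)"
    unfolding cup_def by (rule sum.cong) (use s assms(2) in \<open>auto simp: comp_cochain_def\<close>)
  then show ?thesis using assms(2) by simp
qed

lemma homogeneous_cup:
  assumes "F \<in> hoch_homogeneous G N m" "H \<in> hoch_homogeneous G N n"
  shows "cup G N F H \<in> hoch_homogeneous G N (m + n)"
proof -
  have "cup G N F H xs = 0" if "length xs \<noteq> m + n" for xs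
    unfolding cup_def
  proof (rule sum.neutral, rule ballI)
    fix i assume "i \<in> {..length xs}"
    then have "length (take i xs) \<noteq> m \<or> length (drop i xs) \<noteq> n" using that by auto
    then show "F (take i xs) \<cdot> H (drop i xs) = 0"
      using assms by (auto simp: hoch_homogeneous_def)
  qed
  then show ?thesis using assms by (auto simp: hoch_homogeneous_def cup_cochain)
qed

lemma cup_comp_cochain_idem:
  assumes "set ys \<subseteq> carr" "set zs \<subseteq> carr"
  shows "cup G N (comp_cochain canon m f) (comp_cochain canon n g) (ys @ idem v # zs) = 0"
proof (cases "set (ys @ idem v # zs) \<subseteq> carr \<and> length (ys @ idem v # zs) = m + n")
  case True
  have "canon (take m (ys @ idem v # zs)) = 0 \<or> canon (drop m (ys @ idem v # zs)) = 0"
  proof (cases "length ys < m")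
    case True
    then obtain j where "m - length ys = Suc j" by (metis Suc_diff_Suc)
    moreover have "set (take j zs) \<subseteq> carr" using assms(2) set_take_subset[of j zs] by auto
    ultimately show ?thesis using True by (simp add: canon_idem)
  next
    case False
    then show ?thesis using assms(2) by (simp add: canon_idem)
  qed
  then show ?thesis using True
    by (subst cup_comp_cochain) (auto simp: linmap_0[OF linmap_Pstar_hom[OF linmap_id]])
next
  case False
  show ?thesis unfolding cup_def
  proof (rule sum.neutral, rule ballI)
    let ?xs = "ys @ idem v # zs"
    fix i assume i: "i \<in> {..length ?xs}"
    have "set ?xs = set (take i ?xs) \<union> set (drop i ?xs)" by (metis append_take_drop_id set_append)
    then have "\<not> (set (take i ?xs) \<subseteq> carr \<and> length (take i ?xs) = m) \<or> \<not> (set (drop i ?xs) \<subseteq> carr \<and> length (drop i ?xs) = n)"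
      using False i by auto
    then show "comp_cochain canon m f (take i ?xs) \<cdot> comp_cochain canon n g (drop i ?xs) = 0"
      unfolding comp_cochain_def by (elim disjE) (simp_all only: if_False mult_zero)
  qed
qed

lemma res_len_add: "even m \<or> even n \<Longrightarrow> res_len N (m + n) = res_len N m + res_len N n"
  by (cases m rule: parity_cases; cases n rule: parity_cases)
    (auto simp: res_len_def algebra_simps)

text \<open>
  At the level of resolutions: the composition of the two comparison maps is the identity of the
  minimal resolution, not only homotopic to it.
\<close>

lemma pull_comp_cochain:
  fixes f :: "('v,'e,'k::comm_ring_1) pstar"
  assumes f: "f \<in> Pstar G N n"
  shows "pull n (comp_cochain canon n f) = f"
proof (rule Pstar_eqI)
  fix p
  let ?H = "comp_cochain canon n f"
  have Hc: "?H \<in> hoch_cochains G N"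
    by (rule homogeneous_cochain[OF comp_cochain_homogeneous[OF canon_comparison f]])
  show "Pstar_eval (pull n ?H) p = Pstar_eval f p"
  proof (cases "p \<in> paths G (res_len N n)")
    case True
    let ?L = "stdn n"
    have L: "good n ?L" "fulln n ?L" using stdn_props[of n] altn_good by auto
    have s: "set (pieces ?L p) \<subseteq> short_paths G N"
      using True sum_fulln[OF L] good_bound[OF L(1)] by (intro pieces_short) auto
    have "Pstar_eval (pull n ?H) p = idem (psrc p) \<cdot> ?H (map path (pieces ?L p)) \<cdot> idem (ptgt G p)"
    proof (rule pull_eval[OF hoch_cochainsD(1)[OF Hc] _ _ True])
      show "?H (ys @ idem v # zs) = 0" if "set ys \<subseteq> carr" "set zs \<subseteq> carr" for ys zs v
        using that by (simp add: comp_cochain_def canon_idem linmap_0[OF linmap_Pstar_hom[OF linmap_id]])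
      show "?H (map path qs) = 0" if "set qs \<subseteq> short_paths G N" "altn n (map plen qs)" "\<not> fulln n (map plen qs)" for qs
        by (simp add: canon_good_zero[OF altn_good[OF that(2)] that(3,1)] comp_cochain_def linmap_0[OF linmap_Pstar_hom[OF linmap_id]])
    qed
    also have "?H (map path (pieces ?L p)) = Pstar_hom G N f (canon (map path (pieces ?L p)))"
      using carr_map_path[OF s, where 'a = 'k] L by (simp add: comp_cochain_def good_def)
    also have "idem (psrc p) \<cdot> \<dots> = Pstar_eval f p" by (rule Pstar_hom_canon_pieces[OF L True f])
    finally show ?thesis using f by (simp add: Pstar_eval_parallel)
  next
    case False
    then show ?thesis using f by (simp add: Pstar_eval_pull Pstar_eval_parallel)
  qed
qed

text \<open>
  Cutting the standard decomposition of a path after \<open>m\<close> pieces gives lengths that are full on both sides,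
  so both factors can be evaluated on the corresponding part of the path. If \<open>m\<close> is even and \<open>n\<close> odd, the
  first part consists of pairs \<open>1, N - 1\<close> instead of \<open>N - 1, 1\<close>, so it matters that \<open>paired\<close> is symmetric.
\<close>

lemma pull_cup_even:
  fixes f g :: "('v,'e,'k::comm_ring_1) pstar"
  assumes f: "f \<in> Pstar G N m" and g: "g \<in> Pstar G N n" and ev: "even m \<or> even n"
    and p: "p \<in> paths G (res_len N (m + n))"
  shows "Pstar_eval (pull (m + n) (cup G N (comp_cochain canon m f) (comp_cochain canon n g))) p
    = Pstar_eval f (pseg G 0 (res_len N m) p) \<cdot> Pstar_eval g (pdrop G (res_len N m) p)"
proof -
  let ?H = "cup G N (comp_cochain canon m f) (comp_cochain canon n g)"
  let ?p1 = "pseg G 0 (res_len N m) p" and ?p2 = "pdrop G (res_len N m) p"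
  let ?L = "stdn (m + n)"
  have Hc: "?H \<in> hoch_cochains G N"
    by (intro cup_cochain homogeneous_cochain[OF comp_cochain_homogeneous[OF canon_comparison f]]
        homogeneous_cochain[OF comp_cochain_homogeneous[OF canon_comparison g]])
  have L: "good (m + n) ?L" "fulln (m + n) ?L" using stdn_props[of "m + n"] altn_good by auto
  have l: "length ?L = m + n" using L by (simp add: good_def)
  have "good m (take m ?L)" "good n (drop m ?L)" "fulln m (take m ?L)" "fulln n (drop m ?L)"
    using split_altn[OF stdn_props(1) ev] L(2) by auto
  note L12 = this
  have r: "res_len N (m + n) = res_len N m + res_len N n" by (rule res_len_add[OF ev])
  have p1: "?p1 \<in> paths G (res_len N m)" using r by (intro pseg_in_paths'[OF p]) auto
  have p2: "?p2 \<in> paths G (res_len N n)" using pdrop_in_paths[OF p, of "res_len N m"] r by simp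
  have s: "set (pieces ?L p) \<subseteq> short_paths G N"
    using p sum_fulln[OF L] good_bound[OF L(1)] by (intro pieces_short) auto
  have split: "pieces ?L p = pieces (take m ?L) ?p1 @ pieces (drop m ?L) ?p2"
    using pieces_append[of "take m ?L" "drop m ?L" p] sum_fulln[OF L12(1,3)]
      pieces_pseg[of "take m ?L" "res_len N m" p] by simp
  have zero: "Pstar_hom G N h 0 = 0" for h :: "('v,'e,'k) pstar"
    by (rule linmap_0[OF linmap_Pstar_hom[OF linmap_id]])
  have "Pstar_eval (pull (m + n) ?H) p = idem (psrc p) \<cdot> ?H (map path (pieces ?L p)) \<cdot> idem (ptgt G p)"
  proof (rule pull_eval[OF hoch_cochainsD(1)[OF Hc] _ _ p])
    show "?H (ys @ idem v # zs) = 0" if "set ys \<subseteq> carr" "set zs \<subseteq> carr" for ys zs v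
      using that by (rule cup_comp_cochain_idem)
    fix qs assume qs: "set qs \<subseteq> short_paths G N" "altn (m + n) (map plen qs)" "\<not> fulln (m + n) (map plen qs)"
    have ql: "length qs = m + n" using qs(2) by (simp add: altn_def)
    have sp: "set (take m qs) \<subseteq> short_paths G N" "set (drop m qs) \<subseteq> short_paths G N"
      using qs(1) set_take_subset[of m qs] set_drop_subset[of m qs] by auto
    have "canon (map path (take m qs)) = (0 :: ('v,'e,'k) res) \<or> canon (map path (drop m qs)) = (0 :: ('v,'e,'k) res)"
      using split_altn[OF qs(2) ev] qs(3) canon_good_zero[OF _ _ sp(1), of m] canon_good_zero[OF _ _ sp(2), of n]
      by (auto simp: take_map drop_map)
    then show "?H (map path qs) = 0"
      using ql carr_map_path[OF qs(1), where 'a = 'k]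
      by (subst cup_comp_cochain) (auto simp: take_map drop_map zero)
  qed
  also have "?H (map path (pieces ?L p))
    = Pstar_hom G N f (canon (map path (pieces (take m ?L) ?p1))) \<cdot> Pstar_hom G N g (canon (map path (pieces (drop m ?L) ?p2)))"
  proof -
    have "take m (map path (pieces ?L p)) = (map path (pieces (take m ?L) ?p1) :: ('v,'e,'k) alg list)"
      "drop m (map path (pieces ?L p)) = (map path (pieces (drop m ?L) ?p2) :: ('v,'e,'k) alg list)"
      using l unfolding split by simp_all
    then show ?thesis
      using carr_map_path[OF s, where 'a = 'k] l by (subst cup_comp_cochain) (simp_all del: map_append)
  qed
  also have "idem (psrc p) \<cdot> \<dots> = Pstar_eval f ?p1 \<cdot> Pstar_hom G N g (canon (map path (pieces (drop m ?L) ?p2)))"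
    using Pstar_hom_canon_pieces[OF L12(1,3) p1 f] by (simp add: psrc_def[of p] flip: mult_assoc)
  also have "\<dots> = Pstar_eval f ?p1 \<cdot> (idem (psrc ?p2) \<cdot> Pstar_hom G N g (canon (map path (pieces (drop m ?L) ?p2))))"
    using Pstar_eval_parallel(3)[OF f, of ?p1] by (simp flip: mult_assoc)
  also have "\<dots> = Pstar_eval f ?p1 \<cdot> Pstar_eval g ?p2"
    unfolding Pstar_hom_canon_pieces[OF L12(2,4) p2 g] ..
  also have "\<dots> \<cdot> idem (ptgt G p) = \<dots>"
    using Pstar_eval_parallel(3)[OF g, of ?p2] by (simp add: mult_assoc)
  finally show ?thesis .
qed

lemma Pstar_eval_vee_basis:
  assumes a: "(a, p') \<in> Pstar_basis G N m" and b: "(b, q) \<in> Pstar_basis G N n" and ev: "even m \<or> even n"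
  shows "Pstar_eval (if ptgt G a = psrc b \<and> ptgt G p' = psrc q \<and> plen a + plen b < N
      then Poly_Mapping.single (pcat a b, pcat p' q) 1 else 0) p
    = (if p \<in> paths G (res_len N (m + n))
       then (if p' = pseg G 0 (res_len N m) p then path a else 0) \<cdot> (if q = pdrop G (res_len N m) p then path b else 0)
       else 0)"
proof -
  have *: "p' \<in> paths G (res_len N m)" "q \<in> paths G (res_len N n)" "psrc a = psrc p'" "ptgt G a = ptgt G p'"
    "psrc b = psrc q" "ptgt G b = ptgt G q"
    using a b by (auto simp: Pstar_basis_def)
  have l: "plen p' = res_len N m" "plen q = res_len N n" using * by (auto simp: plen_paths)
  have iff: "pcat p' q = p \<longleftrightarrow> p \<in> paths G (res_len N (m + n)) \<and> p' = pseg G 0 (res_len N m) p \<and> q = pdrop G (res_len N m) p"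
    if "ptgt G p' = psrc q"
  proof
    assume "pcat p' q = p"
    then show "p \<in> paths G (res_len N (m + n)) \<and> p' = pseg G 0 (res_len N m) p \<and> q = pdrop G (res_len N m) p"
      using pcat_in_paths[OF *(1,2) that] res_len_add[OF ev] l that pdrop_pcat2[of G p' q 0]
      by (auto simp: pseg_pcat1 pseg_all)
  next
    assume A: "p \<in> paths G (res_len N (m + n)) \<and> p' = pseg G 0 (res_len N m) p \<and> q = pdrop G (res_len N m) p"
    have "pcat (pseg G 0 (res_len N m) p) (pdrop G (res_len N m) p) = p" by (rule pcat_prefix_pdrop)
    then show "pcat p' q = p" using A by simp
  qed
  have tgt: "ptgt G p' = psrc q" if "p' = pseg G 0 (res_len N m) p" "q = pdrop G (res_len N m) p"
    using that by simp
  show ?thesis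
  proof (cases "ptgt G p' = psrc q")
    case True
    then show ?thesis using * iff[OF True]
      by (auto simp: Pstar_eval_single path_prod_def linmap_0[OF linmap_Pstar_eval[OF linmap_id]])
  next
    case False
    then show ?thesis using tgt by (auto simp: linmap_0[OF linmap_Pstar_eval[OF linmap_id]])
  qed
qed

lemma Pstar_eval_vee:
  fixes f g :: "('v,'e,'k::comm_ring_1) pstar"
  assumes f: "f \<in> Pstar G N m" and g: "g \<in> Pstar G N n" and ev: "even m \<or> even n"
  shows "Pstar_eval (vee G N m n f g) p = (if p \<in> paths G (res_len N (m + n))
    then Pstar_eval f (pseg G 0 (res_len N m) p) \<cdot> Pstar_eval g (pdrop G (res_len N m) p) else 0)"
proof -
  let ?s = "\<lambda>a p' b q. (if ptgt G a = psrc b \<and> ptgt G p' = psrc q \<and> plen a + plen b < N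
      then Poly_Mapping.single (pcat a b, pcat p' q) 1 else 0) :: ('v,'e,'k) pstar"
  let ?P = "p \<in> paths G (res_len N (m + n))"
  let ?p1 = "pseg G 0 (res_len N m) p" and ?p2 = "pdrop G (res_len N m) p"
  have 1: "Pstar_eval (lin_ext (\<lambda>(b, q). ?s a p' b q) g) p
    = (if ?P then (if p' = ?p1 then path a else 0) \<cdot> Pstar_eval g ?p2 else 0)"
    if ap: "(a, p') \<in> Poly_Mapping.keys f" for a p'
  proof (rule linmap_eqI[of "\<lambda>g. Pstar_eval (lin_ext (\<lambda>(b, q). ?s a p' b q) g) p"
        "\<lambda>g. if ?P then (if p' = ?p1 then path a else 0) \<cdot> Pstar_eval g ?p2 else 0"])
    show "linmap (\<lambda>g. Pstar_eval (lin_ext (\<lambda>(b, q). ?s a p' b q) g) p)" by (intro lin_intro)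
    show "linmap (\<lambda>g. if ?P then (if p' = ?p1 then path a else 0) \<cdot> Pstar_eval g ?p2 else 0)"
      by (cases ?P; simp only: if_True if_False; intro lin_intro)
    fix t assume "t \<in> Poly_Mapping.keys g"
    moreover obtain b q where t: "t = (b, q)" by (cases t)
    ultimately have "(a, p') \<in> Pstar_basis G N m" "(b, q) \<in> Pstar_basis G N n"
      using f g ap by (auto simp: Pstar_def)
    from Pstar_eval_vee_basis[OF this ev, of p]
    show "Pstar_eval (lin_ext (\<lambda>(b, q). ?s a p' b q) (Poly_Mapping.single t 1)) p
      = (if ?P then (if p' = ?p1 then path a else 0) \<cdot> Pstar_eval (Poly_Mapping.single t 1) ?p2 else 0)"
      unfolding t Pstar_eval_single by simp
  qed
  have v: "vee G N m n f g = lin_ext (\<lambda>(a, p'). lin_ext (\<lambda>(b, q). ?s a p' b q) g) f"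
    using ev by (simp add: vee_def)
  show ?thesis unfolding v
  proof (rule linmap_eqI[of "\<lambda>f. Pstar_eval (lin_ext (\<lambda>(a, p'). lin_ext (\<lambda>(b, q). ?s a p' b q) g) f) p"
        "\<lambda>f. if ?P then Pstar_eval f ?p1 \<cdot> Pstar_eval g ?p2 else 0"])
    show "linmap (\<lambda>f. Pstar_eval (lin_ext (\<lambda>(a, p'). lin_ext (\<lambda>(b, q). ?s a p' b q) g) f) p)" by (intro lin_intro)
    show "linmap (\<lambda>f. if ?P then Pstar_eval f ?p1 \<cdot> Pstar_eval g ?p2 else 0)"
      by (cases ?P; simp only: if_True if_False; intro lin_intro)
    fix t assume "t \<in> Poly_Mapping.keys f"
    moreover obtain a p' where t: "t = (a, p')" by (cases t)
    ultimately have "(a, p') \<in> Poly_Mapping.keys f" by simp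
    from 1[OF this]
    show "Pstar_eval (lin_ext (\<lambda>(a, p'). lin_ext (\<lambda>(b, q). ?s a p' b q) g) (Poly_Mapping.single t 1)) p
      = (if ?P then Pstar_eval (Poly_Mapping.single t 1) ?p1 \<cdot> Pstar_eval g ?p2 else 0)"
      unfolding t Pstar_eval_single by simp
  qed
qed

lemma pull_cup_eq_vee:
  assumes "f \<in> Pstar G N m" "g \<in> Pstar G N n" "even m \<or> even n"
  shows "pull (m + n) (cup G N (comp_cochain canon m f) (comp_cochain canon n g)) = vee G N m n f g"
proof (rule Pstar_eqI)
  show "Pstar_eval (pull (m + n) (cup G N (comp_cochain canon m f) (comp_cochain canon n g))) p
    = Pstar_eval (vee G N m n f g) p" for p
    using pull_cup_even[OF assms, of p] by (simp add: Pstar_eval_vee[OF assms]) (simp add: Pstar_eval_pull)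
qed

subsection \<open>Products of two classes of odd degree\<close>

text \<open>
  Membership in the \<open>l\<close>-th power of the arrow ideal. The bound is an integer because lower bounds
  that arise from counting lengths may be negative.
\<close>

definition order_ge :: "int \<Rightarrow> ('v,'e,'k::comm_ring_1) alg \<Rightarrow> bool" where
  "order_ge l x \<longleftrightarrow> Poly_Mapping.keys x \<subseteq> {c. l \<le> int (plen c)}"

lemma linmap_keys:
  "linmap L \<Longrightarrow> (\<And>t. t \<in> Poly_Mapping.keys z \<Longrightarrow> Poly_Mapping.keys (L (Poly_Mapping.single t 1)) \<subseteq> S)
    \<Longrightarrow> Poly_Mapping.keys (L z) \<subseteq> S"
  using keys_lin_ext_subset[of z "\<lambda>t. L (Poly_Mapping.single t 1)" S] linmap_expand[of L z] by simp

lemma order_ge_path: "l \<le> int (plen p) \<Longrightarrow> order_ge l (path p)"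
  by (simp add: order_ge_def)

lemma order_ge_mult:
  assumes "order_ge l x" "order_ge l' y"
  shows "order_ge (l + l') (x \<cdot> y)"
  unfolding order_ge_def A_mult_def
proof (intro keys_lin_ext_subset)
  fix p q assume "p \<in> Poly_Mapping.keys x" "q \<in> Poly_Mapping.keys y"
  then have "l \<le> int (plen p)" "l' \<le> int (plen q)" using assms by (auto simp: order_ge_def)
  then show "Poly_Mapping.keys (path_prod G N p q) \<subseteq> {c. l + l' \<le> int (plen c)}"
    by (simp add: path_prod_def)
qed

lemma order_ge_diff: "order_ge l x \<Longrightarrow> order_ge l y \<Longrightarrow> order_ge l (x - y)"
  using Poly_Mapping.keys_diff[of x y] unfolding order_ge_def by blast

lemma order_ge_sum: "(\<And>i. i \<in> S \<Longrightarrow> order_ge l (f i)) \<Longrightarrow> order_ge l (sum f S)"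
  unfolding order_ge_def by (rule keys_sum_subset)

lemma order_ge_Phi:
  fixes H :: "('v,'e,'k::comm_ring_1) cochain"
  assumes "\<And>qs. set qs \<subseteq> short_paths G N \<Longrightarrow> length qs = Suc n \<Longrightarrow>
      order_ge (int (sum_list (map plen qs)) + c) (H (map path qs))"
    and "\<rho> \<in> paths G (plen \<rho>)" "i + res_len N n \<le> plen \<rho>" "i < N"
  shows "order_ge (int (plen \<rho>) + c) (Phi n H (pt n \<rho> i))"
  using assms
proof (induction n arbitrary: H c \<rho> i)
  case 0
  have "pseg G 0 i \<rho> \<in> short_paths G N" using 0 by (intro short_pathsI[OF pseg_in_paths']) auto
  then have "order_ge (int i + c) (H [path (pseg G 0 i \<rho>)])"
    using 0(1)[of "[pseg G 0 i \<rho>]"] 0 by (simp add: min_absorb2)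
  then have "order_ge ((int i + c) + int (plen (pdrop G i \<rho>))) (H [path (pseg G 0 i \<rho>)] \<cdot> path (pdrop G i \<rho>))"
    by (rule order_ge_mult) (simp add: order_ge_path)
  then show ?case using 0 by (simp add: Phi_0_pt of_nat_diff algebra_simps)
next
  case (Suc n)
  let ?r = "res_len N (Suc n)"
  let ?a = "pseg G 0 i \<rho>" and ?p = "pseg G i ?r \<rho>" and ?b = "pdrop G (i + ?r) \<rho>"
  have a: "?a \<in> short_paths G N" using Suc.prems by (intro short_pathsI[OF pseg_in_paths']) auto
  have pl: "plen ?p = ?r" "plen ?a = i" using Suc.prems by (simp_all add: min_absorb2)
  have p: "?p \<in> paths G (plen ?p)" unfolding pl using Suc.prems by (intro pseg_in_paths')
  have IH: "order_ge (int (plen ?p) + (c + int i)) (Phi n (\<lambda>xs. H (path ?a # xs)) (pt n ?p j))"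
    if "j + res_len N n \<le> plen ?p" "j < N" for j
  proof (rule Suc.IH[OF _ p that])
    fix qs assume "set qs \<subseteq> short_paths G N" "length qs = Suc n"
    then show "order_ge (int (sum_list (map plen qs)) + (c + int i)) (H (path ?a # map path qs))"
      using Suc.prems(1)[of "?a # qs"] a pl by (simp add: algebra_simps del: plen_pseg)
  qed
  have "order_ge (int (plen ?p) + (c + int i)) (Phi n (\<lambda>xs. H (path ?a # xs)) (P_diff G N (Suc n) (pt (Suc n) ?p 0)))"
  proof (cases n rule: parity_cases)
    case (even k)
    have "P_diff G N (Suc n) (pt (Suc n) ?p 0) = (pt n ?p 1 - pt n ?p 0 :: ('v,'e,'k) res)"
      unfolding even by (subst P_diff_odd_pt) (use pl even in auto)
    then show ?thesis using IH[of 0] IH[of 1] N2 pl even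
      by (simp add: linmap_diff[OF linmap_Phi[OF linmap_id]] order_ge_diff del: plen_pseg)
  next
    case (odd k)
    have "P_diff G N (Suc n) (pt (Suc n) ?p 0) = (\<Sum>j<N. pt n ?p j :: ('v,'e,'k) res)"
      unfolding odd by (subst P_diff_even_pt) (use pl odd in auto)
    then show ?thesis using IH pl odd
      by (auto simp add: linmap_sum[OF linmap_Phi[OF linmap_id]] simp del: plen_pseg intro!: order_ge_sum)
  qed
  then have "order_ge ((int (plen ?p) + (c + int i)) + int (plen ?b))
    (Phi n (\<lambda>xs. H (path ?a # xs)) (P_diff G N (Suc n) (pt (Suc n) ?p 0)) \<cdot> path ?b)"
    by (rule order_ge_mult) (simp add: order_ge_path)
  moreover have "(int (plen ?p) + (c + int i)) + int (plen ?b) = int (plen \<rho>) + c"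
    unfolding pl using Suc.prems by simp
  ultimately show ?case using Suc.prems by (simp add: Phi_Suc_pt del: plen_pseg plen_pdrop)
qed

abbreviation total_len :: "nat \<Rightarrow> (('v,'e) path \<times> ('v,'e) path \<times> ('v,'e) path) set" where
  "total_len T \<equiv> {(a, p, b). plen a + plen p + plen b = T}"

lemma keys_pt: "i + res_len N n \<le> plen \<rho> \<Longrightarrow> Poly_Mapping.keys (pt n \<rho> i) \<subseteq> total_len (plen \<rho>)"
  by (auto simp: pt_eq min_absorb2)

lemma linmap_keys_pt:
  assumes "linmap L" "z \<in> P_carrier G N n" "Poly_Mapping.keys z \<subseteq> total_len T"
    and "\<And>\<rho> i. i + res_len N n \<le> plen \<rho> \<Longrightarrow> i < N \<Longrightarrow> plen \<rho> = T \<Longrightarrow> Poly_Mapping.keys (L (pt n \<rho> i)) \<subseteq> S"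
  shows "Poly_Mapping.keys (L z) \<subseteq> S"
proof (rule linmap_keys[OF assms(1)])
  fix t assume t: "t \<in> Poly_Mapping.keys z"
  obtain a p b where abp: "t = (a, p, b)" by (cases t)
  then have "(a, p, b) \<in> P_basis G N n" using t assms(2) by (auto simp: P_carrier_def)
  note b = basis_eq_pt[OF this]
  show "Poly_Mapping.keys (L (Poly_Mapping.single t 1)) \<subseteq> S"
    unfolding abp b(1) by (rule assms(4)) (use b t abp assms(3) in auto)
qed

text \<open>
  The contraction only moves the mark, and the action adds the length of the new argument.
\<close>

lemma canon_total:
  "set qs \<subseteq> short_paths G N \<Longrightarrow> Poly_Mapping.keys (canon (map path qs) :: ('v,'e,'k::comm_ring_1) res) \<subseteq> total_len (sum_list (map plen qs))"
proof (induction qs)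
  case Nil
  show ?case unfolding list.map canon.simps
    by (rule keys_sum_subset, rule subset_trans[OF keys_pt]) simp_all
next
  case (Cons q qs)
  let ?n = "length qs"
  let ?L = "\<lambda>z :: ('v,'e,'k) res. contr ?n (P_lact G N (path q) z)"
  have c: "(canon (map path qs) :: ('v,'e,'k) res) \<in> P_carrier G N ?n"
    using canon_carrier[OF carr_map_path[of qs]] Cons.prems by simp
  have "Poly_Mapping.keys (?L (canon (map path qs))) \<subseteq> total_len (plen q + sum_list (map plen qs))"
  proof (rule linmap_keys_pt[where L = ?L, OF linmap_contr[OF linmap_P_lact2[OF linmap_id]] c Cons.IH])
    fix \<rho> :: "('v,'e) path" and i assume *: "i + res_len N ?n \<le> plen \<rho>" "i < N" "plen \<rho> = sum_list (map plen qs)"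
    show "Poly_Mapping.keys (?L (pt ?n \<rho> i)) \<subseteq> total_len (plen q + sum_list (map plen qs))"
    proof (cases "ptgt G q = psrc \<rho> \<and> plen q + i < N")
      case False
      then have "P_lact G N (path q) (pt ?n \<rho> i) = (0 :: ('v,'e,'k) res)" using * by (auto simp: P_lact_path_pt pt_0)
      then show ?thesis by (simp add: linmap_0[OF linmap_contr[OF linmap_id]])
    next
      case True
      let ?\<rho> = "pcat q \<rho>"
      have \<rho>: "plen ?\<rho> = plen q + sum_list (map plen qs)" using * by simp
      show ?thesis
      proof (cases ?n rule: parity_cases)
        case (even k)
        then have "contr ?n (pt ?n ?\<rho> (plen q + i)) = (\<Sum>j<plen q + i. pt (Suc ?n) ?\<rho> j :: ('v,'e,'k) res)"
          using True * by (simp only: contr_even_pt) (simp add: contr_even_pt)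
        moreover have "Poly_Mapping.keys (\<Sum>j<plen q + i. pt (Suc ?n) ?\<rho> j :: ('v,'e,'k) res) \<subseteq> total_len (plen ?\<rho>)"
          using True * even by (intro keys_sum_subset keys_pt) auto
        ultimately show ?thesis using True * \<rho> by (simp add: P_lact_path_pt)
      next
        case (odd k)
        then have "contr ?n (pt ?n ?\<rho> (plen q + i)) = (if plen q + i = N - 1 then pt (Suc ?n) ?\<rho> 0 else 0 :: ('v,'e,'k) res)"
          using True * by (simp add: contr_odd_pt)
        moreover have "Poly_Mapping.keys (pt (Suc ?n) ?\<rho> 0 :: ('v,'e,'k) res) \<subseteq> total_len (plen ?\<rho>)" if "plen q + i = N - 1"
          using that N2 * odd by (intro keys_pt) auto
        ultimately show ?thesis using True * \<rho> by (simp add: P_lact_path_pt)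
      qed
    qed
  qed (use Cons.prems in auto)
  then show ?case by simp
qed

text \<open>
  The value has the total length of the arguments, except that a middle segment of length \<open>res_len n\<close> is
  replaced by an element of the radical.
\<close>

lemma order_ge_hom_canon:
  assumes f: "f \<in> Pstar G N n" "\<And>p. order_ge 1 (Pstar_eval f p)"
    and qs: "set qs \<subseteq> short_paths G N" "length qs = n"
  shows "order_ge (int (sum_list (map plen qs)) - int (res_len N n) + 1) (Pstar_hom G N f (canon (map path qs)))"
  unfolding order_ge_def
proof (rule linmap_keys_pt[OF _ _ canon_total[OF qs(1)]])
  show "canon (map path qs) \<in> P_carrier G N n" using canon_carrier[OF carr_map_path[OF qs(1)]] qs(2) by simp
  fix \<rho> :: "('v,'e) path" and i assume *: "i + res_len N n \<le> plen \<rho>" "i < N" "plen \<rho> = sum_list (map plen qs)"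
  have "order_ge ((int i + 1) + int (plen \<rho> - (i + res_len N n))) (Pstar_hom G N f (pt n \<rho> i))"
    unfolding Pstar_hom_pt[OF *(1)]
    using * by (intro order_ge_mult f(2)) (auto simp: order_ge_path min_absorb2)
  moreover have "(int i + 1) + int (plen \<rho> - (i + res_len N n)) = int (sum_list (map plen qs)) - int (res_len N n) + 1"
    using * by simp
  ultimately show "Poly_Mapping.keys (Pstar_hom G N f (pt n \<rho> i)) \<subseteq> {c. int (sum_list (map plen qs)) - int (res_len N n) + 1 \<le> int (plen c)}"
    by (simp add: order_ge_def)
qed (intro lin_intro)

text \<open>
  The two odd middle segments have total length \<open>N - 2\<close> less than the path at which the pullback is
  evaluated; each of them contributes at least one arrow in the value. Hence every path in the value has length at
  least \<open>N\<close>.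
\<close>

lemma pull_cup_odd:
  fixes f g :: "('v,'e,'k::comm_ring_1) pstar"
  assumes f: "f \<in> Pstar G N m" "\<And>p. order_ge 1 (Pstar_eval f p)"
    and g: "g \<in> Pstar G N n" "\<And>p. order_ge 1 (Pstar_eval g p)"
    and odd: "odd m" "odd n"
  shows "pull (m + n) (cup G N (comp_cochain canon m f) (comp_cochain canon n g)) = 0"
proof (rule Pstar_eqI)
  fix p
  let ?H = "cup G N (comp_cochain canon m f) (comp_cochain canon n g)"
  have Hc: "?H \<in> hoch_cochains G N"
    by (intro cup_cochain homogeneous_cochain[OF comp_cochain_homogeneous[OF canon_comparison f(1)]]
        homogeneous_cochain[OF comp_cochain_homogeneous[OF canon_comparison g(1)]])
  have "Pstar_eval (pull (m + n) ?H) p = 0"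
  proof (cases "p \<in> paths G (res_len N (m + n))")
    case True
    let ?c = "2 - int (res_len N m) - int (res_len N n)"
    have lp: "plen p = res_len N (m + n)" using True by (rule plen_paths)
    have "order_ge (int (plen p) + ?c) (Phi (m + n) (ext_left ?H) (pt (m + n) p 0))"
    proof (rule order_ge_Phi)
      fix qs assume qs: "set qs \<subseteq> short_paths G N" "length qs = Suc (m + n)"
      then obtain q qs' where q: "qs = q # qs'" by (cases qs) auto
      have s: "set (take m qs') \<subseteq> short_paths G N" "set (drop m qs') \<subseteq> short_paths G N"
        using qs q set_take_subset[of m qs'] set_drop_subset[of m qs'] by auto
      have v: "?H (map path qs') = Pstar_hom G N f (canon (map path (take m qs'))) \<cdot> Pstar_hom G N g (canon (map path (drop m qs')))"
        using qs q carr_map_path[of qs', where 'a = 'k] by (subst cup_comp_cochain) (auto simp: take_map drop_map)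
      have t: "sum_list (map plen qs') = sum_list (map plen (take m qs')) + sum_list (map plen (drop m qs'))"
        by (metis append_take_drop_id map_append sum_list_append)
      have "order_ge (int (plen q) + ((int (sum_list (map plen (take m qs'))) - int (res_len N m) + 1)
          + (int (sum_list (map plen (drop m qs'))) - int (res_len N n) + 1))) (path q \<cdot> ?H (map path qs'))"
        unfolding v
        by (intro order_ge_mult order_ge_hom_canon f g s order_ge_path) (use qs q in auto)
      then show "order_ge (int (sum_list (map plen qs)) + ?c) (ext_left ?H (map path qs))"
        using t by (simp add: q algebra_simps)
    qed (use True lp N2 in auto)
    \<comment> \<open>with \<open>m = 2a + 1\<close> and \<open>n = 2b + 1\<close> this is \<open>(a + b + 1) N + 2 - (a N + 1) - (b N + 1)\<close>\<close>
    moreover have "int (plen p) + ?c = int N"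
      using odd unfolding lp by (auto simp: res_len_def algebra_simps elim!: oddE)
    ultimately have o: "order_ge (int N) (Pstar_eval (pull (m + n) ?H) p)" using True by (simp add: Pstar_eval_pull)
    have "Pstar_eval (pull (m + n) ?H) p \<in> carr"
      by (rule Pstar_eval_parallel(1)[OF pull_Pstar[OF hoch_cochainsD(1,2)[OF Hc]]])
    then have "Poly_Mapping.keys (Pstar_eval (pull (m + n) ?H) p) = {}"
      using o by (fastforce simp: order_ge_def dest: carrD short_pathsD)
    then show ?thesis by simp
  qed (simp add: Pstar_eval_pull)
  then show "Pstar_eval (pull (m + n) ?H) p = Pstar_eval 0 p" by (simp add: Pstar_eval_def)
qed

section \<open>Cocycles with coefficients in the vertices\<close>

abbreviation vcoeff :: "('v,'e,'k::comm_ring_1) pstar \<Rightarrow> ('v,'e) path \<Rightarrow> 'k" where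
  "vcoeff f p \<equiv> Poly_Mapping.lookup (Pstar_eval f p) (psrc p, [])"

lemma vertex_key:
  assumes "f \<in> Pstar G N n" "(v, []) \<in> Poly_Mapping.keys (Pstar_eval f p)"
  shows "v = psrc p" "v = ptgt G p" "p \<in> paths G (res_len N n)"
  using assms by (auto simp: in_keys_iff lookup_Pstar_eval Pstar_def Pstar_basis_def dest!: subsetD)

lemma order_ge_1I:
  assumes f: "f \<in> Pstar G N n" and v: "\<And>p. p \<in> paths G (res_len N n) \<Longrightarrow> ptgt G p = psrc p \<Longrightarrow> vcoeff f p = 0"
  shows "order_ge 1 (Pstar_eval f p)"
  unfolding order_ge_def
proof (rule subsetI, rule CollectI, rule ccontr)
  fix c assume c: "c \<in> Poly_Mapping.keys (Pstar_eval f p)" and "\<not> 1 \<le> int (plen c)"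
  then have "c = (psrc c, [])" by (simp flip: plen_0_iff)
  then have k: "(psrc c, []) \<in> Poly_Mapping.keys (Pstar_eval f p)" using c by simp
  note vertex_key[OF f k]
  with v[of p] k show False by (simp add: in_keys_iff)
qed

subsection \<open>Odd degree\<close>

text \<open>
  The cocycle condition is evaluated on paths that wind around a closed path \<open>\<pi>\<close> several times;
  \<open>window \<pi> i l\<close> below is the segment of length \<open>l\<close> that begins at position \<open>i\<close>. Enough copies of \<open>\<pi>\<close> are
  taken for the segment to exist.
\<close>

primrec loop_power :: "('v,'e) path \<Rightarrow> nat \<Rightarrow> ('v,'e) path" where
  "loop_power \<pi> 0 = (psrc \<pi>, [])"
| "loop_power \<pi> (Suc n) = pcat \<pi> (loop_power \<pi> n)"

definition window :: "('v,'e) path \<Rightarrow> nat \<Rightarrow> nat \<Rightarrow> ('v,'e) path" where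
  "window \<pi> i l = pseg G i l (loop_power \<pi> (i + l))"

context
  fixes \<pi> :: "('v,'e) path" and L :: nat
  assumes \<pi>: "\<pi> \<in> paths G L" and closed: "ptgt G \<pi> = psrc \<pi>" and L: "1 \<le> L"
begin

lemma loop_power_path:
  "loop_power \<pi> n \<in> paths G (n * L)" "psrc (loop_power \<pi> n) = psrc \<pi>" "ptgt G (loop_power \<pi> n) = psrc \<pi>"
proof (induction n)
  case 0
  show "loop_power \<pi> 0 \<in> paths G (0 * L)" using \<pi> by (simp add: vertex_in_paths psrc_in_verts)
next
  case (Suc n)
  then show "loop_power \<pi> (Suc n) \<in> paths G (Suc n * L)"
    using pcat_in_paths[OF \<pi>, of "loop_power \<pi> n" "n * L"] closed by simp
  show "ptgt G (loop_power \<pi> (Suc n)) = psrc \<pi>" using Suc closed by simp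
qed simp_all

lemma loop_power_right: "loop_power \<pi> (Suc n) = pcat (loop_power \<pi> n) \<pi>"
proof (induction n)
  case (Suc n)
  then show ?case by (metis loop_power.simps(2) pcat_assoc)
qed simp

lemma plen_loop_power: "plen (loop_power \<pi> n) = n * L"
  by (rule plen_paths[OF loop_power_path(1)])

lemma window_eq: "i + l \<le> M \<Longrightarrow> pseg G i l (loop_power \<pi> M) = window \<pi> i l"
proof (induction M rule: dec_induct)
  case (step M)
  have "i + l \<le> plen (loop_power \<pi> M)"
    using step(1) L unfolding plen_loop_power by (metis le_trans mult.right_neutral mult_le_mono2)
  then have "pseg G i l (loop_power \<pi> (Suc M)) = pseg G i l (loop_power \<pi> M)"
    unfolding loop_power_right by (rule pseg_pcat1)
  with step show ?case by simp
qed (simp add: window_def)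

lemma window_period: "window \<pi> (i + L) l = window \<pi> i l"
proof -
  let ?M = "i + L + l"
  have "window \<pi> (i + L) l = pseg G (L + i) l (loop_power \<pi> (Suc ?M))"
    by (subst window_eq[symmetric, where M = "Suc ?M"]) (auto simp: add.commute)
  also have "\<dots> = pseg G i l (loop_power \<pi> ?M)"
    using pseg_pcat2[of G \<pi> "loop_power \<pi> ?M" i l] \<pi> closed loop_power_path(2)[of ?M] by (simp add: plen_paths)
  also have "\<dots> = window \<pi> i l" by (rule window_eq) simp
  finally show ?thesis .
qed

lemma window_paths: "window \<pi> i l \<in> paths G l"
proof -
  have "i + l \<le> (i + l) * L" using L by (metis mult.right_neutral mult_le_mono2)
  then show ?thesis unfolding window_def by (rule pseg_in_paths'[OF loop_power_path(1)])
qed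

lemma pseg_window: "j + l \<le> m \<Longrightarrow> pseg G j l (window \<pi> i m) = window \<pi> (i + j) l"
  unfolding window_def[of _ i m] by (simp add: pseg_pseg) (rule window_eq, simp)

lemma pdrop_window: "j \<le> m \<Longrightarrow> pdrop G j (window \<pi> i m) = window \<pi> (i + j) (m - j)"
  unfolding window_def[of _ i m] by (simp add: pdrop_pseg) (rule window_eq, simp)

lemma window_0: "window \<pi> 0 L = \<pi>"
proof -
  have "window \<pi> 0 L = pseg G 0 L (loop_power \<pi> (Suc L))" by (rule window_eq[symmetric]) simp
  also have "\<dots> = \<pi>" using \<pi> by (simp add: pseg_pcat1 pseg_all plen_paths)
  finally show ?thesis .
qed

lemma pcat_window: "pcat (window \<pi> i j) (window \<pi> (i + j) l) = window \<pi> i (j + l)"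
proof -
  have "pcat (pseg G i j (loop_power \<pi> (i + j + l))) (pseg G (i + j) l (loop_power \<pi> (i + j + l)))
    = pseg G i (j + l) (loop_power \<pi> (i + j + l))" by (rule pcat_pseg_pseg)
  then show ?thesis by (simp add: window_eq)
qed

lemma ptgt_window: "ptgt G (window \<pi> i l) = psrc (window \<pi> (i + l) l')"
proof -
  have "ptgt G (pseg G i l (loop_power \<pi> (i + l + l'))) = psrc (pseg G (i + l) l' (loop_power \<pi> (i + l + l')))"
    by simp
  then show ?thesis by (simp only: window_eq le_add1 order_refl)
qed

end

text \<open>
  With \<open>N - 1\<close> arrows outside, only the vertex part of the middle factor survives.
\<close>

lemma sandwich_vertex:
  fixes x :: "('v,'e,'k::comm_ring_1) alg"
  assumes ab: "plen a + plen b = N - 1" and comp: "ptgt G a = psrc b"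
  shows "path a \<cdot> x \<cdot> path b = smul (Poly_Mapping.lookup x (ptgt G a, [])) (path (pcat a b))"
proof (rule linmap_eqI[of "\<lambda>x. path a \<cdot> x \<cdot> path b" "\<lambda>x. smul (Poly_Mapping.lookup x (ptgt G a, [])) (path (pcat a b))"])
  show "linmap (\<lambda>x. smul (Poly_Mapping.lookup x (ptgt G a, [])) (path (pcat a b)))"
    by (rule linmapI) (simp_all add: lookup_add smul_add_left smul_smul)
  show "linmap (\<lambda>x. path a \<cdot> x \<cdot> path b)" by (intro lin_intro)
  fix c
  show "path a \<cdot> path c \<cdot> path b = (smul (Poly_Mapping.lookup (path c) (ptgt G a, [])) (path (pcat a b)) :: ('v,'e,'k) alg)"
  proof (cases "plen c = 0")
    case True
    then have c: "c = (psrc c, [])" by (simp add: plen_0_iff)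
    have "path a \<cdot> idem u \<cdot> path b = smul (Poly_Mapping.lookup (idem u) (ptgt G a, [])) (path (pcat a b))" for u
      using ab comp N2 by (auto simp: path_prod_def lookup_single when_def)
    from this[of "psrc c"] show ?thesis using c by simp
  next
    case False
    then have "Poly_Mapping.lookup (path c) (ptgt G a, []) = (0 :: 'k)" by (auto simp: lookup_single when_def)
    moreover have "path a \<cdot> path c \<cdot> path b = (0 :: ('v,'e,'k) alg)" using False ab N2 by (auto simp: path_prod_def)
    ultimately show ?thesis by simp
  qed
qed

text \<open>
  Evaluating the cocycle condition on a path that winds around \<open>\<pi>\<close> shows that the vertex coefficients
  \<open>r i\<close> of the rotations of \<open>\<pi>\<close> sum to zero over any \<open>N\<close> consecutive \<open>i\<close>. So \<open>r\<close> has period \<open>N\<close>; it also has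
  period \<open>k N + 1\<close>, the length of \<open>\<pi>\<close>. Hence it is constant, and \<open>N\<close> times the constant is zero.
\<close>

lemma odd_cocycle_vcoeff:
  fixes f :: "('v,'e,'k::field_char_0) pstar"
  assumes f: "f \<in> Pstar_cocycles G N (Suc (2 * k))" and \<pi>: "\<pi> \<in> paths G (k * N + 1)" "ptgt G \<pi> = psrc \<pi>"
  shows "vcoeff f \<pi> = 0"
proof -
  let ?L = "k * N + 1"
  have L: "1 \<le> ?L" by simp
  define r where "r i = vcoeff f (window \<pi> i ?L)" for i
  have period: "r (i + ?L) = r i" for i
    unfolding r_def using window_period[OF \<pi> L, of i ?L] by simp
  have sum: "(\<Sum>j<N. r (i + j)) = 0" for i
  proof -
    let ?\<rho> = "window \<pi> i (k * N + N)"
    have \<rho>: "?\<rho> \<in> paths G (res_len N (Suc (Suc (2 * k))))"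
      using window_paths[OF \<pi> L, of i "k * N + N"] by simp
    have p\<rho>: "plen ?\<rho> = k * N + N" using \<rho> by (simp add: plen_paths)
    have "Pstar_eval (Pstar_diff G N (Suc (2 * k)) f) ?\<rho> = 0"
      using f by (simp add: Pstar_cocycles_def Pstar_eval_def)
    then have "Pstar_hom G N f (P_diff G N (Suc (Suc (2 * k))) (pt (Suc (Suc (2 * k))) ?\<rho> 0)) = 0"
      using \<rho> by (simp only: Pstar_eval_diff if_True)
    moreover have "P_diff G N (Suc (Suc (2 * k))) (pt (Suc (Suc (2 * k))) ?\<rho> 0)
      = (\<Sum>j<N. pt (Suc (2 * k)) ?\<rho> j :: ('v,'e,'k) res)"
      by (subst P_diff_even_pt) (use p\<rho> in auto)
    ultimately have 0: "(\<Sum>j<N. Pstar_hom G N f (pt (Suc (2 * k)) ?\<rho> j)) = 0"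
      by (simp only: linmap_sum[OF linmap_Pstar_hom[OF linmap_id]])
    have t: "Pstar_hom G N f (pt (Suc (2 * k)) ?\<rho> j) = smul (r (i + j)) (path (window \<pi> i (N - 1)))" if j: "j < N" for j
    proof -
      have "Pstar_hom G N f (pt (Suc (2 * k)) ?\<rho> j)
        = path (pseg G 0 j ?\<rho>) \<cdot> Pstar_eval f (pseg G j ?L ?\<rho>) \<cdot> path (pdrop G (j + ?L) ?\<rho>)"
        using p\<rho> j by (subst Pstar_hom_pt) auto
      also have "pseg G 0 j ?\<rho> = window \<pi> i j" using j pseg_window[OF \<pi> L, of 0 j _ i] by simp
      also have "pseg G j ?L ?\<rho> = window \<pi> (i + j) ?L" using j by (intro pseg_window[OF \<pi> L]) auto
      also have "pdrop G (j + ?L) ?\<rho> = window \<pi> (i + (j + ?L)) (k * N + N - (j + ?L))"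
        using j by (intro pdrop_window[OF \<pi> L]) auto
      also have "\<dots> = window \<pi> (i + j) (N - 1 - j)"
        using window_period[OF \<pi> L, of "i + j"] by (simp add: add.assoc)
      also have "path (window \<pi> i j) \<cdot> Pstar_eval f (window \<pi> (i + j) ?L) \<cdot> path (window \<pi> (i + j) (N - 1 - j))
        = smul (Poly_Mapping.lookup (Pstar_eval f (window \<pi> (i + j) ?L)) (ptgt G (window \<pi> i j), []))
            (path (pcat (window \<pi> i j) (window \<pi> (i + j) (N - 1 - j))))"
        using j plen_paths[OF window_paths[OF \<pi> L]] by (intro sandwich_vertex) (auto intro: ptgt_window[OF \<pi> L])
      also have "ptgt G (window \<pi> i j) = psrc (window \<pi> (i + j) ?L)" by (rule ptgt_window[OF \<pi> L])
      also have "pcat (window \<pi> i j) (window \<pi> (i + j) (N - 1 - j)) = window \<pi> i (N - 1)"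
        using pcat_window[OF \<pi> L, of i j "N - 1 - j"] j by simp
      finally show ?thesis by (simp add: r_def)
    qed
    have "smul (\<Sum>j<N. r (i + j)) (path (window \<pi> i (N - 1))) = (\<Sum>j<N. smul (r (i + j)) (path (window \<pi> i (N - 1))))"
    proof -
      have "smul (sum h S) x = (\<Sum>j\<in>S. smul (h j) x)" for h :: "nat \<Rightarrow> 'k" and S and x :: "('v,'e,'k) alg"
        by (induction S rule: infinite_finite_induct) (auto simp: smul_add_left)
      then show ?thesis by simp
    qed
    also have "\<dots> = 0" using 0 t by simp
    finally have "Poly_Mapping.lookup (smul (\<Sum>j<N. r (i + j)) (path (window \<pi> i (N - 1)))) (window \<pi> i (N - 1)) = 0"
      by simp
    then show ?thesis by simp
  qed
  have step: "r (i + N) = r i" for i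
  proof -
    have "0 = (\<Sum>j<N. r (Suc i + j)) - (\<Sum>j<N. r (i + j))" by (simp only: sum diff_self)
    also have "\<dots> = (\<Sum>j<N. r (i + Suc j) - r (i + j))" by (simp add: sum_subtractf)
    also have "\<dots> = r (i + N) - r i" using sum_telescope[of "\<lambda>j. r (i + j)" N] by simp
    finally show ?thesis by simp
  qed
  have steps: "r (i + m * N) = r i" for i m
  proof (induction m)
    case (Suc m)
    then show ?case using step[of "i + m * N"] by (simp add: algebra_simps)
  qed simp
  \<comment> \<open>the periods \<open>N\<close> and \<open>k N + 1\<close> have greatest common divisor \<open>1\<close>\<close>
  have "r (Suc i) = r i" for i
    using steps[of "Suc i" k] period[of i] by (simp add: algebra_simps)
  then have const: "r i = r 0" for i by (induction i) auto
  have "(\<Sum>j<N. r (0 + j)) = (\<Sum>j<N. r 0)" by (rule sum.cong[OF refl]) (rule const)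
  then have "of_nat N * r 0 = 0" by (simp only: sum sum_constant card_lessThan)
  then have "r 0 = 0" using N2 by simp
  then show ?thesis unfolding r_def window_0[OF \<pi> L] .
qed

lemma odd_cocycle_order:
  fixes f :: "('v,'e,'k::field_char_0) pstar"
  assumes f: "f \<in> Pstar_cocycles G N n" and "odd n"
  shows "order_ge 1 (Pstar_eval f p)"
proof (rule order_ge_1I[OF Pstar_cocyclesD[OF f]])
  fix p assume "p \<in> paths G (res_len N n)" "ptgt G p = psrc p"
  then show "vcoeff f p = 0" using assms by (cases n rule: parity_cases) (auto intro!: odd_cocycle_vcoeff)
qed

subsection \<open>Even positive degree\<close>

lemma lookup_lin_ext_delta:
  assumes "\<And>q. Poly_Mapping.lookup (h q) c = (if q = d then w else 0)"
  shows "Poly_Mapping.lookup (lin_ext h x) c = Poly_Mapping.lookup x d * w"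
proof -
  have "Poly_Mapping.lookup (lin_ext h x) c
    = (\<Sum>b\<in>Poly_Mapping.keys x. if b = d then Poly_Mapping.lookup x d * w else 0)"
    unfolding lookup_lin_ext assms by (rule sum.cong) auto
  then show ?thesis by (simp add: in_keys_iff)
qed

lemma lookup_arrow_mult:
  fixes x :: "('v,'e,'k::comm_ring_1) alg"
  assumes "plen a = 1" "plen c = 1"
  shows "Poly_Mapping.lookup (path a \<cdot> x) c = (if c = a then Poly_Mapping.lookup x (ptgt G a, []) else 0)"
    and "Poly_Mapping.lookup (x \<cdot> path a) c = (if c = a then Poly_Mapping.lookup x (psrc a, []) else 0)"
proof -
  have m: "path a \<cdot> x = lin_ext (\<lambda>q. path_prod G N a q) x" "x \<cdot> path a = lin_ext (\<lambda>q. path_prod G N q a) x"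
    by (simp_all add: A_mult_def)
  have l: "Poly_Mapping.lookup (path_prod G N a q) c = (if q = (ptgt G a, []) then if c = a then 1 else 0 else (0 :: 'k))"
    "Poly_Mapping.lookup (path_prod G N q a) c = (if q = (psrc a, []) then if c = a then 1 else 0 else (0 :: 'k))" for q
  proof -
    show "Poly_Mapping.lookup (path_prod G N a q) c = (if q = (ptgt G a, []) then if c = a then 1 else 0 else (0 :: 'k))"
    proof (cases "plen q = 0")
      case True
      then have "q = (psrc q, [])" by (simp add: plen_0_iff)
      then show ?thesis using assms N2 by (cases q) (auto simp: path_prod_def lookup_single when_def)
    next
      case False
      then have "pcat a q \<noteq> c" "q \<noteq> (u, [])" for u using assms by auto
      then show ?thesis using False by (auto simp: path_prod_def lookup_single when_def)
    qed
    show "Poly_Mapping.lookup (path_prod G N q a) c = (if q = (psrc a, []) then if c = a then 1 else 0 else (0 :: 'k))"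
    proof (cases "plen q = 0")
      case True
      then have "q = (psrc q, [])" by (simp add: plen_0_iff)
      then show ?thesis using assms N2 by (cases q) (auto simp: path_prod_def lookup_single when_def)
    next
      case False
      then have "pcat q a \<noteq> c" "q \<noteq> (u, [])" for u using assms by auto
      then show ?thesis using False by (auto simp: path_prod_def lookup_single when_def)
    qed
  qed
  show "Poly_Mapping.lookup (path a \<cdot> x) c = (if c = a then Poly_Mapping.lookup x (ptgt G a, []) else 0)"
    "Poly_Mapping.lookup (x \<cdot> path a) c = (if c = a then Poly_Mapping.lookup x (psrc a, []) else 0)"
    unfolding m lookup_lin_ext_delta[of "\<lambda>q. path_prod G N a q", OF l(1)]
      lookup_lin_ext_delta[of "\<lambda>q. path_prod G N q a", OF l(2)] by simp_all
qed

text \<open>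
  The coefficient of an arrow \<open>c\<close> in the cocycle condition at \<open>\<rho>\<close>: each of the two subpaths of length \<open>k N\<close>
  contributes its vertex coefficient if the remaining arrow of \<open>\<rho>\<close> is \<open>c\<close>, and nothing otherwise.
\<close>

lemma even_cocycle_relation:
  assumes f: "f \<in> Pstar_cocycles G N (2 * k)" and \<rho>: "\<rho> \<in> paths G (k * N + 1)" and c: "plen c = 1"
  shows "(if c = pseg G 0 1 \<rho> then Poly_Mapping.lookup (Pstar_eval f (pdrop G 1 \<rho>)) (psrc (pdrop G 1 \<rho>), []) else 0)
    = (if c = pdrop G (k * N) \<rho> then Poly_Mapping.lookup (Pstar_eval f (pseg G 0 (k * N) \<rho>)) (ptgt G (pseg G 0 (k * N) \<rho>), []) else 0)"
proof -
  have p: "plen \<rho> = k * N + 1" using \<rho> by (rule plen_paths)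
  have "Pstar_eval (Pstar_diff G N (2 * k) f) \<rho> = 0"
    using f by (simp add: Pstar_cocycles_def Pstar_eval_def)
  then have 0: "Pstar_hom G N f (P_diff G N (Suc (2 * k)) (pt (Suc (2 * k)) \<rho> 0)) = 0"
    using \<rho> by (simp add: Pstar_eval_diff)
  have fP: "f \<in> Pstar G N (2 * k)" by (rule Pstar_cocyclesD[OF f])
  have "Pstar_hom G N f (P_diff G N (Suc (2 * k)) (pt (Suc (2 * k)) \<rho> 0))
    = Pstar_hom G N f (pt (2 * k) \<rho> 1) - Pstar_hom G N f (pt (2 * k) \<rho> 0)"
    by (subst P_diff_odd_pt) (use p in \<open>simp_all add: linmap_diff[OF linmap_Pstar_hom[OF linmap_id]]\<close>)
  also have "Pstar_hom G N f (pt (2 * k) \<rho> 1) = path (pseg G 0 1 \<rho>) \<cdot> (Pstar_eval f (pdrop G 1 \<rho>) \<cdot> idem (ptgt G (pdrop G 1 \<rho>)))"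
    using p by (subst Pstar_hom_pt) (simp_all add: pseg_rest[of \<rho> "Suc 0" "k * N"] pdrop_all mult_assoc)
  also have "\<dots> = path (pseg G 0 1 \<rho>) \<cdot> Pstar_eval f (pdrop G 1 \<rho>)"
    using Pstar_eval_parallel(3)[OF fP, of "pdrop G 1 \<rho>"] by simp
  also have "Pstar_hom G N f (pt (2 * k) \<rho> 0)
    = idem (psrc (pseg G 0 (k * N) \<rho>)) \<cdot> Pstar_eval f (pseg G 0 (k * N) \<rho>) \<cdot> path (pdrop G (k * N) \<rho>)"
    using p by (subst Pstar_hom_pt) simp_all
  also have "\<dots> = Pstar_eval f (pseg G 0 (k * N) \<rho>) \<cdot> path (pdrop G (k * N) \<rho>)"
    using Pstar_eval_parallel(2)[OF fP, of "pseg G 0 (k * N) \<rho>"] by simp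
  finally have "path (pseg G 0 1 \<rho>) \<cdot> Pstar_eval f (pdrop G 1 \<rho>)
    = Pstar_eval f (pseg G 0 (k * N) \<rho>) \<cdot> path (pdrop G (k * N) \<rho>)"
    using 0 by simp
  then have eq: "Poly_Mapping.lookup (path (pseg G 0 1 \<rho>) \<cdot> Pstar_eval f (pdrop G 1 \<rho>)) c
    = Poly_Mapping.lookup (Pstar_eval f (pseg G 0 (k * N) \<rho>) \<cdot> path (pdrop G (k * N) \<rho>)) c" by simp
  have l: "plen (pseg G 0 1 \<rho>) = 1" "plen (pdrop G (k * N) \<rho>) = 1" using p by simp_all
  have e: "ptgt G (pseg G 0 1 \<rho>) = psrc (pdrop G 1 \<rho>)"
    "psrc (pdrop G (k * N) \<rho>) = ptgt G (pseg G 0 (k * N) \<rho>)" by simp_all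
  from eq show ?thesis
    unfolding lookup_arrow_mult(1)[OF l(1) c] lookup_arrow_mult(2)[OF l(2) c] e .
qed

end

lemma (in wf_digraph) connected_closed_set:
  assumes conn: "connected G" and S: "S \<noteq> {}" "S \<subseteq> verts G"
    and head: "\<And>e. e \<in> arcs G \<Longrightarrow> tail G e \<in> S \<Longrightarrow> head G e \<in> S"
    and tail: "\<And>e. e \<in> arcs G \<Longrightarrow> head G e \<in> S \<Longrightarrow> tail G e \<in> S"
  shows "verts G = S"
proof
  obtain u where u: "u \<in> S" using S by auto
  show "verts G \<subseteq> S"
  proof
    fix v assume v: "v \<in> verts G"
    have "(u, v) \<in> rtrancl_on (verts G) (arcs_ends (with_proj (mk_symmetric G)))"
      using conn u v S by (auto simp: connected_def strongly_connected_def reachable_def mk_symmetric_def)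
    then show "v \<in> S"
    proof (induction rule: rtrancl_on_induct)
      case (step x y)
      have "arcs_ends (with_proj (mk_symmetric G)) = {(a, b). (a, b) \<in> arcs_ends G \<or> (b, a) \<in> arcs_ends G}"
        by (auto simp: mk_symmetric_def arcs_ends_def arc_to_ends_def image_iff)
      then have "(x, y) \<in> arcs_ends G \<or> (y, x) \<in> arcs_ends G" using step by auto
      then show ?case using step.IH head tail by (auto simp: arcs_ends_def arc_to_ends_def)
    qed (rule u)
  qed
qed (rule S(2))

lemma (in pre_digraph) closed_walk_tails_heads:
  assumes "cas u p u" "p \<noteq> []"
  shows "tail G ` set p = head G ` set p"
proof -
  have "cas w q z \<Longrightarrow> insert z (tail G ` set q) = insert w (head G ` set q)" for w q z
    by (induction q arbitrary: w) auto
  from this[OF assms(1)] have 1: "insert u (tail G ` set p) = insert u (head G ` set p)" .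
  have "cas w q z \<Longrightarrow> q \<noteq> [] \<Longrightarrow> z \<in> head G ` set q" for w q z
    by (induction q arbitrary: w) (auto, metis cas.simps(1))
  then have "u \<in> head G ` set p" using assms by blast
  moreover have "u \<in> tail G ` set p" using assms by (cases p) auto
  ultimately show ?thesis using 1 by (metis insert_absorb)
qed

text \<open>
  A cycle exists by hypothesis. Its vertices are closed under arrows in both directions, since there is
  only one arrow to follow, so that they are all vertices by connectedness.
\<close>

lemma (in wf_digraph) oriented_cycleI:
  assumes conn: "connected G" and p: "closed_w p"
    and out: "\<And>e e'. e \<in> arcs G \<Longrightarrow> e' \<in> arcs G \<Longrightarrow> tail G e = tail G e' \<Longrightarrow> e = e'"
    and inn: "\<And>e e'. e \<in> arcs G \<Longrightarrow> e' \<in> arcs G \<Longrightarrow> head G e = head G e' \<Longrightarrow> e = e'"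
  shows "is_oriented_cycle G"
proof -
  obtain q where q: "cycle q" using closed_w_imp_cycle[OF p] by blast
  then obtain u where u: "awalk u q u" "q \<noteq> []" by (auto simp: cycle_def)
  then have th: "tail G ` set q = head G ` set q" by (intro closed_walk_tails_heads) auto
  have qa: "set q \<subseteq> arcs G" using u by auto
  have v: "verts G = tail G ` set q"
  proof (rule connected_closed_set[OF conn])
    fix e assume e: "e \<in> arcs G"
    show "head G e \<in> tail G ` set q" if "tail G e \<in> tail G ` set q"
      using that out[OF e] qa by (subst th) blast
    show "tail G e \<in> tail G ` set q" if "head G e \<in> tail G ` set q"
      using that inn[OF e] qa by (subst (asm) th) blast
  qed (use u qa in auto)
  have "arcs G \<subseteq> set q"
  proof
    fix e assume e: "e \<in> arcs G"
    then have "tail G e \<in> tail G ` set q" using v by auto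
    then obtain e' where "e' \<in> set q" "tail G e = tail G e'" by blast
    then show "e \<in> set q" using out[OF e, of e'] qa by auto
  qed
  then show ?thesis using q v qa unfolding is_oriented_cycle_def by blast
qed

lemma ptgt_Cons: "ptgt G (v, e # es) = ptgt G (head G e, es)"
  by (simp add: ptgt_def)

context truncated_quiver begin

context
  fixes f :: "('v,'e,'k::comm_ring_1) pstar" and k :: nat
  assumes f: "f \<in> Pstar_cocycles G N (2 * k)" and k: "0 < k"
begin

lemma vcoeff_path:
  assumes "vcoeff f \<pi> \<noteq> 0"
  shows "\<pi> \<in> paths G (k * N)" "ptgt G \<pi> = psrc \<pi>"
  using vertex_key[OF Pstar_cocyclesD[OF f], of "psrc \<pi>" \<pi>] assms by (auto simp: in_keys_iff)

text \<open>
  Prolong \<open>\<pi>\<close> by \<open>e\<close> and compare the coefficients of \<open>e\<close>: the initial part \<open>\<pi>\<close> contributes its nonzero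
  vertex coefficient, so the other side has to contribute too.
\<close>

lemma vcoeff_out:
  assumes \<pi>: "vcoeff f \<pi> \<noteq> 0" and e: "e \<in> arcs G" "tail G e = psrc \<pi>"
  shows "(psrc \<pi>, [e]) = pseg G 0 1 \<pi>" "\<exists>\<tau>. psrc \<tau> = head G e \<and> vcoeff f \<tau> \<noteq> 0"
proof -
  note p = vcoeff_path[OF \<pi>]
  have l: "plen \<pi> = k * N" by (rule plen_paths[OF p(1)])
  have kN: "1 \<le> k * N" using k N2 by (simp add: Suc_leI)
  let ?c = "(psrc \<pi>, [e])" let ?\<rho> = "pcat \<pi> ?c"
  have c: "?c \<in> paths G 1" using e tail_in_verts[OF e(1)] by (auto simp: paths_def plen_def psrc_def ptgt_def awalk_def)
  have \<rho>: "?\<rho> \<in> paths G (k * N + 1)" by (rule pcat_in_paths[OF p(1) c]) (simp add: p)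
  have s: "pseg G 0 (k * N) ?\<rho> = \<pi>" "pdrop G (k * N) ?\<rho> = ?c" "pseg G 0 1 ?\<rho> = pseg G 0 1 \<pi>"
    using l kN p by (simp_all add: pseg_pcat1 pseg_all pdrop_pcat1 pdrop_all)
  have "(if ?c = pseg G 0 1 ?\<rho> then vcoeff f (pdrop G 1 ?\<rho>) else 0) = vcoeff f \<pi>"
    using even_cocycle_relation[OF f \<rho>, of ?c] c unfolding s by (simp add: plen_paths p)
  with \<pi> have r: "?c = pseg G 0 1 ?\<rho>" "vcoeff f (pdrop G 1 ?\<rho>) \<noteq> 0" by (auto split: if_splits)
  show "?c = pseg G 0 1 \<pi>" using r(1) unfolding s(3) .
  have "psrc (pdrop G 1 ?\<rho>) = ptgt G (pseg G 0 1 ?\<rho>)" by simp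
  also have "\<dots> = head G e" by (simp only: r(1)[symmetric]) (simp add: ptgt_Cons)
  finally show "\<exists>\<tau>. psrc \<tau> = head G e \<and> vcoeff f \<tau> \<noteq> 0" using r(2) by blast
qed

text \<open>
  The mirror image, with \<open>e\<close> put in front of \<open>\<pi>\<close>.
\<close>

lemma vcoeff_in:
  assumes \<pi>: "vcoeff f \<pi> \<noteq> 0" and e: "e \<in> arcs G" "head G e = psrc \<pi>"
  shows "(tail G e, [e]) = pdrop G (k * N - 1) \<pi>" "\<exists>\<tau>. psrc \<tau> = tail G e \<and> vcoeff f \<tau> \<noteq> 0"
proof -
  note p = vcoeff_path[OF \<pi>]
  have l: "plen \<pi> = k * N" by (rule plen_paths[OF p(1)])
  obtain M where M: "k * N = Suc M" using k N2 by (cases "k * N") auto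
  let ?c = "(tail G e, [e])" let ?\<rho> = "pcat ?c \<pi>"
  have c: "?c \<in> paths G 1" using e tail_in_verts[OF e(1)] by (auto simp: paths_def plen_def psrc_def ptgt_def awalk_def)
  have t: "ptgt G ?c = psrc \<pi>" using e by (simp add: ptgt_def)
  have \<rho>: "?\<rho> \<in> paths G (k * N + 1)" using pcat_in_paths[OF c p(1) t] by simp
  have s: "pseg G 0 1 ?\<rho> = ?c" "pdrop G 1 ?\<rho> = \<pi>" "pdrop G (k * N) ?\<rho> = pdrop G (k * N - 1) \<pi>"
    using l p e unfolding M
    by (auto simp: pseg_def pdrop_def pcat_def psrc_def ptgt_Cons plen_def prod_eq_iff)
  have "vcoeff f \<pi> = (if ?c = pdrop G (k * N) ?\<rho> then
      Poly_Mapping.lookup (Pstar_eval f (pseg G 0 (k * N) ?\<rho>)) (ptgt G (pseg G 0 (k * N) ?\<rho>), []) else 0)"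
    using even_cocycle_relation[OF f \<rho>, of ?c] c unfolding s by (simp add: plen_paths)
  with \<pi> have r: "?c = pdrop G (k * N) ?\<rho>"
    "Poly_Mapping.lookup (Pstar_eval f (pseg G 0 (k * N) ?\<rho>)) (ptgt G (pseg G 0 (k * N) ?\<rho>), []) \<noteq> 0"
    by (auto split: if_splits)
  show "?c = pdrop G (k * N - 1) \<pi>" using r(1) unfolding s(3) .
  have "psrc (pseg G 0 (k * N) ?\<rho>) = tail G e" by (simp add: pseg_def psrc_def pcat_def)
  moreover have "ptgt G (pseg G 0 (k * N) ?\<rho>) = psrc (pseg G 0 (k * N) ?\<rho>)"
    using r(2) by (intro vertex_key(1)[OF Pstar_cocyclesD[OF f]]) (simp only: in_keys_iff not_False_eq_True)
  ultimately show "\<exists>\<tau>. psrc \<tau> = tail G e \<and> vcoeff f \<tau> \<noteq> 0" using r(2) by metis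
qed

text \<open>
  The base vertices of closed paths with nonzero coefficient are closed under arrows in both
  directions, hence all vertices; so every vertex has at most one arrow in each direction.
\<close>

lemma even_cocycle_vcoeff:
  assumes conn: "connected G" and cyc: "\<not> is_oriented_cycle G"
  shows "vcoeff f \<pi> = 0"
proof (rule ccontr)
  assume \<pi>: "vcoeff f \<pi> \<noteq> 0"
  let ?S = "{psrc \<tau> | \<tau>. vcoeff f \<tau> \<noteq> 0}"
  have S: "verts G = ?S"
  proof (rule connected_closed_set[OF conn])
    show "?S \<noteq> {}" using \<pi> by blast
    show "?S \<subseteq> verts G" using vcoeff_path(1) psrc_in_verts by blast
    fix e assume e: "e \<in> arcs G"
    show "head G e \<in> ?S" if "tail G e \<in> ?S"
      using that vcoeff_out(2)[OF _ e] by (auto; metis)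
    show "tail G e \<in> ?S" if "head G e \<in> ?S"
      using that vcoeff_in(2)[OF _ e] by (auto; metis)
  qed
  have "is_oriented_cycle G"
  proof (rule oriented_cycleI[OF conn])
    show "closed_w (snd \<pi>)"
      using vcoeff_path[OF \<pi>] k N2 by (auto simp: closed_w_def paths_def plen_def)
    fix e e' assume e: "e \<in> arcs G" "e' \<in> arcs G"
    show "e = e'" if "tail G e = tail G e'"
    proof -
      have "tail G e \<in> ?S" using e S by auto
      then obtain \<tau> where \<tau>: "vcoeff f \<tau> \<noteq> 0" "tail G e = psrc \<tau>" by auto
      then have "(psrc \<tau>, [e]) = (psrc \<tau>, [e'])"
        using vcoeff_out(1)[OF \<tau>(1) e(1)] vcoeff_out(1)[OF \<tau>(1) e(2)] that by simp
      then show ?thesis by simp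
    qed
    show "e = e'" if "head G e = head G e'"
    proof -
      have "head G e \<in> ?S" using e S by auto
      then obtain \<tau> where \<tau>: "vcoeff f \<tau> \<noteq> 0" "head G e = psrc \<tau>" by auto
      then have "(tail G e, [e]) = (tail G e', [e'])"
        using vcoeff_in(1)[OF \<tau>(1) e(1)] vcoeff_in(1)[OF \<tau>(1) e(2)] that by simp
      then show ?thesis by simp
    qed
  qed
  with cyc show False by simp
qed

end

lemma positive_cocycle_order:
  fixes f :: "('v,'e,'k::field_char_0) pstar"
  assumes f: "f \<in> Pstar_cocycles G N n" and n: "0 < n"
    and conn: "connected G" and cyc: "\<not> is_oriented_cycle G"
  shows "order_ge 1 (Pstar_eval f p)"
proof (cases "odd n")
  case True
  then show ?thesis by (rule odd_cocycle_order[OF f])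
next
  case False
  then obtain k where k: "n = 2 * k" by blast
  have "vcoeff f \<pi> = 0" for \<pi>
    by (rule even_cocycle_vcoeff[OF f[unfolded k] _ conn cyc]) (use n k in simp)
  then show ?thesis by (rule order_ge_1I[OF Pstar_cocyclesD[OF f]])
qed

section \<open>The product on cohomology\<close>

lemma HH_ring: "ring (HH G N :: ('v,'e,'k::comm_ring_1) cochain set ring)"
  unfolding HH_def by (rule ideal.quotient_is_ring[OF coboundaries_ideal])

lemma HH_class_hom: "HH_class G N \<in> ring_hom (hoch_cocycle_ring G N) (HH G N)"
  unfolding HH_def HH_class_def[abs_def] by (rule ideal.rcos_ring_hom[OF coboundaries_ideal])

lemma HH_carrier: "carrier (HH G N) = HH_class G N ` carrier (hoch_cocycle_ring G N)"
  by (auto simp: HH_def FactRing_def A_RCOSETS_def' HH_class_def)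

lemma HH_one: "\<one>\<^bsub>HH G N\<^esub> = HH_class G N (hoch_scalar G 1)"
  by (simp add: HH_def FactRing_def HH_class_def)

lemma HH_deg_carrier: "x \<in> HH_deg G N n \<Longrightarrow> x \<in> carrier (HH G N)"
  by (auto simp: HH_deg_def HH_carrier)

text \<open>
  All comparison morphisms induce the same identification: both sides are the class of the cochain
  obtained from \<open>canon\<close>, whose pullback is \<open>f\<close>.
\<close>

lemma comparison_class_canon:
  assumes \<psi>: "is_comparison G N \<psi>" and f: "f \<in> Pstar_cocycles G N n"
  shows "comparison_class G N \<psi> n f = comparison_class G N canon n f"
proof -
  have "HH_class G N (comp_cochain canon n f) = comparison_class G N \<psi> n (pull n (comp_cochain canon n f))"
    by (intro HH_class_pull \<psi> comp_cochain_cocycle comp_cochain_homogeneous canon_comparison f Pstar_cocyclesD[OF f])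
  then show ?thesis by (simp add: pull_comp_cochain[OF Pstar_cocyclesD[OF f]] comparison_class_eq)
qed

lemma comparison_class_image:
  "comparison_class G N canon n ` Pstar_cocycles G N n = HH_deg G N n"
proof (intro equalityI subsetI)
  fix x assume "x \<in> comparison_class G N canon n ` Pstar_cocycles G N n"
  then obtain f where f: "f \<in> Pstar_cocycles G N n" "x = HH_class G N (comp_cochain canon n f)"
    by (auto simp: comparison_class_eq)
  with comp_cochain_cocycle[OF canon_comparison f(1)]
    comp_cochain_homogeneous[OF canon_comparison Pstar_cocyclesD[OF f(1)]]
  show "x \<in> HH_deg G N n" by (simp add: HH_deg_def)
next
  fix x assume "x \<in> HH_deg G N n"
  then obtain F where F: "cocycle F" "F \<in> hoch_homogeneous G N n" "x = HH_class G N F"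
    by (auto simp: HH_deg_def)
  then have "x = comparison_class G N canon n (pull n F)"
    by (simp add: HH_class_pull[OF canon_comparison F(1,2)])
  then show "x \<in> comparison_class G N canon n ` Pstar_cocycles G N n" using pull_cocycle[OF F(1)] by blast
qed

text \<open>
  Comparison morphisms map coboundaries to coboundaries; conversely \<open>f\<close> is the pullback of its image, and
  pullbacks of coboundaries are coboundaries.
\<close>

lemma comparison_class_zero_iff:
  assumes f: "f \<in> Pstar_cocycles G N n"
  shows "comparison_class G N canon n f = \<zero>\<^bsub>HH G N\<^esub> \<longleftrightarrow> f \<in> Pstar_coboundaries G N n"
proof -
  have "comparison_class G N canon n f = \<zero>\<^bsub>HH G N\<^esub> \<longleftrightarrow> comp_cochain canon n f \<in> hoch_coboundaries G N"
    unfolding comparison_class_eq by (rule HH_class_zero_iff[OF comp_cochain_cocycle[OF canon_comparison f]])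
  also have "\<dots> \<longleftrightarrow> f \<in> Pstar_coboundaries G N n"
  proof
    assume "comp_cochain canon n f \<in> hoch_coboundaries G N"
    then obtain K where K: "K \<in> hoch_cochains G N" "comp_cochain canon n f = hoch_diff G N K"
      by (auto simp: hoch_coboundaries_def)
    then have fK: "f = pull n (hoch_diff G N K)" using pull_comp_cochain[OF Pstar_cocyclesD[OF f]] by simp
    show "f \<in> Pstar_coboundaries G N n"
    proof (cases n)
      case 0
      have "comp_cochain canon n f = (\<lambda>_. 0)"
      proof
        fix xs show "comp_cochain canon n f xs = 0"
        proof (cases "xs = []")
          case True
          then show ?thesis unfolding K(2) by (simp add: hoch_diff_eq)
        next
          case False
          then show ?thesis using 0 by (simp add: comp_cochain_def)
        qed
      qed
      then have "hoch_diff G N K = (\<lambda>_. 0)" using K(2) by simp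
      then have "f = 0" unfolding fK by (simp only: pull_zero)
      then show ?thesis using 0 by (simp add: Pstar_coboundaries_def)
    next
      case (Suc m)
      then have "f = Pstar_diff G N m (pull m K)" using fK pull_chain[OF K(1)] by simp
      then show ?thesis using pull_Pstar[OF hoch_cochainsD(1,2)[OF K(1)]] Suc by (simp add: Pstar_coboundaries_def)
    qed
  next
    assume c: "f \<in> Pstar_coboundaries G N n"
    show "comp_cochain canon n f \<in> hoch_coboundaries G N"
    proof (cases n)
      case 0
      then have "comp_cochain canon n f = (\<lambda>_. 0)" using c by (simp add: Pstar_coboundaries_def comp_cochain_zero)
      then show ?thesis using additive_subgroup.zero_closed[OF ideal.axioms(1)[OF coboundaries_ideal]] by simp
    next
      case (Suc m)
      with c obtain g where g: "g \<in> Pstar G N m" "f = Pstar_diff G N m g" by (auto simp: Pstar_coboundaries_def)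
      then have "comp_cochain canon n f = hoch_diff G N (comp_cochain canon m g)"
        using comp_cochain_diff[OF canon_comparison g(1)] Suc by simp
      then show ?thesis
        using homogeneous_cochain[OF comp_cochain_homogeneous[OF canon_comparison g(1)]]
        by (simp only: hoch_coboundaries_def imageI)
    qed
  qed
  finally show ?thesis .
qed

lemma comparison_class_0: "comparison_class G N canon n 0 = \<zero>\<^bsub>HH G N\<^esub>"
  unfolding comparison_class_eq comp_cochain_zero HH_class_zero_iff[OF zero_cocycle]
  using additive_subgroup.zero_closed[OF ideal.axioms(1)[OF coboundaries_ideal]] by simp

lemma zero_Pstar_cocycle: "0 \<in> Pstar_cocycles G N n"
  using pull_cocycle[OF zero_cocycle, of n] by (simp add: pull_zero)

lemma pull_cup:
  fixes f g :: "('v,'e,'k::field_char_0) pstar"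
  assumes f: "f \<in> Pstar_cocycles G N m" and g: "g \<in> Pstar_cocycles G N n"
  shows "pull (m + n) (cup G N (comp_cochain canon m f) (comp_cochain canon n g)) = vee G N m n f g"
proof (cases "even m \<or> even n")
  case True
  then show ?thesis by (rule pull_cup_eq_vee[OF Pstar_cocyclesD[OF f] Pstar_cocyclesD[OF g]])
next
  case False
  then have "odd m" "odd n" by auto
  then show ?thesis
    using pull_cup_odd[OF Pstar_cocyclesD[OF f] odd_cocycle_order[OF f] Pstar_cocyclesD[OF g] odd_cocycle_order[OF g]]
    by (simp add: vee_def)
qed

lemma vee_cocycle:
  fixes f g :: "('v,'e,'k::field_char_0) pstar"
  assumes f: "f \<in> Pstar_cocycles G N m" and g: "g \<in> Pstar_cocycles G N n"
  shows "vee G N m n f g \<in> Pstar_cocycles G N (m + n)"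
  unfolding pull_cup[OF assms, symmetric]
  by (intro pull_cocycle cup_cocycle comp_cochain_cocycle canon_comparison assms)

lemma comparison_class_vee:
  fixes f g :: "('v,'e,'k::field_char_0) pstar"
  assumes f: "f \<in> Pstar_cocycles G N m" and g: "g \<in> Pstar_cocycles G N n"
  shows "comparison_class G N canon (m + n) (vee G N m n f g)
    = comparison_class G N canon m f \<otimes>\<^bsub>HH G N\<^esub> comparison_class G N canon n g"
proof -
  note c = comp_cochain_cocycle[OF canon_comparison f] comp_cochain_cocycle[OF canon_comparison g]
  note h = comp_cochain_homogeneous[OF canon_comparison Pstar_cocyclesD[OF f]]
    comp_cochain_homogeneous[OF canon_comparison Pstar_cocyclesD[OF g]]
  have "HH_class G N (cup G N (comp_cochain canon m f) (comp_cochain canon n g))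
    = comparison_class G N canon (m + n) (vee G N m n f g)"
    unfolding pull_cup[OF assms, symmetric] by (rule HH_class_pull[OF canon_comparison cup_cocycle[OF c] homogeneous_cup[OF h]])
  then show ?thesis by (simp add: comparison_class_eq HH_class_cup[OF c])
qed

lemma comparison_class_carrier:
  "f \<in> Pstar_cocycles G N n \<Longrightarrow> comparison_class G N canon n f \<in> carrier (HH G N)"
  using comparison_class_image[of n] HH_deg_carrier by blast

lemma vee_coboundary:
  fixes f g :: "('v,'e,'k::field_char_0) pstar"
  assumes f: "f \<in> Pstar_cocycles G N m" and g: "g \<in> Pstar_cocycles G N n"
    and "f \<in> Pstar_coboundaries G N m \<or> g \<in> Pstar_coboundaries G N n"
  shows "vee G N m n f g \<in> Pstar_coboundaries G N (m + n)"
proof -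
  interpret H: ring "HH G N :: ('v,'e,'k) cochain set ring" by (rule HH_ring)
  have "comparison_class G N canon m f \<otimes>\<^bsub>HH G N\<^esub> comparison_class G N canon n g = \<zero>\<^bsub>HH G N\<^esub>"
    using assms(3)
  proof
    assume "f \<in> Pstar_coboundaries G N m"
    then have "comparison_class G N canon m f = \<zero>\<^bsub>HH G N\<^esub>" by (simp only: comparison_class_zero_iff[OF f])
    then show ?thesis by (simp only: H.l_null[OF comparison_class_carrier[OF g]])
  next
    assume "g \<in> Pstar_coboundaries G N n"
    then have "comparison_class G N canon n g = \<zero>\<^bsub>HH G N\<^esub>" by (simp only: comparison_class_zero_iff[OF g])
    then show ?thesis by (simp only: H.r_null[OF comparison_class_carrier[OF f]])
  qed
  then show ?thesis
    by (simp only: comparison_class_vee[OF f g, symmetric] comparison_class_zero_iff[OF vee_cocycle[OF f g]])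
qed

lemma class_product_odd:
  fixes x y :: "('v,'e,'k::field_char_0) cochain set"
  assumes "odd m" "odd n" "x \<in> HH_deg G N m" "y \<in> HH_deg G N n"
  shows "x \<otimes>\<^bsub>HH G N\<^esub> y = \<zero>\<^bsub>HH G N\<^esub>"
proof -
  obtain f g where f: "f \<in> Pstar_cocycles G N m" "x = comparison_class G N canon m f"
    and g: "g \<in> Pstar_cocycles G N n" "y = comparison_class G N canon n g"
    using assms(3,4) unfolding comparison_class_image[symmetric] by blast
  have "vee G N m n f g = vee G N m n 0 g" using assms(1,2) by (simp add: vee_def)
  moreover have "vee G N m n 0 g \<in> Pstar_coboundaries G N (m + n)"
    using comparison_class_0 comparison_class_zero_iff[OF zero_Pstar_cocycle]
    by (intro vee_coboundary[OF zero_Pstar_cocycle g(1)]) blast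
  ultimately have "vee G N m n f g \<in> Pstar_coboundaries G N (m + n)" by simp
  then show ?thesis
    unfolding f(2) g(2) comparison_class_vee[OF f(1) g(1), symmetric]
    by (simp only: comparison_class_zero_iff[OF vee_cocycle[OF f(1) g(1)]])
qed

text \<open>
  The condition is on representatives in the complex of parallel paths. There the product is computed by
  multiplying values, so the exponents \<open>l\<close> add.
\<close>

definition radical_classes :: "nat \<Rightarrow> ('v,'e,'k::comm_ring_1) cochain set set" where
  "radical_classes l = {comparison_class G N canon n f | n f.
     f \<in> Pstar_cocycles G N n \<and> (\<forall>p. order_ge (int l) (Pstar_eval f p))}"

lemma radical_classes_mult:
  fixes x y :: "('v,'e,'k::field_char_0) cochain set"
  assumes "x \<in> radical_classes l" "y \<in> radical_classes l'"
  shows "x \<otimes>\<^bsub>HH G N\<^esub> y \<in> radical_classes (l + l')"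
proof -
  obtain m f n g where f: "f \<in> Pstar_cocycles G N m" "x = comparison_class G N canon m f" "\<And>p. order_ge (int l) (Pstar_eval f p)"
    and g: "g \<in> Pstar_cocycles G N n" "y = comparison_class G N canon n g" "\<And>p. order_ge (int l') (Pstar_eval g p)"
    using assms unfolding radical_classes_def by blast
  have "order_ge (int (l + l')) (Pstar_eval (vee G N m n f g) p)" for p
  proof (cases "even m \<or> even n")
    case True
    then show ?thesis
      using order_ge_mult[OF f(3) g(3)]
      by (simp add: Pstar_eval_vee[OF Pstar_cocyclesD[OF f(1)] Pstar_cocyclesD[OF g(1)] True]) (simp add: order_ge_def)
  qed (simp add: vee_def order_ge_def Pstar_eval_def)
  then show ?thesis
    using vee_cocycle[OF f(1) g(1)]
    unfolding radical_classes_def mem_Collect_eq f(2) g(2) comparison_class_vee[OF f(1) g(1), symmetric] by blast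
qed

lemma one_radical_0: "\<one>\<^bsub>HH G N\<^esub> \<in> radical_classes 0"
proof -
  have "\<one>\<^bsub>HH G N\<^esub> = comparison_class G N canon 0 (pull 0 (hoch_scalar G 1))"
    unfolding HH_one by (rule HH_class_pull[OF canon_comparison scalar_cocycle scalar_cochain])
  moreover have "order_ge (int 0) x" for x by (simp add: order_ge_def)
  ultimately show ?thesis using pull_cocycle[OF scalar_cocycle] unfolding radical_classes_def by blast
qed

lemma radical_classes_N:
  assumes "x \<in> radical_classes N"
  shows "x = \<zero>\<^bsub>HH G N\<^esub>"
proof -
  obtain n f where f: "f \<in> Pstar_cocycles G N n" "x = comparison_class G N canon n f"
    and o: "\<And>p. order_ge (int N) (Pstar_eval f p)"
    using assms unfolding radical_classes_def by blast
  have "f = 0"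
  proof (rule Pstar_eqI)
    show "Pstar_eval f p = Pstar_eval 0 p" for p
    proof -
      have "Pstar_eval f p \<in> carr" by (rule Pstar_eval_parallel(1)[OF Pstar_cocyclesD[OF f(1)]])
      then have "c \<notin> Poly_Mapping.keys (Pstar_eval f p)" for c
        using o[of p] short_pathsD[of c] unfolding order_ge_def A_carrier_def by fastforce
      then have "Pstar_eval f p = 0" by (metis ex_in_conv keys_eq_empty)
      then show ?thesis by (simp add: Pstar_eval_def)
    qed
  qed
  then show ?thesis using f(2) comparison_class_0 by simp
qed

lemma radical_classes_product:
  fixes fs :: "('v,'e,'k::field_char_0) cochain set list"
  assumes "set fs \<subseteq> radical_classes 1"
  shows "foldr (\<otimes>\<^bsub>HH G N\<^esub>) fs \<one>\<^bsub>HH G N\<^esub> \<in> radical_classes (length fs)"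
  using assms
proof (induction fs)
  case (Cons x fs)
  then have "x \<otimes>\<^bsub>HH G N\<^esub> foldr (\<otimes>\<^bsub>HH G N\<^esub>) fs \<one>\<^bsub>HH G N\<^esub> \<in> radical_classes (1 + length fs)"
    by (intro radical_classes_mult) auto
  then show ?case by simp
qed (simp add: one_radical_0)

lemma positive_degree_radical:
  fixes x :: "('v,'e,'k::field_char_0) cochain set"
  assumes "x \<in> HH_deg G N n" "0 < n" "connected G" "\<not> is_oriented_cycle G"
  shows "x \<in> radical_classes 1"
proof -
  obtain f where f: "f \<in> Pstar_cocycles G N n" "x = comparison_class G N canon n f"
    using assms(1) unfolding comparison_class_image[symmetric] by blast
  have "order_ge (int 1) (Pstar_eval f p)" for p
    using positive_cocycle_order[OF f(1) assms(2-4)] by simp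
  then show ?thesis using f unfolding radical_classes_def by blast
qed

section \<open>The quotient by the nilpotent classes\<close>

text \<open>
  The projection of the algebra to its semisimple quotient, at one vertex.
\<close>

lemma lookup_mult_vertex:
  fixes x y :: "('v,'e,'k::comm_ring_1) alg"
  shows "Poly_Mapping.lookup (x \<cdot> y) (v, []) = Poly_Mapping.lookup x (v, []) * Poly_Mapping.lookup y (v, [])"
proof -
  have 1: "Poly_Mapping.lookup (path_prod G N p q) (v, []) = (if q = (v, []) then if p = (v, []) then 1 else 0 else (0 :: 'k))" for p q
    using N2 by (cases p; cases q) (auto simp: path_prod_def lookup_single when_def pcat_def psrc_def plen_def)
  have 2: "Poly_Mapping.lookup (lin_ext (path_prod G N p) y) (v, [])
    = (if p = (v, []) then Poly_Mapping.lookup y (v, []) else 0)" for p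
    using lookup_lin_ext_delta[OF 1, of p y] by simp
  show ?thesis unfolding A_mult_def by (rule lookup_lin_ext_delta[OF 2])
qed

lemma pull_degree_0:
  fixes F :: "('v,'e,'k::comm_ring_1) cochain"
  assumes F: "F \<in> hoch_homogeneous G N 0" and v: "v \<in> verts G"
  shows "vcoeff (pull 0 F) (v, []) = Poly_Mapping.lookup (F []) (v, [])"
proof -
  have "Pstar_eval (pull 0 F) (v, []) = idem (psrc (v, [] :: 'e list)) \<cdot> F (map path (pieces (stdn 0) (v, []))) \<cdot> idem (ptgt G (v, []))"
  proof (rule pull_eval[where H = F and n = 0 and p = "(v, [])"])
    show "multilinear_on carr F" by (rule hoch_cochainsD(1)[OF homogeneous_cochain[OF F]])
    show "F (ys @ idem u # zs) = 0" for ys u zs using F by (simp add: hoch_homogeneous_def)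
    show "F (map path qs) = 0" if "altn 0 (map plen qs)" "\<not> fulln 0 (map plen qs)" for qs
      using that by (simp add: altn_def fulln_def)
    show "(v, []) \<in> paths G (res_len N 0)" using vertex_in_paths[OF v] by (simp add: res_len_def)
  qed
  then have "Pstar_eval (pull 0 F) (v, []) = idem v \<cdot> F [] \<cdot> idem v"
    by (simp add: stdn_def)
  then show ?thesis by (simp add: lookup_mult_vertex)
qed

text \<open>
  This is the relation for even cocycles in degree \<open>0\<close>, read at the two ends of an arrow.
\<close>

lemma degree_0_constant:
  assumes f: "f \<in> Pstar_cocycles G N 0" and conn: "connected G" and "v \<in> verts G" "w \<in> verts G"
  shows "vcoeff f (v, []) = vcoeff f (w, [])"
proof -
  let ?S = "{u \<in> verts G. vcoeff f (u, []) = vcoeff f (w, [])}"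
  have arc: "vcoeff f (head G e, []) = vcoeff f (tail G e, [])" if e: "e \<in> arcs G" for e
  proof -
    let ?c = "(tail G e, [e])"
    have c: "?c \<in> paths G (0 * N + 1)"
      using e tail_in_verts[OF e] by (auto simp: paths_def plen_def psrc_def ptgt_def awalk_def)
    show ?thesis
      using even_cocycle_relation[of f 0, OF _ c, of ?c] f
      by (simp add: pseg_def pdrop_def psrc_def ptgt_Cons plen_def)
  qed
  have "verts G = ?S"
    by (rule connected_closed_set[OF conn]) (use assms(4) arc in auto)
  then show ?thesis using assms(3) by blast
qed

lemma degree_0_radical:
  fixes F :: "('v,'e,'k::comm_ring_1) cochain"
  assumes F: "cocycle F" "F \<in> hoch_homogeneous G N 0" and conn: "connected G"
    and v: "v \<in> verts G" "Poly_Mapping.lookup (F []) (v, []) = 0"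
  shows "HH_class G N F \<in> radical_classes 1"
proof -
  have f: "pull 0 F \<in> Pstar_cocycles G N 0" by (rule pull_cocycle[OF F(1)])
  have "order_ge 1 (Pstar_eval (pull 0 F) p)" for p
  proof (rule order_ge_1I[OF Pstar_cocyclesD[OF f]])
    fix q assume q: "q \<in> paths G (res_len N 0)" "ptgt G q = psrc q"
    then have "q = (psrc q, [])" by (auto simp: res_len_def simp flip: plen_0_iff dest: plen_paths)
    then have "vcoeff (pull 0 F) q = vcoeff (pull 0 F) (psrc q, [])" by simp
    also have "\<dots> = vcoeff (pull 0 F) (v, [])"
      by (rule degree_0_constant[OF f conn psrc_in_verts[OF q(1)] v(1)])
    finally show "vcoeff (pull 0 F) q = 0" using v(2) by (simp only: pull_degree_0[OF F(2) v(1)])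
  qed
  then have "comparison_class G N canon 0 (pull 0 F) \<in> radical_classes 1"
    using f unfolding radical_classes_def by auto
  then show ?thesis by (simp only: HH_class_pull[OF canon_comparison F])
qed

lemma radical_nil_ideal:
  fixes x :: "('v,'e,'k::field_char_0) cochain set"
  assumes x: "x \<in> radical_classes 1"
  shows "x \<in> HH_nil_ideal G N"
proof -
  interpret H: ring "HH G N :: ('v,'e,'k) cochain set ring" by (rule HH_ring)
  let ?X = "{x :: ('v,'e,'k) cochain set. (\<exists>n. x \<in> HH_deg G N n) \<and> (\<exists>m::nat. m > 0 \<and> x [^]\<^bsub>HH G N\<^esub> m = \<zero>\<^bsub>HH G N\<^esub>)}"
  have "x [^]\<^bsub>HH G N\<^esub> n \<in> radical_classes n" for n :: nat
  proof (induction n)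
    case (Suc n)
    from radical_classes_mult[OF this x] show ?case by simp
  qed (simp add: one_radical_0)
  then have "x [^]\<^bsub>HH G N\<^esub> N = \<zero>\<^bsub>HH G N\<^esub>" by (rule radical_classes_N)
  moreover obtain n where "x \<in> HH_deg G N n"
    using x unfolding radical_classes_def comparison_class_image[symmetric] by blast
  ultimately have "x \<in> ?X" using N2 by (intro CollectI conjI exI[of _ n] exI[of _ N]) simp_all
  moreover have "?X \<subseteq> carrier (HH G N)" using HH_deg_carrier by blast
  ultimately show ?thesis unfolding HH_nil_ideal_def using H.genideal_self by blast
qed

lemma HH_class_add:
  "cocycle F \<Longrightarrow> cocycle F' \<Longrightarrow> HH_class G N (\<lambda>xs. F xs + F' xs) = HH_class G N F \<oplus>\<^bsub>HH G N\<^esub> HH_class G N F'"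
  using ring_hom_add[OF HH_class_hom, of F F'] by simp

lemma nil_ideal: "ideal (HH_nil_ideal G N) (HH G N)"
  unfolding HH_nil_ideal_def by (rule ring.genideal_ideal[OF HH_ring]) (use HH_deg_carrier in blast)

lemma degree_component:
  fixes F :: "('v,'e,'k::comm_ring_1) cochain"
  assumes F: "cocycle F" and F': "F' = (\<lambda>xs. if set xs \<subseteq> carr \<and> length xs = n then F xs else 0)"
  shows "cocycle F'" "F' \<in> hoch_homogeneous G N n"
proof -
  have Fc: "F \<in> hoch_cochains G N" and d: "\<And>xs. set xs \<subseteq> carr \<Longrightarrow> cobd F xs = 0"
    using F by (auto simp: cocycle_iff)
  show h: "F' \<in> hoch_homogeneous G N n"
    unfolding F' by (rule restrict_degree_cochain[OF hoch_cochainsD(1)[OF Fc]]) (rule hoch_cochainsD(2)[OF Fc])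
  have "cobd F' xs = 0" if xs: "set xs \<subseteq> carr" for xs
  proof (cases "length xs = Suc n")
    case True
    have "cobd F' xs = cobd F xs" using xs by (rule cobd_cong) (use True in \<open>simp add: F'\<close>)
    then show ?thesis using d[OF xs] by simp
  qed (use xs in \<open>auto simp: F' intro: cobd_degree[of _ n]\<close>)
  then show "cocycle F'" using h by (simp add: cocycle_iff homogeneous_cochain)
qed

text \<open>
  Removing the homogeneous components one by one. They are cocycles, and each of them has a radical
  representative: in positive degree always, in degree \<open>0\<close> because the coefficient at \<open>v\<close> vanishes.
\<close>

lemma class_in_nil_ideal:
  fixes F :: "('v,'e,'k::field_char_0) cochain"
  assumes F: "cocycle F" and conn: "connected G" and cyc: "\<not> is_oriented_cycle G"
    and v: "v \<in> verts G" "Poly_Mapping.lookup (F []) (v, []) = 0"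
  shows "HH_class G N F \<in> HH_nil_ideal G N"
proof -
  interpret J: ideal "HH_nil_ideal G N" "HH G N :: ('v,'e,'k) cochain set ring" by (rule nil_ideal)
  have "HH_class G N F \<in> HH_nil_ideal G N"
    if "cocycle F" "Poly_Mapping.lookup (F []) (v, []) = 0" "\<And>xs. d \<le> length xs \<Longrightarrow> F xs = 0"
    for F :: "('v,'e,'k) cochain" and d
    using that
  proof (induction d arbitrary: F)
    case 0
    then have "F = (\<lambda>_. 0)" by auto
    then have "HH_class G N F = \<zero>\<^bsub>HH G N\<^esub>"
      using comparison_class_0 by (simp add: comparison_class_eq comp_cochain_zero)
    then show ?case by (simp only: additive_subgroup.zero_closed[OF J.is_additive_subgroup])
  next
    case (Suc d)
    define T where "T xs = (if set xs \<subseteq> carr \<and> length xs = d then F xs else 0)" for xs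
    have "T = (\<lambda>xs. if set xs \<subseteq> carr \<and> length xs = d then F xs else 0)" by (rule ext) (rule T_def)
    note T = degree_component[OF Suc.prems(1) this]
    have R: "cocycle (\<lambda>xs. F xs + - T xs)"
      by (rule cocycle_linear(1)[OF Suc.prems(1) cocycle_linear(2)[OF T(1)]])
    have Fout: "F xs = 0" if "\<not> set xs \<subseteq> carr" for xs
      using Suc.prems(1) that by (auto simp: cocycle_iff hoch_cochains_def)
    have "HH_class G N (\<lambda>xs. F xs + - T xs) \<in> HH_nil_ideal G N"
    proof (rule Suc.IH[OF R])
      show "Poly_Mapping.lookup (F [] + - T []) (v, []) = 0" using Suc.prems(2) by (simp add: T_def)
      show "F xs + - T xs = 0" if "d \<le> length xs" for xs
        using Suc.prems(3)[of xs] Fout[of xs] that by (auto simp: T_def not_less_eq_eq)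
    qed
    moreover have "HH_class G N T \<in> HH_nil_ideal G N"
    proof (rule radical_nil_ideal, cases "d = 0")
      case True
      with T Suc.prems(2) show "HH_class G N T \<in> radical_classes 1"
        by (intro degree_0_radical[OF T(1) _ conn v(1)]) (simp_all add: T_def)
    next
      case False
      with T show "HH_class G N T \<in> radical_classes 1"
        by (intro positive_degree_radical[of _ d] conn cyc) (auto simp: HH_deg_def)
    qed
    ultimately have "HH_class G N (\<lambda>xs. F xs + - T xs) \<oplus>\<^bsub>HH G N\<^esub> HH_class G N T \<in> HH_nil_ideal G N"
      by (rule additive_subgroup.a_closed[OF J.is_additive_subgroup])
    then have "HH_class G N (\<lambda>xs. F xs + - T xs + T xs) \<in> HH_nil_ideal G N"
      by (simp only: HH_class_add[OF R T(1)])
    then show ?case by simp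
  qed
  moreover obtain d where "\<And>xs. d \<le> length xs \<Longrightarrow> F xs = 0"
    using F by (auto simp: cocycle_iff hoch_cochains_def)
  ultimately show ?thesis using F v(2) by blast
qed

text \<open>
  Well defined because coboundaries vanish in degree \<open>0\<close>.
\<close>

definition vertex_value :: "'v \<Rightarrow> ('v,'e,'k::comm_ring_1) cochain set \<Rightarrow> 'k" where
  "vertex_value v B = the_elem ((\<lambda>F. Poly_Mapping.lookup (F []) (v, [])) ` B)"

lemma vertex_value_class:
  assumes "cocycle F"
  shows "vertex_value v (HH_class G N F) = Poly_Mapping.lookup (F []) (v, [])"
proof -
  interpret ideal "hoch_coboundaries G N" "hoch_cocycle_ring G N :: ('v,'e,'a) cochain ring"
    by (rule coboundaries_ideal)
  have "Poly_Mapping.lookup (F' []) (v, []) = Poly_Mapping.lookup (F []) (v, [])" if "F' \<in> HH_class G N F" for F'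
    using that unfolding HH_class_def a_r_coset_def' hoch_coboundaries_def by (auto simp: hoch_diff_eq)
  moreover have "F \<in> HH_class G N F" unfolding HH_class_def by (rule a_rcos_self[OF assms])
  ultimately have "(\<lambda>F. Poly_Mapping.lookup (F []) (v, [])) ` HH_class G N F = {Poly_Mapping.lookup (F []) (v, [])}"
    by blast
  then show ?thesis by (simp add: vertex_value_def)
qed

lemma lookup_scalar:
  assumes "v \<in> verts G"
  shows "Poly_Mapping.lookup (hoch_scalar G c []) (v, []) = c"
proof -
  have "Poly_Mapping.lookup (A_one G) (v, []) = (\<Sum>u\<in>verts G. if u = v then 1 else (0 :: 'a))"
    unfolding A_one_def lookup_sum by (rule sum.cong) (auto simp: lookup_single when_def)
  then show ?thesis using assms by (simp add: hoch_scalar_def)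
qed

lemma vertex_value_hom:
  assumes v: "v \<in> verts G"
  shows "ring_hom_ring (HH G N) (ring_of_type_algebra :: 'k::comm_ring_1 ring) (vertex_value v)"
proof (rule ring_hom_ringI2[OF HH_ring ring_from_type_algebra ring_hom_memI])
  show "vertex_value v \<one>\<^bsub>HH G N\<^esub> = \<one>\<^bsub>(ring_of_type_algebra :: 'k ring)\<^esub>"
    by (simp add: HH_one vertex_value_class[OF scalar_cocycle] lookup_scalar[OF v] ring_of_type_algebra_def)
  fix x y :: "('v,'e,'k) cochain set"
  assume "x \<in> carrier (HH G N)" "y \<in> carrier (HH G N)"
  then obtain F F' where F: "cocycle F" "cocycle F'" and e: "x = HH_class G N F" "y = HH_class G N F'"
    by (auto simp: HH_carrier)
  show "vertex_value v (x \<otimes>\<^bsub>HH G N\<^esub> y) = vertex_value v x \<otimes>\<^bsub>ring_of_type_algebra\<^esub> vertex_value v y"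
    unfolding e HH_class_cup[OF F] vertex_value_class[OF F(1)] vertex_value_class[OF F(2)]
      vertex_value_class[OF cup_cocycle[OF F]]
    by (simp add: cup_Nil lookup_mult_vertex ring_of_type_algebra_def)
  show "vertex_value v (x \<oplus>\<^bsub>HH G N\<^esub> y) = vertex_value v x \<oplus>\<^bsub>ring_of_type_algebra\<^esub> vertex_value v y"
    unfolding e HH_class_add[OF F, symmetric] vertex_value_class[OF F(1)] vertex_value_class[OF F(2)]
      vertex_value_class[OF cocycle_linear(1)[OF F]]
    by (simp add: lookup_add ring_of_type_algebra_def)
qed (simp add: ring_of_type_algebra_def)

text \<open>
  A ring homomorphism to a field annihilates nilpotent elements and hence the ideal that they generate.
\<close>

lemma vertex_value_nil:
  fixes x :: "('v,'e,'k::field) cochain set"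
  assumes v: "v \<in> verts G" and x: "x \<in> HH_nil_ideal G N"
  shows "vertex_value v x = 0"
proof -
  let ?K = "ring_of_type_algebra :: 'k ring"
  interpret \<epsilon>: ring_hom_ring "HH G N" ?K "vertex_value v" by (rule vertex_value_hom[OF v])
  have "HH_nil_ideal G N \<subseteq> a_kernel (HH G N) ?K (vertex_value v)"
    unfolding HH_nil_ideal_def
  proof (rule \<epsilon>.R.genideal_minimal[OF \<epsilon>.kernel_is_ideal], rule subsetI)
    fix x :: "('v,'e,'k) cochain set"
    assume "x \<in> {x. (\<exists>n. x \<in> HH_deg G N n) \<and> (\<exists>m::nat. m > 0 \<and> x [^]\<^bsub>HH G N\<^esub> m = \<zero>\<^bsub>HH G N\<^esub>)}"
    then obtain m :: nat where x: "x \<in> carrier (HH G N)" and m: "x [^]\<^bsub>HH G N\<^esub> m = \<zero>\<^bsub>HH G N\<^esub>"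
      using HH_deg_carrier by blast
    have "vertex_value v (x [^]\<^bsub>HH G N\<^esub> j) = vertex_value v x ^ j" for j :: nat
    proof (induction j)
      case 0
      show ?case using \<epsilon>.hom_one by (simp add: ring_of_type_algebra_def)
    next
      case (Suc j)
      then show ?case using x \<epsilon>.hom_mult[of "x [^]\<^bsub>HH G N\<^esub> j" x] by (simp add: ring_of_type_algebra_def mult.commute)
    qed
    then have "vertex_value v x ^ m = vertex_value v (x [^]\<^bsub>HH G N\<^esub> m)" by (rule sym)
    also have "\<dots> = \<zero>\<^bsub>?K\<^esub>" unfolding m by (rule \<epsilon>.hom_zero)
    also have "\<dots> = 0" unfolding ring_of_type_algebra_def by simp
    finally have "vertex_value v x = 0" by (simp only: power_eq_0_iff)
    then have "vertex_value v x = \<zero>\<^bsub>?K\<^esub>" unfolding ring_of_type_algebra_def by simp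
    with x show "x \<in> a_kernel (HH G N) ?K (vertex_value v)"
      unfolding a_kernel_def' by (intro CollectI conjI)
  qed
  then have "vertex_value v x = \<zero>\<^bsub>?K\<^esub>" using x unfolding a_kernel_def' by blast
  then show ?thesis unfolding ring_of_type_algebra_def by simp
qed

lemma scalar_hom: "hoch_scalar G \<in> ring_hom (ring_of_type_algebra :: 'k::comm_ring_1 ring) (hoch_cocycle_ring G N)"
proof (rule ring_hom_memI)
  fix c d :: 'k
  show "hoch_scalar G c \<in> carrier (hoch_cocycle_ring G N)" by (rule scalar_cocycle)
  have "hoch_scalar G (c * d) = cup G N (hoch_scalar G c) (hoch_scalar G d)"
  proof (rule hoch_cochains_eqI)
    note s = homogeneous_cochain[OF scalar_cochain]
    show "cup G N (hoch_scalar G c) (hoch_scalar G d) \<in> hoch_cochains G N" by (rule cup_cochain[OF s s])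
    show "hoch_scalar G (c * d) \<in> hoch_cochains G N" by (rule s)
    fix xs :: "('v,'e,'k) alg list" assume "set xs \<subseteq> carr"
    then show "hoch_scalar G (c * d) xs = cup G N (hoch_scalar G c) (hoch_scalar G d) xs"
      using hoch_cochainsD(2)[OF s] by (subst cup_scalar_left) (auto simp: hoch_scalar_def smul_smul one_carr)
  qed
  then show "hoch_scalar G (c \<otimes>\<^bsub>ring_of_type_algebra\<^esub> d)
    = hoch_scalar G c \<otimes>\<^bsub>hoch_cocycle_ring G N\<^esub> hoch_scalar G d"
    by (simp add: ring_of_type_algebra_def)
  show "hoch_scalar G (c \<oplus>\<^bsub>ring_of_type_algebra\<^esub> d)
    = hoch_scalar G c \<oplus>\<^bsub>hoch_cocycle_ring G N\<^esub> hoch_scalar G d"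
    by (simp add: ring_of_type_algebra_def hoch_scalar_def smul_add_left fun_eq_iff)
qed (simp add: ring_of_type_algebra_def)

text \<open>
  The coefficient at a vertex separates the scalars modulo the nilpotent ideal. Subtracting from a class the
  scalar given by that coefficient leaves an element of the ideal.
\<close>

lemma nil_quotient_iso:
  assumes conn: "connected G" and cyc: "\<not> is_oriented_cycle G"
  shows "(\<lambda>c. HH_nil_ideal G N +>\<^bsub>HH G N\<^esub> HH_class G N (hoch_scalar G c))
    \<in> ring_iso (ring_of_type_algebra :: 'k::field_char_0 ring) (HH G N Quot HH_nil_ideal G N)"
proof -
  interpret J: ideal "HH_nil_ideal G N" "HH G N :: ('v,'e,'k) cochain set ring" by (rule nil_ideal)
  let ?K = "ring_of_type_algebra :: 'k ring"
  let ?\<theta> = "\<lambda>c :: 'k. HH_nil_ideal G N +>\<^bsub>HH G N\<^esub> HH_class G N (hoch_scalar G c)"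
  obtain v where v: "v \<in> verts G"
    using conn by (auto simp: connected_def strongly_connected_def mk_symmetric_def)
  have s: "HH_class G N (hoch_scalar G c) \<in> carrier (HH G N)" for c :: 'k
    using scalar_cocycle by (auto simp: HH_carrier)
  have hom: "?\<theta> \<in> ring_hom ?K (HH G N Quot HH_nil_ideal G N)"
    using ring_hom_trans[OF ring_hom_trans[OF scalar_hom HH_class_hom] J.rcos_ring_hom] by (simp add: comp_def)
  have inj: "inj ?\<theta>"
  proof (rule injI)
    fix c d :: 'k assume "?\<theta> c = ?\<theta> d"
    from J.a_repr_independenceD[OF s this[symmetric]] obtain j where j: "j \<in> HH_nil_ideal G N"
      "HH_class G N (hoch_scalar G c) = j \<oplus>\<^bsub>HH G N\<^esub> HH_class G N (hoch_scalar G d)"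
      by (auto simp: a_r_coset_def')
    interpret \<epsilon>: ring_hom_ring "HH G N" ?K "vertex_value v" by (rule vertex_value_hom[OF v])
    have "vertex_value v (HH_class G N (hoch_scalar G c))
      = vertex_value v j + vertex_value v (HH_class G N (hoch_scalar G d))"
      unfolding j(2) using \<epsilon>.hom_add[OF J.a_Hcarr[OF j(1)] s] by (simp add: ring_of_type_algebra_def)
    then show "c = d"
      by (simp add: vertex_value_nil[OF v j(1)] vertex_value_class[OF scalar_cocycle] lookup_scalar[OF v])
  qed
  have surj: "carrier (HH G N Quot HH_nil_ideal G N) \<subseteq> range ?\<theta>"
  proof
    fix B assume "B \<in> carrier (HH G N Quot HH_nil_ideal G N :: ('v,'e,'k) cochain set set ring)"
    then obtain F where F: "cocycle F" and B: "B = HH_nil_ideal G N +>\<^bsub>HH G N\<^esub> HH_class G N F"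
      by (auto simp: FactRing_def A_RCOSETS_def' HH_carrier)
    define c where "c = Poly_Mapping.lookup (F []) (v, [])"
    let ?F = "\<lambda>xs. F xs + - hoch_scalar G c xs"
    have F': "cocycle ?F" by (rule cocycle_linear(1)[OF F cocycle_linear(2)[OF scalar_cocycle]])
    have "HH_class G N ?F \<in> HH_nil_ideal G N"
      by (rule class_in_nil_ideal[OF F' conn cyc v]) (simp add: lookup_minus lookup_scalar[OF v] c_def)
    moreover have "HH_class G N F = HH_class G N ?F \<oplus>\<^bsub>HH G N\<^esub> HH_class G N (hoch_scalar G c)"
      using HH_class_add[OF F' scalar_cocycle, of c] by simp
    ultimately have "HH_class G N F \<in> ?\<theta> c" by (auto simp: a_r_coset_def')
    from J.a_repr_independence'[OF this s] show "B \<in> range ?\<theta>" using B by auto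
  qed
  have "range ?\<theta> \<subseteq> carrier (HH G N Quot HH_nil_ideal G N)"
    using s by (auto simp: FactRing_def A_RCOSETS_def')
  with surj have "range ?\<theta> = carrier (HH G N Quot HH_nil_ideal G N)" by (rule equalityI[rotated])
  moreover have "carrier ?K = UNIV" by (simp add: ring_of_type_algebra_def)
  ultimately show ?thesis
    unfolding ring_iso_def bij_betw_def by (intro CollectI conjI hom) (simp_all only: inj)
qed

end

theorem mainTheorem2:
  fixes G :: "('v,'e) pre_digraph" and N :: nat
    and H :: "('v,'e,'k::field_char_0) cochain set ring"
  assumes "fin_digraph G" and "connected G" and "N \<ge> 2"
    and H: "H = HH G N"
  shows
    \<comment> \<open>\<open>\<or>\<close> descends to the cohomology of \<open>P\<^sup>*\<close>\<close>
    "(\<forall>m n (f :: ('v,'e,'k) pstar) g.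
        f \<in> Pstar_cocycles G N m \<and> g \<in> Pstar_cocycles G N n \<longrightarrow>
          vee G N m n f g \<in> Pstar_cocycles G N (m + n)
          \<and> (f \<in> Pstar_coboundaries G N m \<or> g \<in> Pstar_coboundaries G N n \<longrightarrow>
               vee G N m n f g \<in> Pstar_coboundaries G N (m + n)))
     \<comment> \<open>and becomes the product of \<open>H\<^sup>*(A,A)\<close> under the canonical identification\<close>
     \<and> (\<exists>\<psi> :: ('v,'e,'k) alg list \<Rightarrow> ('v,'e,'k) res. is_comparison G N \<psi>)
     \<and> (\<forall>\<psi> :: ('v,'e,'k) alg list \<Rightarrow> ('v,'e,'k) res. is_comparison G N \<psi> \<longrightarrow>
          (\<forall>n. comparison_class G N \<psi> n ` Pstar_cocycles G N n = HH_deg G N n)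
          \<and> (\<forall>n. \<forall>f \<in> Pstar_cocycles G N n.
               comparison_class G N \<psi> n f = \<zero>\<^bsub>H\<^esub> \<longleftrightarrow> f \<in> Pstar_coboundaries G N n)
          \<and> (\<forall>m n. \<forall>f \<in> Pstar_cocycles G N m. \<forall>g \<in> Pstar_cocycles G N n.
               comparison_class G N \<psi> (m + n) (vee G N m n f g)
               = comparison_class G N \<psi> m f \<otimes>\<^bsub>H\<^esub> comparison_class G N \<psi> n g))
     \<comment> \<open>(i)\<close>
     \<and> (\<forall>m n x y. odd m \<and> odd n \<and> x \<in> HH_deg G N m \<and> y \<in> HH_deg G N n \<longrightarrow>
          x \<otimes>\<^bsub>H\<^esub> y = \<zero>\<^bsub>H\<^esub>)
     \<comment> \<open>(ii)\<close>
     \<and> (\<not> is_oriented_cycle G \<longrightarrow>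
          (\<forall>fs. length fs = N \<and> (\<forall>x \<in> set fs. \<exists>n>0. x \<in> HH_deg G N n) \<longrightarrow>
             foldr (\<otimes>\<^bsub>H\<^esub>) fs \<one>\<^bsub>H\<^esub> = \<zero>\<^bsub>H\<^esub>))
     \<comment> \<open>(iii)\<close>
     \<and> (\<not> is_oriented_cycle G \<longrightarrow>
          (\<lambda>c. HH_nil_ideal G N +>\<^bsub>H\<^esub> HH_class G N (hoch_scalar G c))
            \<in> ring_iso (ring_of_type_algebra :: 'k ring) (H Quot HH_nil_ideal G N))"
proof -
  interpret fin_digraph G by (rule assms(1))
  interpret truncated_quiver G N by unfold_locales (rule assms(3))
  show ?thesis
    unfolding H
  proof (intro conjI allI impI ballI)
    fix m n and f g :: "('v,'e,'k) pstar"
    assume a: "f \<in> Pstar_cocycles G N m \<and> g \<in> Pstar_cocycles G N n"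
    then show "vee G N m n f g \<in> Pstar_cocycles G N (m + n)" by (intro vee_cocycle) simp_all
    assume "f \<in> Pstar_coboundaries G N m \<or> g \<in> Pstar_coboundaries G N n"
    with a show "vee G N m n f g \<in> Pstar_coboundaries G N (m + n)" by (intro vee_coboundary) simp_all
  next
    show "\<exists>\<psi> :: ('v,'e,'k) alg list \<Rightarrow> ('v,'e,'k) res. is_comparison G N \<psi>"
      using canon_comparison by blast
  next
    fix \<psi> :: "('v,'e,'k) alg list \<Rightarrow> ('v,'e,'k) res" assume \<psi>: "is_comparison G N \<psi>"
    show "comparison_class G N \<psi> n ` Pstar_cocycles G N n = HH_deg G N n" for n
      unfolding comparison_class_image[symmetric] by (rule image_cong[OF refl comparison_class_canon[OF \<psi>]])
    fix n and g :: "('v,'e,'k) pstar" assume g: "g \<in> Pstar_cocycles G N n"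
    show "(comparison_class G N \<psi> n g = \<zero>\<^bsub>HH G N\<^esub>) = (g \<in> Pstar_coboundaries G N n)"
      unfolding comparison_class_canon[OF \<psi> g] by (rule comparison_class_zero_iff[OF g])
    fix m and f :: "('v,'e,'k) pstar" assume f: "f \<in> Pstar_cocycles G N m"
    show "comparison_class G N \<psi> (m + n) (vee G N m n f g)
      = comparison_class G N \<psi> m f \<otimes>\<^bsub>HH G N\<^esub> comparison_class G N \<psi> n g"
      unfolding comparison_class_canon[OF \<psi> f] comparison_class_canon[OF \<psi> g]
        comparison_class_canon[OF \<psi> vee_cocycle[OF f g]] by (rule comparison_class_vee[OF f g])
  next
    fix m n and x y :: "('v,'e,'k) cochain set"
    assume "odd m \<and> odd n \<and> x \<in> HH_deg G N m \<and> y \<in> HH_deg G N n"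
    then show "x \<otimes>\<^bsub>HH G N\<^esub> y = \<zero>\<^bsub>HH G N\<^esub>" by (intro class_product_odd[of m n]) simp_all
  next
    fix fs :: "('v,'e,'k) cochain set list"
    assume cyc: "\<not> is_oriented_cycle G" and "length fs = N \<and> (\<forall>x \<in> set fs. \<exists>n>0. x \<in> HH_deg G N n)"
    then have l: "length fs = N" and d: "\<And>x. x \<in> set fs \<Longrightarrow> \<exists>n>0. x \<in> HH_deg G N n" by auto
    have "set fs \<subseteq> radical_classes 1"
      using d positive_degree_radical[OF _ _ assms(2) cyc] by blast
    with l show "foldr (\<otimes>\<^bsub>HH G N\<^esub>) fs \<one>\<^bsub>HH G N\<^esub> = \<zero>\<^bsub>HH G N\<^esub>"
      using radical_classes_product[of fs] by (intro radical_classes_N) (simp only:)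
  next
    assume "\<not> is_oriented_cycle G"
    then show "(\<lambda>c. HH_nil_ideal G N +>\<^bsub>HH G N\<^esub> HH_class G N (hoch_scalar G c))
        \<in> ring_iso (ring_of_type_algebra :: 'k ring) (HH G N Quot HH_nil_ideal G N)"
      by (rule nil_quotient_iso[OF assms(2)])
  qed
qed

end
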